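(* Let $k\ge 0$ be an integer. (a) The rook-Brauer algebra $\mathsf{RB}_k(x)$ over $\mathbb{C}$ is semisimple for all but a finite number of $x\in\mathbb{C}$. (b) If $x\in\mathbb{C}$ is such that $\mathsf{RB}_k(x)$ is semisimple, then $\Lambda_k$ is an index set for the isomorphism classes of irreducible $\mathsf{RB}_k(x)$-modules, in such a way that the irreducible module $\mathsf{M}_k^\lambda$ labeled by $\lambda\in\Lambda_k$ satisfies $\dim(\mathsf{M}_k^\lambda)=m_k^\lambda$.
   Context: A rook-Brauer $k$-diagram is a graph on two rows of $k$ vertices each (a top row and a bottom row, each numbered $1,\dots,k$ from left to right) in which each vertex is joined by an edge to at most one other vertex. The set of these diagrams is $\mathcal{RB}_k$. For $x\in\mathbb{C}$, the rook-Brauer algebra $\mathsf{RB}_k(x)$ is the $\mathbb{C}$-vector space with basis $\mathcal{RB}_k$ (with $\mathsf{RB}_0(x)=\mathbb{C}1$) and bilinear multiplication determined as follows. For diagrams $d_1,d_2$, place $d_1$ above $d_2$ and identify the bottom vertices of $d_1$ with the corresponding top vertices of $d_2$. Then $d_1d_2=x^{\kappa(d_1,d_2)}d_3$, where $\kappa(d_1,d_2)$ is the number of closed loops formed entirely in the middle row, and $d_3$ is the rook-Brauer diagram on the top row of $d_1$ and the bottom row of $d_2$ in which two vertices are joined by an edge if and only if they lie in the same connected component of the stacked graph. (Components contained in the middle row that are not closed loops are discarded with factor $1$.) $\Lambda_k$ is the set of all integer partitions $\lambda\vdash r$ with $0\le r\le k$. For $\lambda\in\Lambda_k$, $m_k^\lambda$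 is the number of sequences $(\lambda^0,\lambda^1,\dots,\lambda^k)$ of partitions with $\lambda^0=\emptyset$, $\lambda^k=\lambda$, and such that for each $0\le i<k$ the partition $\lambda^{i+1}$ is equal to $\lambda^i$ or is obtained from $\lambda^i$ by adding one box or by removing one box. *)

theory Defs
  imports "Jordan_Normal_Form.VS_Connect"
begin

section \<open>Rook-Brauer diagrams\<close>

datatype vertex = Top nat | Bot nat

type_synonym diagram = "vertex set set"

definition vertices :: "nat \<Rightarrow> vertex set" where
  "vertices k = Top ` {1..k} \<union> Bot ` {1..k}"

definition RB_diagrams :: "nat \<Rightarrow> diagram set" where
  "RB_diagrams k = {d. (\<forall>e\<in>d. e \<subseteq> vertices k \<and> card e = 2) \<and>
                       (\<forall>e\<in>d. \<forall>e'\<in>d. e \<noteq> e' \<longrightarrow> e \<inter> e' = {})}"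

definition id_diagram :: "nat \<Rightarrow> diagram" where
  "id_diagram k = {{Top i, Bot i} | i. i \<in> {1..k}}"

text \<open>Stacking \<open>d1\<close> above \<open>d2\<close> gives a multigraph on three rows: an edge in the bottom row of
  \<open>d1\<close> and the same edge in the top row of \<open>d2\<close> are parallel. The edges coming from \<open>d1\<close> and
  from \<open>d2\<close> are therefore kept apart.\<close>

datatype svertex = Upper nat | Middle nat | Lower nat

primrec place_above :: "vertex \<Rightarrow> svertex" where
  "place_above (Top i) = Upper i"
| "place_above (Bot i) = Middle i"

primrec place_below :: "vertex \<Rightarrow> svertex" where
  "place_below (Top i) = Middle i"
| "place_below (Bot i) = Lower i"

primrec place_outer :: "vertex \<Rightarrow> svertex" where
  "place_outer (Top i) = Upper i"
| "place_outer (Bot i) = Lower i"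

definition edges_above :: "diagram \<Rightarrow> svertex set set" where
  "edges_above d = (\<lambda>e. place_above ` e) ` d"

definition edges_below :: "diagram \<Rightarrow> svertex set set" where
  "edges_below d = (\<lambda>e. place_below ` e) ` d"

definition connected_in_stack :: "diagram \<Rightarrow> diagram \<Rightarrow> (svertex \<times> svertex) set" where
  "connected_in_stack d1 d2 = {(u, v). {u, v} \<in> edges_above d1 \<union> edges_below d2}\<^sup>*"

definition compose_diagrams :: "nat \<Rightarrow> diagram \<Rightarrow> diagram \<Rightarrow> diagram" where
  "compose_diagrams k d1 d2 =
     {{u, v} | u v. u \<in> vertices k \<and> v \<in> vertices k \<and> u \<noteq> v \<and>
                    (place_outer u, place_outer v) \<in> connected_in_stack d1 d2}"

text \<open>Every middle vertex meets at most one edge of \<open>d1\<close> and at most one edge of \<open>d2\<close>, so a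
  connected component is a closed loop (possibly two parallel edges) exactly if all its
  vertices have degree two in the multigraph, that is, meet an edge of each diagram. The
  remaining components inside the middle row are paths (possibly isolated vertices).\<close>

definition middle_loops :: "nat \<Rightarrow> diagram \<Rightarrow> diagram \<Rightarrow> svertex set set" where
  "middle_loops k d1 d2 =
     {C. (\<exists>i\<in>{1..k}. C = connected_in_stack d1 d2 `` {Middle i}) \<and>
         C \<subseteq> Middle ` {1..k} \<and>
         (\<forall>v\<in>C. v \<in> \<Union>(edges_above d1) \<and> v \<in> \<Union>(edges_below d2))}"

definition kappa :: "nat \<Rightarrow> diagram \<Rightarrow> diagram \<Rightarrow> nat" where
  "kappa k d1 d2 = card (middle_loops k d1 d2)"


section \<open>The rook-Brauer algebra\<close>

text \<open>The vector space with basis \<open>RB_diagrams k\<close> is realised by coefficient functions vanishing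
  outside that finite set.\<close>

definition RB_algebra :: "nat \<Rightarrow> complex \<Rightarrow> (complex, diagram \<Rightarrow> complex) module" where
  "RB_algebra k x =
     \<lparr>carrier = {a. \<forall>d. d \<notin> RB_diagrams k \<longrightarrow> a d = 0},
      mult = (\<lambda>a b d. \<Sum>d1\<in>RB_diagrams k. \<Sum>d2\<in>RB_diagrams k.
                if compose_diagrams k d1 d2 = d then a d1 * b d2 * x ^ kappa k d1 d2 else 0),
      one = (\<lambda>d. if d = id_diagram k then 1 else 0),
      zero = (\<lambda>d. 0),
      add = (\<lambda>a b d. a d + b d),
      smult = (\<lambda>c a d. c * a d)\<rparr>"


section \<open>Algebras and their modules\<close>

text \<open>The locale \<open>algebra\<close> of HOL-Algebra requires commutativity.\<close>

locale assoc_algebra = Module.module K A + ring A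
  for K :: "('k, 'r) ring_scheme" and A :: "('k, 'a, 'm) module_scheme" (structure) +
  assumes smult_mult_left:
      "\<lbrakk>c \<in> carrier K; a \<in> carrier A; b \<in> carrier A\<rbrakk> \<Longrightarrow> (c \<odot> a) \<otimes> b = c \<odot> (a \<otimes> b)"
    and smult_mult_right:
      "\<lbrakk>c \<in> carrier K; a \<in> carrier A; b \<in> carrier A\<rbrakk> \<Longrightarrow> a \<otimes> (c \<odot> b) = c \<odot> (a \<otimes> b)"

text \<open>As in HOL-Algebra, the ring multiplication stored in a module record is irrelevant.\<close>

locale left_module = R?: ring A + M?: abelian_group M
  for A :: "('a, 'm) ring_scheme" and M :: "('a, 'v, 'n) module_scheme" (structure) +
  assumes lsmult_closed:
      "\<lbrakk>a \<in> carrier A; v \<in> carrier M\<rbrakk> \<Longrightarrow> a \<odot> v \<in> carrier M"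
    and lsmult_l_distr:
      "\<lbrakk>a \<in> carrier A; b \<in> carrier A; v \<in> carrier M\<rbrakk> \<Longrightarrow> (a \<oplus>\<^bsub>A\<^esub> b) \<odot> v = a \<odot> v \<oplus> b \<odot> v"
    and lsmult_r_distr:
      "\<lbrakk>a \<in> carrier A; v \<in> carrier M; w \<in> carrier M\<rbrakk> \<Longrightarrow> a \<odot> (v \<oplus> w) = a \<odot> v \<oplus> a \<odot> w"
    and lsmult_assoc:
      "\<lbrakk>a \<in> carrier A; b \<in> carrier A; v \<in> carrier M\<rbrakk> \<Longrightarrow> (a \<otimes>\<^bsub>A\<^esub> b) \<odot> v = a \<odot> (b \<odot> v)"
    and lsmult_one:
      "v \<in> carrier M \<Longrightarrow> \<one>\<^bsub>A\<^esub> \<odot> v = v"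

text \<open>The constant \<open>Module.submodule\<close> does not require the ring to be commutative, in contrast to
  the constant of the same base name in the vector space library.\<close>

definition irreducible_module :: "('a, 'm) ring_scheme \<Rightarrow> ('a, 'v, 'n) module_scheme \<Rightarrow> bool" where
  "irreducible_module A M \<longleftrightarrow>
     left_module A M \<and> carrier M \<noteq> {\<zero>\<^bsub>M\<^esub>} \<and>
     (\<forall>H. Module.submodule H A M \<longrightarrow> H = {\<zero>\<^bsub>M\<^esub>} \<or> H = carrier M)"

definition isomorphic_modules ::
    "('a, 'm) ring_scheme \<Rightarrow> ('a, 'v, 'n) module_scheme \<Rightarrow> ('a, 'w, 'p) module_scheme \<Rightarrow> bool" where
  "isomorphic_modules A M N \<longleftrightarrow>
     (\<exists>f \<in> LinearCombinations.module_hom A M N. bij_betw f (carrier M) (carrier N))"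

definition regular_module :: "('a, 'm) ring_scheme \<Rightarrow> ('a, 'a) module" where
  "regular_module A =
     \<lparr>carrier = carrier A, mult = mult A, one = one A, zero = zero A, add = add A, smult = mult A\<rparr>"

text \<open>The regular module is the internal direct sum of irreducible submodules. As it is generated
  by the unit, only finitely many summands can occur.\<close>

definition semisimple_algebra :: "('k, 'r) ring_scheme \<Rightarrow> ('k, 'a, 'm) module_scheme \<Rightarrow> bool" where
  "semisimple_algebra K A \<longleftrightarrow>
     assoc_algebra K A \<and>
     (\<exists>\<S>. finite \<S> \<and>
          (\<forall>H\<in>\<S>. Module.submodule H A (regular_module A) \<and>
                  irreducible_module A ((regular_module A)\<lparr>carrier := H\<rparr>)) \<and>
          (\<forall>a\<in>carrier A. \<exists>!f. f \<in> (\<Pi>\<^sub>E H\<in>\<S>. H) \<and>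
                               a = finsum (regular_module A) f \<S>))"

text \<open>A module over a \<open>K\<close>-algebra \<open>A\<close> is a \<open>K\<close>-vector space along \<open>c \<mapsto> c \<cdot> 1\<close>.\<close>

definition underlying_space ::
    "('k, 'a, 'm) module_scheme \<Rightarrow> ('a, 'v, 'n) module_scheme \<Rightarrow> ('k, 'v) module" where
  "underlying_space A M =
     \<lparr>carrier = carrier M, mult = mult M, one = one M, zero = zero M, add = add M,
      smult = (\<lambda>c v. (c \<odot>\<^bsub>A\<^esub> \<one>\<^bsub>A\<^esub>) \<odot>\<^bsub>M\<^esub> v)\<rparr>"


section \<open>Partitions\<close>

text \<open>A partition is encoded by the weakly decreasing sequence of its parts, padded with zeros;
  \<open>\<nu> i\<close> is the length of row \<open>i\<close>, counted from zero, of the Young diagram.\<close>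

type_synonym part = "nat \<Rightarrow> nat"

definition is_partition :: "part \<Rightarrow> bool" where
  "is_partition \<nu> \<longleftrightarrow> antimono \<nu> \<and> finite {i. \<nu> i \<noteq> 0}"

definition psize :: "part \<Rightarrow> nat" where
  "psize \<nu> = (\<Sum>i | \<nu> i \<noteq> 0. \<nu> i)"

definition empty_partition :: part where
  "empty_partition = (\<lambda>i. 0)"

definition partitions_upto :: "nat \<Rightarrow> part set" where
  "partitions_upto k = {\<nu>. is_partition \<nu> \<and> psize \<nu> \<le> k}"

definition adds_box :: "part \<Rightarrow> part \<Rightarrow> bool" where
  "adds_box \<nu> \<mu> \<longleftrightarrow> (\<exists>i. \<mu> = \<nu>(i := Suc (\<nu> i)))"

definition walks :: "nat \<Rightarrow> part \<Rightarrow> part list set" where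
  "walks k \<nu> =
     {ps. length ps = Suc k \<and> (\<forall>\<mu>\<in>set ps. is_partition \<mu>) \<and>
          ps ! 0 = empty_partition \<and> ps ! k = \<nu> \<and>
          (\<forall>i<k. ps ! Suc i = ps ! i \<or> adds_box (ps ! i) (ps ! Suc i) \<or>
                 adds_box (ps ! Suc i) (ps ! i))}"

definition num_walks :: "nat \<Rightarrow> part \<Rightarrow> nat" where
  "num_walks k \<nu> = card (walks k \<nu>)"

end

theory Submission imports Defs begin

text \<open>A diagram with \<open>r\<close> through strands is a half diagram with \<open>r\<close> through strands, composed with a
  permutation of the strands and a reflected half diagram. The diagrams act on the span of the half
  diagrams modulo those with fewer through strands, and the right action of the symmetric group commutes
  with this action. Splitting with Young's orthogonal form for \<open>\<mu> \<turnstile> r\<close> gives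
  a matrix representation for every \<open>\<mu> \<in> \<Lambda>\<^sub>k\<close>. Its dimension is the number of half diagrams up to
  permutation times the number of standard tableaux of shape \<open>\<mu>\<close>, which is \<open>m\<^sub>k\<^sup>\<mu>\<close>, and the squares of these
  dimensions add up to the number of diagrams.

  The kernel of the product of these representations is a nil ideal, since left multiplication by
  one of its elements lowers the number of through strands. So a semisimple
  algebra is isomorphic to the product of the matrix algebras, whose irreducible modules are the columns.
  Conversely, at a large integer parameter the algebra acts faithfully on a tensor power by matrices
  closed under transposition, hence has no nonzero nil left ideal. As bijectivity of the product map
  is the nonvanishing of a determinant that is polynomial in \<open>x\<close>, it fails for only finitely many \<open>x\<close>.\<close>

section \<open>Matrices with trivial kernel\<close>

text \<open>Both parts of the theorem meet in one equivalence: the algebra at \<open>x\<close> is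
  semisimple iff the product map is bijective. The index sets of the matrices do not depend on
  \<open>x\<close>, so one good parameter bounds the exceptional set.

  The good parameter comes from colouring vertices by \<open>0, ..., n\<close>. Colour
  \<open>0\<close> is forced at isolated vertices, so a discarded path contributes a factor
  \<open>1\<close>, while a closed loop may have any colour and contributes \<open>n + 1\<close>. If
  there is a nonzero colour for every edge, the matrices separate diagrams. Identities about
  composites and loop numbers, associativity included, are therefore read off from matrix products
  instead of being traced along paths through several layers.

  On the side of the symmetric group the obstacle is completeness of the orthogonal form.
  Interpolation in the contents produces all matrix units inside the blocks, and the squares of the
  tableau numbers sum to \<open>r!\<close>, so that a square linear system results.\<close>

definition trivial_kernel :: "'i set \<Rightarrow> 'j set \<Rightarrow> ('j \<Rightarrow> 'i \<Rightarrow> complex) \<Rightarrow> bool" where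
  "trivial_kernel I J m \<longleftrightarrow> (\<forall>v. (\<forall>j\<in>J. (\<Sum>i\<in>I. m j i * v i) = 0) \<longrightarrow> (\<forall>i\<in>I. v i = 0))"

lemma sum_over_enumeration:
  fixes f :: "nat \<Rightarrow> 'i"
  assumes "bij_betw f {..<n} I"
  shows "(\<Sum>i\<in>I. h i) = (\<Sum>b = 0..<n. h (f b))"
  using sum.reindex_bij_betw[OF assms, of h] by (simp add: lessThan_atLeast0)

lemma trivial_kernel_iff_det:
  fixes f :: "nat \<Rightarrow> 'i" and g :: "nat \<Rightarrow> 'j"
  assumes f: "bij_betw f {..<n} I" and g: "bij_betw g {..<n} J"
  shows "trivial_kernel I J m \<longleftrightarrow> det (mat n n (\<lambda>(a, b). m (g a) (f b))) \<noteq> 0"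
proof -
  let ?A = "mat n n (\<lambda>(a, b). m (g a) (f b))"
  have A: "?A \<in> carrier_mat n n" by simp
  have fI: "I = f ` {..<n}" and gJ: "J = g ` {..<n}" and injf: "inj_on f {..<n}"
    using f g by (auto simp: bij_betw_def)
  have eq0: "?A *\<^sub>v w = 0\<^sub>v n \<longleftrightarrow> (\<forall>a<n. (\<Sum>b = 0..<n. m (g a) (f b) * w $ b) = 0)"
    if "w \<in> carrier_vec n" for w
    using that by (auto simp: vec_eq_iff scalar_prod_def)
  show ?thesis
  proof
    assume tk: "trivial_kernel I J m"
    show "det ?A \<noteq> 0"
    proof
      assume "det ?A = 0"
      then obtain w where w: "w \<in> carrier_vec n" "w \<noteq> 0\<^sub>v n" "?A *\<^sub>v w = 0\<^sub>v n"
        using det_0_iff_vec_prod_zero_field[OF A] by auto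
      define v where "v i = w $ (the_inv_into {..<n} f i)" for i
      have vf: "v (f b) = w $ b" if "b < n" for b
        using that injf by (simp add: v_def the_inv_into_f_f)
      have "(\<Sum>i\<in>I. m j i * v i) = 0" if "j \<in> J" for j
      proof -
        obtain a where a: "a < n" "j = g a" using \<open>j \<in> J\<close> gJ by blast
        have "(\<Sum>i\<in>I. m j i * v i) = (\<Sum>b = 0..<n. m (g a) (f b) * w $ b)"
          using vf a by (simp add: sum_over_enumeration[OF f])
        then show ?thesis using w eq0 a by simp
      qed
      then have "\<forall>i\<in>I. v i = 0" using tk unfolding trivial_kernel_def by blast
      then have "w = 0\<^sub>v n" using w(1) vf fI by (auto simp: vec_eq_iff)
      then show False using w(2) by simp
    qed
  next
    assume d: "det ?A \<noteq> 0"
    show "trivial_kernel I J m"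
      unfolding trivial_kernel_def
    proof (intro allI impI)
      fix v assume v: "\<forall>j\<in>J. (\<Sum>i\<in>I. m j i * v i) = 0"
      define w where "w = vec n (\<lambda>b. v (f b))"
      have w: "w \<in> carrier_vec n" by (simp add: w_def)
      have "(\<Sum>b = 0..<n. m (g a) (f b) * w $ b) = 0" if "a < n" for a
      proof -
        have "(\<Sum>i\<in>I. m (g a) i * v i) = 0" using v that gJ by auto
        then show ?thesis by (simp add: sum_over_enumeration[OF f] w_def)
      qed
      then have "?A *\<^sub>v w = 0\<^sub>v n" using eq0[OF w] by blast
      then have "w = 0\<^sub>v n" using det_0_iff_vec_prod_zero_field[OF A] d w by blast
      then show "\<forall>i\<in>I. v i = 0" using fI by (auto simp: w_def vec_eq_iff)
    qed
  qed
qed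

lemma same_card_enumerations:
  assumes "finite I" "finite J" "card I = card J"
  obtains n :: nat and f g where "bij_betw f {..<n} I" "bij_betw g {..<n} J"
  using ex_bij_betw_nat_finite[OF assms(1)] ex_bij_betw_nat_finite[OF assms(2)] assms(3)
  by (metis lessThan_atLeast0)

text \<open>The solutions for the unit vectors are the columns of a right inverse \<open>?B\<close>,
  and \<open>det ?A * det ?B = 1\<close> excludes a vanishing determinant. A proof that all matrices
  are attained thus becomes a proof of linear independence.\<close>

lemma square_matrix_surj_imp_inj:
  assumes "finite I" "finite J" "card I = card J"
    and surj: "\<And>j. j \<in> J \<Longrightarrow> \<exists>v. \<forall>j'\<in>J. (\<Sum>i\<in>I. m j' i * v i) = (if j' = j then 1 else 0)"
  shows "trivial_kernel I J m"
proof -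
  obtain n f g where f: "bij_betw f {..<n::nat} I" and g: "bij_betw g {..<n} J"
    by (rule same_card_enumerations[OF assms(1-3)])
  have "\<forall>j\<in>J. \<exists>v. \<forall>j'\<in>J. (\<Sum>i\<in>I. m j' i * v i) = (if j' = j then 1 else 0)" using surj by blast
  then obtain V where V: "\<And>j j'. j \<in> J \<Longrightarrow> j' \<in> J \<Longrightarrow>
      (\<Sum>i\<in>I. m j' i * V j i) = (if j' = j then 1 else 0)" by metis
  let ?A = "mat n n (\<lambda>(a, b). m (g a) (f b))" and ?B = "mat n n (\<lambda>(b, a). V (g a) (f b))"
  have "(\<Sum>b = 0..<n. m (g a) (f b) * V (g c) (f b)) = (if a = c then 1 else 0)"
    if "a < n" "c < n" for a c
  proof -
    have "g a \<in> J" "g c \<in> J" "g a = g c \<longleftrightarrow> a = c" using g that by (auto simp: bij_betw_def inj_on_def)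
    then show ?thesis using V[of "g c" "g a"] by (simp add: sum_over_enumeration[OF f])
  qed
  then have "?A * ?B = 1\<^sub>m n" by (auto simp: mat_eq_iff scalar_prod_def)
  then have "det ?A * det ?B = 1" using det_mult[of ?A n ?B] by simp
  then have "det ?A \<noteq> 0" by auto
  then show ?thesis using trivial_kernel_iff_det[OF f g] by blast
qed

text \<open>The adjugate divided by the determinant is a right inverse; its column at
  \<open>j\<close> solves the system for the unit vector at \<open>j\<close>.\<close>

lemma square_matrix_inj_imp_surj:
  assumes "finite I" "finite J" "card I = card J" and "trivial_kernel I J m" "j \<in> J"
  shows "\<exists>v. \<forall>j'\<in>J. (\<Sum>i\<in>I. m j' i * v i) = (if j' = j then 1 else 0)"
proof -
  obtain n f g where f: "bij_betw f {..<n::nat} I" and g: "bij_betw g {..<n} J"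
    by (rule same_card_enumerations[OF assms(1-3)])
  let ?A = "mat n n (\<lambda>(a, b). m (g a) (f b))"
  have d: "det ?A \<noteq> 0" using trivial_kernel_iff_det[OF f g] assms by blast
  define B where "B = inverse (det ?A) \<cdot>\<^sub>m adj_mat ?A"
  have adj: "adj_mat ?A \<in> carrier_mat n n" "?A * adj_mat ?A = det ?A \<cdot>\<^sub>m 1\<^sub>m n"
    using adj_mat[of ?A n] by auto
  have "?A * B = inverse (det ?A) \<cdot>\<^sub>m (?A * adj_mat ?A)"
    unfolding B_def using adj by (intro mult_smult_distrib) auto
  then have AB: "?A * B = 1\<^sub>m n" using d adj by (auto simp: mat_eq_iff)
  have Bc: "B \<in> carrier_mat n n" using adj by (simp add: B_def)
  obtain c where c: "c < n" "j = g c" using g assms(5) by (auto simp: bij_betw_def)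
  define v where "v i = B $$ (the_inv_into {..<n} f i, c)" for i
  have vf: "v (f b) = B $$ (b, c)" if "b < n" for b
    using that f by (simp add: v_def the_inv_into_f_f bij_betw_def)
  have "(\<Sum>i\<in>I. m j' i * v i) = (if j' = j then 1 else 0)" if "j' \<in> J" for j'
  proof -
    obtain a where a: "a < n" "j' = g a" using g \<open>j' \<in> J\<close> by (auto simp: bij_betw_def)
    have "(\<Sum>i\<in>I. m j' i * v i) = (\<Sum>b = 0..<n. m (g a) (f b) * B $$ (b, c))"
      using a vf by (simp add: sum_over_enumeration[OF f])
    also have "\<dots> = (?A * B) $$ (a, c)" using a c Bc by (simp add: scalar_prod_def)
    also have "\<dots> = (if a = c then 1 else 0)" using AB a c by simp
    finally show ?thesis using a c g by (auto simp: bij_betw_def inj_on_def)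
  qed
  then show ?thesis by blast
qed

text \<open>After both index sets are enumerated, the determinant at \<open>x\<close> is the value
  of a single polynomial, which is nonzero because of \<open>x0\<close>. The exceptional
  \<open>x\<close> are its roots.\<close>

lemma trivial_kernel_cofinite:
  fixes p :: "'j \<Rightarrow> 'i \<Rightarrow> complex poly"
  assumes "finite I" "finite J" "card I = card J"
    and x0: "trivial_kernel I J (\<lambda>j i. poly (p j i) x0)"
  shows "finite {x. \<not> trivial_kernel I J (\<lambda>j i. poly (p j i) x)}"
proof -
  obtain n f g where f: "bij_betw f {..<n::nat} I" and g: "bij_betw g {..<n} J"
    by (rule same_card_enumerations[OF assms(1-3)])
  let ?P = "mat n n (\<lambda>(a, b). p (g a) (f b))"
  have "det (mat n n (\<lambda>(a, b). poly (p (g a) (f b)) x)) = poly (det ?P) x" for x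
  proof -
    interpret comm_ring_hom "\<lambda>q. poly q x" by unfold_locales auto
    have "map_mat (\<lambda>q. poly q x) ?P = mat n n (\<lambda>(a, b). poly (p (g a) (f b)) x)"
      by (auto simp: mat_eq_iff)
    then show ?thesis using hom_det[of ?P] by simp
  qed
  then have tk: "trivial_kernel I J (\<lambda>j i. poly (p j i) x) \<longleftrightarrow> poly (det ?P) x \<noteq> 0" for x
    using trivial_kernel_iff_det[OF f g, of "\<lambda>j i. poly (p j i) x"] by simp
  then have "det ?P \<noteq> 0" using x0 by auto
  then show ?thesis using tk poly_roots_finite[of "det ?P"] by simp
qed

section \<open>Split semisimple algebras\<close>

lemma module_class_ring_iff:
  "Module.module class_ring A \<longleftrightarrow> abelian_group A \<and> Module.module_axioms class_ring A"
  for A :: "('k::field, 'a, 'm) module_scheme"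
  using class_field by (auto simp: Module.module_def class_cring.is_cring)

section \<open>Left modules over a noncommutative ring and their submodules\<close>

lemma left_module_regular:
  assumes "ring A"
  shows "left_module A (regular_module A)"
proof -
  interpret ring A by fact
  have "abelian_group (regular_module A)"
    by (rule abelian_groupI) (auto simp: regular_module_def a_ac intro: add.l_inv_ex)
  then show ?thesis
    by (intro left_module.intro left_module_axioms.intro)
       (auto simp: regular_module_def l_distr r_distr m_assoc ring_axioms)
qed

context left_module
begin

lemma lsmult_zero_right:
  assumes "a \<in> carrier A" shows "a \<odot> \<zero> = \<zero>"
proof -
  have "a \<odot> \<zero> \<oplus> a \<odot> \<zero> = a \<odot> \<zero>"
    using lsmult_r_distr[OF assms, of "\<zero>" "\<zero>"] by simp
  then show ?thesis using lsmult_closed[OF assms] by (metis M.add.r_cancel_one M.zero_closed)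
qed

lemma lsmult_zero_left:
  assumes "v \<in> carrier M" shows "\<zero>\<^bsub>A\<^esub> \<odot> v = \<zero>"
proof -
  have "\<zero>\<^bsub>A\<^esub> \<odot> v \<oplus> \<zero>\<^bsub>A\<^esub> \<odot> v = \<zero>\<^bsub>A\<^esub> \<odot> v"
    using lsmult_l_distr[of "\<zero>\<^bsub>A\<^esub>" "\<zero>\<^bsub>A\<^esub>" v] assms by simp
  then show ?thesis using lsmult_closed[of "\<zero>\<^bsub>A\<^esub>" v] assms by (metis M.add.r_cancel_one R.zero_closed)
qed

text \<open>Negatives are obtained from the action, since \<open>\<ominus> v\<close> is the result
  of acting by \<open>- 1\<close>.\<close>

lemma submoduleI:
  assumes "H \<subseteq> carrier M" "\<zero> \<in> H" "\<And>v w. v \<in> H \<Longrightarrow> w \<in> H \<Longrightarrow> v \<oplus> w \<in> H"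
    and "\<And>a v. a \<in> carrier A \<Longrightarrow> v \<in> H \<Longrightarrow> a \<odot> v \<in> H"
  shows "Module.submodule H A M"
proof -
  have "\<ominus> v \<in> H" if "v \<in> H" for v
  proof -
    have v: "v \<in> carrier M" using that assms(1) by blast
    have "v \<oplus> (\<ominus>\<^bsub>A\<^esub> \<one>\<^bsub>A\<^esub>) \<odot> v = (\<one>\<^bsub>A\<^esub> \<oplus>\<^bsub>A\<^esub> \<ominus>\<^bsub>A\<^esub> \<one>\<^bsub>A\<^esub>) \<odot> v"
      using v lsmult_one[OF v] by (simp add: lsmult_l_distr)
    also have "\<dots> = \<zero>" using lsmult_zero_left[OF v] by (simp add: R.r_neg)
    finally have "(\<ominus>\<^bsub>A\<^esub> \<one>\<^bsub>A\<^esub>) \<odot> v = \<ominus> v"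
      using v lsmult_closed by (metis M.add.inv_equality M.add.m_comm R.add.inv_closed R.one_closed)
    then show ?thesis using assms(4)[of "\<ominus>\<^bsub>A\<^esub> \<one>\<^bsub>A\<^esub>" v] that by simp
  qed
  then show ?thesis
    unfolding Module.submodule_def submodule_axioms_def
    using assms by (auto intro!: group.subgroupI[OF M.a_group] simp: a_inv_def)
qed

lemma submoduleD:
  assumes "Module.submodule H A M"
  shows "H \<subseteq> carrier M" "\<zero> \<in> H" "\<And>v w. v \<in> H \<Longrightarrow> w \<in> H \<Longrightarrow> v \<oplus> w \<in> H" "\<And>v. v \<in> H \<Longrightarrow> \<ominus> v \<in> H"
    and "\<And>a v. a \<in> carrier A \<Longrightarrow> v \<in> H \<Longrightarrow> a \<odot> v \<in> H"
proof -
  have s: "subgroup H (add_monoid M)" "submodule_axioms H A M"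
    using assms by (auto simp: Module.submodule_def)
  show "H \<subseteq> carrier M" "\<zero> \<in> H" "\<And>v w. v \<in> H \<Longrightarrow> w \<in> H \<Longrightarrow> v \<oplus> w \<in> H" "\<And>v. v \<in> H \<Longrightarrow> \<ominus> v \<in> H"
    using subgroup.subset[OF s(1)] subgroup.one_closed[OF s(1)] subgroup.m_closed[OF s(1)]
      subgroup.m_inv_closed[OF s(1)] by (auto simp: a_inv_def)
  show "\<And>a v. a \<in> carrier A \<Longrightarrow> v \<in> H \<Longrightarrow> a \<odot> v \<in> H"
    using s(2) by (auto simp: submodule_axioms_def)
qed

lemma left_module_submodule:
  assumes "Module.submodule H A M"
  shows "left_module A (M\<lparr>carrier := H\<rparr>)"
proof -
  note H = submoduleD[OF assms]
  have c: "v \<in> carrier M" if "v \<in> H" for v using H(1) that by blast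
  have "abelian_group (M\<lparr>carrier := H\<rparr>)"
  proof (rule abelian_groupI)
    fix v assume "v \<in> carrier (M\<lparr>carrier := H\<rparr>)"
    then show "\<exists>w\<in>carrier (M\<lparr>carrier := H\<rparr>). w \<oplus>\<^bsub>M\<lparr>carrier := H\<rparr>\<^esub> v = \<zero>\<^bsub>M\<lparr>carrier := H\<rparr>\<^esub>"
      using H(4)[of v] c[of v] M.l_neg[of v] by auto
  qed (use H c M.a_assoc M.a_comm in auto)
  then show ?thesis
    by (intro left_module.intro left_module_axioms.intro)
       (use H c lsmult_l_distr lsmult_r_distr lsmult_assoc lsmult_one in \<open>auto simp: R.ring_axioms\<close>)
qed

end

section \<open>Nil left ideals of a semisimple algebra\<close>

lemma finsum_regular_module: "finsum (regular_module A) f S = finsum A f S"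
  by (simp add: finsum_def finprod_def regular_module_def)

text \<open>Suppose \<open>a\<close> in \<open>N\<close> does not kill some \<open>h\<close> in a
  simple summand \<open>H\<close>. Then \<open>a h\<close> generates \<open>H\<close>, so
  \<open>h = (b a) h\<close> for some \<open>b\<close>, and \<open>b a\<close> is again in
  \<open>N\<close>. Applying \<open>b a\<close> repeatedly pushes \<open>h\<close> from
  \<open>F n\<close> down to \<open>F 0\<close>, so \<open>h = 0\<close>, a contradiction. Hence
  \<open>a\<close> kills every component of the unit, and \<open>a = 0\<close>.\<close>

lemma semisimple_no_nil_left_ideal:
  assumes ss: "semisimple_algebra K A" and N: "N \<subseteq> carrier A"
    and left: "\<And>b a. b \<in> carrier A \<Longrightarrow> a \<in> N \<Longrightarrow> b \<otimes>\<^bsub>A\<^esub> a \<in> N"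
    and F: "F 0 = {\<zero>\<^bsub>A\<^esub>}" "F n = carrier A"
    and chain: "\<And>i a y. a \<in> N \<Longrightarrow> y \<in> F (Suc i) \<Longrightarrow> a \<otimes>\<^bsub>A\<^esub> y \<in> F i"
  shows "N \<subseteq> {\<zero>\<^bsub>A\<^esub>}"
proof
  fix a assume a: "a \<in> N"
  have "assoc_algebra K A" using ss by (simp add: semisimple_algebra_def)
  then interpret ring A by (simp add: assoc_algebra_def)
  let ?R = "regular_module A"
  interpret R: left_module A ?R by (rule left_module_regular) (rule ring_axioms)
  obtain \<S> where \<S>: "finite \<S>" "\<And>H. H \<in> \<S> \<Longrightarrow> Module.submodule H A ?R"
      "\<And>H. H \<in> \<S> \<Longrightarrow> irreducible_module A (?R\<lparr>carrier := H\<rparr>)"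
      "\<And>a. a \<in> carrier A \<Longrightarrow> \<exists>!f. f \<in> (\<Pi>\<^sub>E H\<in>\<S>. H) \<and> a = finsum ?R f \<S>"
  proof -
    have "\<exists>\<S>. finite \<S> \<and> (\<forall>H\<in>\<S>. Module.submodule H A ?R \<and> irreducible_module A (?R\<lparr>carrier := H\<rparr>)) \<and>
        (\<forall>a\<in>carrier A. \<exists>!f. f \<in> (\<Pi>\<^sub>E H\<in>\<S>. H) \<and> a = finsum ?R f \<S>)"
      using ss unfolding semisimple_algebra_def by (rule conjunct2)
    then obtain \<S> where s: "finite \<S> \<and> (\<forall>H\<in>\<S>. Module.submodule H A ?R \<and> irreducible_module A (?R\<lparr>carrier := H\<rparr>)) \<and>
        (\<forall>a\<in>carrier A. \<exists>!f. f \<in> (\<Pi>\<^sub>E H\<in>\<S>. H) \<and> a = finsum ?R f \<S>)" ..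
    show thesis by (rule that[OF s[THEN conjunct1]]) (use s in simp_all)
  qed
  have aA: "a \<in> carrier A" using a N by blast
  have kill: "a \<otimes>\<^bsub>A\<^esub> h = \<zero>\<^bsub>A\<^esub>" if H: "H \<in> \<S>" and h: "h \<in> H" for H h
  proof (rule ccontr)
    assume nz: "a \<otimes>\<^bsub>A\<^esub> h \<noteq> \<zero>\<^bsub>A\<^esub>"
    interpret H: left_module A "?R\<lparr>carrier := H\<rparr>" by (rule R.left_module_submodule[OF \<S>(2)[OF H]])
    note sub = R.submoduleD[OF \<S>(2)[OF H]]
    have hA: "h \<in> carrier A" using sub(1) h by (auto simp: regular_module_def)
    have ah: "a \<otimes>\<^bsub>A\<^esub> h \<in> H" using sub(5)[OF aA h] by (simp add: regular_module_def)
    let ?J = "{b \<otimes>\<^bsub>A\<^esub> (a \<otimes>\<^bsub>A\<^esub> h) | b. b \<in> carrier A}"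
    have "Module.submodule ?J A (?R\<lparr>carrier := H\<rparr>)"
    proof (rule H.submoduleI)
      show "?J \<subseteq> carrier (?R\<lparr>carrier := H\<rparr>)" using sub(5)[OF _ ah] by (auto simp: regular_module_def)
      show "\<zero>\<^bsub>?R\<lparr>carrier := H\<rparr>\<^esub> \<in> ?J" using aA hA by (auto simp: regular_module_def intro!: exI[of _ "\<zero>\<^bsub>A\<^esub>"])
    next
      fix v w assume "v \<in> ?J" "w \<in> ?J"
      then obtain b c where "b \<in> carrier A" "v = b \<otimes>\<^bsub>A\<^esub> (a \<otimes>\<^bsub>A\<^esub> h)" "c \<in> carrier A" "w = c \<otimes>\<^bsub>A\<^esub> (a \<otimes>\<^bsub>A\<^esub> h)" by blast
      then show "v \<oplus>\<^bsub>?R\<lparr>carrier := H\<rparr>\<^esub> w \<in> ?J"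
        using aA hA by (auto simp: regular_module_def l_distr intro!: exI[of _ "b \<oplus>\<^bsub>A\<^esub> c"])
    next
      fix c v assume c: "c \<in> carrier A" and "v \<in> ?J"
      then obtain b where "b \<in> carrier A" "v = b \<otimes>\<^bsub>A\<^esub> (a \<otimes>\<^bsub>A\<^esub> h)" by blast
      then show "c \<odot>\<^bsub>?R\<lparr>carrier := H\<rparr>\<^esub> v \<in> ?J"
        using aA hA c by (auto simp: regular_module_def m_assoc intro!: exI[of _ "c \<otimes>\<^bsub>A\<^esub> b"])
    qed
    moreover have "a \<otimes>\<^bsub>A\<^esub> h \<in> ?J" using aA hA by (auto intro!: exI[of _ "\<one>\<^bsub>A\<^esub>"])
    ultimately have "?J = H"
      using \<S>(3)[OF H] nz unfolding irreducible_module_def by (auto simp: regular_module_def)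
    then obtain b where b: "b \<in> carrier A" "h = b \<otimes>\<^bsub>A\<^esub> (a \<otimes>\<^bsub>A\<^esub> h)" using h by blast
    have c: "b \<otimes>\<^bsub>A\<^esub> a \<in> N" "(b \<otimes>\<^bsub>A\<^esub> a) \<otimes>\<^bsub>A\<^esub> h = h" using left[OF b(1) a] b aA hA m_assoc by auto
    have "h \<in> F (n - m)" if "m \<le> n" for m
      using that
    proof (induction m)
      case 0
      then show ?case using F hA by simp
    next
      case (Suc m)
      then have "h \<in> F (Suc (n - Suc m))" by (simp add: Suc_diff_Suc)
      then show ?case using chain[OF c(1), of h "n - Suc m"] c(2) by simp
    qed
    from this[of n] have "h = \<zero>\<^bsub>A\<^esub>" using F by simp
    then show False using nz aA by simp
  qed
  obtain f where f: "f \<in> (\<Pi>\<^sub>E H\<in>\<S>. H)" "\<one>\<^bsub>A\<^esub> = finsum A f \<S>"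
    using \<S>(4)[OF one_closed] finsum_regular_module by metis
  have fH: "f H \<in> H" "f H \<in> carrier A" if "H \<in> \<S>" for H
    using f(1) that R.submoduleD(1)[OF \<S>(2)[OF that]] by (auto simp: regular_module_def)
  have "a = a \<otimes>\<^bsub>A\<^esub> finsum A f \<S>" using f(2) aA by (metis r_one)
  also have "\<dots> = finsum A (\<lambda>H. a \<otimes>\<^bsub>A\<^esub> f H) \<S>" using fH by (intro finsum_rdistr \<S>(1) aA) auto
  also have "\<dots> = finsum A (\<lambda>H. \<zero>\<^bsub>A\<^esub>) \<S>" using kill fH aA by (intro finsum_cong') auto
  finally show "a \<in> {\<zero>\<^bsub>A\<^esub>}" by simp
qed

section \<open>Algebras isomorphic to a product of full matrix algebras\<close>

locale split_algebra = assoc_algebra class_ring A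
  for A :: "(complex, 'a) module" (structure) +
  fixes \<Lambda> :: "'l set" and I :: "'l \<Rightarrow> 'i set" and \<Phi> :: "'a \<Rightarrow> 'l \<Rightarrow> 'i \<Rightarrow> 'i \<Rightarrow> complex"
  assumes fin_\<Lambda>: "finite \<Lambda>" and fin_I: "l \<in> \<Lambda> \<Longrightarrow> finite (I l)" and I_ne: "l \<in> \<Lambda> \<Longrightarrow> I l \<noteq> {}"
    and \<Phi>_add: "a \<in> carrier A \<Longrightarrow> b \<in> carrier A \<Longrightarrow> l \<in> \<Lambda> \<Longrightarrow> i \<in> I l \<Longrightarrow> j \<in> I l \<Longrightarrow> \<Phi> (a \<oplus> b) l i j = \<Phi> a l i j + \<Phi> b l i j"
    and \<Phi>_smult: "a \<in> carrier A \<Longrightarrow> l \<in> \<Lambda> \<Longrightarrow> i \<in> I l \<Longrightarrow> j \<in> I l \<Longrightarrow> \<Phi> (c \<odot> a) l i j = c * \<Phi> a l i j"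
    and \<Phi>_mult: "a \<in> carrier A \<Longrightarrow> b \<in> carrier A \<Longrightarrow> l \<in> \<Lambda> \<Longrightarrow> i \<in> I l \<Longrightarrow> j \<in> I l \<Longrightarrow>
       \<Phi> (a \<otimes> b) l i j = (\<Sum>m\<in>I l. \<Phi> a l i m * \<Phi> b l m j)"
    and \<Phi>_one: "l \<in> \<Lambda> \<Longrightarrow> i \<in> I l \<Longrightarrow> j \<in> I l \<Longrightarrow> \<Phi> \<one> l i j = (if i = j then 1 else 0)"
    and \<Phi>_inj: "a \<in> carrier A \<Longrightarrow> (\<And>l i j. l \<in> \<Lambda> \<Longrightarrow> i \<in> I l \<Longrightarrow> j \<in> I l \<Longrightarrow> \<Phi> a l i j = 0) \<Longrightarrow> a = \<zero>"
    and \<Phi>_surj: "\<exists>a\<in>carrier A. \<forall>l\<in>\<Lambda>. \<forall>i\<in>I l. \<forall>j\<in>I l. \<Phi> a l i j = X l i j"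
begin

lemma \<Phi>_zero: "l \<in> \<Lambda> \<Longrightarrow> i \<in> I l \<Longrightarrow> j \<in> I l \<Longrightarrow> \<Phi> \<zero> l i j = 0"
  using \<Phi>_add[of "\<zero>" "\<zero>" l i j] by simp

lemma \<Phi>_eqI:
  assumes a: "a \<in> carrier A" and b: "b \<in> carrier A"
    and e: "\<And>l i j. l \<in> \<Lambda> \<Longrightarrow> i \<in> I l \<Longrightarrow> j \<in> I l \<Longrightarrow> \<Phi> a l i j = \<Phi> b l i j"
  shows "a = b"
proof -
  have "\<Phi> (a \<oplus> \<ominus> b) l i j = 0" if "l \<in> \<Lambda>" "i \<in> I l" "j \<in> I l" for l i j
    using \<Phi>_add[OF a _ that, of "\<ominus> b"] \<Phi>_add[OF b _ that, of "\<ominus> b"] e[OF that] \<Phi>_zero[OF that] b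
    by (simp add: r_neg)
  then have "a \<oplus> \<ominus> b = \<zero>" using \<Phi>_inj[of "a \<oplus> \<ominus> b"] a b by simp
  then show ?thesis using a b by (metis add.inv_closed add.inv_inv add.inv_equality minus_equality minus_minus)
qed

definition el :: "('l \<Rightarrow> 'i \<Rightarrow> 'i \<Rightarrow> complex) \<Rightarrow> 'a" where
  "el X = (SOME a. a \<in> carrier A \<and> (\<forall>l\<in>\<Lambda>. \<forall>i\<in>I l. \<forall>j\<in>I l. \<Phi> a l i j = X l i j))"

lemma el: "el X \<in> carrier A" "l \<in> \<Lambda> \<Longrightarrow> i \<in> I l \<Longrightarrow> j \<in> I l \<Longrightarrow> \<Phi> (el X) l i j = X l i j"
proof -
  have "\<exists>a. a \<in> carrier A \<and> (\<forall>l\<in>\<Lambda>. \<forall>i\<in>I l. \<forall>j\<in>I l. \<Phi> a l i j = X l i j)" using \<Phi>_surj[of X] by blast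
  from someI_ex[OF this] show "el X \<in> carrier A" "l \<in> \<Lambda> \<Longrightarrow> i \<in> I l \<Longrightarrow> j \<in> I l \<Longrightarrow> \<Phi> (el X) l i j = X l i j"
    unfolding el_def by blast+
qed

definition mat_unit :: "'l \<Rightarrow> 'i \<Rightarrow> 'i \<Rightarrow> 'a" where
  "mat_unit l i j = el (\<lambda>l' i' j'. if l' = l \<and> i' = i \<and> j' = j then 1 else 0)"

lemma mat_unit_closed [simp]: "mat_unit l i j \<in> carrier A"
  by (simp add: mat_unit_def el)

lemma \<Phi>_mat_unit: "l' \<in> \<Lambda> \<Longrightarrow> i' \<in> I l' \<Longrightarrow> j' \<in> I l' \<Longrightarrow>
    \<Phi> (mat_unit l i j) l' i' j' = (if l' = l \<and> i' = i \<and> j' = j then 1 else 0)"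
  by (simp add: mat_unit_def el)

lemma mat_unit_mult:
  assumes l: "l \<in> \<Lambda>" "i \<in> I l" "j \<in> I l" "m \<in> I l"
  shows "mat_unit l i j \<otimes> mat_unit l j m = mat_unit l i m"
proof (rule \<Phi>_eqI)
  fix l' i' j' assume l': "l' \<in> \<Lambda>" "i' \<in> I l'" "j' \<in> I l'"
  have "\<Phi> (mat_unit l i j \<otimes> mat_unit l j m) l' i' j' =
      (\<Sum>p\<in>I l'. \<Phi> (mat_unit l i j) l' i' p * \<Phi> (mat_unit l j m) l' p j')"
    using l' by (simp add: \<Phi>_mult)
  also have "\<dots> = (\<Sum>p\<in>I l'. if p = j then (if l' = l \<and> i' = i \<and> j' = m then 1 else 0) else 0)"
    using l' by (intro sum.cong refl) (simp add: \<Phi>_mat_unit)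
  also have "\<dots> = \<Phi> (mat_unit l i m) l' i' j'"
    using l l' fin_I[OF l'(1)] by (auto simp: \<Phi>_mat_unit)
  finally show "\<Phi> (mat_unit l i j \<otimes> mat_unit l j m) l' i' j' = \<Phi> (mat_unit l i m) l' i' j'" .
qed simp_all

text \<open>For \<open>j \<in> I l\<close> this is the minimal left ideal generated by the diagonal
  matrix unit at \<open>j\<close> in block \<open>l\<close>.\<close>

definition column :: "'l \<Rightarrow> 'i \<Rightarrow> 'a set" where
  "column l j = {a \<in> carrier A. \<forall>l'\<in>\<Lambda>. \<forall>i\<in>I l'. \<forall>j'\<in>I l'. \<Phi> a l' i j' \<noteq> 0 \<longrightarrow> l' = l \<and> j' = j}"

abbreviation col_module :: "'l \<Rightarrow> 'i \<Rightarrow> ('a, 'a) module" where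
  "col_module l j \<equiv> (regular_module A)\<lparr>carrier := column l j\<rparr>"

lemma column_D: "a \<in> column l j \<Longrightarrow> a \<in> carrier A"
    "a \<in> column l j \<Longrightarrow> l' \<in> \<Lambda> \<Longrightarrow> i \<in> I l' \<Longrightarrow> j' \<in> I l' \<Longrightarrow> \<not> (l' = l \<and> j' = j) \<Longrightarrow> \<Phi> a l' i j' = 0"
  by (auto simp: column_def)

lemma mat_unit_column: "mat_unit l i j \<in> column l j"
  by (auto simp: column_def \<Phi>_mat_unit)

lemma mat_unit_nonzero:
  assumes "l \<in> \<Lambda>" "i \<in> I l" "j \<in> I l" shows "mat_unit l i j \<noteq> \<zero>"
  using \<Phi>_mat_unit[OF assms, of l i j] \<Phi>_zero[OF assms] by auto

lemma column_submodule: "Module.submodule (column l j) A (regular_module A)"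
proof -
  interpret R: left_module A "regular_module A" by (rule left_module_regular) (rule ring_axioms)
  show ?thesis
  proof (rule R.submoduleI)
    fix v w assume "v \<in> column l j" "w \<in> column l j"
    then have "v \<oplus> w \<in> column l j"
      unfolding column_def mem_Collect_eq using \<Phi>_add[of v w] by (metis add.right_neutral a_closed)
    then show "v \<oplus>\<^bsub>regular_module A\<^esub> w \<in> column l j" by (simp add: regular_module_def)
  next
    fix a v assume a: "a \<in> carrier A" and v: "v \<in> column l j"
    have "\<Phi> (a \<otimes> v) l' i j' = 0" if l': "l' \<in> \<Lambda>" "i \<in> I l'" "j' \<in> I l'" and ne: "\<not> (l' = l \<and> j' = j)" for l' i j'
    proof -
      have "\<Phi> v l' m j' = 0" if "m \<in> I l'" for m using column_D(2)[OF v l'(1) that l'(3) ne] .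
      then show ?thesis using \<Phi>_mult[OF a column_D(1)[OF v] l'] by simp
    qed
    then show "a \<odot>\<^bsub>regular_module A\<^esub> v \<in> column l j"
      using a column_D(1)[OF v] by (auto simp: column_def regular_module_def)
  qed (auto simp: column_def regular_module_def \<Phi>_zero)
qed

lemma left_module_column: "left_module A (col_module l j)"
  using left_module.left_module_submodule[OF left_module_regular[OF ring_axioms] column_submodule] .

text \<open>Pick a nonzero entry of \<open>a\<close>, say in row \<open>i\<close>. The matrix whose
  column \<open>i\<close> is the column of \<open>b\<close> divided by that entry carries
  \<open>a\<close> to \<open>b\<close>.\<close>

lemma column_generated:
  assumes l: "l \<in> \<Lambda>" "j \<in> I l" and a: "a \<in> column l j" "a \<noteq> \<zero>" and b: "b \<in> column l j"
  obtains c where "c \<in> carrier A" "b = c \<otimes> a"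
proof -
  obtain l' i j' where "l' \<in> \<Lambda>" "i \<in> I l'" "j' \<in> I l'" "\<Phi> a l' i j' \<noteq> 0"
    using \<Phi>_inj[OF column_D(1)[OF a(1)]] a(2) by blast
  then have i: "i \<in> I l" "\<Phi> a l i j \<noteq> 0" using column_D(2)[OF a(1)] by metis+
  define c where "c = el (\<lambda>l' p q. if l' = l \<and> q = i then \<Phi> b l p j / \<Phi> a l i j else 0)"
  have c: "c \<in> carrier A" by (simp add: c_def el)
  have "b = c \<otimes> a"
  proof (rule \<Phi>_eqI)
    fix l' p q assume l': "l' \<in> \<Lambda>" "p \<in> I l'" "q \<in> I l'"
    have "\<Phi> (c \<otimes> a) l' p q = (\<Sum>m\<in>I l'. \<Phi> c l' p m * \<Phi> a l' m q)"
      using l' c column_D(1)[OF a(1)] by (simp add: \<Phi>_mult)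
    also have "\<dots> = (\<Sum>m\<in>I l'. if m = i then (if l' = l then \<Phi> b l p j / \<Phi> a l i j * \<Phi> a l i q else 0) else 0)"
      using l' by (intro sum.cong refl) (simp add: c_def el)
    also have "\<dots> = (if l' = l then \<Phi> b l p j / \<Phi> a l i j * \<Phi> a l i q else 0)"
      using i fin_I[OF l'(1)] by auto
    also have "\<dots> = \<Phi> b l' p q"
      using i l' column_D(2)[OF a(1) l'(1) _ l'(3)] column_D(2)[OF b l'] by (cases "l' = l \<and> q = j") auto
    finally show "\<Phi> b l' p q = \<Phi> (c \<otimes> a) l' p q" by simp
  qed (use c column_D(1) a b in auto)
  then show ?thesis using that c by blast
qed

lemma irreducible_column:
  assumes l: "l \<in> \<Lambda>" "j \<in> I l"
  shows "irreducible_module A (col_module l j)"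
  unfolding irreducible_module_def
proof (intro conjI allI impI)
  show "left_module A (col_module l j)" by (rule left_module_column)
  show "carrier (col_module l j) \<noteq> {\<zero>\<^bsub>col_module l j\<^esub>}"
    using mat_unit_column[of l j j] mat_unit_nonzero[OF l(1,2,2)] by (auto simp: regular_module_def)
next
  fix H assume H: "Module.submodule H A (col_module l j)"
  interpret C: left_module A "col_module l j" by (rule left_module_column)
  note sub = C.submoduleD[OF H]
  show "H = {\<zero>\<^bsub>col_module l j\<^esub>} \<or> H = carrier (col_module l j)"
  proof (cases "H \<subseteq> {\<zero>}")
    case True
    then show ?thesis using sub(2) by (auto simp: regular_module_def)
  next
    case False
    then obtain a where a: "a \<in> H" "a \<noteq> \<zero>" by blast
    then have ac: "a \<in> column l j" using sub(1) by auto
    have "b \<in> H" if b: "b \<in> column l j" for b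
    proof -
      obtain c where "c \<in> carrier A" "b = c \<otimes> a" by (rule column_generated[OF l ac a(2) b])
      then show ?thesis using sub(5)[of c a] a(1) by (simp add: regular_module_def)
    qed
    then show ?thesis using sub(1) by auto
  qed
qed

lemma \<Phi>_finsum:
  assumes "finite S" "\<And>s. s \<in> S \<Longrightarrow> f s \<in> carrier A" "l \<in> \<Lambda>" "i \<in> I l" "j \<in> I l"
  shows "\<Phi> (finsum A f S) l i j = (\<Sum>s\<in>S. \<Phi> (f s) l i j)"
  using assms(1,2)
proof (induction S)
  case empty
  then show ?case using \<Phi>_zero assms by simp
next
  case (insert s S)
  then have "finsum A f S \<in> carrier A" by (intro finsum_closed) auto
  then show ?case using insert assms by (simp add: finsum_insert \<Phi>_add Pi_def)
qed

text \<open>The decomposition of the regular module is indexed by columns as sets, so different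
  positions have to give different sets. The diagonal matrix unit tells them apart.\<close>

lemma column_inj:
  assumes l: "l \<in> \<Lambda>" "j \<in> I l" and l': "l' \<in> \<Lambda>" "j' \<in> I l'" and eq: "column l j = column l' j'"
  shows "l = l' \<and> j = j'"
proof -
  have "mat_unit l j j \<in> column l' j'" using mat_unit_column eq by blast
  moreover have "\<Phi> (mat_unit l j j) l j j \<noteq> 0" using \<Phi>_mat_unit l by simp
  ultimately show ?thesis using column_D(2) l by metis
qed

text \<open>Cutting all matrices into their columns decomposes the regular module. The component in
  a column is unique because entries are additive and all other summands vanish at the positions of
  that column.\<close>

lemma semisimple: "semisimple_algebra class_ring A"
proof -
  define \<S> where "\<S> = (\<Union>l\<in>\<Lambda>. (\<lambda>j. column l j) ` I l)"
  have fin: "finite \<S>" using fin_\<Lambda> fin_I by (auto simp: \<S>_def)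
  have sum_\<S>: "\<Phi> (finsum A f \<S>) l i j = \<Phi> (f (column l j)) l i j"
    if f: "f \<in> (\<Pi>\<^sub>E H\<in>\<S>. H)" and l: "l \<in> \<Lambda>" "i \<in> I l" "j \<in> I l" for f l i j
  proof -
    have fH: "f H \<in> H" if "H \<in> \<S>" for H using f that by auto
    have "f H \<in> carrier A" if "H \<in> \<S>" for H using fH[OF that] that column_D(1) by (auto simp: \<S>_def)
    then have "\<Phi> (finsum A f \<S>) l i j = (\<Sum>H\<in>\<S>. \<Phi> (f H) l i j)" using \<Phi>_finsum[OF fin _ l] by blast
    also have "\<dots> = (\<Sum>H\<in>\<S>. if H = column l j then \<Phi> (f H) l i j else 0)"
    proof (intro sum.cong refl)
      fix H assume H: "H \<in> \<S>"
      then obtain l' j' where "l' \<in> \<Lambda>" "j' \<in> I l'" "H = column l' j'" by (auto simp: \<S>_def)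
      then show "\<Phi> (f H) l i j = (if H = column l j then \<Phi> (f H) l i j else 0)"
        using fH[OF H] column_D(2)[of "f H" l' j' l i j] l by auto
    qed
    also have "\<dots> = \<Phi> (f (column l j)) l i j" using fin l by (auto simp: \<S>_def)
    finally show ?thesis .
  qed
  have "\<exists>!f. f \<in> (\<Pi>\<^sub>E H\<in>\<S>. H) \<and> a = finsum A f \<S>" if a: "a \<in> carrier A" for a
  proof (rule ex_ex1I)
    \<comment> \<open>The component in \<open>H\<close> keeps the entries of \<open>a\<close> in the
      column \<open>H\<close> and replaces all others by zero.\<close>
    define f where "f = (\<lambda>H\<in>\<S>. el (\<lambda>l i j. if column l j = H then \<Phi> a l i j else 0))"
    have f: "f \<in> (\<Pi>\<^sub>E H\<in>\<S>. H)"
    proof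
      fix H assume H: "H \<in> \<S>"
      then obtain l j where lj: "l \<in> \<Lambda>" "j \<in> I l" "H = column l j" by (auto simp: \<S>_def)
      show "f H \<in> H"
      proof -
        have "l' = l \<and> j' = j" if "l' \<in> \<Lambda>" "i \<in> I l'" "j' \<in> I l'" "\<Phi> (f H) l' i j' \<noteq> 0" for l' i j'
        proof -
          have "column l' j' = H" using that H by (auto simp: f_def el split: if_splits)
          then show ?thesis using column_inj that lj by metis
        qed
        moreover have "f H \<in> carrier A" using H by (simp add: f_def el)
        ultimately show ?thesis unfolding lj(3) column_def by blast
      qed
    qed (simp add: f_def)
    have "a = finsum A f \<S>"
    proof (rule \<Phi>_eqI[OF a])
      show "finsum A f \<S> \<in> carrier A" by (intro finsum_closed) (auto simp: f_def el)
    next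
      fix l i j assume l: "l \<in> \<Lambda>" "i \<in> I l" "j \<in> I l"
      then have "column l j \<in> \<S>" by (auto simp: \<S>_def)
      then show "\<Phi> a l i j = \<Phi> (finsum A f \<S>) l i j" using sum_\<S>[OF f l] l by (simp add: f_def el)
    qed
    then show "\<exists>f. f \<in> (\<Pi>\<^sub>E H\<in>\<S>. H) \<and> a = finsum A f \<S>" using f by blast
  next
    fix f g assume fg: "f \<in> (\<Pi>\<^sub>E H\<in>\<S>. H) \<and> a = finsum A f \<S>" "g \<in> (\<Pi>\<^sub>E H\<in>\<S>. H) \<and> a = finsum A g \<S>"
    show "f = g"
    proof (rule PiE_ext[of f \<S> "\<lambda>H. H" g])
      fix H assume H: "H \<in> \<S>"
      then obtain l j where lj: "l \<in> \<Lambda>" "j \<in> I l" "H = column l j" by (auto simp: \<S>_def)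
      have c: "f H \<in> column l j" "g H \<in> column l j" using fg H lj(3) by auto
      show "f H = g H"
      proof (rule \<Phi>_eqI)
        fix l' i j' assume l': "l' \<in> \<Lambda>" "i \<in> I l'" "j' \<in> I l'"
        show "\<Phi> (f H) l' i j' = \<Phi> (g H) l' i j'"
        proof (cases "l' = l \<and> j' = j")
          case True
          then show ?thesis using sum_\<S>[of f l' i j'] sum_\<S>[of g l' i j'] fg l' lj(3) by auto
        next
          case False
          then show ?thesis using column_D(2)[OF c(1) l'] column_D(2)[OF c(2) l'] by simp
        qed
      qed (use c column_D(1) in auto)
    qed (use fg in auto)
  qed
  moreover have "\<forall>H\<in>\<S>. Module.submodule H A (regular_module A) \<and> irreducible_module A ((regular_module A)\<lparr>carrier := H\<rparr>)"
    using column_submodule irreducible_column by (auto simp: \<S>_def)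
  moreover have "assoc_algebra class_ring A" by (rule assoc_algebra_axioms)
  ultimately show ?thesis unfolding semisimple_algebra_def finsum_regular_module
    by (intro conjI exI[of _ \<S>] ballI) (simp_all add: fin)
qed

text \<open>The central idempotent \<open>e\<close> of block \<open>l\<close> acts as the identity
  on the columns of that block and as zero on those of the other blocks. A homomorphism commutes
  with \<open>e\<close>, so between different blocks it is zero.\<close>

lemma not_isomorphic_columns:
  assumes l: "l \<in> \<Lambda>" "j \<in> I l" and l': "l' \<in> \<Lambda>" "j' \<in> I l'"
    and iso: "isomorphic_modules A (col_module l j) (col_module l' j')"
  shows "l = l'"
proof (rule ccontr)
  assume ne: "l \<noteq> l'"
  obtain f where f: "f \<in> LinearCombinations.module_hom A (col_module l j) (col_module l' j')"
      and bij: "bij_betw f (column l j) (column l' j')"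
    using iso by (auto simp: isomorphic_modules_def)
  define e where "e = el (\<lambda>l' i j. if l' = l \<and> i = j then 1 else 0)"
  have eA: "e \<in> carrier A" by (simp add: e_def el)
  have act: "e \<otimes> a = (if p = l then a else \<zero>)" if p: "a \<in> column p q" for a p q
  proof (rule \<Phi>_eqI)
    fix m i i' assume m: "m \<in> \<Lambda>" "i \<in> I m" "i' \<in> I m"
    have "\<Phi> (e \<otimes> a) m i i' = (\<Sum>s\<in>I m. \<Phi> e m i s * \<Phi> a m s i')"
      using m eA column_D(1)[OF p] by (simp add: \<Phi>_mult)
    also have "\<dots> = (\<Sum>s\<in>I m. if s = i then (if m = l then \<Phi> a m i i' else 0) else 0)"
      using m by (intro sum.cong refl) (simp add: e_def el)
    also have "\<dots> = (if m = l then \<Phi> a m i i' else 0)" using m fin_I[OF m(1)] by auto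
    finally show "\<Phi> (e \<otimes> a) m i i' = \<Phi> (if p = l then a else \<zero>) m i i'"
      using column_D(2)[OF p m] \<Phi>_zero[OF m] by auto
  qed (use eA column_D(1)[OF p] in auto)
  have hom: "f (e \<otimes> a) = e \<otimes> f a" if "a \<in> column l j" for a
    using f eA that by (auto simp: LinearCombinations.module_hom_def regular_module_def)
  have zero: "\<zero> \<in> column l j" by (auto simp: column_def \<Phi>_zero)
  have "f a = \<zero>" if a: "a \<in> column l j" for a
  proof -
    have "f a \<in> column l' j'" using bij a by (auto simp: bij_betw_def)
    then show ?thesis using hom[OF a] act[OF a] act[of "f a" l' j'] ne by simp
  qed
  then have "f (mat_unit l j j) = f \<zero>" using zero mat_unit_column by metis
  then have "mat_unit l j j = \<zero>" using bij zero mat_unit_column by (metis bij_betw_imp_inj_on inj_onD)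
  then show False using mat_unit_nonzero l by blast
qed

text \<open>The unit is the sum of the diagonal matrix units, so one of them does not kill a chosen
  nonzero \<open>v\<close>. Moving the result to the selected column gives a nonzero homomorphism
  from a simple column to the simple module \<open>N\<close>, which is bijective by Schur's
  argument. Its inverse is the required isomorphism.\<close>

lemma irreducible_imp_isomorphic_column:
  assumes N: "irreducible_module A N" and pick: "\<And>l. l \<in> \<Lambda> \<Longrightarrow> p l \<in> I l"
  shows "\<exists>l\<in>\<Lambda>. isomorphic_modules A N (col_module l (p l))"
proof -
  interpret N: left_module A N using N by (simp add: irreducible_module_def)
  obtain v where v: "v \<in> carrier N" "v \<noteq> \<zero>\<^bsub>N\<^esub>"
    using N N.M.zero_closed unfolding irreducible_module_def by blast
  \<comment> \<open>\<open>D P\<close> is the sum of the diagonal matrix units at the positions in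
    \<open>P\<close>; over all positions it is the unit.\<close>
  define D where "D P = el (\<lambda>l i j. if i = j \<and> (l, i) \<in> P then 1 else 0)" for P
  have DA: "D P \<in> carrier A" for P by (simp add: D_def el)
  have \<Phi>D: "\<Phi> (D P) l i j = (if i = j \<and> (l, i) \<in> P then 1 else 0)" if "l \<in> \<Lambda>" "i \<in> I l" "j \<in> I l" for P l i j
    using that by (simp add: D_def el)
  have "\<exists>l\<in>\<Lambda>. \<exists>j\<in>I l. mat_unit l j j \<odot>\<^bsub>N\<^esub> v \<noteq> \<zero>\<^bsub>N\<^esub>"
  proof (rule ccontr)
    assume "\<not> ?thesis"
    then have kill: "mat_unit l j j \<odot>\<^bsub>N\<^esub> v = \<zero>\<^bsub>N\<^esub>" if "l \<in> \<Lambda>" "j \<in> I l" for l j using that by blast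
    have "D P \<odot>\<^bsub>N\<^esub> v = \<zero>\<^bsub>N\<^esub>" if "finite P" "P \<subseteq> Sigma \<Lambda> I" for P
      using that
    proof (induction P)
      case empty
      have "D {} = \<zero>" by (rule \<Phi>_eqI) (auto simp: DA \<Phi>D \<Phi>_zero)
      then show ?case using N.lsmult_zero_left v by simp
    next
      case (insert q P)
      obtain l j where q: "q = (l, j)" "l \<in> \<Lambda>" "j \<in> I l" using insert by auto
      have "D (insert q P) = mat_unit l j j \<oplus> D P"
        using insert q by (intro \<Phi>_eqI) (auto simp: DA \<Phi>D \<Phi>_add \<Phi>_mat_unit)
      then show ?case using insert v kill[OF q(2,3)] by (simp add: N.lsmult_l_distr DA)
    qed
    moreover have "D (Sigma \<Lambda> I) = \<one>" by (rule \<Phi>_eqI) (auto simp: DA \<Phi>D \<Phi>_one)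
    moreover have "finite (Sigma \<Lambda> I)" using fin_\<Lambda> fin_I by auto
    ultimately have "\<one> \<odot>\<^bsub>N\<^esub> v = \<zero>\<^bsub>N\<^esub>" by (metis order_refl)
    then show False using v N.lsmult_one by simp
  qed
  then obtain l j where l: "l \<in> \<Lambda>" "j \<in> I l" and nz: "mat_unit l j j \<odot>\<^bsub>N\<^esub> v \<noteq> \<zero>\<^bsub>N\<^esub>" by blast
  define q where "q = p l"
  have q: "q \<in> I l" using pick l by (simp add: q_def)
  let ?C = "col_module l q"
  interpret C: left_module A ?C by (rule left_module_column)
  \<comment> \<open>The matrix unit \<open>mat_unit l j q\<close> sends \<open>w\<close> back to the
    nonzero vector found above, so acting on \<open>w\<close> is not the zero map on column
    \<open>q\<close>.\<close>
  define w where "w = mat_unit l q j \<odot>\<^bsub>N\<^esub> v"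
  have w: "w \<in> carrier N" using v by (simp add: w_def N.lsmult_closed)
  have "mat_unit l j q \<odot>\<^bsub>N\<^esub> w = mat_unit l j j \<odot>\<^bsub>N\<^esub> v"
    using v mat_unit_mult[OF l(1,2) q l(2)] by (simp add: w_def flip: N.lsmult_assoc)
  then have nz': "mat_unit l j q \<odot>\<^bsub>N\<^esub> w \<noteq> \<zero>\<^bsub>N\<^esub>" using nz by simp
  define g where "g a = a \<odot>\<^bsub>N\<^esub> w" for a
  have gN: "g a \<in> carrier N" if "a \<in> column l q" for a
    using that column_D(1) w by (simp add: g_def N.lsmult_closed)
  have gadd: "g (a \<oplus> b) = g a \<oplus>\<^bsub>N\<^esub> g b" if "a \<in> column l q" "b \<in> column l q" for a b
    using that column_D(1) w by (simp add: g_def N.lsmult_l_distr)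
  have gsm: "g (c \<otimes> a) = c \<odot>\<^bsub>N\<^esub> g a" if "c \<in> carrier A" "a \<in> column l q" for a c
    using that column_D(1) w by (simp add: g_def N.lsmult_assoc)
  have gz: "g \<zero> = \<zero>\<^bsub>N\<^esub>" using w by (simp add: g_def N.lsmult_zero_left)
  have Cops: "a \<oplus>\<^bsub>?C\<^esub> b = a \<oplus> b" "c \<odot>\<^bsub>?C\<^esub> a = c \<otimes> a" "\<zero>\<^bsub>?C\<^esub> = \<zero>" "carrier ?C = column l q" for a b c
    by (simp_all add: regular_module_def)
  have Cclosed: "a \<oplus> b \<in> column l q" "c \<otimes> a \<in> column l q"
    if "a \<in> column l q" "b \<in> column l q" "c \<in> carrier A" for a b c
    using C.M.a_closed[of a b] C.lsmult_closed[of c a] that unfolding Cops by auto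
  let ?K = "{a \<in> column l q. g a = \<zero>\<^bsub>N\<^esub>}"
  have "Module.submodule ?K A ?C"
    by (rule C.submoduleI; unfold Cops) (use Cclosed gadd gsm gz C.M.zero_closed N.lsmult_zero_right Cops in auto)
  moreover have "?K \<noteq> carrier ?C" using nz' mat_unit_column[of l j q] unfolding Cops g_def by blast
  ultimately have K: "?K = {\<zero>}" using irreducible_column[OF l(1) q] unfolding irreducible_module_def Cops by blast
  have inj: "inj_on g (column l q)"
  proof (rule inj_onI)
    fix a b assume a: "a \<in> column l q" and b: "b \<in> column l q" and eq: "g a = g b"
    have mb: "\<ominus>\<^bsub>?C\<^esub> b \<in> column l q" "b \<oplus> \<ominus>\<^bsub>?C\<^esub> b = \<zero>" using C.M.a_inv_closed[of b] C.M.r_neg[of b] b unfolding Cops by auto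
    have "g (a \<oplus> \<ominus>\<^bsub>?C\<^esub> b) = g (b \<oplus> \<ominus>\<^bsub>?C\<^esub> b)" using gadd[OF a mb(1)] gadd[OF b mb(1)] eq by (simp only:)
    then have "a \<oplus> \<ominus>\<^bsub>?C\<^esub> b \<in> ?K" using Cclosed(1)[OF a mb(1) zero_closed] mb gz by simp
    then have "a \<oplus> \<ominus>\<^bsub>?C\<^esub> b = b \<oplus> \<ominus>\<^bsub>?C\<^esub> b" using K mb(2) by auto
    then show "a = b" using column_D(1) a b mb(1) by (metis add.right_cancel)
  qed
  let ?Im = "g ` column l q"
  have "Module.submodule ?Im A N"
  proof (rule N.submoduleI)
    show "\<zero>\<^bsub>N\<^esub> \<in> ?Im" using gz C.M.zero_closed unfolding Cops by force
    show "?Im \<subseteq> carrier N" using gN by blast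
  next
    fix x y assume "x \<in> ?Im" "y \<in> ?Im"
    then obtain a b where "a \<in> column l q" "b \<in> column l q" "x = g a" "y = g b" by blast
    then have "a \<oplus> b \<in> column l q" "x \<oplus>\<^bsub>N\<^esub> y = g (a \<oplus> b)" using Cclosed(1)[of a b \<zero>] gadd by simp_all
    then show "x \<oplus>\<^bsub>N\<^esub> y \<in> ?Im" by blast
  next
    fix c x assume "c \<in> carrier A" "x \<in> ?Im"
    then obtain a where "c \<in> carrier A" "a \<in> column l q" "x = g a" by blast
    then have "c \<otimes> a \<in> column l q" "c \<odot>\<^bsub>N\<^esub> x = g (c \<otimes> a)" using Cclosed(2)[of a a c] gsm by simp_all
    then show "c \<odot>\<^bsub>N\<^esub> x \<in> ?Im" by blast
  qed
  moreover have "?Im \<noteq> {\<zero>\<^bsub>N\<^esub>}" using nz' mat_unit_column[of l j q] unfolding g_def by blast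
  ultimately have surj: "?Im = carrier N" using N unfolding irreducible_module_def by blast
  have bij: "bij_betw g (column l q) (carrier N)" using inj surj by (simp add: bij_betw_def)
  let ?h = "the_inv_into (column l q) g"
  have h: "?h x \<in> column l q" "g (?h x) = x" if "x \<in> carrier N" for x
    using the_inv_into_into[OF inj, of x] f_the_inv_into_f[OF inj, of x] surj that by auto
  have hg: "?h (g a) = a" if "a \<in> column l q" for a using the_inv_into_f_f[OF inj that] .
  have "?h \<in> LinearCombinations.module_hom A N ?C"
    unfolding LinearCombinations.module_hom_def Cops
  proof (intro CollectI conjI allI impI; (elim conjE)?)
    fix x y assume xy: "x \<in> carrier N" "y \<in> carrier N"
    then have "g (?h x \<oplus> ?h y) = x \<oplus>\<^bsub>N\<^esub> y" using h gadd by simp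
    then show "?h (x \<oplus>\<^bsub>N\<^esub> y) = ?h x \<oplus> ?h y" using hg Cclosed(1)[of "?h x" "?h y"] h xy by (metis zero_closed)
  next
    fix c x assume cx: "c \<in> carrier A" "x \<in> carrier N"
    then have "g (c \<otimes> ?h x) = c \<odot>\<^bsub>N\<^esub> x" using h gsm by simp
    then show "?h (c \<odot>\<^bsub>N\<^esub> x) = c \<otimes> ?h x" using hg Cclosed(2)[of "?h x" "?h x" c] h cx by metis
  qed (use h in auto)
  moreover have "bij_betw ?h (carrier N) (carrier ?C)" using bij_betw_the_inv_into[OF bij] unfolding Cops .
  ultimately show ?thesis using l(1) unfolding isomorphic_modules_def q_def by blast
qed

end

section \<open>Columns as complex vector spaces\<close>

context split_algebra
begin

text \<open>Scalars can be pulled out of products, so acting by a multiple of the unit is the scalar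
  multiplication of the algebra itself.\<close>

lemma underlying_column_simps:
  "carrier (underlying_space A (col_module l j)) = column l j"
  "\<zero>\<^bsub>underlying_space A (col_module l j)\<^esub> = \<zero>"
  "v \<oplus>\<^bsub>underlying_space A (col_module l j)\<^esub> w = v \<oplus> w"
  "v \<in> carrier A \<Longrightarrow> c \<odot>\<^bsub>underlying_space A (col_module l j)\<^esub> v = c \<odot> v"
  by (simp_all add: underlying_space_def regular_module_def smult_mult_left)

lemma column_smult: "v \<in> column l j \<Longrightarrow> c \<odot> v \<in> column l j"
  by (auto simp: column_def \<Phi>_smult)

lemma vectorspace_underlying_column: "vectorspace class_ring (underlying_space A (col_module l j))"
proof -
  let ?V = "underlying_space A (col_module l j)"
  interpret C: left_module A "col_module l j" by (rule left_module_column)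
  have "abelian_group ?V"
  proof (rule abelian_groupI)
    fix v w assume "v \<in> carrier ?V" "w \<in> carrier ?V"
    then show "v \<oplus>\<^bsub>?V\<^esub> w \<in> carrier ?V" "v \<oplus>\<^bsub>?V\<^esub> w = w \<oplus>\<^bsub>?V\<^esub> v"
      using C.M.a_closed[of v w] C.M.a_comm[of v w] by (simp_all add: underlying_space_def)
  next
    fix v assume "v \<in> carrier ?V"
    then show "\<exists>w\<in>carrier ?V. w \<oplus>\<^bsub>?V\<^esub> v = \<zero>\<^bsub>?V\<^esub>"
      using C.M.l_neg[of v] C.M.a_inv_closed[of v] by (auto simp: underlying_space_def)
  qed (use C.M.a_assoc C.M.zero_closed C.M.l_zero in \<open>auto simp: underlying_space_def\<close>)
  moreover have "module_axioms class_ring ?V"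
  proof -
    have "v \<oplus> w \<in> column l j" if "v \<in> column l j" "w \<in> column l j" for v w
      using C.M.a_closed[of v w] that by (simp add: regular_module_def)
    moreover have "(a + b) \<odot> v = a \<odot> v \<oplus> b \<odot> v" "a * b \<odot> v = a \<odot> (b \<odot> v)" "1 \<odot> v = v"
      if "v \<in> column l j" for a b v
      using smult_l_distr[of a b v] smult_assoc1[of a b v] smult_one[of v] column_D(1)[OF that] by simp_all
    ultimately show ?thesis
      using column_D(1) column_smult
      by (auto simp: Module.module_axioms_def underlying_column_simps smult_r_distr)
  qed
  ultimately have "Module.module class_ring ?V" by (simp add: module_class_ring_iff)
  then show ?thesis using class_field by (simp add: vectorspace_def)
qed

text \<open>The matrix units of a column form a basis: the coefficients of an element are its own
  entries, which gives both spanning and independence.\<close>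

lemma dim_column:
  assumes l: "l \<in> \<Lambda>" "j \<in> I l"
  shows "vectorspace.fin_dim class_ring (underlying_space A (col_module l j))"
    and "vectorspace.dim class_ring (underlying_space A (col_module l j)) = card (I l)"
proof -
  let ?V = "underlying_space A (col_module l j)"
  interpret V: vectorspace class_ring ?V by (rule vectorspace_underlying_column)
  let ?B = "(\<lambda>i. mat_unit l i j) ` I l"
  have B: "?B \<subseteq> column l j" using mat_unit_column by blast
  have finB: "finite ?B" using fin_I l by simp
  have inj: "inj_on (\<lambda>i. mat_unit l i j) (I l)"
  proof (rule inj_onI)
    fix i i' assume i: "i \<in> I l" "i' \<in> I l" "mat_unit l i j = mat_unit l i' j"
    then show "i = i'" using \<Phi>_mat_unit[OF l(1) i(1) l(2), of l i j] \<Phi>_mat_unit[OF l(1) i(1) l(2), of l i' j] by (auto split: if_splits)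
  qed
  \<comment> \<open>The sum is formed in the space of the column rather than in the algebra.
    Additivity of the entries is carried along with membership in the column.\<close>
  have fs: "finsum ?V f S \<in> column l j \<and> \<Phi> (finsum ?V f S) l' i i' = (\<Sum>s\<in>S. \<Phi> (f s) l' i i')"
    if "finite S" "\<And>s. s \<in> S \<Longrightarrow> f s \<in> column l j" "l' \<in> \<Lambda>" "i \<in> I l'" "i' \<in> I l'" for f and S :: "'a set" and l' i i'
    using that(1,2)
  proof (induction S)
    case empty
    then show ?case using V.M.zero_closed \<Phi>_zero that by (simp add: underlying_column_simps)
  next
    case (insert s S)
    then have f: "f \<in> S \<rightarrow> carrier ?V" "f s \<in> carrier ?V" by (auto simp: underlying_column_simps)
    have IH: "finsum ?V f S \<in> column l j" "\<Phi> (finsum ?V f S) l' i i' = (\<Sum>s\<in>S. \<Phi> (f s) l' i i')" using insert by auto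
    have "finsum ?V f (insert s S) = f s \<oplus> finsum ?V f S"
      using V.M.finsum_insert[OF insert(1,2) f] by (simp add: underlying_column_simps)
    moreover have "f s \<oplus> finsum ?V f S \<in> column l j"
      using V.M.a_closed[of "f s" "finsum ?V f S"] f IH by (simp add: underlying_column_simps)
    moreover have "\<Phi> (f s \<oplus> finsum ?V f S) l' i i' = \<Phi> (f s) l' i i' + \<Phi> (finsum ?V f S) l' i i'"
      using f(2) IH(1) column_D(1) that(3-5) by (intro \<Phi>_add) (auto simp: underlying_column_simps)
    ultimately show ?case using insert(1,2) IH(2) by simp
  qed
  have lc: "V.lincomb a S \<in> column l j \<and> \<Phi> (V.lincomb a S) l' i i' = (\<Sum>s\<in>S. a s * \<Phi> s l' i i')"
    if S: "finite S" "S \<subseteq> column l j" and l': "l' \<in> \<Lambda>" "i \<in> I l'" "i' \<in> I l'" for a S l' i i'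
  proof -
    have sm: "a s \<odot>\<^bsub>?V\<^esub> s = a s \<odot> s" "s \<in> carrier A" "a s \<odot> s \<in> column l j" if "s \<in> S" for s
      using that S column_D(1) column_smult by (auto simp: underlying_column_simps)
    have "V.lincomb a S \<in> column l j \<and> \<Phi> (V.lincomb a S) l' i i' = (\<Sum>s\<in>S. \<Phi> (a s \<odot>\<^bsub>?V\<^esub> s) l' i i')"
      unfolding V.lincomb_def using sm by (intro fs S l') simp
    then show ?thesis using sm l' by (simp add: \<Phi>_smult)
  qed
  have "V.span ?B = carrier ?V"
  proof
    show "V.span ?B \<subseteq> carrier ?V"
    proof
      fix v assume "v \<in> V.span ?B"
      then obtain a S where "v = V.lincomb a S" "finite S" "S \<subseteq> ?B" unfolding V.span_def by blast
      then show "v \<in> carrier ?V" using lc[of S] B l by (auto simp: underlying_column_simps)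
    qed
    show "carrier ?V \<subseteq> V.span ?B"
    proof
      fix v assume "v \<in> carrier ?V"
      then have v: "v \<in> column l j" by (simp add: underlying_column_simps)
      \<comment> \<open>Linear combinations take coefficients indexed by vectors, not by
        \<open>i\<close>. As \<open>i \<mapsto> mat_unit l i j\<close> is injective, the sum has a
        single relevant term at each basis vector.\<close>
      define a where "a b = (\<Sum>i\<in>I l. if b = mat_unit l i j then \<Phi> v l i j else 0)" for b
      have am: "a (mat_unit l i j) = \<Phi> v l i j" if "i \<in> I l" for i
      proof -
        have "a (mat_unit l i j) = (\<Sum>i'\<in>I l. if i' = i then \<Phi> v l i' j else 0)"
          unfolding a_def using inj that by (intro sum.cong refl) (auto dest: inj_onD)
        then show ?thesis using that fin_I l by simp
      qed
      have "v = V.lincomb a ?B"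
      proof (rule \<Phi>_eqI)
        show "V.lincomb a ?B \<in> carrier A" using lc[OF finB B, of l j j a] l column_D(1) by blast
        show "v \<in> carrier A" using v column_D(1) by blast
        fix l' i i' assume l': "l' \<in> \<Lambda>" "i \<in> I l'" "i' \<in> I l'"
        have "\<Phi> (V.lincomb a ?B) l' i i' = (\<Sum>s\<in>?B. a s * \<Phi> s l' i i')" using lc[OF finB B l'] by blast
        also have "\<dots> = (\<Sum>p\<in>I l. \<Phi> v l p j * \<Phi> (mat_unit l p j) l' i i')"
          by (subst sum.reindex[OF inj]) (simp add: am)
        also have "\<dots> = (\<Sum>p\<in>I l. if p = i then (if l' = l \<and> i' = j then \<Phi> v l i j else 0) else 0)"
          using l' by (intro sum.cong refl) (simp add: \<Phi>_mat_unit)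
        also have "\<dots> = \<Phi> v l' i i'"
          using column_D(2)[OF v l'] l' fin_I l by auto
        finally show "\<Phi> v l' i i' = \<Phi> (V.lincomb a ?B) l' i i'" by simp
      qed
      then show "v \<in> V.span ?B" unfolding V.span_def using finB by auto
    qed
  qed
  moreover have "\<not> V.lin_dep ?B"
  proof
    assume "V.lin_dep ?B"
    then obtain S a v where S: "finite S" "S \<subseteq> ?B" "V.lincomb a S = \<zero>\<^bsub>?V\<^esub>" "v \<in> S" "a v \<noteq> 0"
      unfolding V.lin_dep_def by auto
    obtain i where i: "i \<in> I l" "v = mat_unit l i j" using S(2,4) by blast
    have "0 = (\<Sum>s\<in>S. a s * \<Phi> s l i j)"
      using lc[of S l i j a] S(1-3) B i l \<Phi>_zero[OF l(1) i(1) l(2)] by (auto simp: underlying_column_simps)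
    also have "\<dots> = (\<Sum>s\<in>S. if s = v then a v else 0)"
    proof (intro sum.cong refl)
      fix s assume "s \<in> S"
      then obtain i' where "i' \<in> I l" "s = mat_unit l i' j" using S(2) by blast
      then show "a s * \<Phi> s l i j = (if s = v then a v else 0)"
        using i l inj by (auto simp: \<Phi>_mat_unit dest: inj_onD)
    qed
    also have "\<dots> = a v" using S(1,4) by simp
    finally show False using S(5) by simp
  qed
  ultimately have bas: "V.basis ?B" unfolding V.basis_def using B by (simp add: underlying_column_simps)
  show "V.fin_dim" unfolding V.fin_dim_def using bas finB unfolding V.basis_def by blast
  show "V.dim = card (I l)" using V.dim_basis[OF finB bas] card_image[OF inj] by simp
qed

end

section \<open>Superposition of two matchings\<close>

text \<open>Partial matchings on an arbitrary vertex set, so that diagrams, their copies inside a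
  stack, and half diagrams are treated alike.\<close>

definition matchings :: "'a set \<Rightarrow> 'a set set set" where
  "matchings V = {d. (\<forall>e\<in>d. e \<subseteq> V \<and> card e = 2) \<and>
                     (\<forall>e\<in>d. \<forall>e'\<in>d. e \<noteq> e' \<longrightarrow> e \<inter> e' = {})}"

lemma RB_diagrams_matchings: "RB_diagrams k = matchings (vertices k)"
  by (simp add: RB_diagrams_def matchings_def)

lemma matchings_subset: "d \<in> matchings V \<Longrightarrow> \<Union>d \<subseteq> V"
  by (auto simp: matchings_def)

lemma matchings_mono: "d \<in> matchings V \<Longrightarrow> \<Union>d \<subseteq> W \<Longrightarrow> d \<in> matchings W"
  by (fastforce simp: matchings_def)

lemma matching_partner: "d \<in> matchings V \<Longrightarrow> {u, v} \<in> d \<Longrightarrow> {u, w} \<in> d \<Longrightarrow> v = w"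
proof -
  assume d: "d \<in> matchings V" "{u, v} \<in> d" "{u, w} \<in> d"
  have "\<forall>e\<in>d. \<forall>e'\<in>d. e \<noteq> e' \<longrightarrow> e \<inter> e' = {}" using d(1) by (simp add: matchings_def)
  moreover have "{u, v} \<inter> {u, w} \<noteq> {}" by simp
  ultimately have "{u, v} = {u, w}" using d(2,3) by metis
  then show "v = w" by (auto simp: doubleton_eq_iff)
qed

lemma matching_edgeE:
  assumes "d \<in> matchings V" "e \<in> d"
  obtains u v where "e = {u, v}" "u \<noteq> v" "u \<in> V" "v \<in> V"
  using assms unfolding matchings_def by (auto simp: card_2_iff)

lemma matching_vertexE:
  assumes "d \<in> matchings V" "u \<in> \<Union>d"
  obtains v where "{u, v} \<in> d" "v \<noteq> u"
proof -
  obtain e where e: "e \<in> d" "u \<in> e" using assms by auto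
  obtain a b where "e = {a, b}" "a \<noteq> b" by (rule matching_edgeE[OF assms(1) e(1)])
  then show ?thesis using e that by (auto simp: insert_commute)
qed

lemma matchings_image:
  assumes "inj_on f V" "d \<in> matchings V"
  shows "(\<lambda>e. f ` e) ` d \<in> matchings (f ` V)"
proof -
  have "e \<subseteq> V" "card e = 2" if "e \<in> d" for e using assms that by (auto simp: matchings_def)
  then have "f ` e \<subseteq> f ` V" "card (f ` e) = 2" if "e \<in> d" for e
    using that assms(1) by (auto simp: card_image inj_on_subset)
  moreover have "f ` e \<inter> f ` e' = {}" if "e \<in> d" "e' \<in> d" "f ` e \<noteq> f ` e'" for e e'
  proof -
    have "e \<noteq> e'" using that(3) by auto
    then have "e \<subseteq> V" "e' \<subseteq> V" "e \<inter> e' = {}" using assms(2) that(1,2) by (simp_all add: matchings_def)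
    then show ?thesis using assms(1) by (metis image_empty inj_on_image_Int)
  qed
  ultimately show ?thesis by (auto simp: matchings_def)
qed

text \<open>The edges of \<open>d\<close> inside \<open>S\<close> are disjoint pairs that exhaust
  \<open>S\<close>.\<close>

lemma even_card_matched:
  assumes "finite S" "d \<in> matchings V" "\<And>v. v \<in> S \<Longrightarrow> \<exists>w\<in>S. {v, w} \<in> d"
  shows "even (card S)"
proof -
  define P where "P = {e \<in> d. e \<subseteq> S}"
  have dis: "\<And>e e'. e \<in> P \<Longrightarrow> e' \<in> P \<Longrightarrow> e \<noteq> e' \<Longrightarrow> e \<inter> e' = {}" and c2: "\<And>e. e \<in> P \<Longrightarrow> card e = 2"
    using assms(2) by (auto simp: P_def matchings_def)
  have S: "S = \<Union>P" using assms(3) by (auto simp: P_def) 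
  have "finite P" using assms(1) S finite_UnionD by metis
  have "card (\<Union>P) = sum card P"
    using c2 dis by (intro card_Union_disjoint) (auto simp: disjnt_def pairwise_def card_ge_0_finite)
  also have "\<dots> = 2 * card P" using c2 by simp
  finally show ?thesis using S by simp
qed

section \<open>Connected components of a stacked pair of matchings\<close>

locale two_matchings =
  fixes U M L :: "'v set" and E1 E2 :: "'v set set"
  assumes fin: "finite U" "finite M" "finite L"
    and disj: "U \<inter> M = {}" "U \<inter> L = {}" "M \<inter> L = {}"
    and E1: "E1 \<in> matchings (U \<union> M)" and E2: "E2 \<in> matchings (M \<union> L)"
begin

definition conn :: "('v \<times> 'v) set" where
  "conn = {(u, v). {u, v} \<in> E1 \<union> E2}\<^sup>*"

text \<open>A middle vertex has to meet both matchings, an outer vertex the only one that it can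
  meet. An unsaturated vertex is therefore isolated in one of the diagrams, and colourings must
  vanish there.\<close>

definition saturated :: "'v \<Rightarrow> bool" where
  "saturated v \<longleftrightarrow> (v \<in> U \<union> M \<longrightarrow> v \<in> \<Union>E1) \<and> (v \<in> M \<union> L \<longrightarrow> v \<in> \<Union>E2)"

definition loops :: "'v set set" where
  "loops = {C. (\<exists>i\<in>M. C = conn `` {i}) \<and> C \<subseteq> M \<and> (\<forall>v\<in>C. v \<in> \<Union>E1 \<and> v \<in> \<Union>E2)}"

lemma sub1: "\<Union>E1 \<subseteq> U \<union> M" and sub2: "\<Union>E2 \<subseteq> M \<union> L"
  using matchings_subset E1 E2 by auto

lemma conn_refl [simp]: "(u, u) \<in> conn" by (simp add: conn_def)

lemma conn_sym: "(u, v) \<in> conn \<Longrightarrow> (v, u) \<in> conn"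
proof -
  have "sym {(u, v). {u, v} \<in> E1 \<union> E2}" by (auto simp: sym_def insert_commute)
  then show "(u, v) \<in> conn \<Longrightarrow> (v, u) \<in> conn" unfolding conn_def by (meson sym_rtrancl symD)
qed

lemma conn_trans: "(u, v) \<in> conn \<Longrightarrow> (v, w) \<in> conn \<Longrightarrow> (u, w) \<in> conn"
  by (simp add: conn_def)

lemma conn_edge: "{u, v} \<in> E1 \<union> E2 \<Longrightarrow> (u, v) \<in> conn"
  by (auto simp: conn_def)

lemma conn_class_eq: "(u, v) \<in> conn \<Longrightarrow> conn `` {u} = conn `` {v}"
  using conn_trans conn_sym by blast

lemma conn_closed:
  assumes "(u, v) \<in> conn" "u \<in> S" "\<And>a b. a \<in> S \<Longrightarrow> {a, b} \<in> E1 \<union> E2 \<Longrightarrow> b \<in> S"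
  shows "v \<in> S"
  using assms(1,2) unfolding conn_def by (induction rule: rtrancl_induct) (auto intro: assms(3))

lemma conn_vertices: "(u, v) \<in> conn \<Longrightarrow> u \<in> U \<union> M \<union> L \<Longrightarrow> v \<in> U \<union> M \<union> L"
  by (erule conn_closed) (use sub1 sub2 in auto)

lemma const_on_conn:
  assumes "\<forall>e\<in>E1 \<union> E2. \<forall>u\<in>e. \<forall>v\<in>e. g u = g v" "(u, v) \<in> conn"
  shows "g u = g v"
proof -
  have "v \<in> {w. g u = g w}"
    using assms(2)
  proof (rule conn_closed)
    fix a b assume "a \<in> {w. g u = g w}" and ab: "{a, b} \<in> E1 \<union> E2"
    moreover have "g a = g b" by (rule bspec[OF bspec[OF bspec[OF assms(1) ab]]]) simp_all
    ultimately show "b \<in> {w. g u = g w}" by simp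
  qed simp
  then show ?thesis by simp
qed

text \<open>A component is explored from an outer vertex \<open>u\<close> by alternating edges of the two matchings;
  the flag of a state says which matching is to be used next. The exploration is deterministic and
  stops at any further outer vertex.\<close>

definition steps :: "(('v \<times> bool) \<times> ('v \<times> bool)) set" where
  "steps = {((v, b), (w, \<not> b)) | v b w. {v, w} \<in> (if b then E1 else E2)}"

lemma steps_iff: "((v, b), (w, c)) \<in> steps \<longleftrightarrow> c = (\<not> b) \<and> {v, w} \<in> (if b then E1 else E2)"
  by (auto simp: steps_def)

lemma single_valued_steps: "single_valued steps"
  using matching_partner[OF E1] matching_partner[OF E2]
  by (auto simp: single_valued_def steps_def split: if_splits)

text \<open>The component of \<open>u\<close> is a path ending at \<open>v\<close>. The exploration
  from \<open>u\<close> is deterministic and cannot continue at a second outer vertex, so every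
  state that it reaches precedes the one at \<open>v\<close>. A vertex in between is entered and
  left along different matchings, which is saturation, and a third outer vertex would be another
  end.\<close>

lemma conn_outer:
  assumes u: "u \<in> U \<union> L" and v: "v \<in> U \<union> L" and "u \<noteq> v" and uv: "(u, v) \<in> conn" and uw: "(u, w) \<in> conn"
  shows "saturated w" "w \<in> U \<union> L \<Longrightarrow> w = u \<or> w = v"
proof -
  \<comment> \<open>An outer vertex can meet only one of the matchings, and the initial flag selects
    that one.\<close>
  define s0 where "s0 = (u, u \<in> U)"
  \<comment> \<open>A state other than the start was entered along the matching that is not to be
    used next.\<close>
  have pred: "\<exists>v'. {v', w'} \<in> (if b then E2 else E1) \<and> (s0, (v', \<not> b)) \<in> steps\<^sup>*"
    if "(s0, (w', b)) \<in> steps\<^sup>*" "(w', b) \<noteq> s0" for w' b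
  proof -
    obtain s where s: "(s0, s) \<in> steps\<^sup>*" "(s, (w', b)) \<in> steps"
      using rtranclE[OF \<open>(s0, (w', b)) \<in> steps\<^sup>*\<close>] \<open>(w', b) \<noteq> s0\<close> by metis
    obtain v' c where "s = (v', c)" by (cases s) blast
    then show ?thesis using s by (auto simp: steps_iff split: if_splits)
  qed
  have adv: "(s0, (b', \<not> c)) \<in> steps\<^sup>*" if "(s0, (a, c)) \<in> steps\<^sup>*" "{a, b'} \<in> (if c then E1 else E2)" for a b' c
    using that(2) by (intro rtrancl_into_rtrancl[OF that(1)]) (simp add: steps_iff)
  have reach: "\<exists>b. (s0, (w', b)) \<in> steps\<^sup>*" if "(u, w') \<in> conn" for w'
  proof -
    have "w' \<in> {w'. \<exists>b. (s0, (w', b)) \<in> steps\<^sup>*}"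
      using that
    proof (rule conn_closed)
      show "u \<in> {w'. \<exists>b. (s0, (w', b)) \<in> steps\<^sup>*}" by (auto simp: s0_def)
    next
      fix a b assume "a \<in> {w'. \<exists>b. (s0, (w', b)) \<in> steps\<^sup>*}" and ab: "{a, b} \<in> E1 \<union> E2"
      then obtain c where c: "(s0, (a, c)) \<in> steps\<^sup>*" by auto
      show "b \<in> {w'. \<exists>b. (s0, (w', b)) \<in> steps\<^sup>*}"
      proof (cases "{a, b} \<in> (if c then E1 else E2)")
        case True
        then show ?thesis using adv[OF c] by blast
      next
        \<comment> \<open>The edge belongs to the matching that is not next. It is then the edge
          along which \<open>a\<close> was entered, so \<open>b\<close> has been visited
          already.\<close>
        case False
        then have ab': "{a, b} \<in> (if c then E2 else E1)" using ab by (auto split: if_splits)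
        have "(a, c) \<noteq> s0"
        proof
          assume "(a, c) = s0"
          then have "a = u" "c = (u \<in> U)" by (auto simp: s0_def)
          moreover have "u \<in> \<Union>(if c then E2 else E1)" using ab' \<open>a = u\<close> by auto
          ultimately show False using u sub1 sub2 disj by (auto split: if_splits)
        qed
        then obtain v' where v': "{v', a} \<in> (if c then E2 else E1)" "(s0, (v', \<not> c)) \<in> steps\<^sup>*"
          using pred[OF c] by blast
        then have "v' = b"
          using ab' matching_partner[OF E1, of a v' b] matching_partner[OF E2, of a v' b]
          by (auto simp: insert_commute split: if_splits)
        then show ?thesis using v'(2) by auto
      qed
    qed
    then show ?thesis by simp
  qed
  have terminal: "(v', b) \<noteq> s0 \<and> \<not> (\<exists>s. ((v', b), s) \<in> steps)"
    if "v' \<in> U \<union> L" "v' \<noteq> u" "(s0, (v', b)) \<in> steps\<^sup>*" for v' b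
  proof -
    have ne: "(v', b) \<noteq> s0" using that by (auto simp: s0_def)
    then obtain v'' where "{v'', v'} \<in> (if b then E2 else E1)" using pred[OF \<open>(s0, (v', b)) \<in> steps\<^sup>*\<close>] by blast
    then have "v' \<in> \<Union>(if b then E2 else E1)" by auto
    then have b: "b \<longleftrightarrow> v' \<in> L" using that(1) sub1 sub2 disj by (auto split: if_splits)
    have "v' \<notin> \<Union>(if b then E1 else E2)" using b that(1) sub1 sub2 disj by (auto split: if_splits)
    then have "\<not> (\<exists>s. ((v', b), s) \<in> steps)" by (auto simp: steps_iff)
    then show ?thesis using ne by blast
  qed
  obtain b where b: "(s0, (v, b)) \<in> steps\<^sup>*" using reach[OF uv] by auto
  have tv: "(v, b) \<noteq> s0" "\<And>s. ((v, b), s) \<notin> steps" using terminal[OF v _ b] \<open>u \<noteq> v\<close> by auto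
  \<comment> \<open>The states reachable under a single-valued relation are pairwise comparable, and
    \<open>(v, b)\<close> has no successor, so it comes last.\<close>
  have vmax: "(s, (v, b)) \<in> steps\<^sup>*" if "(s0, s) \<in> steps\<^sup>*" for s
  proof -
    have "(s, (v, b)) \<in> steps\<^sup>* \<or> ((v, b), s) \<in> steps\<^sup>*"
      using single_valued_confluent[OF single_valued_steps that b] .
    then show ?thesis
    proof
      assume "((v, b), s) \<in> steps\<^sup>*"
      then show ?thesis by (cases rule: converse_rtranclE) (use tv(2) in auto)
    qed
  qed
  obtain c where c: "(s0, (w, c)) \<in> steps\<^sup>*" using reach[OF uw] by auto
  have fwd: "w \<in> \<Union>(if c then E1 else E2)" if "(w, c) \<noteq> (v, b)"
  proof -
    obtain s where "((w, c), s) \<in> steps"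
      using converse_rtranclE[OF vmax[OF c]] \<open>(w, c) \<noteq> (v, b)\<close> by metis
    then show ?thesis by (cases s) (auto simp: steps_iff)
  qed
  have bwd: "w \<in> \<Union>(if c then E2 else E1)" if "(w, c) \<noteq> s0"
  proof -
    obtain v' where "{v', w} \<in> (if c then E2 else E1)" using pred[OF c \<open>(w, c) \<noteq> s0\<close>] by blast
    then show ?thesis by auto
  qed
  show "saturated w"
  proof (cases "(w, c) = s0")
    case True
    then have "w = u" "c = (u \<in> U)" by (auto simp: s0_def)
    then have "w \<in> \<Union>(if c then E1 else E2)" using fwd True tv(1) by metis
    then show ?thesis using \<open>w = u\<close> \<open>c = (u \<in> U)\<close> u disj by (auto simp: saturated_def split: if_splits)
  next
    case False
    show ?thesis
    proof (cases "(w, c) = (v, b)")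
      case True
      have "w \<in> \<Union>(if c then E2 else E1)" using bwd False .
      then show ?thesis using True v sub1 sub2 disj by (auto simp: saturated_def split: if_splits)
    next
      case False2: False
      show ?thesis using fwd[OF False2] bwd[OF False] by (auto simp: saturated_def split: if_splits)
    qed
  qed
  show "w = u \<or> w = v" if "w \<in> U \<union> L"
  proof (rule ccontr)
    assume "\<not> (w = u \<or> w = v)"
    then have "\<And>s. ((w, c), s) \<notin> steps" using terminal[OF that _ c] by auto
    with vmax[OF c] have "(w, c) = (v, b)" by (cases rule: converse_rtranclE) auto
    then show False using \<open>\<not> (w = u \<or> w = v)\<close> by auto
  qed
qed

text \<open>If every vertex of the component is saturated, \<open>E1\<close> perfectly matches its
  part in \<open>U \<union> M\<close>, and \<open>E2\<close> its part in
  \<open>M \<union> L\<close>. Both parts are even, so the number of outer vertices in the component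
  is even and \<open>u\<close> is not the only one.\<close>

lemma conn_other_outer:
  assumes u: "u \<in> U \<union> L" and sat: "\<And>w. (u, w) \<in> conn \<Longrightarrow> saturated w"
  obtains v where "v \<in> U \<union> L" "v \<noteq> u" "(u, v) \<in> conn"
proof (rule ccontr)
  assume none: "\<not> thesis"
  define C where "C = conn `` {u}"
  have CV: "C \<subseteq> U \<union> M \<union> L" using conn_vertices u by (auto simp: C_def)
  have outer: "C \<inter> (U \<union> L) = {u}" using none that u by (auto simp: C_def)
  have finC: "finite C" using CV fin by (meson finite_Un finite_subset)
  have "\<exists>w\<in>C \<inter> (U \<union> M). {v, w} \<in> E1" if v: "v \<in> C \<inter> (U \<union> M)" for v
  proof -
    have "v \<in> \<Union>E1" using v sat by (auto simp: C_def saturated_def)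
    then obtain w where w: "{v, w} \<in> E1" by (rule matching_vertexE[OF E1])
    then have "w \<in> C" "w \<in> U \<union> M" using v sub1 conn_edge[of v w] conn_trans by (auto simp: C_def)
    then show ?thesis using w by blast
  qed
  then have 1: "even (card (C \<inter> (U \<union> M)))"
    by (rule even_card_matched[OF finite_Int[OF disjI1[OF finC]] E1])
  have "\<exists>w\<in>C \<inter> (M \<union> L). {v, w} \<in> E2" if v: "v \<in> C \<inter> (M \<union> L)" for v
  proof -
    have "v \<in> \<Union>E2" using v sat by (auto simp: C_def saturated_def)
    then obtain w where w: "{v, w} \<in> E2" by (rule matching_vertexE[OF E2])
    then have "w \<in> C" "w \<in> M \<union> L" using v sub2 conn_edge[of v w] conn_trans by (auto simp: C_def)
    then show ?thesis using w by blast
  qed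
  then have 2: "even (card (C \<inter> (M \<union> L)))"
    by (rule even_card_matched[OF finite_Int[OF disjI1[OF finC]] E2])
  have "card (C \<inter> (U \<union> M)) = card (C \<inter> U) + card (C \<inter> M)" "card (C \<inter> (M \<union> L)) = card (C \<inter> M) + card (C \<inter> L)"
    using finC disj by (auto simp: Int_Un_distrib intro!: card_Un_disjoint)
  moreover have "card (C \<inter> U) + card (C \<inter> L) = 1"
  proof -
    have "card (C \<inter> U \<union> C \<inter> L) = card (C \<inter> U) + card (C \<inter> L)"
      using finC disj by (intro card_Un_disjoint) auto
    then show ?thesis using outer by (simp add: Int_Un_distrib)
  qed
  ultimately show False using 1 2 by presburger
qed

section \<open>Colourings of the three rows of a stack\<close>

definition outer_compat :: "('v \<Rightarrow> nat) \<Rightarrow> bool" where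
  "outer_compat g \<longleftrightarrow>
     (\<forall>u\<in>U \<union> L. \<forall>v\<in>U \<union> L. u \<noteq> v \<and> (u, v) \<in> conn \<longrightarrow> g u = g v) \<and>
     (\<forall>u\<in>U \<union> L. \<not> (\<exists>v\<in>U \<union> L. v \<noteq> u \<and> (u, v) \<in> conn) \<longrightarrow> g u = 0)"

text \<open>This says that the colouring is compatible with both diagrams at once, that is, that
  both factors of a term in the product of their tensor matrices are nonzero.\<close>

definition stack_compat :: "('v \<Rightarrow> nat) \<Rightarrow> bool" where
  "stack_compat g \<longleftrightarrow> (\<forall>e\<in>E1 \<union> E2. \<forall>u\<in>e. \<forall>v\<in>e. g u = g v) \<and>
     (\<forall>v\<in>U \<union> M \<union> L. \<not> saturated v \<longrightarrow> g v = 0)"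

definition fill :: "('v \<Rightarrow> nat) \<Rightarrow> ('v \<Rightarrow> nat) \<Rightarrow> 'v \<Rightarrow> nat" where
  "fill \<gamma> g = (\<lambda>v. if v \<in> M then \<gamma> v else g v)"

text \<open>Colours are constant on components. By parity, an outer vertex without an outer partner
  has an unsaturated vertex in its component and shares its colour \<open>0\<close>.\<close>

lemma stack_compat_imp_outer:
  assumes "stack_compat (fill \<gamma> g)"
  shows "outer_compat g"
proof -
  have c: "fill \<gamma> g u = fill \<gamma> g v" if "(u, v) \<in> conn" for u v
    using assms that const_on_conn unfolding stack_compat_def by blast
  have o: "fill \<gamma> g u = g u" if "u \<in> U \<union> L" for u using that disj by (auto simp: fill_def)
  show ?thesis unfolding outer_compat_def
  proof (intro conjI ballI impI)
    fix u v assume "u \<in> U \<union> L" "v \<in> U \<union> L" "u \<noteq> v \<and> (u, v) \<in> conn"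
    then show "g u = g v" using c o by metis
  next
    fix u assume u: "u \<in> U \<union> L" and n: "\<not> (\<exists>v\<in>U \<union> L. v \<noteq> u \<and> (u, v) \<in> conn)"
    then obtain w where w: "(u, w) \<in> conn" "\<not> saturated w" using conn_other_outer[OF u] by metis
    then have "w \<in> U \<union> M \<union> L" using conn_vertices u by blast
    then have "fill \<gamma> g w = 0" using assms w unfolding stack_compat_def by blast
    then show "g u = 0" using c[OF w(1)] o[OF u] by simp
  qed
qed

text \<open>Given the outer colours, a component that meets the outer rows inherits their colour,
  and a path inside the middle row must have colour \<open>0\<close>. Only the closed loops are
  free, with \<open>n + 1\<close> choices each.\<close>

lemma card_stack_compat:
  assumes g: "\<And>v. v \<in> U \<union> L \<Longrightarrow> g v \<le> n"
  shows "card {\<gamma> \<in> M \<rightarrow>\<^sub>E {0..n}. stack_compat (fill \<gamma> g)} =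
         (if outer_compat g then (n + 1) ^ card loops else 0)"
proof (cases "outer_compat g")
  case False
  then have e: "{\<gamma> \<in> M \<rightarrow>\<^sub>E {0..n}. stack_compat (fill \<gamma> g)} = {}" using stack_compat_imp_outer by blast
  show ?thesis unfolding e using False by simp
next
  case ok: True
  let ?S = "{\<gamma> \<in> M \<rightarrow>\<^sub>E {0..n}. stack_compat (fill \<gamma> g)}"
  \<comment> \<open>The only candidate: the free colour on a loop, the outer colour on a component
    reaching the outer rows, and \<open>0\<close> on the remaining middle components.\<close>
  define h where "h \<phi> v = (if conn `` {v} \<in> loops then \<phi> (conn `` {v})
      else if \<exists>u\<in>U \<union> L. (v, u) \<in> conn then g (SOME u. u \<in> U \<union> L \<and> (v, u) \<in> conn) else 0)" for \<phi> v
  define F where "F \<phi> = restrict (h \<phi>) M" for \<phi>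
  define G where "G \<gamma> = restrict (\<lambda>C. \<gamma> (SOME i. i \<in> C)) loops" for \<gamma> :: "'v \<Rightarrow> nat"
  have loopsM: "C \<subseteq> M" "\<exists>i\<in>M. C = conn `` {i}" if "C \<in> loops" for C using that by (auto simp: loops_def)
  have h_conn: "h \<phi> v = h \<phi> w" if "(v, w) \<in> conn" for \<phi> v w
  proof -
    have "\<And>u. (v, u) \<in> conn \<longleftrightarrow> (w, u) \<in> conn" using conn_class_eq[OF that] by blast
    then show ?thesis unfolding h_def using conn_class_eq[OF that] by simp
  qed
  have gconst: "g u = g v" if "u \<in> U \<union> L" "v \<in> U \<union> L" "(u, v) \<in> conn" for u v
    using ok that unfolding outer_compat_def by (cases "u = v") simp_all
  have notloop: "conn `` {v} \<notin> loops" if "(v, u) \<in> conn" "u \<in> U \<union> L" for u v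
    using that disj loopsM(1)[of "conn `` {v}"] by auto
  have h_g: "h \<phi> v = g u" if "(v, u) \<in> conn" "u \<in> U \<union> L" for \<phi> u v
  proof -
    have s: "(SOME u. u \<in> U \<union> L \<and> (v, u) \<in> conn) \<in> U \<union> L \<and> (v, SOME u. u \<in> U \<union> L \<and> (v, u) \<in> conn) \<in> conn"
      using that by (intro someI[of "\<lambda>u. u \<in> U \<union> L \<and> (v, u) \<in> conn" u]) auto
    then have "g (SOME u. u \<in> U \<union> L \<and> (v, u) \<in> conn) = g u"
      using gconst that conn_trans conn_sym by blast
    then show ?thesis using notloop[OF that] that by (auto simp: h_def)
  qed
  have fillF: "fill (F \<phi>) g v = h \<phi> v" if "v \<in> U \<union> M \<union> L" for \<phi> v
    using that h_g[of v v \<phi>] disj by (auto simp: fill_def F_def)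
  have F_in: "F \<phi> \<in> ?S" if \<phi>: "\<phi> \<in> loops \<rightarrow>\<^sub>E {0..n}" for \<phi>
  proof -
    have le: "h \<phi> v \<le> n" for v
    proof (cases "\<exists>u\<in>U \<union> L. (v, u) \<in> conn")
      case True
      then show ?thesis using h_g g by metis
    next
      case False
      then show ?thesis using \<phi> by (auto simp: h_def)
    qed
    then have 1: "F \<phi> \<in> M \<rightarrow>\<^sub>E {0..n}" by (auto simp: F_def)
    have 2: "fill (F \<phi>) g u = fill (F \<phi>) g v" if e: "e \<in> E1 \<union> E2" "u \<in> e" "v \<in> e" for e u v
    proof -
      have "card e = 2" using e(1) E1 E2 by (auto simp: matchings_def)
      then obtain a b where ab: "e = {a, b}" by (auto simp: card_2_iff)
      have "(u, v) \<in> conn" using e ab conn_edge[of a b] conn_sym by auto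
      moreover have "u \<in> U \<union> M \<union> L" "v \<in> U \<union> M \<union> L" using e sub1 sub2 by auto
      ultimately show ?thesis using fillF h_conn by metis
    qed
    have 3: "fill (F \<phi>) g v = 0" if v: "v \<in> U \<union> M \<union> L" "\<not> saturated v" for v
    proof (cases "\<exists>u\<in>U \<union> L. (v, u) \<in> conn")
      case True
      then obtain u where u: "u \<in> U \<union> L" "(v, u) \<in> conn" by auto
      \<comment> \<open>A component joining two outer vertices is saturated throughout, so
        \<open>u\<close> has no outer partner and its colour is \<open>0\<close>.\<close>
      have "\<not> (\<exists>u'\<in>U \<union> L. u' \<noteq> u \<and> (u, u') \<in> conn)"
        using conn_outer(1)[OF u(1) _ _ _ conn_sym[OF u(2)]] v(2) by metis
      then have "g u = 0" using ok u(1) unfolding outer_compat_def by blast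
      then show ?thesis using fillF[OF v(1)] h_g[OF u(2,1)] by simp
    next
      case False
      then have "v \<in> M" using v(1) conn_refl by blast
      have "conn `` {v} \<notin> loops"
      proof
        assume "conn `` {v} \<in> loops"
        then have "v \<in> \<Union>E1" "v \<in> \<Union>E2" unfolding loops_def by auto
        then show False using v(2) by (simp add: saturated_def)
      qed
      then show ?thesis using fillF[OF v(1)] False by (simp add: h_def)
    qed
    show ?thesis using 1 2 3 unfolding stack_compat_def by blast
  qed
  have G_in: "G \<gamma> \<in> loops \<rightarrow>\<^sub>E {0..n}" if "\<gamma> \<in> ?S" for \<gamma>
  proof -
    have "(SOME i. i \<in> C) \<in> M" if "C \<in> loops" for C
      using loopsM[OF that] by (metis conn_refl Image_singleton_iff someI_ex subsetD)
    then show ?thesis using that by (auto simp: G_def)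
  qed
  have GF: "G (F \<phi>) = \<phi>" if \<phi>: "\<phi> \<in> loops \<rightarrow>\<^sub>E {0..n}" for \<phi>
  proof
    fix C show "G (F \<phi>) C = \<phi> C"
    proof (cases "C \<in> loops")
      case True
      then obtain i where i: "C = conn `` {i}" using loopsM by blast
      then have s: "(SOME i. i \<in> C) \<in> C" by (metis conn_refl Image_singleton_iff someI_ex)
      then have "conn `` {SOME i. i \<in> C} = C" "(SOME i. i \<in> C) \<in> M"
        using i conn_class_eq loopsM(1)[OF True] by (blast, blast)
      then show ?thesis using True by (simp add: G_def F_def h_def)
    next
      case False
      then show ?thesis using \<phi> by (auto simp: G_def PiE_def extensional_def)
    qed
  qed
  have FG: "F (G \<gamma>) = \<gamma>" if \<gamma>: "\<gamma> \<in> ?S" for \<gamma>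
  proof
    fix i
    have c: "fill \<gamma> g u = fill \<gamma> g v" if "(u, v) \<in> conn" for u v
      using \<gamma> that const_on_conn unfolding stack_compat_def by blast
    show "F (G \<gamma>) i = \<gamma> i"
    proof (cases "i \<in> M")
      case False
      then show ?thesis using \<gamma> by (auto simp: F_def PiE_def extensional_def)
    next
      case iM: True
      show ?thesis
      proof (cases "conn `` {i} \<in> loops")
        case True
        let ?j = "SOME j. j \<in> conn `` {i}"
        have j: "?j \<in> conn `` {i}" by (metis conn_refl Image_singleton_iff someI_ex)
        then have "?j \<in> M" using loopsM(1)[OF True] by blast
        then have "\<gamma> ?j = \<gamma> i" using c[of i ?j] j iM by (simp add: fill_def)
        then show ?thesis using True iM by (simp add: F_def h_def G_def)
      next
        case nl: False
        show ?thesis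
        proof (cases "\<exists>u\<in>U \<union> L. (i, u) \<in> conn")
          case True
          then obtain u where u: "u \<in> U \<union> L" "(i, u) \<in> conn" by auto
          then have "\<gamma> i = g u" using c[of i u] iM disj by (auto simp: fill_def)
          then show ?thesis using h_g[OF u(2,1)] iM by (simp add: F_def)
        next
          case False
          then have sub: "conn `` {i} \<subseteq> M" using conn_vertices iM by blast
          \<comment> \<open>A component that stays in the middle row without being a loop contains
            an unsaturated vertex.\<close>
          then obtain v where v: "(i, v) \<in> conn" "\<not> saturated v"
            using nl iM unfolding loops_def saturated_def by blast
          then have "fill \<gamma> g v = 0" using \<gamma> sub unfolding stack_compat_def by blast
          then have "\<gamma> i = 0" using c[OF v(1)] iM by (simp add: fill_def)
          then show ?thesis using nl False iM by (simp add: F_def h_def)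
        qed
      qed
    qed
  qed
  have "bij_betw G ?S (loops \<rightarrow>\<^sub>E {0..n})"
    by (rule bij_betw_byWitness[where f' = F]) (use F_in G_in GF FG in blast)+
  then have "card ?S = card (loops \<rightarrow>\<^sub>E {0..n})" by (rule bij_betw_same_card)
  moreover have "finite loops" using fin(2) loopsM(1) by (meson Pow_iff finite_Pow_iff finite_subset subsetI)
  ultimately show ?thesis using ok by (simp add: card_PiE)
qed

end

section \<open>Diagrams as matrices on tensor space\<close>

definition compat :: "nat \<Rightarrow> diagram \<Rightarrow> (vertex \<Rightarrow> nat) \<Rightarrow> bool" where
  "compat k d f \<longleftrightarrow> (\<forall>e\<in>d. \<forall>u\<in>e. \<forall>v\<in>e. f u = f v) \<and> (\<forall>v\<in>vertices k. v \<notin> \<Union>d \<longrightarrow> f v = 0)"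

primrec rows :: "(nat \<Rightarrow> nat) \<Rightarrow> (nat \<Rightarrow> nat) \<Rightarrow> vertex \<Rightarrow> nat" where
  "rows \<alpha> \<beta> (Top i) = \<alpha> i"
| "rows \<alpha> \<beta> (Bot i) = \<beta> i"

primrec three_rows :: "(nat \<Rightarrow> nat) \<Rightarrow> (nat \<Rightarrow> nat) \<Rightarrow> (nat \<Rightarrow> nat) \<Rightarrow> svertex \<Rightarrow> nat" where
  "three_rows \<alpha> \<gamma> \<beta> (Upper i) = \<alpha> i"
| "three_rows \<alpha> \<gamma> \<beta> (Middle i) = \<gamma> i"
| "three_rows \<alpha> \<gamma> \<beta> (Lower i) = \<beta> i"

definition colourings :: "nat \<Rightarrow> nat \<Rightarrow> (nat \<Rightarrow> nat) set" where
  "colourings k n = {1..k} \<rightarrow>\<^sub>E {0..n}"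

text \<open>The matrix of a diagram on the \<open>k\<close>-th tensor power of an \<open>(n+1)\<close>-dimensional space with
  basis \<open>0, \<dots>, n\<close>, where an isolated vertex stands for the basis vector \<open>0\<close>.\<close>

definition tensor_mat :: "nat \<Rightarrow> diagram \<Rightarrow> (nat \<Rightarrow> nat) \<Rightarrow> (nat \<Rightarrow> nat) \<Rightarrow> nat" where
  "tensor_mat k d \<alpha> \<beta> = (if compat k d (rows \<alpha> \<beta>) then 1 else 0)"

lemma finite_vertices [simp]: "finite (vertices k)" by (simp add: vertices_def)

lemma finite_RB_diagrams [simp]: "finite (RB_diagrams k)"
proof (rule finite_subset)
  show "RB_diagrams k \<subseteq> Pow (Pow (vertices k))" by (auto simp: RB_diagrams_def)
qed simp

lemma finite_colourings [simp]: "finite (colourings k n)"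
  by (simp add: colourings_def finite_PiE)

lemma compat_cong:
  assumes "d \<in> RB_diagrams k" "\<And>v. v \<in> vertices k \<Longrightarrow> f v = g v"
  shows "compat k d f = compat k d g"
proof -
  have sub: "\<And>e v. e \<in> d \<Longrightarrow> v \<in> e \<Longrightarrow> v \<in> vertices k" using assms(1) by (auto simp: RB_diagrams_def)
  have "(\<forall>e\<in>d. \<forall>u\<in>e. \<forall>v\<in>e. f u = f v) \<longleftrightarrow> (\<forall>e\<in>d. \<forall>u\<in>e. \<forall>v\<in>e. g u = g v)"
    using sub assms(2) by (intro ball_cong refl) (metis sub)
  then show ?thesis using assms(2) by (simp add: compat_def)
qed

lemma inj_place_above: "inj place_above"
proof (rule injI)
  show "place_above u = place_above v \<Longrightarrow> u = v" for u v by (cases u; cases v) auto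
qed

lemma inj_place_below: "inj place_below"
proof (rule injI)
  show "place_below u = place_below v \<Longrightarrow> u = v" for u v by (cases u; cases v) auto
qed

lemma inj_place_outer: "inj place_outer"
proof (rule injI)
  show "place_outer u = place_outer v \<Longrightarrow> u = v" for u v by (cases u; cases v) auto
qed

lemma place_above_vertices: "place_above ` vertices k = Upper ` {1..k} \<union> Middle ` {1..k}"
  by (force simp: vertices_def image_iff)

lemma place_below_vertices: "place_below ` vertices k = Middle ` {1..k} \<union> Lower ` {1..k}"
  by (force simp: vertices_def image_iff)

lemma place_outer_vertices: "place_outer ` vertices k = Upper ` {1..k} \<union> Lower ` {1..k}"
  by (force simp: vertices_def image_iff)

section \<open>Stacks of rook-Brauer diagrams\<close>

lemma two_matchings_stack:
  assumes "d1 \<in> RB_diagrams k" "d2 \<in> RB_diagrams k"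
  shows "two_matchings (Upper ` {1..k}) (Middle ` {1..k}) (Lower ` {1..k}) (edges_above d1) (edges_below d2)"
proof
  show "edges_above d1 \<in> matchings (Upper ` {1..k} \<union> Middle ` {1..k})"
    unfolding edges_above_def place_above_vertices[symmetric]
    using assms by (intro matchings_image inj_on_subset[OF inj_place_above]) (auto simp: RB_diagrams_matchings)
  show "edges_below d2 \<in> matchings (Middle ` {1..k} \<union> Lower ` {1..k})"
    unfolding edges_below_def place_below_vertices[symmetric]
    using assms by (intro matchings_image inj_on_subset[OF inj_place_below]) (auto simp: RB_diagrams_matchings)
qed auto

lemma conn_stack:
  assumes "d1 \<in> RB_diagrams k" "d2 \<in> RB_diagrams k"
  shows "two_matchings.conn (edges_above d1) (edges_below d2) = connected_in_stack d1 d2"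
  using two_matchings.conn_def[OF two_matchings_stack[OF assms]] by (simp add: connected_in_stack_def)

lemma loops_stack:
  assumes "d1 \<in> RB_diagrams k" "d2 \<in> RB_diagrams k"
  shows "two_matchings.loops (Middle ` {1..k}) (edges_above d1) (edges_below d2) = middle_loops k d1 d2"
  using two_matchings.loops_def[OF two_matchings_stack[OF assms]]
  by (simp add: middle_loops_def conn_stack[OF assms])

lemma mem_edges_above: "place_above v \<in> \<Union>(edges_above d) \<longleftrightarrow> v \<in> \<Union>d"
  using inj_place_above by (auto simp: edges_above_def inj_def) 

lemma mem_edges_below: "place_below v \<in> \<Union>(edges_below d) \<longleftrightarrow> v \<in> \<Union>d"
  using inj_place_below by (auto simp: edges_below_def inj_def)

lemma three_rows_place:
  "three_rows \<alpha> \<gamma> \<beta> (place_above v) = rows \<alpha> \<gamma> v"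
  "three_rows \<alpha> \<gamma> \<beta> (place_below v) = rows \<gamma> \<beta> v"
  "three_rows \<alpha> \<gamma> \<beta> (place_outer v) = rows \<alpha> \<beta> v"
  by (cases v; simp)+

text \<open>The essential point is that a component contains at most two outer vertices, so no outer
  vertex acquires two partners.\<close>

lemma compose_closed [simp]:
  assumes d: "d1 \<in> RB_diagrams k" "d2 \<in> RB_diagrams k"
  shows "compose_diagrams k d1 d2 \<in> RB_diagrams k"
proof -
  interpret two_matchings "Upper ` {1..k}" "Middle ` {1..k}" "Lower ` {1..k}" "edges_above d1" "edges_below d2"
    using two_matchings_stack[OF d] .
  have c: "conn = connected_in_stack d1 d2" using conn_stack[OF d] .
  have o: "place_outer v \<in> Upper ` {1..k} \<union> Lower ` {1..k}" if "v \<in> vertices k" for v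
    using that place_outer_vertices by blast
  have key: "v = w" if "u \<in> vertices k" "v \<in> vertices k" "w \<in> vertices k" "u \<noteq> v" "u \<noteq> w"
      "(place_outer u, place_outer v) \<in> conn" "(place_outer u, place_outer w) \<in> conn" for u v w
  proof -
    have "place_outer u \<noteq> place_outer v" "place_outer u \<noteq> place_outer w"
      using that inj_place_outer by (auto dest: injD)
    then have "place_outer w = place_outer v"
      using conn_outer(2)[OF o[OF that(1)] o[OF that(2)] _ that(6,7) o[OF that(3)]] by auto
    then show ?thesis using inj_place_outer by (auto dest: injD)
  qed
  have sub: "e \<subseteq> vertices k \<and> card e = 2" if "e \<in> compose_diagrams k d1 d2" for e
    using that by (auto simp: compose_diagrams_def)
  have eq: "e = e'" if e: "e \<in> compose_diagrams k d1 d2" "e' \<in> compose_diagrams k d1 d2" "u \<in> e" "u \<in> e'" for e e' u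
  proof -
    have "\<exists>v. e = {u, v} \<and> u \<in> vertices k \<and> v \<in> vertices k \<and> u \<noteq> v \<and> (place_outer u, place_outer v) \<in> conn"
      if ec: "e \<in> compose_diagrams k d1 d2" and ue: "u \<in> e" for e
    proof -
      obtain a b where ab: "e = {a, b}" "a \<in> vertices k" "b \<in> vertices k" "a \<noteq> b" "(place_outer a, place_outer b) \<in> conn"
        using ec unfolding compose_diagrams_def c by blast
      from ue ab(1) have "u = a \<or> u = b" by simp
      then show ?thesis
      proof
        assume "u = a"
        then show ?thesis using ab by blast
      next
        assume "u = b"
        then show ?thesis using ab conn_sym[OF ab(5)] by (metis insert_commute)
      qed
    qed
    then show ?thesis using key e by metis
  qed
  show ?thesis unfolding RB_diagrams_def using sub eq by blast
qed

lemma stack_compat_three_rows: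
  assumes d: "d1 \<in> RB_diagrams k" "d2 \<in> RB_diagrams k"
  shows "two_matchings.stack_compat (Upper ` {1..k}) (Middle ` {1..k}) (Lower ` {1..k}) (edges_above d1) (edges_below d2)
           (three_rows \<alpha> \<gamma> \<beta>) \<longleftrightarrow> compat k d1 (rows \<alpha> \<gamma>) \<and> compat k d2 (rows \<gamma> \<beta>)"
proof -
  interpret two_matchings "Upper ` {1..k}" "Middle ` {1..k}" "Lower ` {1..k}" "edges_above d1" "edges_below d2"
    using two_matchings_stack[OF d] .
  let ?g = "three_rows \<alpha> \<gamma> \<beta>"
  have e1: "(\<forall>e\<in>edges_above d1. \<forall>u\<in>e. \<forall>v\<in>e. ?g u = ?g v) \<longleftrightarrow> (\<forall>e\<in>d1. \<forall>u\<in>e. \<forall>v\<in>e. rows \<alpha> \<gamma> u = rows \<alpha> \<gamma> v)"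
    by (simp add: edges_above_def three_rows_place)
  have e2: "(\<forall>e\<in>edges_below d2. \<forall>u\<in>e. \<forall>v\<in>e. ?g u = ?g v) \<longleftrightarrow> (\<forall>e\<in>d2. \<forall>u\<in>e. \<forall>v\<in>e. rows \<gamma> \<beta> u = rows \<gamma> \<beta> v)"
    by (simp add: edges_below_def three_rows_place)
  have *: "(\<forall>v\<in>U \<union> M \<union> L. \<not> ((v \<in> U \<union> M \<longrightarrow> a v) \<and> (v \<in> M \<union> L \<longrightarrow> b v)) \<longrightarrow> z v) \<longleftrightarrow>
      (\<forall>v\<in>U \<union> M. \<not> a v \<longrightarrow> z v) \<and> (\<forall>v\<in>M \<union> L. \<not> b v \<longrightarrow> z v)" for U M L :: "svertex set" and a b z
    by blast
  have "(\<forall>v\<in>Upper ` {1..k} \<union> Middle ` {1..k} \<union> Lower ` {1..k}. \<not> saturated v \<longrightarrow> ?g v = 0) \<longleftrightarrow>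
     (\<forall>v\<in>Upper ` {1..k} \<union> Middle ` {1..k}. v \<notin> \<Union>(edges_above d1) \<longrightarrow> ?g v = 0) \<and>
     (\<forall>v\<in>Middle ` {1..k} \<union> Lower ` {1..k}. v \<notin> \<Union>(edges_below d2) \<longrightarrow> ?g v = 0)"
    unfolding saturated_def by (rule *)
  also have "\<dots> \<longleftrightarrow> (\<forall>v\<in>vertices k. v \<notin> \<Union>d1 \<longrightarrow> rows \<alpha> \<gamma> v = 0) \<and> (\<forall>v\<in>vertices k. v \<notin> \<Union>d2 \<longrightarrow> rows \<gamma> \<beta> v = 0)"
    unfolding place_above_vertices[symmetric] place_below_vertices[symmetric] ball_simps(9)
      mem_edges_above mem_edges_below three_rows_place ..
  finally have s: "(\<forall>v\<in>Upper ` {1..k} \<union> Middle ` {1..k} \<union> Lower ` {1..k}. \<not> saturated v \<longrightarrow> ?g v = 0) \<longleftrightarrow>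
     (\<forall>v\<in>vertices k. v \<notin> \<Union>d1 \<longrightarrow> rows \<alpha> \<gamma> v = 0) \<and> (\<forall>v\<in>vertices k. v \<notin> \<Union>d2 \<longrightarrow> rows \<gamma> \<beta> v = 0)" .
  have e: "(\<forall>e\<in>edges_above d1 \<union> edges_below d2. \<forall>u\<in>e. \<forall>v\<in>e. ?g u = ?g v) \<longleftrightarrow>
     (\<forall>e\<in>d1. \<forall>u\<in>e. \<forall>v\<in>e. rows \<alpha> \<gamma> u = rows \<alpha> \<gamma> v) \<and> (\<forall>e\<in>d2. \<forall>u\<in>e. \<forall>v\<in>e. rows \<gamma> \<beta> u = rows \<gamma> \<beta> v)"
    unfolding ball_Un e1 e2 ..
  show ?thesis unfolding stack_compat_def compat_def e s by (simp only: conj_ac)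
qed

lemma outer_compat_three_rows:
  assumes d: "d1 \<in> RB_diagrams k" "d2 \<in> RB_diagrams k"
  shows "two_matchings.outer_compat (Upper ` {1..k}) (Lower ` {1..k}) (edges_above d1) (edges_below d2)
           (three_rows \<alpha> \<gamma> \<beta>) \<longleftrightarrow> compat k (compose_diagrams k d1 d2) (rows \<alpha> \<beta>)"
proof -
  interpret two_matchings "Upper ` {1..k}" "Middle ` {1..k}" "Lower ` {1..k}" "edges_above d1" "edges_below d2"
    using two_matchings_stack[OF d] .
  let ?R = "\<lambda>u v. u \<noteq> v \<and> (place_outer u, place_outer v) \<in> conn"
  have c: "conn = connected_in_stack d1 d2" using conn_stack[OF d] .
  have inj: "place_outer u = place_outer v \<longleftrightarrow> u = v" for u v
    using inj_place_outer by (auto dest: injD)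
  have sym: "?R u v \<Longrightarrow> ?R v u" for u v using conn_sym by auto
  have 1: "(\<forall>e\<in>compose_diagrams k d1 d2. \<forall>u\<in>e. \<forall>v\<in>e. rows \<alpha> \<beta> u = rows \<alpha> \<beta> v) \<longleftrightarrow>
      (\<forall>u\<in>vertices k. \<forall>v\<in>vertices k. ?R u v \<longrightarrow> rows \<alpha> \<beta> u = rows \<alpha> \<beta> v)" (is "?A \<longleftrightarrow> ?B")
  proof
    assume A: ?A
    show ?B
    proof (intro ballI impI)
      fix u v assume "u \<in> vertices k" "v \<in> vertices k" "?R u v"
      then have "{u, v} \<in> compose_diagrams k d1 d2" unfolding compose_diagrams_def c by blast
      then show "rows \<alpha> \<beta> u = rows \<alpha> \<beta> v" using A[rule_format, of "{u, v}" u v] by simp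
    qed
  next
    assume B: ?B
    then show ?A unfolding compose_diagrams_def c[symmetric] by auto
  qed
  have 2: "v \<in> \<Union>(compose_diagrams k d1 d2) \<longleftrightarrow> (\<exists>u\<in>vertices k. ?R v u)" if "v \<in> vertices k" for v
  proof
    assume "v \<in> \<Union>(compose_diagrams k d1 d2)"
    then obtain a b where "v \<in> {a, b}" "a \<in> vertices k" "b \<in> vertices k" "?R a b"
      unfolding compose_diagrams_def c[symmetric] by blast
    then show "\<exists>u\<in>vertices k. ?R v u" using sym by blast
  next
    assume "\<exists>u\<in>vertices k. ?R v u"
    then obtain u where "u \<in> vertices k" "?R v u" by blast
    then have "{v, u} \<in> compose_diagrams k d1 d2" using that unfolding compose_diagrams_def c by blast
    then show "v \<in> \<Union>(compose_diagrams k d1 d2)" by blast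
  qed
  have "outer_compat (three_rows \<alpha> \<gamma> \<beta>) \<longleftrightarrow>
     (\<forall>u\<in>vertices k. \<forall>v\<in>vertices k. ?R u v \<longrightarrow> rows \<alpha> \<beta> u = rows \<alpha> \<beta> v) \<and>
     (\<forall>u\<in>vertices k. \<not> (\<exists>v\<in>vertices k. v \<noteq> u \<and> (place_outer u, place_outer v) \<in> conn) \<longrightarrow> rows \<alpha> \<beta> u = 0)"
    unfolding outer_compat_def place_outer_vertices[symmetric] ball_simps(9) bex_simps(7) three_rows_place inj ..
  moreover have "(\<forall>u\<in>vertices k. \<not> (\<exists>v\<in>vertices k. v \<noteq> u \<and> (place_outer u, place_outer v) \<in> conn) \<longrightarrow> rows \<alpha> \<beta> u = 0) \<longleftrightarrow>
     (\<forall>u\<in>vertices k. u \<notin> \<Union>(compose_diagrams k d1 d2) \<longrightarrow> rows \<alpha> \<beta> u = 0)"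
    by (intro ball_cong refl) (metis 2)
  ultimately show ?thesis unfolding compat_def 1 by simp
qed

text \<open>The cardinality is an entry of the product of two tensor matrices, and the loops supply
  the power of \<open>n + 1\<close>. The maps \<open>F\<close> and \<open>G\<close> only exchange
  middle vertices and their numbers.\<close>

theorem card_middle_colourings:
  assumes d: "d1 \<in> RB_diagrams k" "d2 \<in> RB_diagrams k"
    and \<alpha>: "\<alpha> \<in> colourings k n" and \<beta>: "\<beta> \<in> colourings k n"
  shows "card {\<gamma> \<in> colourings k n. compat k d1 (rows \<alpha> \<gamma>) \<and> compat k d2 (rows \<gamma> \<beta>)} =
    (if compat k (compose_diagrams k d1 d2) (rows \<alpha> \<beta>) then (n + 1) ^ kappa k d1 d2 else 0)"
proof -
  interpret two_matchings "Upper ` {1..k}" "Middle ` {1..k}" "Lower ` {1..k}" "edges_above d1" "edges_below d2"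
    using two_matchings_stack[OF d] .
  \<comment> \<open>The middle row of \<open>?g\<close> is a placeholder that \<open>fill\<close>
    overwrites.\<close>
  let ?g = "three_rows \<alpha> (\<lambda>_. 0) \<beta>"
  let ?S = "{\<gamma> \<in> Middle ` {1..k} \<rightarrow>\<^sub>E {0..n}. stack_compat (fill \<gamma> ?g)}"
  let ?T = "{\<gamma> \<in> colourings k n. compat k d1 (rows \<alpha> \<gamma>) \<and> compat k d2 (rows \<gamma> \<beta>)}"
  define F where "F \<delta> = (\<lambda>i\<in>{1..k}. \<delta> (Middle i))" for \<delta> :: "svertex \<Rightarrow> nat"
  define G where "G \<gamma> = (\<lambda>v\<in>Middle ` {1..k}. case v of Middle i \<Rightarrow> \<gamma> i | _ \<Rightarrow> 0)" for \<gamma> :: "nat \<Rightarrow> nat"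
  have st: "stack_compat (three_rows \<alpha> \<gamma> \<beta>) \<longleftrightarrow> compat k d1 (rows \<alpha> \<gamma>) \<and> compat k d2 (rows \<gamma> \<beta>)" for \<gamma>
    using stack_compat_three_rows[OF d] .
  have sc: "stack_compat (fill \<delta> ?g) \<longleftrightarrow> stack_compat (three_rows \<alpha> (F \<delta>) \<beta>)" for \<delta>
  proof -
    have eq: "fill \<delta> ?g v = three_rows \<alpha> (F \<delta>) \<beta> v" if "v \<in> Upper ` {1..k} \<union> Middle ` {1..k} \<union> Lower ` {1..k}" for v
      using that unfolding fill_def F_def by auto
    have "v \<in> Upper ` {1..k} \<union> Middle ` {1..k} \<union> Lower ` {1..k}" if "v \<in> e" "e \<in> edges_above d1 \<union> edges_below d2" for v e
      using that sub1 sub2 by blast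
    then have "(\<forall>e\<in>edges_above d1 \<union> edges_below d2. \<forall>u\<in>e. \<forall>v\<in>e. fill \<delta> ?g u = fill \<delta> ?g v) \<longleftrightarrow>
      (\<forall>e\<in>edges_above d1 \<union> edges_below d2. \<forall>u\<in>e. \<forall>v\<in>e. three_rows \<alpha> (F \<delta>) \<beta> u = three_rows \<alpha> (F \<delta>) \<beta> v)"
      using eq by (intro ball_cong refl) metis
    moreover have "(\<forall>v\<in>Upper ` {1..k} \<union> Middle ` {1..k} \<union> Lower ` {1..k}. \<not> saturated v \<longrightarrow> fill \<delta> ?g v = 0) \<longleftrightarrow>
      (\<forall>v\<in>Upper ` {1..k} \<union> Middle ` {1..k} \<union> Lower ` {1..k}. \<not> saturated v \<longrightarrow> three_rows \<alpha> (F \<delta>) \<beta> v = 0)"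
      by (intro ball_cong refl) (simp only: eq)
    ultimately show ?thesis by (simp only: stack_compat_def)
  qed
  have GF: "G (F \<delta>) = \<delta>" if "\<delta> \<in> ?S" for \<delta>
    using that by (fastforce simp: G_def F_def PiE_def extensional_def)
  have FG: "F (G \<gamma>) = \<gamma>" if "\<gamma> \<in> colourings k n" for \<gamma>
    using that by (fastforce simp: G_def F_def colourings_def PiE_def extensional_def)
  have "bij_betw F ?S ?T"
  proof (rule bij_betw_byWitness[where f' = G])
    show "F ` ?S \<subseteq> ?T"
    proof
      fix \<gamma> assume "\<gamma> \<in> F ` ?S"
      then obtain \<delta> where \<delta>: "\<delta> \<in> ?S" "\<gamma> = F \<delta>" by blast
      have "\<delta> \<in> Middle ` {1..k} \<rightarrow>\<^sub>E {0..n}" using \<delta> by simp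
      then have "F \<delta> \<in> colourings k n" by (auto simp: F_def colourings_def)
      then show "\<gamma> \<in> ?T" using \<delta> sc[of \<delta>] st[of "F \<delta>"] by simp
    qed
    show "G ` ?T \<subseteq> ?S"
    proof
      fix \<delta> assume "\<delta> \<in> G ` ?T"
      then obtain \<gamma> where \<gamma>: "\<gamma> \<in> ?T" "\<delta> = G \<gamma>" by blast
      have "\<gamma> \<in> colourings k n" using \<gamma> by simp
      then have "G \<gamma> \<in> Middle ` {1..k} \<rightarrow>\<^sub>E {0..n}" by (auto simp: G_def colourings_def)
      moreover have "stack_compat (fill (G \<gamma>) ?g)" using sc[of "G \<gamma>"] FG \<gamma> st by auto
      ultimately show "\<delta> \<in> ?S" using \<gamma>(2) by blast
    qed
  qed (use GF FG in auto)
  then have "card ?S = card ?T" by (rule bij_betw_same_card)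
  moreover have "card ?S = (if outer_compat ?g then (n + 1) ^ card loops else 0)"
    using \<alpha> \<beta> by (intro card_stack_compat) (auto simp: colourings_def)
  ultimately have "card ?T = (if outer_compat ?g then (n + 1) ^ card loops else 0)" by simp
  then show ?thesis unfolding outer_compat_three_rows[OF d] loops_stack[OF d] kappa_def .
qed

text \<open>At the parameter \<open>n + 1\<close> the tensor matrices multiply like diagrams: every
  middle colouring compatible with both diagrams contributes \<open>1\<close>, and every loop
  multiplies the number of such colourings by \<open>n + 1\<close>.\<close>

lemma tensor_mat_compose:
  assumes "d1 \<in> RB_diagrams k" "d2 \<in> RB_diagrams k" "\<alpha> \<in> colourings k n" "\<beta> \<in> colourings k n"
  shows "(\<Sum>\<gamma>\<in>colourings k n. tensor_mat k d1 \<alpha> \<gamma> * tensor_mat k d2 \<gamma> \<beta>) =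
    (n + 1) ^ kappa k d1 d2 * tensor_mat k (compose_diagrams k d1 d2) \<alpha> \<beta>"
proof -
  have "(\<Sum>\<gamma>\<in>colourings k n. tensor_mat k d1 \<alpha> \<gamma> * tensor_mat k d2 \<gamma> \<beta>) =
     (\<Sum>\<gamma>\<in>colourings k n. if compat k d1 (rows \<alpha> \<gamma>) \<and> compat k d2 (rows \<gamma> \<beta>) then 1 else 0)"
    by (intro sum.cong refl) (simp add: tensor_mat_def)
  also have "\<dots> = card {\<gamma> \<in> colourings k n. compat k d1 (rows \<alpha> \<gamma>) \<and> compat k d2 (rows \<gamma> \<beta>)}"
    by (simp flip: sum.inter_filter)
  finally show ?thesis using card_middle_colourings[OF assms] by (simp add: tensor_mat_def)
qed

section \<open>Recovering diagrams and loop numbers from their matrices\<close>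

definition num_colours :: "nat \<Rightarrow> nat" where
  "num_colours k = card (Pow (vertices k))"

lemma num_colours_pos: "num_colours k > 0"
  by (simp add: num_colours_def card_gt_0_iff Pow_not_empty)

text \<open>Colour the edges of \<open>d\<close> with different nonzero colours.\<close>

lemma ex_generic_colouring:
  assumes d: "d \<in> RB_diagrams k"
  shows "\<exists>\<alpha>\<in>colourings k (num_colours k). \<exists>\<beta>\<in>colourings k (num_colours k). compat k d (rows \<alpha> \<beta>) \<and>
     (\<forall>d'\<in>RB_diagrams k. compat k d' (rows \<alpha> \<beta>) \<longrightarrow> d \<subseteq> d')"
proof -
  have dm: "d \<in> matchings (vertices k)" using d by (simp add: RB_diagrams_matchings)
  \<comment> \<open>The edges are subsets of the vertex set, which gives a crude bound on their
    number and hence enough nonzero colours.\<close>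
  have "d \<subseteq> Pow (vertices k)" using d by (auto simp: RB_diagrams_def)
  then have fd: "finite d" "card d \<le> num_colours k"
    by (auto simp: num_colours_def intro: finite_subset card_mono)
  then obtain \<phi> where \<phi>: "inj_on \<phi> d" "\<phi> ` d \<subseteq> {1..num_colours k}"
    using card_le_inj[of d "{1..num_colours k}"] by auto
  define f where "f v = (if v \<in> \<Union>d then \<phi> (THE e. e \<in> d \<and> v \<in> e) else 0)" for v
  have the: "(THE e. e \<in> d \<and> v \<in> e) = e" if "e \<in> d" "v \<in> e" for v e
    using that dm unfolding matchings_def by (intro the_equality) blast+
  have fe: "f v = \<phi> e" if "e \<in> d" "v \<in> e" for v e using that the by (auto simp: f_def)
  have fle: "f v \<le> num_colours k" for v
  proof (cases "v \<in> \<Union>d")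
    case True
    then obtain e where "e \<in> d" "v \<in> e" by blast
    then show ?thesis using fe \<phi>(2) by fastforce
  qed (simp add: f_def)
  define \<alpha> where "\<alpha> = (\<lambda>i\<in>{1..k}. f (Top i))"
  define \<beta> where "\<beta> = (\<lambda>i\<in>{1..k}. f (Bot i))"
  have rf: "rows \<alpha> \<beta> v = f v" if "v \<in> vertices k" for v
    using that by (auto simp: vertices_def \<alpha>_def \<beta>_def)
  have cf: "compat k d' (rows \<alpha> \<beta>) = compat k d' f" if "d' \<in> RB_diagrams k" for d'
    using compat_cong[OF that] rf by blast
  have "compat k d f" using fe by (auto simp: compat_def f_def)
  moreover have "d \<subseteq> d'" if d': "d' \<in> RB_diagrams k" "compat k d' f" for d'
  proof
    fix e assume e: "e \<in> d"
    obtain u v where uv: "e = {u, v}" "u \<noteq> v" "u \<in> vertices k" "v \<in> vertices k"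
      by (rule matching_edgeE[OF dm e])
    \<comment> \<open>A nonzero colour prevents \<open>u\<close> from being isolated in
      \<open>d'\<close>. Its partner there has the same colour, so it lies on the same edge of
      \<open>d\<close> and must be \<open>v\<close>.\<close>
    have "\<phi> e \<noteq> 0" using \<phi>(2) e by fastforce
    then have fu: "f u \<noteq> 0" using fe[OF e, of u] uv by simp
    have "u \<in> \<Union>d'"
    proof (rule ccontr)
      assume "u \<notin> \<Union>d'"
      then have "f u = 0" using d'(2) uv(3) unfolding compat_def by blast
      then show False using fu by simp
    qed
    then obtain w where w: "{u, w} \<in> d'" "w \<noteq> u"
      using matching_vertexE[of d' "vertices k" u] d'(1) by (auto simp: RB_diagrams_matchings)
    have mono: "\<forall>e\<in>d'. \<forall>u\<in>e. \<forall>v\<in>e. f u = f v" using d'(2) unfolding compat_def by (rule conjunct1)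
    have fw: "f u = f w" by (rule mono[rule_format, OF w(1)]) simp_all
    have "w \<in> \<Union>d" using fw fu by (metis f_def)
    then obtain e' where e': "e' \<in> d" "w \<in> e'" by blast
    have "\<phi> e = \<phi> e'" using fe[OF e, of u] fe[OF e'] fw uv by simp
    then have "e' = e" using \<phi>(1) e e' by (auto dest: inj_onD)
    then have "w = v" using e' uv w by auto
    then show "e \<in> d'" using w uv by simp
  qed
  moreover have "\<alpha> \<in> colourings k (num_colours k)" "\<beta> \<in> colourings k (num_colours k)"
    using fle by (auto simp: \<alpha>_def \<beta>_def colourings_def)
  ultimately show ?thesis using cf d by blast
qed

text \<open>The matrices have equal supports, and generic colourings of the two diagrams turn this
  into inclusions in both directions. A nonzero entry then compares the scalars.\<close>

lemma diagram_eq_if_scaled_tensor_mat_eq: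
  assumes d: "d \<in> RB_diagrams k" "d' \<in> RB_diagrams k" and c: "0 < c" "0 < c'"
    and eq: "\<And>\<alpha> \<beta>. \<alpha> \<in> colourings k (num_colours k) \<Longrightarrow> \<beta> \<in> colourings k (num_colours k) \<Longrightarrow>
      c * tensor_mat k d \<alpha> \<beta> = c' * tensor_mat k d' \<alpha> \<beta>"
  shows "d = d'" "c = c'"
proof -
  have cc: "compat k d (rows \<alpha> \<beta>) \<longleftrightarrow> compat k d' (rows \<alpha> \<beta>)"
    if "\<alpha> \<in> colourings k (num_colours k)" "\<beta> \<in> colourings k (num_colours k)" for \<alpha> \<beta>
    using eq[OF that] c by (auto simp: tensor_mat_def split: if_splits)
  show "d = d'"
    using ex_generic_colouring[OF d(1)] ex_generic_colouring[OF d(2)] cc d by blast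
  obtain \<alpha> \<beta> where "\<alpha> \<in> colourings k (num_colours k)" "\<beta> \<in> colourings k (num_colours k)" "compat k d (rows \<alpha> \<beta>)"
    using ex_generic_colouring[OF d(1)] by blast
  then show "c = c'" using eq[of \<alpha> \<beta>] \<open>d = d'\<close> by (simp add: tensor_mat_def)
qed

text \<open>By associativity of matrix multiplication both bracketings have the same scaled matrix.
  With enough colours this matrix determines the diagram and the power of \<open>n + 1\<close>,
  hence the total number of loops.\<close>

lemma compose_kappa_assoc:
  assumes d: "d1 \<in> RB_diagrams k" "d2 \<in> RB_diagrams k" "d3 \<in> RB_diagrams k"
  shows "compose_diagrams k (compose_diagrams k d1 d2) d3 = compose_diagrams k d1 (compose_diagrams k d2 d3)"
    and "kappa k d1 d2 + kappa k (compose_diagrams k d1 d2) d3 = kappa k d2 d3 + kappa k d1 (compose_diagrams k d2 d3)"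
proof -
  let ?n = "num_colours k" and ?C = "colourings k (num_colours k)"
  let ?l = "compose_diagrams k (compose_diagrams k d1 d2) d3" and ?r = "compose_diagrams k d1 (compose_diagrams k d2 d3)"
  let ?c = "(?n + 1) ^ (kappa k d1 d2 + kappa k (compose_diagrams k d1 d2) d3)"
  let ?c' = "(?n + 1) ^ (kappa k d2 d3 + kappa k d1 (compose_diagrams k d2 d3))"
  have eq: "?c * tensor_mat k ?l \<alpha> \<beta> = ?c' * tensor_mat k ?r \<alpha> \<beta>" if ab: "\<alpha> \<in> ?C" "\<beta> \<in> ?C" for \<alpha> \<beta>
  proof -
    have "?c * tensor_mat k ?l \<alpha> \<beta> = (?n + 1) ^ kappa k d1 d2 *
        (\<Sum>\<delta>\<in>?C. tensor_mat k (compose_diagrams k d1 d2) \<alpha> \<delta> * tensor_mat k d3 \<delta> \<beta>)"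
      using tensor_mat_compose[of "compose_diagrams k d1 d2" k d3 \<alpha> ?n \<beta>] d ab by (simp add: power_add mult.assoc)
    also have "\<dots> = (\<Sum>\<delta>\<in>?C. (\<Sum>\<gamma>\<in>?C. tensor_mat k d1 \<alpha> \<gamma> * tensor_mat k d2 \<gamma> \<delta>) * tensor_mat k d3 \<delta> \<beta>)"
      using tensor_mat_compose[OF d(1,2) ab(1)] by (simp add: sum_distrib_left mult.assoc)
    also have "\<dots> = (\<Sum>\<gamma>\<in>?C. tensor_mat k d1 \<alpha> \<gamma> * (\<Sum>\<delta>\<in>?C. tensor_mat k d2 \<gamma> \<delta> * tensor_mat k d3 \<delta> \<beta>))"
      unfolding sum_distrib_right sum_distrib_left mult.assoc by (rule sum.swap)
    also have "\<dots> = (?n + 1) ^ kappa k d2 d3 * (\<Sum>\<gamma>\<in>?C. tensor_mat k d1 \<alpha> \<gamma> * tensor_mat k (compose_diagrams k d2 d3) \<gamma> \<beta>)"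
      using tensor_mat_compose[OF d(2,3) _ ab(2)] by (simp add: sum_distrib_left mult.left_commute)
    also have "\<dots> = ?c' * tensor_mat k ?r \<alpha> \<beta>"
      using tensor_mat_compose[of d1 k "compose_diagrams k d2 d3" \<alpha> ?n \<beta>] d ab by (simp add: power_add mult.assoc)
    finally show ?thesis .
  qed
  note r' = diagram_eq_if_scaled_tensor_mat_eq[OF _ _ _ _ eq]
  have r: "?l = ?r" "?c = ?c'" using r' d by simp_all
  show "?l = ?r" by (fact r)
  show "kappa k d1 d2 + kappa k (compose_diagrams k d1 d2) d3 = kappa k d2 d3 + kappa k d1 (compose_diagrams k d2 d3)"
    using r(2) num_colours_pos[of k] power_inject_exp[of "?n + 1"] by simp
qed

lemma id_diagram_closed [simp]: "id_diagram k \<in> RB_diagrams k"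
  by (auto simp: id_diagram_def RB_diagrams_def vertices_def)

lemma Union_id_diagram: "\<Union>(id_diagram k) = vertices k"
  unfolding id_diagram_def vertices_def by blast

lemma tensor_mat_id:
  assumes "\<alpha> \<in> colourings k n" "\<beta> \<in> colourings k n"
  shows "tensor_mat k (id_diagram k) \<alpha> \<beta> = (if \<alpha> = \<beta> then 1 else 0)"
proof -
  have "compat k (id_diagram k) (rows \<alpha> \<beta>) \<longleftrightarrow> (\<forall>i\<in>{1..k}. \<alpha> i = \<beta> i)"
  proof -
    have "id_diagram k = (\<lambda>i. {Top i, Bot i}) ` {1..k}" by (auto simp: id_diagram_def)
    then show ?thesis unfolding compat_def Union_id_diagram by auto
  qed
  also have "\<dots> \<longleftrightarrow> \<alpha> = \<beta>" using assms by (auto simp: colourings_def intro: PiE_ext)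
  finally show ?thesis by (simp add: tensor_mat_def)
qed

text \<open>The matrix of \<open>id_diagram k\<close> is the identity, so the product has the matrix
  of \<open>d\<close>; this fixes the diagram and leaves no room for a loop.\<close>

lemma compose_id:
  assumes d: "d \<in> RB_diagrams k"
  shows "compose_diagrams k d (id_diagram k) = d" "kappa k d (id_diagram k) = 0"
    and "compose_diagrams k (id_diagram k) d = d" "kappa k (id_diagram k) d = 0"
proof -
  let ?n = "num_colours k"
  have pw: "Suc 0 = Suc ?n ^ m \<Longrightarrow> m = 0" for m
    using num_colours_pos[of k] by (simp add: eq_commute[of "Suc 0"])
  have eq: "1 * tensor_mat k d \<alpha> \<beta> = (?n + 1) ^ kappa k d (id_diagram k) * tensor_mat k (compose_diagrams k d (id_diagram k)) \<alpha> \<beta>"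
    if "\<alpha> \<in> colourings k ?n" "\<beta> \<in> colourings k ?n" for \<alpha> \<beta>
  proof -
    have "(\<Sum>\<gamma>\<in>colourings k ?n. tensor_mat k d \<alpha> \<gamma> * tensor_mat k (id_diagram k) \<gamma> \<beta>) =
        (\<Sum>\<gamma>\<in>colourings k ?n. if \<gamma> = \<beta> then tensor_mat k d \<alpha> \<gamma> else 0)"
      using that by (intro sum.cong refl) (simp add: tensor_mat_id)
    then show ?thesis using that tensor_mat_compose[OF d id_diagram_closed that] by simp
  qed
  have r: "d = compose_diagrams k d (id_diagram k)"
    by (rule diagram_eq_if_scaled_tensor_mat_eq(1)[OF d _ _ _ eq]) (simp_all add: d)
  have "1 = (?n + 1) ^ kappa k d (id_diagram k)"
    by (rule diagram_eq_if_scaled_tensor_mat_eq(2)[OF d _ _ _ eq]) (simp_all add: d)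
  then show "compose_diagrams k d (id_diagram k) = d" "kappa k d (id_diagram k) = 0"
    using r[symmetric] pw by simp_all
  have eq: "1 * tensor_mat k d \<alpha> \<beta> = (?n + 1) ^ kappa k (id_diagram k) d * tensor_mat k (compose_diagrams k (id_diagram k) d) \<alpha> \<beta>"
    if "\<alpha> \<in> colourings k ?n" "\<beta> \<in> colourings k ?n" for \<alpha> \<beta>
  proof -
    have "(\<Sum>\<gamma>\<in>colourings k ?n. tensor_mat k (id_diagram k) \<alpha> \<gamma> * tensor_mat k d \<gamma> \<beta>) =
        (\<Sum>\<gamma>\<in>colourings k ?n. if \<gamma> = \<alpha> then tensor_mat k d \<gamma> \<beta> else 0)"
      using that by (intro sum.cong refl) (auto simp: tensor_mat_id)
    then show ?thesis using that tensor_mat_compose[OF id_diagram_closed d that] by simp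
  qed
  have l: "d = compose_diagrams k (id_diagram k) d"
    by (rule diagram_eq_if_scaled_tensor_mat_eq(1)[OF d _ _ _ eq]) (simp_all add: d)
  have "1 = (?n + 1) ^ kappa k (id_diagram k) d"
    by (rule diagram_eq_if_scaled_tensor_mat_eq(2)[OF d _ _ _ eq]) (simp_all add: d)
  then show "compose_diagrams k (id_diagram k) d = d" "kappa k (id_diagram k) d = 0"
    using l[symmetric] pw by simp_all
qed

section \<open>Young's orthogonal form\<close>

definition sw :: "nat \<Rightarrow> nat \<Rightarrow> nat" where
  "sw i = Transposition.transpose i (Suc i)"

lemma sw_apply: "sw i j = (if j = i then Suc i else if j = Suc i then i else j)"
  by (auto simp: sw_def Transposition.transpose_def)

lemma sw_sw [simp]: "sw i (sw i j) = j" "sw i \<circ> sw i = id"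
  by (auto simp: sw_def)

lemma sw_commute: "Suc i < j \<or> Suc j < i \<Longrightarrow> sw i \<circ> sw j = sw j \<circ> sw i"
  by (auto simp: fun_eq_iff sw_apply)

lemma sw_braid: "sw i \<circ> (sw (Suc i) \<circ> sw i) = sw (Suc i) \<circ> (sw i \<circ> sw (Suc i))"
  by (auto simp: fun_eq_iff sw_apply)

text \<open>Sequences of contents of standard tableaux of the shapes in a family, together with Young's
  orthogonal form of the adjacent transpositions.\<close>

locale content_system =
  fixes r :: nat and Z :: "(nat \<Rightarrow> int) set" and sh :: "(nat \<Rightarrow> int) \<Rightarrow> 'l"
  assumes fin_Z: "finite Z"
    and Z_first: "c \<in> Z \<Longrightarrow> 1 \<le> r \<Longrightarrow> c 1 = 0"
    and Z_outside: "c \<in> Z \<Longrightarrow> j \<notin> {1..r} \<Longrightarrow> c j = 0"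
    and Z_adj: "c \<in> Z \<Longrightarrow> 1 \<le> i \<Longrightarrow> Suc i \<le> r \<Longrightarrow> c i \<noteq> c (Suc i)"
    and Z_adj2: "c \<in> Z \<Longrightarrow> 1 \<le> i \<Longrightarrow> Suc (Suc i) \<le> r \<Longrightarrow> c i \<noteq> c (Suc (Suc i))"
    and Z_swap: "c \<in> Z \<Longrightarrow> 1 \<le> i \<Longrightarrow> Suc i \<le> r \<Longrightarrow> \<bar>c i - c (Suc i)\<bar> \<noteq> 1 \<Longrightarrow> c \<circ> sw i \<in> Z \<and> sh (c \<circ> sw i) = sh c"
    and Z_connected: "c \<in> Z \<Longrightarrow> c' \<in> Z \<Longrightarrow> sh c = sh c' \<Longrightarrow>
       (c, c') \<in> {(c, c \<circ> sw i) | c i. c \<in> Z \<and> 1 \<le> i \<and> Suc i \<le> r \<and> \<bar>c i - c (Suc i)\<bar> \<noteq> 1}\<^sup>*"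
    and card_pairs: "card {(c, c'). c \<in> Z \<and> c' \<in> Z \<and> sh c = sh c'} = fact r"
begin

text \<open>The reciprocal of the axial distance between the entries \<open>i\<close> and
  \<open>Suc i\<close> of a tableau.\<close>

definition p :: "nat \<Rightarrow> (nat \<Rightarrow> int) \<Rightarrow> complex" where
  "p i c = 1 / of_int (c (Suc i) - c i)"

text \<open>A complex root exists for every sequence, so the relations can be checked pointwise.
  What is used of it is its square and that equal arguments give equal roots.\<close>

definition q :: "nat \<Rightarrow> (nat \<Rightarrow> int) \<Rightarrow> complex" where
  "q i c = csqrt (1 - (p i c)\<^sup>2)"

text \<open>Acts on functions of all sequences. The coefficients are meaningful when neighbouring
  contents differ, which is why statements about words are made at points of
  \<open>Z\<close>.\<close>

definition fop :: "nat \<Rightarrow> ((nat \<Rightarrow> int) \<Rightarrow> complex) \<Rightarrow> (nat \<Rightarrow> int) \<Rightarrow> complex" where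
  "fop i F c = p i c * F c + q i c * F (c \<circ> sw i)"

definition letters :: "nat \<Rightarrow> nat list set" where
  "letters n = {w. set w \<subseteq> {i. 1 \<le> i \<and> Suc i \<le> n}}"

definition act :: "nat list \<Rightarrow> ((nat \<Rightarrow> int) \<Rightarrow> complex) \<Rightarrow> (nat \<Rightarrow> int) \<Rightarrow> complex" where
  "act w F = foldr fop w F"

definition perm :: "nat list \<Rightarrow> nat \<Rightarrow> nat" where
  "perm w = foldr (\<lambda>i \<sigma>. sw i \<circ> \<sigma>) w id"

lemma act_simps: "act [] F = F" "act (i # w) F = fop i (act w F)" "act (u @ w) F = act u (act w F)"
  by (simp_all add: act_def)

lemma perm_simps: "perm [] = id" "perm (i # w) = sw i \<circ> perm w"
  by (simp_all add: perm_def)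

lemma perm_append: "perm (u @ w) = perm u \<circ> perm w"
  by (induction u) (simp_all add: perm_simps comp_assoc)

lemma letters_simps: "[] \<in> letters n" "i # w \<in> letters n \<longleftrightarrow> 1 \<le> i \<and> Suc i \<le> n \<and> w \<in> letters n"
    "u @ w \<in> letters n \<longleftrightarrow> u \<in> letters n \<and> w \<in> letters n"
  by (auto simp: letters_def)

lemma q_sq: "(q i c)\<^sup>2 = 1 - (p i c)\<^sup>2"
  by (simp add: q_def)

text \<open>The coefficient \<open>q\<close> vanishes exactly when the swap leaves \<open>Z\<close>, so that \<open>fop\<close> only depends on
  the values on \<open>Z\<close>.\<close>

lemma q_zero_iff:
  assumes "c \<in> Z" "1 \<le> i" "Suc i \<le> r"
  shows "q i c = 0 \<longleftrightarrow> \<bar>c i - c (Suc i)\<bar> = 1"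
proof -
  define m where "m = c (Suc i) - c i"
  have m: "m \<noteq> 0" using Z_adj[OF assms] by (simp add: m_def)
  have "q i c = 0 \<longleftrightarrow> (p i c)\<^sup>2 = 1" by (simp add: q_def)
  also have "\<dots> \<longleftrightarrow> (of_int m :: complex)\<^sup>2 = 1" using m by (auto simp: p_def m_def[symmetric] power_divide)
  also have "\<dots> \<longleftrightarrow> m = 1 \<or> m = -1" by (metis of_int_eq_1_iff of_int_power power2_eq_1_iff)
  finally show ?thesis by (auto simp: m_def)
qed

lemma fop_cong:
  assumes "c \<in> Z" "1 \<le> i" "Suc i \<le> r" and eq: "\<And>c. c \<in> Z \<Longrightarrow> F c = G c"
  shows "fop i F c = fop i G c"
proof (cases "q i c = 0")
  case True
  then show ?thesis using eq assms by (simp add: fop_def)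
next
  case False
  then have "c \<circ> sw i \<in> Z" using Z_swap[OF assms(1-3)] q_zero_iff[OF assms(1-3)] by blast
  then show ?thesis using eq assms by (simp add: fop_def)
qed

lemma act_cong:
  assumes "w \<in> letters r" and eq: "\<And>c. c \<in> Z \<Longrightarrow> F c = G c" and "c \<in> Z"
  shows "act w F c = act w G c"
  using assms(1,3)
proof (induction w arbitrary: c)
  case (Cons i w)
  then show ?case using fop_cong[of c i "act w F" "act w G"] by (simp add: act_simps letters_simps)
qed (simp add: act_simps eq)

lemma p_inverse:
  assumes "c i \<noteq> c (Suc i)"
  shows "p i c * (of_int (c (Suc i)) - of_int (c i)) = 1"
  using assms by (simp add: p_def)

lemma p_swap: "p i (c \<circ> sw i) = - p i c"
proof -
  have "c i - c (Suc i) = - (c (Suc i) - c i)" by simp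
  then show ?thesis unfolding p_def by (simp add: sw_apply del: minus_diff_eq) (metis minus_diff_eq divide_minus_right of_int_diff)
qed

lemma q_swap: "q i (c \<circ> sw i) = q i c"
  by (simp add: q_def p_swap)

lemma comp_sw_sw: "c \<circ> sw i \<circ> sw i = c"
  by (simp add: comp_assoc)

text \<open>A swap changes the sign of \<open>p\<close> and preserves \<open>q\<close>, so the mixed
  terms cancel, and the sum of the squares of \<open>p\<close> and \<open>q\<close> is
  \<open>1\<close>.\<close>

lemma fop_involution: "fop i (fop i F) c = F c"
proof -
  have "fop i (fop i F) c = ((p i c)\<^sup>2 + (q i c)\<^sup>2) * F c"
    by (simp add: fop_def p_swap q_swap comp_sw_sw power2_eq_square algebra_simps)
  then show ?thesis by (simp add: q_sq)
qed

lemma fop_commute: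
  assumes "Suc i < j"
  shows "fop i (fop j F) c = fop j (fop i F) c"
proof -
  have "p i (c \<circ> sw j) = p i c" "p j (c \<circ> sw i) = p j c" using assms by (auto simp: p_def sw_apply)
  moreover from this have "q i (c \<circ> sw j) = q i c" "q j (c \<circ> sw i) = q j c" by (auto simp: q_def)
  moreover have "c \<circ> sw i \<circ> sw j = c \<circ> sw j \<circ> sw i" using sw_commute[of i j] assms by (simp add: comp_assoc)
  ultimately show ?thesis by (simp add: fop_def algebra_simps)
qed

text \<open>With \<open>x = 1/u\<close>, \<open>y = 1/v\<close> and \<open>z = 1/(u + v)\<close> the
  first assumption expresses the additivity of axial distances. The difference of both sides is
  linear in the values of \<open>F\<close>; the coefficients of \<open>f0\<close>, \<open>f1\<close>
  and \<open>f2\<close> vanish by the assumptions, and the remaining terms agree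
  identically.\<close>

lemma braid_identity:
  fixes x y z X Y W f0 f1 f2 f12 f21 f121 :: complex
  assumes "x * y = z * (x + y)" "X\<^sup>2 = 1 - x\<^sup>2" "Y\<^sup>2 = 1 - y\<^sup>2"
  shows "x * (y * (x * f0 + X * f1) + Y * (z * f2 + W * f21)) +
         X * (z * (- x * f1 + X * f0) + W * (y * f12 + Y * f121)) =
         y * (x * (y * f0 + Y * f2) + X * (z * f1 + W * f12)) +
         Y * (z * (- y * f2 + Y * f0) + W * (x * f21 + X * f121))"
proof -
  have "x * y * (x - y) = z * (x + y) * (x - y)" using assms(1) by simp
  then have 0: "x * x * y + z * X\<^sup>2 - y * y * x - z * Y\<^sup>2 = 0"
    unfolding assms(2,3) by (simp add: algebra_simps power2_eq_square)
  have 1: "x * y - z * x - y * z = 0" "x * z - x * y + y * z = 0" using assms(1) by (simp_all add: algebra_simps)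
  have "x * (y * (x * f0 + X * f1) + Y * (z * f2 + W * f21)) +
         X * (z * (- x * f1 + X * f0) + W * (y * f12 + Y * f121)) -
        (y * (x * (y * f0 + Y * f2) + X * (z * f1 + W * f12)) +
         Y * (z * (- y * f2 + Y * f0) + W * (x * f21 + X * f121))) =
        f0 * (x * x * y + z * X\<^sup>2 - y * y * x - z * Y\<^sup>2) + f1 * X * (x * y - z * x - y * z) + f2 * Y * (x * z - x * y + y * z)"
    by (simp add: algebra_simps power2_eq_square)
  then show ?thesis unfolding 0 1 by simp
qed

lemma fop_braid:
  assumes "c i \<noteq> c (Suc i)" "c (Suc i) \<noteq> c (Suc (Suc i))" "c i \<noteq> c (Suc (Suc i))"
  shows "fop i (fop (Suc i) (fop i F)) c = fop (Suc i) (fop i (fop (Suc i) F)) c"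
proof -
  define j where "j = Suc i"
  define x y z :: complex where "x = p i c" and "y = p j c" and "z = 1 / of_int (c (Suc j) - c i)"
  define X Y W where "X = csqrt (1 - x\<^sup>2)" and "Y = csqrt (1 - y\<^sup>2)" and "W = csqrt (1 - z\<^sup>2)"
  have ps: "p i c = x" "p j c = y" "p i (c \<circ> sw i) = - x" "p j (c \<circ> sw j) = - y"
      "p j (c \<circ> sw i) = z" "p i (c \<circ> sw j) = z" "p i (c \<circ> sw i \<circ> sw j) = y" "p j (c \<circ> sw j \<circ> sw i) = x"
    unfolding p_swap by (simp_all add: x_def y_def z_def p_def j_def sw_apply)
  have qs: "q i c = X" "q j c = Y" "q i (c \<circ> sw i) = X" "q j (c \<circ> sw j) = Y"
      "q j (c \<circ> sw i) = W" "q i (c \<circ> sw j) = W" "q i (c \<circ> sw i \<circ> sw j) = Y" "q j (c \<circ> sw j \<circ> sw i) = X"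
    by (simp_all add: q_def ps X_def Y_def W_def)
  have cs: "c \<circ> sw i \<circ> sw j \<circ> sw i = c \<circ> sw j \<circ> sw i \<circ> sw j" using sw_braid[of i] by (simp add: j_def comp_assoc)
  \<comment> \<open>The axial distances of the three entries are \<open>u\<close>, \<open>v\<close>
    and \<open>u + v\<close>, all nonzero by assumption.\<close>
  define u v where "u = (of_int (c j) - of_int (c i) :: complex)" and "v = (of_int (c (Suc j)) - of_int (c j) :: complex)"
  have uv: "u \<noteq> 0" "v \<noteq> 0" "u + v \<noteq> 0" using assms by (simp_all add: u_def v_def j_def)
  have xs: "x = 1 / u" "y = 1 / v" "z = 1 / (u + v)" by (simp_all add: x_def y_def z_def u_def v_def p_def j_def)
  have "1 / u + 1 / v = (v + u) / (u * v)" using add_frac_eq[OF uv(1,2), of 1 1] by simp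
  then have "x * y = z * (x + y)" unfolding xs using uv by (simp add: add.commute)
  moreover have "X\<^sup>2 = 1 - x\<^sup>2" "Y\<^sup>2 = 1 - y\<^sup>2" by (simp_all add: X_def Y_def)
  ultimately show ?thesis
    using braid_identity[of x y z X Y "F c" "F (c \<circ> sw i)" "F (c \<circ> sw j)" W "F (c \<circ> sw j \<circ> sw i)"
        "F (c \<circ> sw i \<circ> sw j)" "F (c \<circ> sw i \<circ> sw j \<circ> sw i)"]
    unfolding j_def[symmetric] fop_def ps qs comp_sw_sw cs by simp
qed

section \<open>Coxeter relations and normal forms of words\<close>

definition equiv :: "nat list \<Rightarrow> nat list \<Rightarrow> bool" where
  "equiv w w' \<longleftrightarrow> perm w = perm w' \<and> (\<forall>F. \<forall>c\<in>Z. act w F c = act w' F c)"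

lemma equiv_refl [simp]: "equiv w w" by (simp add: equiv_def)

lemma equiv_sym: "equiv w w' \<Longrightarrow> equiv w' w" by (simp add: equiv_def)

lemma equiv_trans [trans]: "equiv u v \<Longrightarrow> equiv v w \<Longrightarrow> equiv u w" by (simp add: equiv_def)

text \<open>The operators of the prefix are applied last, and equality known on \<open>Z\<close>
  passes through them only for admissible letters. The suffix merely replaces the function that is
  acted on.\<close>

lemma equiv_context:
  assumes "equiv w w'" "u \<in> letters r"
  shows "equiv (u @ w @ v) (u @ w' @ v)"
proof -
  have "act u (act w (act v F)) c = act u (act w' (act v F)) c" if "c \<in> Z" for F c
    using assms by (intro act_cong that) (auto simp: equiv_def)
  then show ?thesis using assms by (simp add: equiv_def act_simps perm_append)
qed

lemma equiv_involution: "1 \<le> i \<Longrightarrow> Suc i \<le> r \<Longrightarrow> equiv [i, i] []"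
  by (simp add: equiv_def perm_simps act_simps fop_involution)

lemma equiv_commute: "Suc i < j \<or> Suc j < i \<Longrightarrow> equiv [i, j] [j, i]"
  using sw_commute[of i j] fop_commute[of i j] fop_commute[of j i]
  by (auto simp: equiv_def perm_simps act_simps)

lemma equiv_braid: "1 \<le> i \<Longrightarrow> Suc (Suc i) \<le> r \<Longrightarrow> equiv [Suc i, i, Suc i] [i, Suc i, i]"
  using sw_braid[of i] fop_braid[of _ i] Z_adj[of _ i] Z_adj[of _ "Suc i"] Z_adj2[of _ i]
  by (simp add: equiv_def perm_simps act_simps)

lemma equiv_commute_list:
  assumes "\<And>j. j \<in> set u \<Longrightarrow> Suc i < j \<or> Suc j < i" "u \<in> letters r"
  shows "equiv (i # u) (u @ [i])"
  using assms
proof (induction u)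
  case (Cons j u)
  have "equiv (i # j # u) (j # i # u)"
    using equiv_context[OF equiv_commute[of i j], of "[]" u] Cons.prems by (simp add: letters_simps)
  also have "equiv (j # i # u) (j # u @ [i])"
    using equiv_context[OF Cons.IH, of "[j]" "[]"] Cons.prems by (simp add: letters_simps)
  finally show ?case by simp
qed simp

lemma letters_mono: "w \<in> letters m \<Longrightarrow> m \<le> n \<Longrightarrow> w \<in> letters n"
  by (auto simp: letters_def)

lemma letters_upt: "1 \<le> j \<Longrightarrow> [j..<n] \<in> letters n"
  by (auto simp: letters_def)

text \<open>Every word is equivalent to a cycle \<open>[j..<n]\<close>, which sends \<open>n\<close> to \<open>j\<close>, followed by a word that
  fixes \<open>n\<close>. Hence two words with the same permutation act in the same way.\<close>

lemma normal_form:
  assumes n: "1 \<le> n" "n \<le> r" and w: "w \<in> letters n"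
  shows "\<exists>j u. 1 \<le> j \<and> j \<le> n \<and> u \<in> letters (n - 1) \<and> equiv w ([j..<n] @ u)"
  using w
proof (induction w)
  case Nil
  have "equiv [] ([n..<n] @ [])" by simp
  then show ?case using n by (metis letters_simps(1) order_refl)
next
  case (Cons i w)
  then obtain j u where j: "1 \<le> j" "j \<le> n" and u: "u \<in> letters (n - 1)" and e: "equiv w ([j..<n] @ u)"
    by (auto simp: letters_simps)
  have i: "1 \<le> i" "Suc i \<le> n" using Cons.prems by (auto simp: letters_simps)
  have ir: "[i] \<in> letters r" using i n by (simp add: letters_simps)
  have jr: "[j..<n] \<in> letters r" using letters_upt[OF j(1)] letters_mono n by blast
  have e1: "equiv (i # w) (i # [j..<n] @ u)" using equiv_context[OF e ir, of "[]"] by simp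
  \<comment> \<open>The new letter commutes past the cycle, lengthens it, cancels its first letter,
    or, if it lies inside the cycle, comes out on the other side as \<open>i - 1\<close> by a braid
    relation.\<close>
  consider "Suc i < j" | "Suc i = j" | "i = j" | "j < i" by linarith
  then show ?case
  proof cases
    case 1
    have "equiv (i # [j..<n]) ([j..<n] @ [i])" using 1 jr by (intro equiv_commute_list) auto
    then have "equiv (i # [j..<n] @ u) ([j..<n] @ (i # u))" using equiv_context[of _ _ "[]" u] by (fastforce simp: letters_simps)
    then have "equiv (i # w) ([j..<n] @ (i # u))" using e1 equiv_trans by blast
    moreover have "i # u \<in> letters (n - 1)" using 1 j i u by (auto simp: letters_simps)
    ultimately show ?thesis using j by blast
  next
    case 2
    then have "[i..<n] = i # [j..<n]" using i by (simp add: upt_conv_Cons)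
    then have "equiv (i # w) ([i..<n] @ u)" using e1 by simp
    then show ?thesis using i u by (metis Suc_leD)
  next
    case 3
    then have eq: "[j..<n] = i # [Suc j..<n]" using i by (simp add: upt_conv_Cons)
    have "equiv (i # [j..<n] @ u) ([Suc j..<n] @ u)"
      using equiv_context[OF equiv_involution[of i], of "[]" "[Suc j..<n] @ u"] i n eq by (simp add: letters_simps)
    then have "equiv (i # w) ([Suc j..<n] @ u)" using e1 equiv_trans by blast
    then show ?thesis using i 3 u by (metis le_SucI j(1))
  next
    case 4
    then obtain m where m: "i = Suc m" "j \<le> m" by (metis Suc_leI less_imp_Suc_add le_add1 Suc_le_D)
    let ?a = "[j..<m]" and ?b = "[Suc i..<n]"
    have "[j..<n] = [j..<m] @ [m..<n]" using m i by (metis upt_add_eq_append le_add_diff_inverse Suc_leD)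
    also have "[m..<n] = m # i # [Suc i..<n]" using m i by (simp add: upt_conv_Cons)
    finally have sp: "[j..<n] = ?a @ m # i # ?b" .
    have ar: "?a \<in> letters r" and br: "?b \<in> letters r" using jr unfolding sp by (auto simp: letters_simps)
    have m1: "1 \<le> m" "Suc m \<le> r" "Suc (Suc m) \<le> r" using m j i n by auto
    have "equiv (i # ?a) (?a @ [i])" using m ar by (intro equiv_commute_list) auto
    from equiv_context[OF this, of "[]" "m # i # ?b @ u"]
    have "equiv (i # [j..<n] @ u) (?a @ [i, m, i] @ (?b @ u))" by (simp add: sp letters_simps)
    also have "equiv \<dots> (?a @ [m, i, m] @ (?b @ u))"
      using equiv_context[OF equiv_braid[OF m1(1,3)] ar] m by simp
    also have "equiv \<dots> ([j..<n] @ m # u)"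
    proof -
      have "equiv (m # ?b) (?b @ [m])" using m br by (intro equiv_commute_list) auto
      moreover have "?a @ [m, i] \<in> letters r" using ar ir m1 by (simp add: letters_simps)
      ultimately have "equiv ((?a @ [m, i]) @ (m # ?b) @ u) ((?a @ [m, i]) @ (?b @ [m]) @ u)" by (rule equiv_context)
      then show ?thesis by (simp add: sp)
    qed
    finally have "equiv (i # w) ([j..<n] @ m # u)" using e1 equiv_trans by blast
    moreover have "m # u \<in> letters (n - 1)" using m m1 i u by (auto simp: letters_simps)
    ultimately show ?thesis using j by blast
  qed
qed

lemma perm_permutes: "w \<in> letters n \<Longrightarrow> perm w permutes {1..n}"
proof (induction w)
  case (Cons i w)
  then have "sw i permutes {1..n}" unfolding sw_def by (intro permutes_swap_id) (auto simp: letters_simps)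
  moreover have "perm w permutes {1..n}" using Cons by (simp add: letters_simps)
  ultimately show ?case unfolding perm_simps using permutes_compose by blast
qed (simp add: perm_simps permutes_id)

lemma perm_upt: "1 \<le> j \<Longrightarrow> j \<le> n \<Longrightarrow> perm [j..<n] n = j"
proof (induction "n - j" arbitrary: j)
  case 0
  then show ?case by (simp add: perm_simps)
next
  case (Suc m)
  then have "[j..<n] = j # [Suc j..<n]" by (simp add: upt_conv_Cons)
  moreover have "perm [Suc j..<n] n = Suc j" using Suc by auto
  ultimately show ?case by (simp add: perm_simps sw_apply)
qed

lemma perm_fixes: "u \<in> letters (n - 1) \<Longrightarrow> 1 \<le> n \<Longrightarrow> perm u n = n"
  using perm_permutes[of u "n - 1"] by (auto simp: permutes_def)

text \<open>The image of the largest point determines the cycle in the normal form. Cancelling the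
  cycle leaves two words in fewer letters with the same permutation, to which the induction
  applies.\<close>

lemma perm_eq_imp_equiv:
  assumes "n \<le> r" "w \<in> letters n" "w' \<in> letters n" "perm w = perm w'"
  shows "equiv w w'"
  using assms
proof (induction n arbitrary: w w')
  case 0
  then have "w = []" "w' = []" by (auto simp: letters_def)
  then show ?case by simp
next
  case (Suc n)
  obtain j u where j: "1 \<le> j" "j \<le> Suc n" and u: "u \<in> letters n" and e: "equiv w ([j..<Suc n] @ u)"
    using normal_form[of "Suc n" w] Suc.prems by auto
  obtain j' u' where j': "1 \<le> j'" "j' \<le> Suc n" and u': "u' \<in> letters n" and e': "equiv w' ([j'..<Suc n] @ u')"
    using normal_form[of "Suc n" w'] Suc.prems by auto
  have pe: "perm [j..<Suc n] \<circ> perm u = perm [j'..<Suc n] \<circ> perm u'"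
    using e e' Suc.prems(4) by (simp add: equiv_def perm_append del: upt_Suc)
  have "(perm [j..<Suc n] \<circ> perm u) (Suc n) = j" "(perm [j'..<Suc n] \<circ> perm u') (Suc n) = j'"
    using perm_upt[OF j] perm_upt[OF j'] perm_fixes[of u "Suc n"] perm_fixes[of u' "Suc n"] u u' by (simp_all del: upt_Suc)
  then have "j = j'" using pe by metis
  have "bij (perm [j..<Suc n])" using perm_permutes[OF letters_upt[OF j(1), of "Suc n"]] permutes_bij by blast
  then have "perm u = perm u'" using pe \<open>j = j'\<close> by (metis bij_is_inj comp_assoc inv_o_cancel id_comp)
  then have "equiv u u'" using Suc u u' by auto
  moreover have "[j..<Suc n] \<in> letters r" using letters_upt[OF j(1)] letters_mono Suc.prems(1) by blast
  ultimately have "equiv ([j..<Suc n] @ u) ([j..<Suc n] @ u')" using equiv_context[of u u' "[j..<Suc n]" "[]"] by simp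
  then show ?case using e e' \<open>j = j'\<close> equiv_sym equiv_trans by metis
qed

lemma ex_word: "\<sigma> permutes {1..n} \<Longrightarrow> \<exists>w\<in>letters n. perm w = \<sigma>"
proof (induction n arbitrary: \<sigma>)
  case 0
  then have "perm [] = \<sigma>" by (simp add: perm_simps)
  then show ?case using letters_simps(1) by blast
next
  case (Suc n)
  define j where "j = \<sigma> (Suc n)"
  have j: "1 \<le> j" "j \<le> Suc n" using permutes_in_image[OF Suc.prems, of "Suc n"] by (auto simp: j_def)
  let ?P = "perm [j..<Suc n]"
  have P: "?P permutes {1..Suc n}" by (rule perm_permutes[OF letters_upt[OF j(1)]])
  define \<tau> where "\<tau> = inv_into UNIV ?P \<circ> \<sigma>"
  have "\<tau> permutes {1..Suc n}" unfolding \<tau>_def by (rule permutes_compose[OF Suc.prems permutes_inv[OF P]])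
  moreover have "\<tau> (Suc n) = Suc n"
    using perm_upt[OF j] permutes_inverses(2)[OF P, of "Suc n"] by (simp add: \<tau>_def j_def[symmetric] del: upt_Suc)
  ultimately have "\<tau> permutes {1..n}" by (rule_tac permutes_superset[of _ "{1..Suc n}"]) (auto simp: le_Suc_eq)
  then obtain u where u: "u \<in> letters n" "perm u = \<tau>" using Suc.IH by blast
  have "perm ([j..<Suc n] @ u) = \<sigma>"
    unfolding perm_append u \<tau>_def using permutes_inv_o(1)[OF P] by (simp add: comp_assoc[symmetric] del: upt_Suc)
  moreover have "[j..<Suc n] @ u \<in> letters (Suc n)"
    using letters_upt[OF j(1)] letters_mono[OF u(1), of "Suc n"] by (simp add: letters_simps del: upt_Suc)
  ultimately show ?case by blast
qed

section \<open>The matrices of permutations\<close>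

definition word :: "(nat \<Rightarrow> nat) \<Rightarrow> nat list" where
  "word \<sigma> = (SOME w. w \<in> letters r \<and> perm w = \<sigma>)"

lemma word: "\<sigma> permutes {1..r} \<Longrightarrow> word \<sigma> \<in> letters r \<and> perm (word \<sigma>) = \<sigma>"
  unfolding word_def by (rule someI_ex) (use ex_word in blast)

lemma act_word:
  assumes "w \<in> letters r" "c \<in> Z"
  shows "act (word (perm w)) F c = act w F c"
  using perm_eq_imp_equiv[OF order_refl, of "word (perm w)" w] word[OF perm_permutes[OF assms(1)]] assms
  by (simp add: equiv_def)

definition delta :: "(nat \<Rightarrow> int) \<Rightarrow> (nat \<Rightarrow> int) \<Rightarrow> complex" where
  "delta c c' = (if c' = c then 1 else 0)"

definition rep :: "(nat \<Rightarrow> nat) \<Rightarrow> (nat \<Rightarrow> int) \<Rightarrow> (nat \<Rightarrow> int) \<Rightarrow> complex" where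
  "rep \<sigma> c c' = act (word \<sigma>) (delta c') c"

lemma act_linear:
  assumes "finite S"
  shows "act w (\<lambda>c. \<Sum>s\<in>S. a s * F s c) c = (\<Sum>s\<in>S. a s * act w (F s) c)"
proof (induction w arbitrary: c)
  case (Cons i w)
  have "act w (\<lambda>c. \<Sum>s\<in>S. a s * F s c) = (\<lambda>c. \<Sum>s\<in>S. a s * act w (F s) c)" using Cons by blast
  then show ?case by (simp add: act_simps fop_def sum_distrib_left sum.distrib algebra_simps)
qed (simp add: act_simps)

lemma act_expand:
  assumes "w \<in> letters r" "c \<in> Z"
  shows "act w F c = (\<Sum>c'\<in>Z. act w (delta c') c * F c')"
proof -
  have "act w F c = act w (\<lambda>c. \<Sum>c'\<in>Z. F c' * delta c' c) c"
    using assms fin_Z by (intro act_cong) (auto simp: delta_def if_distrib[of "\<lambda>t. _ * t"] cong: if_cong)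
  also have "\<dots> = (\<Sum>c'\<in>Z. F c' * act w (delta c') c)" by (rule act_linear[OF fin_Z])
  finally show ?thesis by (simp add: mult.commute)
qed

text \<open>Concatenating the chosen words gives some word for
  \<open>\<sigma> \<circ> \<tau>\<close>, and the action depends only on the permutation.\<close>

lemma rep_mult:
  assumes "\<sigma> permutes {1..r}" "\<tau> permutes {1..r}" "c \<in> Z" "c'' \<in> Z"
  shows "rep (\<sigma> \<circ> \<tau>) c c'' = (\<Sum>c'\<in>Z. rep \<sigma> c c' * rep \<tau> c' c'')"
proof -
  have w: "word \<sigma> @ word \<tau> \<in> letters r" "perm (word \<sigma> @ word \<tau>) = \<sigma> \<circ> \<tau>"
    using word assms(1,2) by (auto simp: letters_simps perm_append)
  have "rep (\<sigma> \<circ> \<tau>) c c'' = act (word \<sigma>) (act (word \<tau>) (delta c'')) c"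
    using act_word[OF w(1) assms(3), of "delta c''"] w(2) by (simp add: rep_def act_simps)
  also have "\<dots> = (\<Sum>c'\<in>Z. rep \<sigma> c c' * rep \<tau> c' c'')"
    unfolding rep_def by (rule act_expand) (use word assms in auto)
  finally show ?thesis .
qed

lemma rep_id: "c \<in> Z \<Longrightarrow> rep id c c' = (if c = c' then 1 else 0)"
  using act_word[of "[]" c "delta c'"] by (simp add: rep_def letters_simps perm_simps act_simps delta_def)

text \<open>An operator mixes the value at \<open>c\<close> only with the value at its swap, and the
  coefficient vanishes unless the swap lies in \<open>Z\<close>, where it has the same
  shape.\<close>

lemma act_shape:
  assumes "w \<in> letters r" "c \<in> Z" "\<And>c. c \<in> Z \<Longrightarrow> sh c \<noteq> l \<Longrightarrow> F c = 0" "sh c \<noteq> l"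
  shows "act w F c = 0"
  using assms(1,2,4)
proof (induction w arbitrary: c)
  case (Cons i w)
  then have i: "1 \<le> i" "Suc i \<le> r" by (auto simp: letters_simps)
  have "q i c * act w F (c \<circ> sw i) = 0"
  proof (cases "q i c = 0")
    case False
    then have "c \<circ> sw i \<in> Z" "sh (c \<circ> sw i) = sh c" using Z_swap[OF Cons.prems(2) i] q_zero_iff[OF Cons.prems(2) i] by auto
    then show ?thesis using Cons by (simp add: letters_simps)
  qed simp
  moreover have "act w F c = 0" using Cons by (simp add: letters_simps)
  ultimately show ?case by (simp add: act_simps fop_def)
qed (simp add: act_simps assms)

lemma rep_shape:
  assumes "\<sigma> permutes {1..r}" "c \<in> Z" "c' \<in> Z" "sh c \<noteq> sh c'"
  shows "rep \<sigma> c c' = 0"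
  unfolding rep_def using word assms by (intro act_shape[where l = "sh c'"]) (auto simp: delta_def)

section \<open>Operators in the image of the group algebra\<close>

definition alg :: "(((nat \<Rightarrow> int) \<Rightarrow> complex) \<Rightarrow> (nat \<Rightarrow> int) \<Rightarrow> complex) \<Rightarrow> bool" where
  "alg T \<longleftrightarrow> (\<exists>v. \<forall>F. \<forall>c\<in>Z. T F c = (\<Sum>\<sigma> | \<sigma> permutes {1..r}. v \<sigma> * act (word \<sigma>) F c))"

lemma fin_perms: "finite {\<sigma>. \<sigma> permutes {1..r}}"
  by (simp add: finite_permutations)

lemma alg_cong: "alg T \<Longrightarrow> (\<And>F c. c \<in> Z \<Longrightarrow> T' F c = T F c) \<Longrightarrow> alg T'"
  unfolding alg_def by force

lemma alg_scale: "alg T \<Longrightarrow> alg (\<lambda>F c. a * T F c)"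
proof -
  assume "alg T"
  then obtain v where "\<And>F c. c \<in> Z \<Longrightarrow> T F c = (\<Sum>\<sigma> | \<sigma> permutes {1..r}. v \<sigma> * act (word \<sigma>) F c)"
    unfolding alg_def by blast
  then show ?thesis unfolding alg_def
    by (intro exI[of _ "\<lambda>\<sigma>. a * v \<sigma>"]) (simp add: sum_distrib_left mult.assoc)
qed

lemma alg_add: 
  assumes "alg T" "alg T'"
  shows "alg (\<lambda>F c. T F c + T' F c)"
proof -
  obtain v v' where "\<And>F c. c \<in> Z \<Longrightarrow> T F c = (\<Sum>\<sigma> | \<sigma> permutes {1..r}. v \<sigma> * act (word \<sigma>) F c)"
    "\<And>F c. c \<in> Z \<Longrightarrow> T' F c = (\<Sum>\<sigma> | \<sigma> permutes {1..r}. v' \<sigma> * act (word \<sigma>) F c)"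
    using assms unfolding alg_def by blast
  then show ?thesis unfolding alg_def
    by (intro exI[of _ "\<lambda>\<sigma>. v \<sigma> + v' \<sigma>"]) (simp add: sum.distrib distrib_right)
qed

lemma alg_sum:
  assumes "finite S" "\<And>s. s \<in> S \<Longrightarrow> alg (T s)"
  shows "alg (\<lambda>F c. \<Sum>s\<in>S. T s F c)"
  using assms
proof (induction S)
  case empty
  show ?case unfolding alg_def by (intro exI[of _ "\<lambda>_. 0"]) simp
next
  case (insert s S)
  then show ?case using alg_add[of "T s" "\<lambda>F c. \<Sum>s\<in>S. T s F c"] by simp
qed

lemma alg_act:
  assumes "w \<in> letters r"
  shows "alg (act w)"
  unfolding alg_def
proof (intro exI[of _ "\<lambda>\<sigma>. if \<sigma> = perm w then 1 else 0"] allI ballI)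
  fix F c assume c: "c \<in> Z"
  have "(\<Sum>\<sigma> | \<sigma> permutes {1..r}. (if \<sigma> = perm w then 1 else 0) * act (word \<sigma>) F c) =
      (\<Sum>\<sigma> | \<sigma> permutes {1..r}. if \<sigma> = perm w then act (word (perm w)) F c else 0)"
    by (intro sum.cong) auto
  also have "\<dots> = act (word (perm w)) F c"
    using perm_permutes[OF assms] fin_perms by simp
  finally show "act w F c = (\<Sum>\<sigma> | \<sigma> permutes {1..r}. (if \<sigma> = perm w then 1 else 0) * act (word \<sigma>) F c)"
    using act_word[OF assms c] by simp
qed

lemma alg_comp:
  assumes "alg T" "alg T'"
  shows "alg (\<lambda>F. T (T' F))"
proof -
  obtain v v' where v: "\<And>F c. c \<in> Z \<Longrightarrow> T F c = (\<Sum>\<sigma> | \<sigma> permutes {1..r}. v \<sigma> * act (word \<sigma>) F c)"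
    and v': "\<And>F c. c \<in> Z \<Longrightarrow> T' F c = (\<Sum>\<sigma> | \<sigma> permutes {1..r}. v' \<sigma> * act (word \<sigma>) F c)"
    using assms unfolding alg_def by blast
  let ?P = "{\<sigma>. \<sigma> permutes {1..r}}"
  have "T (T' F) c = (\<Sum>\<sigma>\<in>?P. \<Sum>\<tau>\<in>?P. v \<sigma> * (v' \<tau> * act (word \<sigma> @ word \<tau>) F c))" if c: "c \<in> Z" for F c
  proof -
    have "act (word \<sigma>) (T' F) c = (\<Sum>\<tau>\<in>?P. v' \<tau> * act (word \<sigma> @ word \<tau>) F c)" if \<sigma>: "\<sigma> \<in> ?P" for \<sigma>
    proof -
      have "act (word \<sigma>) (T' F) c = act (word \<sigma>) (\<lambda>c. \<Sum>\<tau>\<in>?P. v' \<tau> * act (word \<tau>) F c) c"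
        using word \<sigma> c v' by (intro act_cong) auto
      also have "\<dots> = (\<Sum>\<tau>\<in>?P. v' \<tau> * act (word \<sigma>) (act (word \<tau>) F) c)" by (rule act_linear[OF fin_perms])
      finally show ?thesis by (simp only: act_simps)
    qed
    then show ?thesis using v[OF c] by (simp add: sum_distrib_left)
  qed
  moreover have "alg (\<lambda>F c. \<Sum>\<sigma>\<in>?P. \<Sum>\<tau>\<in>?P. v \<sigma> * (v' \<tau> * act (word \<sigma> @ word \<tau>) F c))"
    using word by (intro alg_sum fin_perms alg_scale alg_act) (auto simp: letters_simps)
  ultimately show ?thesis by (rule_tac alg_cong) auto
qed

text \<open>These diagonal operators are the Jucys--Murphy elements.\<close>

lemma alg_content:
  assumes "1 \<le> j" "j \<le> r"
  shows "alg (\<lambda>F c. of_int (c j) * F c)"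
  using assms
proof (induction j rule: nat_induct_at_least)
  case base
  \<comment> \<open>The first Jucys--Murphy element is zero, in accordance with
    \<open>c 1 = 0\<close>.\<close>
  have "alg (\<lambda>F c. 0 * act [] F c)" by (intro alg_scale alg_act) (simp add: letters_simps)
  then show ?case by (rule alg_cong) (use Z_first base in auto)
next
  case (Suc j)
  let ?X = "\<lambda>F c. of_int (c j) * F c :: complex"
  have s: "alg (fop j)" using alg_act[of "[j]"] Suc by (simp add: letters_simps act_simps(1,2)[abs_def])
  \<comment> \<open>This is the recursion \<open>X_{j+1} = s_j X_j s_j + s_j\<close> of the
    Jucys--Murphy elements.\<close>
  have "alg (\<lambda>F c. fop j (\<lambda>c. of_int (c j) * fop j F c) c + fop j F c)"
    using alg_add[OF alg_comp[OF s alg_comp[OF _ s, of ?X]] s] Suc by simp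
  moreover have "of_int (c (Suc j)) * F c = fop j (\<lambda>c. of_int (c j) * fop j F c) c + fop j F c" if c: "c \<in> Z" for F c
  proof -
    define x X a b :: complex where "x = p j c" and "X = q j c" and "a = of_int (c j)" and "b = of_int (c (Suc j))"
    have "x * (b - a) = 1" using p_inverse[of c j] Z_adj[OF c, of j] Suc by (simp add: x_def a_def b_def)
    moreover have "X\<^sup>2 = 1 - x\<^sup>2" using q_sq by (simp add: X_def x_def)
    moreover have "x * (a * (x * F c + X * F (c \<circ> sw j))) + X * (b * (- x * F (c \<circ> sw j) + X * F c)) + (x * F c + X * F (c \<circ> sw j)) =
        b * F c + (x * F c + X * F (c \<circ> sw j)) * (1 - x * (b - a)) + (X\<^sup>2 - 1 + x\<^sup>2) * b * F c"
      by (simp add: algebra_simps power2_eq_square)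
    ultimately have "b * F c = x * (a * (x * F c + X * F (c \<circ> sw j))) + X * (b * (- x * F (c \<circ> sw j) + X * F c)) + (x * F c + X * F (c \<circ> sw j))"
      by simp
    then show ?thesis
      by (simp add: fop_def p_swap q_swap comp_sw_sw sw_apply x_def X_def a_def b_def)
  qed
  ultimately show ?case by (rule alg_cong)
qed

text \<open>Lagrange interpolation: every other sequence \<open>c1\<close> differs from
  \<open>c0\<close> at some position \<open>d c1\<close>, and the content operator at this position
  yields a factor that is \<open>1\<close> at \<open>c0\<close> and \<open>0\<close> at
  \<open>c1\<close>. The product over all \<open>c1\<close> is the projection.\<close>

lemma alg_projection:
  assumes c0: "c0 \<in> Z"
  shows "alg (\<lambda>F c. if c = c0 then F c else 0)"
proof -
  define d where "d c1 = (SOME j. c0 j \<noteq> c1 j)" for c1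
  have d: "c0 (d c1) \<noteq> c1 (d c1)" "d c1 \<in> {1..r}" if "c1 \<in> Z - {c0}" for c1
  proof -
    have "\<exists>j. c0 j \<noteq> c1 j" using that by auto
    then show *: "c0 (d c1) \<noteq> c1 (d c1)" unfolding d_def by (rule someI_ex)
    show "d c1 \<in> {1..r}" using * Z_outside c0 that by (metis DiffD1)
  qed
  let ?t = "\<lambda>c1 c. (of_int (c (d c1)) - of_int (c1 (d c1))) / (of_int (c0 (d c1)) - of_int (c1 (d c1))) :: complex"
  have "alg (\<lambda>F c. (\<Prod>c1\<in>W. ?t c1 c) * F c)" if "finite W" "W \<subseteq> Z - {c0}" for W
    using that
  proof (induction W)
    case empty
    show ?case by (rule alg_cong[OF alg_act[of "[]"]]) (simp_all add: letters_simps act_simps)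
  next
    case (insert c1 W)
    let ?e = "1 / (of_int (c0 (d c1)) - of_int (c1 (d c1))) :: complex"
    have "alg (\<lambda>F c. ?e * (of_int (c (d c1)) * F c) + (- ?e * of_int (c1 (d c1))) * act [] F c)"
      using d[of c1] insert by (intro alg_add alg_scale alg_content alg_act) (auto simp: letters_simps)
    then have "alg (\<lambda>F c. ?t c1 c * F c)" by (rule alg_cong) (auto simp: act_simps diff_divide_distrib algebra_simps)
    from alg_comp[OF this, of "\<lambda>F c. (\<Prod>c1\<in>W. ?t c1 c) * F c"] insert show ?case by (simp add: mult.assoc)
  qed
  then have A: "alg (\<lambda>F c. (\<Prod>c1\<in>Z - {c0}. ?t c1 c) * F c)" using fin_Z by blast
  have B: "(\<Prod>c1\<in>Z - {c0}. ?t c1 c) = (if c = c0 then 1 else 0)" if "c \<in> Z" for c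
  proof (cases "c = c0")
    case True
    have "?t c1 c0 = 1" if "c1 \<in> Z - {c0}" for c1 using d(1)[OF that] by simp
    then show ?thesis using True by (simp add: prod.neutral)
  next
    case False
    then have "\<exists>c1\<in>Z - {c0}. ?t c1 c = 0" using that by (intro bexI[of _ c]) auto
    then show ?thesis using False fin_Z by (simp add: prod_zero_iff)
  qed
  show ?thesis by (rule alg_cong[OF A]) (simp add: B)
qed

text \<open>Along a chain of swaps, the unit for \<open>c0\<close> and \<open>a\<close>, composed
  with the swap operator and the projection to the next sequence \<open>b\<close>, is the unit for
  \<open>c0\<close> and \<open>b\<close> up to the factor \<open>q i a\<close>, which is nonzero for
  an admissible swap.\<close>

lemma alg_unit:
  assumes c0: "c0 \<in> Z" and c1: "c1 \<in> Z" and s: "sh c0 = sh c1"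
  shows "alg (\<lambda>F c. if c = c0 then F c1 else 0)"
proof -
  have "(c0, c1) \<in> {(c, c \<circ> sw i) | c i. c \<in> Z \<and> 1 \<le> i \<and> Suc i \<le> r \<and> \<bar>c i - c (Suc i)\<bar> \<noteq> 1}\<^sup>*"
    using Z_connected[OF assms] .
  then show ?thesis
  proof (induction rule: rtrancl_induct)
    case base
    show ?case using alg_projection[OF c0] by (rule alg_cong) auto
  next
    case (step a b)
    then obtain i where i: "b = a \<circ> sw i" "a \<in> Z" "1 \<le> i" "Suc i \<le> r" "\<bar>a i - a (Suc i)\<bar> \<noteq> 1" by blast
    have b: "b \<in> Z" using Z_swap i by blast
    have "b \<noteq> a" using Z_adj[OF i(2-4)] i(1) by (metis comp_apply sw_apply)
    have nz: "q i a \<noteq> 0" using q_zero_iff i by blast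
    have "alg (fop i)" using alg_act[of "[i]"] i by (simp add: letters_simps act_simps(1,2)[abs_def])
    from alg_scale[OF alg_comp[OF step.IH alg_comp[OF this alg_projection[OF b]]], of "1 / q i a"]
    show ?case by (rule alg_cong) (use nz \<open>b \<noteq> a\<close> i(1) in \<open>auto simp: fop_def comp_def\<close>)
  qed
qed

text \<open>All matrix units inside the blocks are combinations of matrices of permutations, and
  their number is \<open>fact r\<close>. Surjectivity of this square system gives injectivity, so
  the orthogonal form is faithful on the group algebra.\<close>

theorem rep_trivial_kernel:
  "trivial_kernel {\<sigma>. \<sigma> permutes {1..r}} {(c, c'). c \<in> Z \<and> c' \<in> Z \<and> sh c = sh c'} (\<lambda>(c, c') \<sigma>. rep \<sigma> c c')"
proof (rule square_matrix_surj_imp_inj)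
  show "finite {(c, c'). c \<in> Z \<and> c' \<in> Z \<and> sh c = sh c'}"
    by (rule finite_subset[of _ "Z \<times> Z"]) (use fin_Z in auto)
  show "card {\<sigma>. \<sigma> permutes {1..r}} = card {(c, c'). c \<in> Z \<and> c' \<in> Z \<and> sh c = sh c'}"
    using card_permutations[of "{1..r}" r] by (simp add: card_pairs)
next
  fix j assume "j \<in> {(c, c'). c \<in> Z \<and> c' \<in> Z \<and> sh c = sh c'}"
  then obtain c0 c1 where j: "j = (c0, c1)" "c0 \<in> Z" "c1 \<in> Z" "sh c0 = sh c1" by blast
  obtain v where v: "\<And>F c. c \<in> Z \<Longrightarrow> (if c = c0 then F c1 else 0) = (\<Sum>\<sigma> | \<sigma> permutes {1..r}. v \<sigma> * act (word \<sigma>) F c)"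
    using alg_unit[OF j(2-4)] unfolding alg_def by blast
  have "(\<Sum>\<sigma> | \<sigma> permutes {1..r}. rep \<sigma> c c' * v \<sigma>) = (if c = c0 \<and> c' = c1 then 1 else 0)" if "c \<in> Z" for c c'
    using v[OF that, of "delta c'"] by (simp add: rep_def delta_def mult.commute split: if_splits)
  then show "\<exists>v. \<forall>j'\<in>{(c, c'). c \<in> Z \<and> c' \<in> Z \<and> sh c = sh c'}.
      (\<Sum>\<sigma> | \<sigma> permutes {1..r}. (case j' of (c, c') \<Rightarrow> \<lambda>\<sigma>. rep \<sigma> c c') \<sigma> * v \<sigma>) = (if j' = j then 1 else 0)"
    unfolding j(1) by (intro exI[of _ v]) auto
qed (rule fin_perms)

end

section \<open>Young's lattice\<close>

definition parts_of :: "nat \<Rightarrow> part set" where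
  "parts_of n = {\<nu>. is_partition \<nu> \<and> psize \<nu> = n}"

definition upper_covers :: "part \<Rightarrow> part set" where
  "upper_covers \<nu> = {\<mu>. is_partition \<mu> \<and> adds_box \<nu> \<mu>}"

definition lower_covers :: "part \<Rightarrow> part set" where
  "lower_covers \<mu> = {\<nu>. is_partition \<nu> \<and> adds_box \<nu> \<mu>}"

text \<open>Column minus row, counted from zero, of the box that would be added to row
  \<open>i\<close>. It strictly decreases with \<open>i\<close> and therefore identifies the
  row.\<close>

definition content :: "part \<Rightarrow> nat \<Rightarrow> int" where
  "content \<nu> i = int (\<nu> i) - int i"

lemma is_partition_Suc: "is_partition \<nu> \<longleftrightarrow> (\<forall>i. \<nu> (Suc i) \<le> \<nu> i) \<and> finite {i. \<nu> i \<noteq> 0}"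
  by (simp add: is_partition_def antimono_iff_le_Suc)

lemma is_partition_antimono: "is_partition \<nu> \<Longrightarrow> i \<le> j \<Longrightarrow> \<nu> j \<le> \<nu> i"
  by (simp add: is_partition_def antimonoD)

lemma content_less: "is_partition \<nu> \<Longrightarrow> i < j \<Longrightarrow> content \<nu> j < content \<nu> i"
  using is_partition_antimono[of \<nu> i j] by (simp add: content_def)

lemma content_inj: "is_partition \<nu> \<Longrightarrow> content \<nu> i = content \<nu> j \<longleftrightarrow> i = j"
  using content_less by (metis less_irrefl linorder_neqE_nat)

lemma psize_eq_sum: "finite S \<Longrightarrow> {i. \<nu> i \<noteq> 0} \<subseteq> S \<Longrightarrow> psize \<nu> = sum \<nu> S"
  unfolding psize_def by (rule sum.mono_neutral_left) auto

lemma psize_add_box: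
  assumes "is_partition \<nu>"
  shows "psize (\<nu>(i := Suc (\<nu> i))) = Suc (psize \<nu>)"
proof -
  let ?S = "insert i {j. \<nu> j \<noteq> 0}"
  have fin: "finite ?S" using assms by (simp add: is_partition_def)
  have "psize (\<nu>(i := Suc (\<nu> i))) = sum (\<nu>(i := Suc (\<nu> i))) ?S" using fin by (intro psize_eq_sum) auto
  also have "\<dots> = Suc (\<nu> i) + sum (\<nu>(i := Suc (\<nu> i))) (?S - {i})" using fin by (subst sum.remove[of _ i]) auto
  also have "sum (\<nu>(i := Suc (\<nu> i))) (?S - {i}) = sum \<nu> (?S - {i})" by (intro sum.cong) auto
  also have "Suc (\<nu> i) + sum \<nu> (?S - {i}) = Suc (sum \<nu> ?S)" using fin by (subst (2) sum.remove[of _ i]) auto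
  also have "sum \<nu> ?S = psize \<nu>" using fin by (intro psize_eq_sum[symmetric]) auto
  finally show ?thesis .
qed

lemma psize_adds_box: "is_partition \<nu> \<Longrightarrow> adds_box \<nu> \<mu> \<Longrightarrow> psize \<mu> = Suc (psize \<nu>)"
  using psize_add_box by (auto simp: adds_box_def)

lemma psize_zero_iff:
  assumes "is_partition \<nu>"
  shows "psize \<nu> = 0 \<longleftrightarrow> \<nu> = empty_partition"
proof -
  have "finite {i. \<nu> i \<noteq> 0}" using assms by (simp add: is_partition_def)
  then show ?thesis by (auto simp: psize_def empty_partition_def fun_eq_iff)
qed

lemma empty_partition_parts: "is_partition empty_partition" "psize empty_partition = 0"
  by (auto simp: is_partition_def empty_partition_def psize_def antimono_def)

lemma parts_of_0: "parts_of 0 = {empty_partition}"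
  using psize_zero_iff empty_partition_parts by (auto simp: parts_of_def)

section \<open>Addable and removable boxes\<close>

definition addable :: "part \<Rightarrow> nat set" where
  "addable \<nu> = {i. is_partition (\<nu>(i := Suc (\<nu> i)))}"

definition removable :: "part \<Rightarrow> nat set" where
  "removable \<nu> = {i. \<nu> (Suc i) < \<nu> i}"

lemma finite_support_upd: "finite {j. \<nu> j \<noteq> 0} \<Longrightarrow> finite {j. (\<nu>(i := x)) j \<noteq> 0}"
  by (rule finite_subset[of _ "insert i {j. \<nu> j \<noteq> 0}"]) auto

text \<open>Row \<open>0\<close> can always grow. A later row can grow iff the row above it is
  longer, that is, iff the row above can lose a box. Hence a partition has one more upper cover than
  lower covers.\<close>

lemma addable_eq:
  assumes "is_partition \<nu>"
  shows "addable \<nu> = insert 0 (Suc ` removable \<nu>)"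
proof (rule Set.set_eqI)
  fix i
  have "finite {j. \<nu> j \<noteq> 0}" using assms unfolding is_partition_def by blast
  then have f: "finite {j. (\<nu>(i := Suc (\<nu> i))) j \<noteq> 0}" by (rule finite_support_upd)
  have m: "\<nu> (Suc j) \<le> \<nu> j" for j using assms by (simp add: is_partition_Suc)
  have "i \<in> addable \<nu> \<longleftrightarrow> (\<forall>j. Suc j = i \<longrightarrow> \<nu> i < \<nu> j)"
    unfolding addable_def mem_Collect_eq is_partition_Suc using f m
    by (auto simp: le_SucI Suc_le_eq split: if_splits)
  also have "\<dots> \<longleftrightarrow> i \<in> insert 0 (Suc ` removable \<nu>)"
    by (cases i) (auto simp: removable_def)
  finally show "i \<in> addable \<nu> \<longleftrightarrow> i \<in> insert 0 (Suc ` removable \<nu>)" .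
qed

lemma finite_removable: "is_partition \<nu> \<Longrightarrow> finite (removable \<nu>)"
  by (rule finite_subset[of _ "{i. \<nu> i \<noteq> 0}"]) (auto simp: removable_def is_partition_def)

lemma upper_covers_eq: "upper_covers \<nu> = (\<lambda>i. \<nu>(i := Suc (\<nu> i))) ` addable \<nu>"
  by (auto simp: upper_covers_def addable_def adds_box_def)

lemma inj_add_box: "inj_on (\<lambda>i. \<nu>(i := Suc (\<nu> i))) A"
  by (rule inj_onI) (metis fun_upd_apply n_not_Suc_n)

lemma card_upper_covers:
  assumes "is_partition \<nu>"
  shows "finite (upper_covers \<nu>)" "card (upper_covers \<nu>) = Suc (card (removable \<nu>))"
proof -
  have fin: "finite (addable \<nu>)" using addable_eq finite_removable assms by simp
  then show "finite (upper_covers \<nu>)" by (simp add: upper_covers_eq)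
  have "card (upper_covers \<nu>) = card (addable \<nu>)" unfolding upper_covers_eq by (rule card_image[OF inj_add_box])
  also have "\<dots> = Suc (card (Suc ` removable \<nu>))" using addable_eq[OF assms] finite_removable[OF assms] by simp
  finally show "card (upper_covers \<nu>) = Suc (card (removable \<nu>))" by (simp add: card_image)
qed

lemma removable_lower_cover:
  assumes "is_partition \<mu>" "i \<in> removable \<mu>"
  shows "\<mu>(i := \<mu> i - 1) \<in> lower_covers \<mu>"
proof -
  have "finite {j. \<mu> j \<noteq> 0}" using assms unfolding is_partition_def by blast
  then have "finite {j. (\<mu>(i := \<mu> i - 1)) j \<noteq> 0}" by (rule finite_support_upd)
  moreover have "(\<mu>(i := \<mu> i - 1)) (Suc j) \<le> (\<mu>(i := \<mu> i - 1)) j" for j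
  proof -
    have "\<mu> (Suc j) \<le> \<mu> j" "\<mu> (Suc i) < \<mu> i" using assms by (auto simp: is_partition_Suc removable_def)
    then show ?thesis by (auto intro: le_diff_conv[THEN iffD2] le_trans[OF diff_le_self])
  qed
  ultimately have "is_partition (\<mu>(i := \<mu> i - 1))" by (simp add: is_partition_Suc)
  moreover have "\<mu> = (\<mu>(i := \<mu> i - 1))(i := Suc ((\<mu>(i := \<mu> i - 1)) i))"
    using assms(2) by (auto simp: removable_def)
  ultimately show ?thesis unfolding lower_covers_def adds_box_def by blast
qed

lemma lower_covers_eq:
  assumes "is_partition \<mu>"
  shows "lower_covers \<mu> = (\<lambda>i. \<mu>(i := \<mu> i - 1)) ` removable \<mu>"
proof
  show "lower_covers \<mu> \<subseteq> (\<lambda>i. \<mu>(i := \<mu> i - 1)) ` removable \<mu>"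
  proof
    fix \<nu> assume "\<nu> \<in> lower_covers \<mu>"
    then obtain i where \<nu>: "is_partition \<nu>" "\<mu> = \<nu>(i := Suc (\<nu> i))" by (auto simp: lower_covers_def adds_box_def)
    then have "\<nu> = \<mu>(i := \<mu> i - 1)" "i \<in> removable \<mu>" by (auto simp: removable_def is_partition_Suc le_imp_less_Suc)
    then show "\<nu> \<in> (\<lambda>i. \<mu>(i := \<mu> i - 1)) ` removable \<mu>" by blast
  qed
qed (use removable_lower_cover[OF assms] in blast)

lemma card_lower_covers:
  assumes "is_partition \<mu>"
  shows "finite (lower_covers \<mu>)" "card (lower_covers \<mu>) = card (removable \<mu>)"
proof -
  show "finite (lower_covers \<mu>)" using lower_covers_eq[OF assms] finite_removable[OF assms] by simp
  have "inj_on (\<lambda>i. \<mu>(i := \<mu> i - 1)) (removable \<mu>)"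
  proof (rule inj_onI)
    fix i j assume ij: "i \<in> removable \<mu>" "j \<in> removable \<mu>" "\<mu>(i := \<mu> i - 1) = \<mu>(j := \<mu> j - 1)"
    show "i = j"
    proof (rule ccontr)
      assume "i \<noteq> j"
      then have "\<mu> i - 1 = \<mu> i" using fun_cong[OF ij(3), of i] by simp
      then show False using ij(1) by (simp add: removable_def)
    qed
  qed
  then show "card (lower_covers \<mu>) = card (removable \<mu>)" unfolding lower_covers_eq[OF assms] by (rule card_image)
qed

lemma ex_lower_cover:
  assumes "is_partition \<mu>" "psize \<mu> \<noteq> 0"
  shows "\<exists>\<nu>. \<nu> \<in> lower_covers \<mu>"
proof -
  have fin: "finite {i. \<mu> i \<noteq> 0}" using assms by (simp add: is_partition_def)
  have ne: "{i. \<mu> i \<noteq> 0} \<noteq> {}"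
  proof
    assume e: "{i. \<mu> i \<noteq> 0} = {}"
    have "psize \<mu> = 0" unfolding psize_def e by simp
    then show False using assms(2) by simp
  qed
  define i where "i = Max {i. \<mu> i \<noteq> 0}"
  have "\<mu> i \<noteq> 0" using Max_in[OF fin ne] by (simp add: i_def)
  moreover have "\<mu> (Suc i) = 0" using Max_ge[OF fin, of "Suc i"] unfolding i_def[symmetric] by (rule_tac ccontr) simp
  ultimately have "i \<in> removable \<mu>" by (simp add: removable_def)
  then show ?thesis using removable_lower_cover[OF assms(1)] by blast
qed

lemma finite_parts_of [simp]: "finite (parts_of n)"
proof (induction n)
  case 0
  then show ?case by (simp add: parts_of_0)
next
  case (Suc n)
  have "parts_of (Suc n) \<subseteq> (\<Union>\<nu>\<in>parts_of n. upper_covers \<nu>)"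
  proof
    fix \<mu> assume \<mu>: "\<mu> \<in> parts_of (Suc n)"
    then obtain \<nu> where \<nu>: "\<nu> \<in> lower_covers \<mu>" using ex_lower_cover[of \<mu>] by (auto simp: parts_of_def)
    then have "\<nu> \<in> parts_of n" "\<mu> \<in> upper_covers \<nu>"
      using \<mu> psize_adds_box by (auto simp: lower_covers_def upper_covers_def parts_of_def)
    then show "\<mu> \<in> (\<Union>\<nu>\<in>parts_of n. upper_covers \<nu>)" by blast
  qed
  moreover have "finite (\<Union>\<nu>\<in>parts_of n. upper_covers \<nu>)"
    using Suc card_upper_covers(1) by (auto simp: parts_of_def)
  ultimately show ?case by (rule finite_subset)
qed

text \<open>Distinct partitions of the same size have a common upper cover iff they have a common lower
  cover; these are then the join and the meet.\<close>

definition join :: "part \<Rightarrow> part \<Rightarrow> part" where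
  "join \<rho> \<nu> = (\<lambda>i. max (\<rho> i) (\<nu> i))"

definition meet :: "part \<Rightarrow> part \<Rightarrow> part" where
  "meet \<rho> \<nu> = (\<lambda>i. min (\<rho> i) (\<nu> i))"

lemma is_partition_join:
  assumes "is_partition \<rho>" "is_partition \<nu>"
  shows "is_partition (join \<rho> \<nu>)"
proof -
  have "finite ({i. \<rho> i \<noteq> 0} \<union> {i. \<nu> i \<noteq> 0})" using assms unfolding is_partition_def by blast
  then have "finite {i. join \<rho> \<nu> i \<noteq> 0}" by (rule rev_finite_subset) (auto simp: join_def max_def)
  moreover have "join \<rho> \<nu> (Suc i) \<le> join \<rho> \<nu> i" for i
    using assms unfolding join_def is_partition_Suc by (intro max.mono) blast+
  ultimately show ?thesis unfolding is_partition_Suc by blast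
qed

lemma is_partition_meet:
  assumes "is_partition \<rho>" "is_partition \<nu>"
  shows "is_partition (meet \<rho> \<nu>)"
proof -
  have "finite {i. \<rho> i \<noteq> 0}" using assms unfolding is_partition_def by blast
  then have "finite {i. meet \<rho> \<nu> i \<noteq> 0}" by (rule rev_finite_subset) (auto simp: meet_def)
  moreover have "meet \<rho> \<nu> (Suc i) \<le> meet \<rho> \<nu> i" for i
    using assms unfolding meet_def is_partition_Suc by (intro min.mono) blast+
  ultimately show ?thesis unfolding is_partition_Suc by blast
qed

lemma common_upper_cover:
  assumes "adds_box \<rho> \<mu>" "adds_box \<nu> \<mu>" "\<rho> \<noteq> \<nu>"
  shows "\<mu> = join \<rho> \<nu>" "adds_box (meet \<rho> \<nu>) \<rho>" "adds_box (meet \<rho> \<nu>) \<nu>"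
proof -
  obtain i where i: "\<mu> = \<rho>(i := Suc (\<rho> i))" using assms(1) unfolding adds_box_def by blast
  obtain j where j: "\<mu> = \<nu>(j := Suc (\<nu> j))" using assms(2) unfolding adds_box_def by blast
  have e: "(\<rho>(i := Suc (\<rho> i))) l = (\<nu>(j := Suc (\<nu> j))) l" for l using i j by metis
  have ij: "i \<noteq> j"
  proof
    assume "i = j"
    have "\<rho> l = \<nu> l" for l using e[of l] \<open>i = j\<close> by (simp split: if_splits)
    then show False using assms(3) by blast
  qed
  have ei: "\<nu> i = Suc (\<rho> i)" and ej: "\<rho> j = Suc (\<nu> j)" using e[of i] e[of j] ij by auto
  have el: "\<nu> l = \<rho> l" if "l \<noteq> i" "l \<noteq> j" for l using e[of l] that by simp
  show "\<mu> = join \<rho> \<nu>" unfolding i join_def using ei ej el by (auto simp: fun_eq_iff) (metis max.idem max_Suc_Suc n_not_Suc_n max_def Suc_n_not_le_n)+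
  have "\<rho> = (meet \<rho> \<nu>)(j := Suc (meet \<rho> \<nu> j))"
  proof
    show "\<rho> l = ((meet \<rho> \<nu>)(j := Suc (meet \<rho> \<nu> j))) l" for l
      using ei ej el[of l] by (cases "l = i"; cases "l = j") (auto simp: meet_def)
  qed
  then show "adds_box (meet \<rho> \<nu>) \<rho>" unfolding adds_box_def by blast
  have "\<nu> = (meet \<rho> \<nu>)(i := Suc (meet \<rho> \<nu> i))"
  proof
    show "\<nu> l = ((meet \<rho> \<nu>)(i := Suc (meet \<rho> \<nu> i))) l" for l
      using ei ej el[of l] by (cases "l = i"; cases "l = j") (auto simp: meet_def)
  qed
  then show "adds_box (meet \<rho> \<nu>) \<nu>" unfolding adds_box_def by blast
qed

lemma common_lower_cover:
  assumes "adds_box \<kappa> \<rho>" "adds_box \<kappa> \<nu>" "\<rho> \<noteq> \<nu>"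
  shows "\<kappa> = meet \<rho> \<nu>" "adds_box \<rho> (join \<rho> \<nu>)" "adds_box \<nu> (join \<rho> \<nu>)"
proof -
  obtain i where i: "\<rho> = \<kappa>(i := Suc (\<kappa> i))" using assms(1) unfolding adds_box_def by blast
  obtain j where j: "\<nu> = \<kappa>(j := Suc (\<kappa> j))" using assms(2) unfolding adds_box_def by blast
  have ij: "i \<noteq> j" using i j assms(3) by auto
  show "\<kappa> = meet \<rho> \<nu>" unfolding i j meet_def using ij by (auto simp: fun_eq_iff)
  have "join \<rho> \<nu> = \<rho>(j := Suc (\<rho> j))" unfolding i j join_def using ij by (auto simp: fun_eq_iff)
  then show "adds_box \<rho> (join \<rho> \<nu>)" unfolding adds_box_def by blast
  have "join \<rho> \<nu> = \<nu>(i := Suc (\<nu> i))" unfolding i j join_def using ij by (auto simp: fun_eq_iff)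
  then show "adds_box \<nu> (join \<rho> \<nu>)" unfolding adds_box_def by blast
qed

text \<open>The relation \<open>D U - U D = 1\<close> of Young's lattice. For
  \<open>\<nu> \<noteq> \<rho>\<close>, join and meet put the common upper covers in bijection with
  the common lower covers. The term at \<open>\<rho>\<close> itself occurs once per cover, and there
  is one more upper cover.\<close>

lemma up_down_commutation:
  fixes f :: "part \<Rightarrow> nat"
  assumes \<rho>: "is_partition \<rho>"
  shows "(\<Sum>\<mu>\<in>upper_covers \<rho>. \<Sum>\<nu>\<in>lower_covers \<mu>. f \<nu>) = (\<Sum>\<kappa>\<in>lower_covers \<rho>. \<Sum>\<nu>\<in>upper_covers \<kappa>. f \<nu>) + f \<rho>"
proof -
  let ?P = "Sigma (upper_covers \<rho>) (\<lambda>\<mu>. lower_covers \<mu> - {\<rho>})" and ?Q = "Sigma (lower_covers \<rho>) (\<lambda>\<kappa>. upper_covers \<kappa> - {\<rho>})"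
  have fU: "finite (upper_covers \<rho>)" "finite (lower_covers \<rho>)" using card_upper_covers card_lower_covers \<rho> by auto
  have L: "(\<Sum>\<nu>\<in>lower_covers \<mu>. f \<nu>) = f \<rho> + (\<Sum>\<nu>\<in>lower_covers \<mu> - {\<rho>}. f \<nu>)" if "\<mu> \<in> upper_covers \<rho>" for \<mu>
    using that \<rho> card_lower_covers(1)[of \<mu>] by (intro sum.remove) (auto simp: upper_covers_def lower_covers_def)
  have U: "(\<Sum>\<nu>\<in>upper_covers \<kappa>. f \<nu>) = f \<rho> + (\<Sum>\<nu>\<in>upper_covers \<kappa> - {\<rho>}. f \<nu>)" if "\<kappa> \<in> lower_covers \<rho>" for \<kappa>
    using that \<rho> card_upper_covers(1)[of \<kappa>] by (intro sum.remove) (auto simp: upper_covers_def lower_covers_def)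
  have "(\<Sum>(\<mu>, \<nu>)\<in>?P. f \<nu>) = (\<Sum>(\<kappa>, \<nu>)\<in>?Q. f \<nu>)"
  proof (rule sum.reindex_bij_witness[of _ "\<lambda>(\<kappa>, \<nu>). (join \<rho> \<nu>, \<nu>)" "\<lambda>(\<mu>, \<nu>). (meet \<rho> \<nu>, \<nu>)"])
    fix a assume "a \<in> ?P"
    then obtain \<mu> \<nu> where a: "a = (\<mu>, \<nu>)" "is_partition \<mu>" "is_partition \<nu>" "adds_box \<rho> \<mu>" "adds_box \<nu> \<mu>" "\<rho> \<noteq> \<nu>"
      by (auto simp: upper_covers_def lower_covers_def)
    note c = common_upper_cover[OF a(4-6)]
    show "(case case a of (\<mu>, \<nu>) \<Rightarrow> (meet \<rho> \<nu>, \<nu>) of (\<kappa>, \<nu>) \<Rightarrow> (join \<rho> \<nu>, \<nu>)) = a" using c a by simp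
    show "(case a of (\<mu>, \<nu>) \<Rightarrow> (meet \<rho> \<nu>, \<nu>)) \<in> ?Q"
      using c a \<rho> is_partition_meet by (auto simp: upper_covers_def lower_covers_def)
    show "(case case a of (\<mu>, \<nu>) \<Rightarrow> (meet \<rho> \<nu>, \<nu>) of (\<kappa>, \<nu>) \<Rightarrow> f \<nu>) = (case a of (\<mu>, \<nu>) \<Rightarrow> f \<nu>)" using a by simp
  next
    fix b assume "b \<in> ?Q"
    then obtain \<kappa> \<nu> where b: "b = (\<kappa>, \<nu>)" "is_partition \<kappa>" "is_partition \<nu>" "adds_box \<kappa> \<rho>" "adds_box \<kappa> \<nu>" "\<rho> \<noteq> \<nu>"
      by (auto simp: upper_covers_def lower_covers_def)
    note c = common_lower_cover[OF b(4-6)]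
    show "(case case b of (\<kappa>, \<nu>) \<Rightarrow> (join \<rho> \<nu>, \<nu>) of (\<mu>, \<nu>) \<Rightarrow> (meet \<rho> \<nu>, \<nu>)) = b" using c b by simp
    show "(case b of (\<kappa>, \<nu>) \<Rightarrow> (join \<rho> \<nu>, \<nu>)) \<in> ?P"
      using c b \<rho> is_partition_join by (auto simp: upper_covers_def lower_covers_def)
  qed
  moreover have "(\<Sum>\<mu>\<in>upper_covers \<rho>. \<Sum>\<nu>\<in>lower_covers \<mu> - {\<rho>}. f \<nu>) = (\<Sum>(\<mu>, \<nu>)\<in>?P. f \<nu>)"
    using fU card_lower_covers(1) by (intro sum.Sigma) (auto simp: upper_covers_def)
  moreover have "(\<Sum>\<kappa>\<in>lower_covers \<rho>. \<Sum>\<nu>\<in>upper_covers \<kappa> - {\<rho>}. f \<nu>) = (\<Sum>(\<kappa>, \<nu>)\<in>?Q. f \<nu>)"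
    using fU card_upper_covers(1) by (intro sum.Sigma) (auto simp: lower_covers_def)
  ultimately have eq: "(\<Sum>\<mu>\<in>upper_covers \<rho>. \<Sum>\<nu>\<in>lower_covers \<mu> - {\<rho>}. f \<nu>) = (\<Sum>\<kappa>\<in>lower_covers \<rho>. \<Sum>\<nu>\<in>upper_covers \<kappa> - {\<rho>}. f \<nu>)"
    by simp
  have "(\<Sum>\<mu>\<in>upper_covers \<rho>. \<Sum>\<nu>\<in>lower_covers \<mu>. f \<nu>) =
      card (upper_covers \<rho>) * f \<rho> + (\<Sum>\<mu>\<in>upper_covers \<rho>. \<Sum>\<nu>\<in>lower_covers \<mu> - {\<rho>}. f \<nu>)"
    using L by (simp add: sum.distrib)
  moreover have "(\<Sum>\<kappa>\<in>lower_covers \<rho>. \<Sum>\<nu>\<in>upper_covers \<kappa>. f \<nu>) =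
      card (lower_covers \<rho>) * f \<rho> + (\<Sum>\<kappa>\<in>lower_covers \<rho>. \<Sum>\<nu>\<in>upper_covers \<kappa> - {\<rho>}. f \<nu>)"
    using U by (simp add: sum.distrib)
  ultimately show ?thesis using eq card_upper_covers(2)[OF \<rho>] card_lower_covers(2)[OF \<rho>] by simp
qed

text \<open>A standard tableau of shape \<open>\<mu>\<close> is encoded by the sequence of the contents of its boxes.\<close>

primrec tableaux :: "nat \<Rightarrow> part \<Rightarrow> (nat \<Rightarrow> int) set" where
  "tableaux 0 \<mu> = (if \<mu> = empty_partition then {\<lambda>_. 0} else {})"
| "tableaux (Suc n) \<mu> = {c(Suc n := content \<nu> i) | c \<nu> i.
     is_partition \<nu> \<and> is_partition \<mu> \<and> \<mu> = \<nu>(i := Suc (\<nu> i)) \<and> c \<in> tableaux n \<nu>}"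

section \<open>Standard tableaux and their number\<close>

lemma tableauxD:
  assumes "c \<in> tableaux n \<mu>"
  shows "is_partition \<mu>" "psize \<mu> = n" "j \<notin> {1..n} \<Longrightarrow> c j = 0"
  using assms
proof (induction n arbitrary: c \<mu>)
  case 0
  { case 1 then show ?case by (auto split: if_splits simp: empty_partition_parts) }
  { case 2 then show ?case by (auto split: if_splits simp: empty_partition_parts) }
  { case 3 then show ?case by (auto split: if_splits) }
next
  case (Suc n)
  { case 1 then show ?case by auto }
  { case 2
    then obtain c' \<nu> i where "is_partition \<nu>" "\<mu> = \<nu>(i := Suc (\<nu> i))" "c' \<in> tableaux n \<nu>" by auto
    then show ?case using Suc(2)[of c' \<nu>] psize_add_box[of \<nu> i] by metis }
  { case 3 then show ?case using Suc(3) by auto }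
qed

lemma tableaux_SucE:
  assumes "c \<in> tableaux (Suc n) \<mu>"
  obtains c' \<nu> i where "c = c'(Suc n := content \<nu> i)" "is_partition \<nu>" "is_partition \<mu>"
    "\<mu> = \<nu>(i := Suc (\<nu> i))" "c' \<in> tableaux n \<nu>" "c' = c(Suc n := 0)"
proof -
  obtain c' \<nu> i where c: "c = c'(Suc n := content \<nu> i)" "is_partition \<nu>" "is_partition \<mu>"
      "\<mu> = \<nu>(i := Suc (\<nu> i))" "c' \<in> tableaux n \<nu>"
    using assms by auto
  moreover have "c' (Suc n) = 0" using tableauxD(3)[OF c(5), of "Suc n"] by simp
  ultimately show ?thesis using that by (metis fun_upd_triv fun_upd_upd)
qed

text \<open>The prefix determines the shape without the last box, and the last content determines
  the row of that box, since different rows of a partition have different contents.\<close>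

lemma tableaux_shape_unique: "c \<in> tableaux n \<mu> \<Longrightarrow> c \<in> tableaux n \<mu>' \<Longrightarrow> \<mu> = \<mu>'"
proof (induction n arbitrary: c \<mu> \<mu>')
  case 0
  then show ?case by (auto split: if_splits)
next
  case (Suc n)
  obtain c1 \<nu> i where 1: "c = c1(Suc n := content \<nu> i)" "is_partition \<nu>" "\<mu> = \<nu>(i := Suc (\<nu> i))" "c1 \<in> tableaux n \<nu>" "c1 = c(Suc n := 0)"
    by (rule tableaux_SucE[OF Suc.prems(1)])
  obtain c2 \<nu>' i' where 2: "c = c2(Suc n := content \<nu>' i')" "is_partition \<nu>'" "\<mu>' = \<nu>'(i' := Suc (\<nu>' i'))" "c2 \<in> tableaux n \<nu>'" "c2 = c(Suc n := 0)"
    by (rule tableaux_SucE[OF Suc.prems(2)])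
  have "\<nu> = \<nu>'" by (metis Suc.IH 1(4,5) 2(4,5))
  moreover have "content \<nu> i = content \<nu>' i'" using 1(1) 2(1) by (metis fun_upd_same)
  ultimately have "i = i'" using content_inj[OF 1(2)] by metis
  then show ?case using 1(3) 2(3) \<open>\<nu> = \<nu>'\<close> by (simp only:)
qed

text \<open>The row in which \<open>\<nu>\<close> and \<open>\<mu>\<close> differ is unique, so the
  last content is a function \<open>g\<close> of \<open>\<nu>\<close>. This eliminates the row from
  the recursion and leaves a union over lower covers.\<close>

lemma tableaux_Suc_covers:
  assumes "is_partition \<mu>"
  shows "\<exists>g. tableaux (Suc n) \<mu> = (\<Union>\<nu>\<in>lower_covers \<mu>. (\<lambda>c. c(Suc n := g \<nu>)) ` tableaux n \<nu>)"
proof -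
  have "\<exists>x. \<forall>i. \<mu> = \<nu>(i := Suc (\<nu> i)) \<longrightarrow> content \<nu> i = x" for \<nu>
    by (metis fun_upd_apply n_not_Suc_n)
  then obtain g where g: "\<And>\<nu> i. \<mu> = \<nu>(i := Suc (\<nu> i)) \<Longrightarrow> content \<nu> i = g \<nu>" by metis
  have "tableaux (Suc n) \<mu> = (\<Union>\<nu>\<in>lower_covers \<mu>. (\<lambda>c. c(Suc n := g \<nu>)) ` tableaux n \<nu>)"
  proof
    show "tableaux (Suc n) \<mu> \<subseteq> (\<Union>\<nu>\<in>lower_covers \<mu>. (\<lambda>c. c(Suc n := g \<nu>)) ` tableaux n \<nu>)"
    proof
      fix c assume "c \<in> tableaux (Suc n) \<mu>"
      then obtain c' \<nu> i where "c = c'(Suc n := content \<nu> i)" "is_partition \<nu>" "\<mu> = \<nu>(i := Suc (\<nu> i))" "c' \<in> tableaux n \<nu>" by auto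
      moreover from this have "\<nu> \<in> lower_covers \<mu>" unfolding lower_covers_def adds_box_def by blast
      moreover have "content \<nu> i = g \<nu>" using g \<open>\<mu> = \<nu>(i := Suc (\<nu> i))\<close> .
      ultimately show "c \<in> (\<Union>\<nu>\<in>lower_covers \<mu>. (\<lambda>c. c(Suc n := g \<nu>)) ` tableaux n \<nu>)" by auto
    qed
    show "(\<Union>\<nu>\<in>lower_covers \<mu>. (\<lambda>c. c(Suc n := g \<nu>)) ` tableaux n \<nu>) \<subseteq> tableaux (Suc n) \<mu>"
    proof
      fix c assume "c \<in> (\<Union>\<nu>\<in>lower_covers \<mu>. (\<lambda>c. c(Suc n := g \<nu>)) ` tableaux n \<nu>)"
      then obtain \<nu> c' where *: "\<nu> \<in> lower_covers \<mu>" "c' \<in> tableaux n \<nu>" "c = c'(Suc n := g \<nu>)" by auto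
      then obtain i where i: "is_partition \<nu>" "\<mu> = \<nu>(i := Suc (\<nu> i))" by (auto simp: lower_covers_def adds_box_def)
      then have "g \<nu> = content \<nu> i" using g by simp
      then show "c \<in> tableaux (Suc n) \<mu>" using * i assms by auto
    qed
  qed
  then show ?thesis by blast
qed

lemma finite_tableaux [simp]: "finite (tableaux n \<mu>)"
proof (induction n arbitrary: \<mu>)
  case (Suc n)
  show ?case
  proof (cases "is_partition \<mu>")
    case True
    then show ?thesis using tableaux_Suc_covers[OF True, of n] Suc card_lower_covers(1)[OF True] by auto
  qed auto
qed simp

lemma card_tableaux_Suc:
  assumes \<mu>: "is_partition \<mu>"
  shows "card (tableaux (Suc n) \<mu>) = (\<Sum>\<nu>\<in>lower_covers \<mu>. card (tableaux n \<nu>))"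
proof -
  obtain g where g: "tableaux (Suc n) \<mu> = (\<Union>\<nu>\<in>lower_covers \<mu>. (\<lambda>c. c(Suc n := g \<nu>)) ` tableaux n \<nu>)"
    using tableaux_Suc_covers[OF \<mu>] by blast
  have rest: "(c(Suc n := x))(Suc n := 0) = c" if "c \<in> tableaux n \<nu>" for c \<nu> x
    using tableauxD(3)[OF that, of "Suc n"] by (simp add: fun_eq_iff)
  have inj: "inj_on (\<lambda>c. c(Suc n := g \<nu>)) (tableaux n \<nu>)" for \<nu>
    by (rule inj_onI) (metis rest)
  have "(\<lambda>c. c(Suc n := g \<nu>)) ` tableaux n \<nu> \<inter> (\<lambda>c. c(Suc n := g \<nu>')) ` tableaux n \<nu>' = {}" if "\<nu> \<noteq> \<nu>'" for \<nu> \<nu>'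
  proof (rule equals0I, elim IntE imageE)
    fix c c1 c2 assume "c = c1(Suc n := g \<nu>)" "c1 \<in> tableaux n \<nu>" "c = c2(Suc n := g \<nu>')" "c2 \<in> tableaux n \<nu>'"
    then have "c1 = c2" using rest by metis
    then show False using tableaux_shape_unique \<open>c1 \<in> tableaux n \<nu>\<close> \<open>c2 \<in> tableaux n \<nu>'\<close> that by blast
  qed
  then have "card (tableaux (Suc n) \<mu>) = (\<Sum>\<nu>\<in>lower_covers \<mu>. card ((\<lambda>c. c(Suc n := g \<nu>)) ` tableaux n \<nu>))"
    unfolding g using card_lower_covers(1)[OF \<mu>] by (intro card_UN_disjoint) auto
  then show ?thesis using inj by (simp add: card_image)
qed

lemma lower_covers_parts: "\<mu> \<in> parts_of (Suc n) \<Longrightarrow> lower_covers \<mu> \<subseteq> parts_of n"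
  using psize_adds_box by (auto simp: lower_covers_def parts_of_def)

lemma upper_covers_parts: "\<nu> \<in> parts_of n \<Longrightarrow> upper_covers \<nu> \<subseteq> parts_of (Suc n)"
  using psize_adds_box by (auto simp: upper_covers_def parts_of_def)

lemma lower_covers_empty: "\<mu> \<in> parts_of 0 \<Longrightarrow> lower_covers \<mu> = {}"
  using psize_adds_box by (fastforce simp: lower_covers_def parts_of_def)

text \<open>Expanding each term over lower covers and commuting the up and down steps reduces the
  sum to sums of the same kind one level below; the commutator supplies the additional
  summand.\<close>

lemma sum_card_tableaux_upper:
  "\<rho> \<in> parts_of n \<Longrightarrow> (\<Sum>\<mu>\<in>upper_covers \<rho>. card (tableaux (Suc n) \<mu>)) = Suc n * card (tableaux n \<rho>)"
proof (induction n arbitrary: \<rho>)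
  case (0 \<rho>)
  then have \<rho>: "is_partition \<rho>" "lower_covers \<rho> = {}" using lower_covers_empty by (auto simp: parts_of_def)
  have "(\<Sum>\<mu>\<in>upper_covers \<rho>. card (tableaux (Suc 0) \<mu>)) = (\<Sum>\<mu>\<in>upper_covers \<rho>. \<Sum>\<nu>\<in>lower_covers \<mu>. card (tableaux 0 \<nu>))"
    by (intro sum.cong refl card_tableaux_Suc) (auto simp: upper_covers_def)
  then show ?case using up_down_commutation[OF \<rho>(1), of "\<lambda>\<nu>. card (tableaux 0 \<nu>)"] \<rho>(2) by simp
next
  case (Suc n)
  then have \<rho>: "is_partition \<rho>" by (simp add: parts_of_def)
  have "(\<Sum>\<mu>\<in>upper_covers \<rho>. card (tableaux (Suc (Suc n)) \<mu>)) = (\<Sum>\<mu>\<in>upper_covers \<rho>. \<Sum>\<nu>\<in>lower_covers \<mu>. card (tableaux (Suc n) \<nu>))"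
    by (intro sum.cong refl card_tableaux_Suc) (auto simp: upper_covers_def)
  also have "\<dots> = (\<Sum>\<kappa>\<in>lower_covers \<rho>. \<Sum>\<nu>\<in>upper_covers \<kappa>. card (tableaux (Suc n) \<nu>)) + card (tableaux (Suc n) \<rho>)"
    by (rule up_down_commutation[OF \<rho>])
  also have "(\<Sum>\<kappa>\<in>lower_covers \<rho>. \<Sum>\<nu>\<in>upper_covers \<kappa>. card (tableaux (Suc n) \<nu>)) = (\<Sum>\<kappa>\<in>lower_covers \<rho>. Suc n * card (tableaux n \<kappa>))"
    using lower_covers_parts[OF Suc.prems] by (intro sum.cong refl Suc.IH) auto
  also have "\<dots> = Suc n * card (tableaux (Suc n) \<rho>)"
    using card_tableaux_Suc[OF \<rho>] by (simp only: sum_distrib_left)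
  finally show ?case by simp
qed

text \<open>One factor of each square is expanded over lower covers. After the sums are exchanged,
  the other factor is summed over upper covers, where the value is known.\<close>

lemma sum_card_tableaux_squares: "(\<Sum>\<mu>\<in>parts_of n. (card (tableaux n \<mu>))\<^sup>2) = fact n"
proof (induction n)
  case 0
  then show ?case by (simp add: parts_of_0)
next
  case (Suc n)
  have p: "is_partition \<mu>" if "\<mu> \<in> parts_of n" for \<mu> n using that by (simp add: parts_of_def)
  have "(\<Sum>\<mu>\<in>parts_of (Suc n). (card (tableaux (Suc n) \<mu>))\<^sup>2) =
      (\<Sum>\<mu>\<in>parts_of (Suc n). \<Sum>\<nu>\<in>lower_covers \<mu>. card (tableaux (Suc n) \<mu>) * card (tableaux n \<nu>))"
    using p by (intro sum.cong refl) (simp add: power2_eq_square sum_distrib_left[symmetric] card_tableaux_Suc[symmetric])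
  also have "\<dots> = (\<Sum>\<nu>\<in>parts_of n. \<Sum>\<mu>\<in>upper_covers \<nu>. card (tableaux (Suc n) \<mu>) * card (tableaux n \<nu>))"
  proof -
    have "(\<Sum>\<mu>\<in>parts_of (Suc n). \<Sum>\<nu>\<in>lower_covers \<mu>. card (tableaux (Suc n) \<mu>) * card (tableaux n \<nu>)) =
        (\<Sum>\<mu>\<in>parts_of (Suc n). \<Sum>\<nu>\<in>{\<nu>\<in>parts_of n. adds_box \<nu> \<mu>}. card (tableaux (Suc n) \<mu>) * card (tableaux n \<nu>))"
      using lower_covers_parts p by (intro sum.cong refl) (auto simp: lower_covers_def)
    also have "\<dots> = (\<Sum>\<nu>\<in>parts_of n. \<Sum>\<mu>\<in>{\<mu>\<in>parts_of (Suc n). adds_box \<nu> \<mu>}. card (tableaux (Suc n) \<mu>) * card (tableaux n \<nu>))"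
      by (rule sum.swap_restrict) auto
    also have "\<dots> = (\<Sum>\<nu>\<in>parts_of n. \<Sum>\<mu>\<in>upper_covers \<nu>. card (tableaux (Suc n) \<mu>) * card (tableaux n \<nu>))"
      using upper_covers_parts p by (intro sum.cong refl) (auto simp: upper_covers_def)
    finally show ?thesis .
  qed
  also have "\<dots> = (\<Sum>\<nu>\<in>parts_of n. Suc n * (card (tableaux n \<nu>))\<^sup>2)"
    by (intro sum.cong refl) (simp only: sum_distrib_right[symmetric] sum_card_tableaux_upper power2_eq_square mult.assoc)
  also have "\<dots> = fact (Suc n)" using Suc by (simp add: sum_distrib_left[symmetric])
  finally show ?case .
qed

lemma ex_tableau: "\<mu> \<in> parts_of n \<Longrightarrow> tableaux n \<mu> \<noteq> {}"
proof (induction n arbitrary: \<mu>)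
  case 0
  then show ?case by (simp add: parts_of_0)
next
  case (Suc n)
  then have \<mu>: "is_partition \<mu>" by (simp add: parts_of_def)
  obtain \<nu> where "\<nu> \<in> lower_covers \<mu>" using ex_lower_cover[OF \<mu>] Suc.prems by (auto simp: parts_of_def)
  then show ?case using Suc.IH[of \<nu>] lower_covers_parts[OF Suc.prems] tableaux_Suc_covers[OF \<mu>, of n] by fastforce
qed

section \<open>Tableaux and lattice walks\<close>

declare tableaux.simps(2) [simp del]

lemma tableau_prefix:
  assumes "c \<in> tableaux (Suc n) \<mu>"
  obtains \<nu> i where "is_partition \<nu>" "is_partition \<mu>" "\<mu> = \<nu>(i := Suc (\<nu> i))"
    "c(Suc n := 0) \<in> tableaux n \<nu>" "c (Suc n) = content \<nu> i"
  by (rule tableaux_SucE[OF assms]) (metis fun_upd_same)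

lemma tableau_extend:
  assumes "c(Suc n := 0) \<in> tableaux n \<nu>" "c (Suc n) = content \<nu> i" "is_partition \<mu>" "\<mu> = \<nu>(i := Suc (\<nu> i))"
  shows "c \<in> tableaux (Suc n) \<mu>"
proof -
  have "c = (c(Suc n := 0))(Suc n := content \<nu> i)" using assms(2) by (simp add: fun_eq_iff)
  then show ?thesis using assms tableauxD(1)[OF assms(1)] unfolding tableaux.simps by blast
qed

lemma content_add_box: "content (\<nu>(i := Suc (\<nu> i))) j = (if j = i then content \<nu> i + 1 else content \<nu> j)"
  by (simp add: content_def)

text \<open>Consecutive boxes in one row have contents differing by one, and consecutive boxes in
  different rows have different contents.\<close>

lemma tableau_adjacent:
  "c \<in> tableaux n \<mu> \<Longrightarrow> 1 \<le> i \<Longrightarrow> Suc i \<le> n \<Longrightarrow> c i \<noteq> c (Suc i)"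
proof (induction n arbitrary: c \<mu>)
  case (Suc n)
  obtain \<nu> j where \<nu>: "is_partition \<nu>" "c(Suc n := 0) \<in> tableaux n \<nu>" "c (Suc n) = content \<nu> j"
    by (rule tableau_prefix[OF Suc.prems(1)])
  show ?case
  proof (cases "Suc i \<le> n")
    case True
    then show ?thesis using Suc.IH[OF \<nu>(2) Suc.prems(2)] by simp
  next
    case False
    then have i: "i = n" using Suc.prems by simp
    obtain m where m: "n = Suc m" using i Suc.prems by (cases n) auto
    obtain \<rho> l where \<rho>: "is_partition \<rho>" "\<nu> = \<rho>(l := Suc (\<rho> l))" "(c(Suc n := 0)) (Suc m) = content \<rho> l"
    proof -
      have "c(Suc n := 0) \<in> tableaux (Suc m) \<nu>" by (subst m[symmetric]) (rule \<nu>(2))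
      then show ?thesis by (rule tableau_prefix) (rule that)
    qed
    have "c n = content \<rho> l" using \<rho>(3) m by simp
    moreover have "content \<rho> l \<noteq> content \<nu> j"
      unfolding \<rho>(2) content_add_box using content_inj[OF \<rho>(1), of l j] by auto
    ultimately show ?thesis using \<nu>(3) i by simp
  qed
qed simp

text \<open>If the first and third content agree, the third box must lie in the row of the second
  one. After it has been added, the rows \<open>j\<close> and \<open>h\<close> of
  \<open>\<mu>\<close> have equal contents, which is impossible for a partition.\<close>

lemma tableau_adjacent2:
  "c \<in> tableaux n \<mu> \<Longrightarrow> 1 \<le> i \<Longrightarrow> Suc (Suc i) \<le> n \<Longrightarrow> c i \<noteq> c (Suc (Suc i))"
proof (induction n arbitrary: c \<mu>)
  case (Suc n)
  obtain \<nu> j where \<nu>: "is_partition \<nu>" "is_partition \<mu>" "\<mu> = \<nu>(j := Suc (\<nu> j))" "c(Suc n := 0) \<in> tableaux n \<nu>" "c (Suc n) = content \<nu> j"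
    by (rule tableau_prefix[OF Suc.prems(1)])
  show ?case
  proof (cases "Suc (Suc i) \<le> n")
    case True
    then show ?thesis using Suc.IH[OF \<nu>(4) Suc.prems(2)] by simp
  next
    case False
    then have n: "n = Suc i" using Suc.prems by simp
    obtain m where m: "i = Suc m" using Suc.prems by (cases i) auto
    let ?c1 = "c(Suc n := 0)"
    obtain \<rho> l where \<rho>: "is_partition \<rho>" "\<nu> = \<rho>(l := Suc (\<rho> l))" "?c1(Suc i := 0) \<in> tableaux i \<rho>" "?c1 (Suc i) = content \<rho> l"
    proof -
      have "?c1 \<in> tableaux (Suc i) \<nu>" by (subst n[symmetric]) (rule \<nu>(4))
      then show ?thesis by (rule tableau_prefix) (rule that)
    qed
    obtain \<kappa> h where \<kappa>: "is_partition \<kappa>" "\<rho> = \<kappa>(h := Suc (\<kappa> h))" "(?c1(Suc i := 0)) (Suc m) = content \<kappa> h"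
    proof -
      have "?c1(Suc i := 0) \<in> tableaux (Suc m) \<rho>" by (subst m[symmetric]) (rule \<rho>(3))
      then show ?thesis by (rule tableau_prefix) (rule that)
    qed
    have ci: "c i = content \<kappa> h" using \<kappa>(3) m n by simp
    have "content \<kappa> h \<noteq> content \<nu> j"
    proof
      assume e: "content \<kappa> h = content \<nu> j"
      have hj: "j \<noteq> h" using e unfolding \<rho>(2) \<kappa>(2) content_add_box by (auto split: if_splits)
      then have "j = l" using e content_inj[OF \<kappa>(1), of h j] unfolding \<rho>(2) \<kappa>(2) content_add_box by (auto split: if_splits)
      then have "content \<mu> j = content \<mu> h"
        using e hj unfolding \<nu>(3) content_add_box[of \<nu> j] by (simp add: \<rho>(2) \<kappa>(2) content_def)
      then show False using content_inj[OF \<nu>(2)] hj by blast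
    qed
    then show ?thesis using ci \<nu>(5) n by simp
  qed
qed simp

text \<open>The only obstruction to adding the box in row \<open>j\<close> before the other one is
  that row \<open>j\<close> lies directly below row \<open>i\<close> and has the same length. The
  two contents then differ by exactly one.\<close>

lemma partition_swap_boxes:
  assumes "is_partition \<nu>" "is_partition (\<nu>(i := Suc (\<nu> i)))" "is_partition ((\<nu>(i := Suc (\<nu> i)))(j := Suc (\<nu> j)))"
    and "i \<noteq> j" "\<bar>content \<nu> i - content \<nu> j\<bar> \<noteq> 1"
  shows "is_partition (\<nu>(j := Suc (\<nu> j)))"
proof -
  have m: "((\<nu>(i := Suc (\<nu> i)))(j := Suc (\<nu> j))) (Suc l) \<le> ((\<nu>(i := Suc (\<nu> i)))(j := Suc (\<nu> j))) l" for l
    using assms(3) unfolding is_partition_Suc by blast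
  have m0: "\<nu> (Suc l) \<le> \<nu> l" for l using assms(1) unfolding is_partition_Suc by blast
  have "(\<nu>(j := Suc (\<nu> j))) (Suc l) \<le> (\<nu>(j := Suc (\<nu> j))) l" for l
  proof (cases "Suc l = j")
    case True
    show ?thesis
    proof (cases "l = i")
      case True
      then have "\<nu> j \<le> \<nu> i" using m[of l] \<open>Suc l = j\<close> assms(4) by auto
      moreover have "\<nu> j \<noteq> \<nu> i" using assms(5) \<open>Suc l = j\<close> True by (auto simp: content_def)
      ultimately show ?thesis using \<open>Suc l = j\<close> True by auto
    next
      case False
      then show ?thesis using m[of l] True by auto
    qed
  next
    case False
    then show ?thesis using m0[of l] by (auto simp: le_SucI)
  qed
  moreover have "finite {l. \<nu> l \<noteq> 0}" using assms(1) unfolding is_partition_def by blast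
  then have "finite {l. (\<nu>(j := Suc (\<nu> j))) l \<noteq> 0}" by (rule finite_support_upd)
  ultimately show ?thesis unfolding is_partition_Suc by blast
qed

text \<open>A swap that avoids the last box acts on the prefix. Otherwise the last two boxes lie in
  different rows and can be added in the opposite order.\<close>

lemma tableau_swap:
  "c \<in> tableaux n \<mu> \<Longrightarrow> 1 \<le> i \<Longrightarrow> Suc i \<le> n \<Longrightarrow> \<bar>c i - c (Suc i)\<bar> \<noteq> 1 \<Longrightarrow> c \<circ> sw i \<in> tableaux n \<mu>"
proof (induction n arbitrary: c \<mu>)
  case (Suc n)
  obtain \<nu> j where \<nu>: "is_partition \<nu>" "is_partition \<mu>" "\<mu> = \<nu>(j := Suc (\<nu> j))" "c(Suc n := 0) \<in> tableaux n \<nu>" "c (Suc n) = content \<nu> j"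
    by (rule tableau_prefix[OF Suc.prems(1)])
  show ?case
  proof (cases "Suc i \<le> n")
    case True
    have "(c \<circ> sw i)(Suc n := 0) = (c(Suc n := 0)) \<circ> sw i" using True by (auto simp: fun_eq_iff sw_apply)
    moreover have "(c(Suc n := 0)) \<circ> sw i \<in> tableaux n \<nu>" by (rule Suc.IH[OF \<nu>(4)]) (use Suc.prems True in auto)
    moreover have "(c \<circ> sw i) (Suc n) = content \<nu> j" using True \<nu>(5) by (simp add: sw_apply)
    ultimately show ?thesis using tableau_extend \<nu> by metis
  next
    case False
    then have n: "n = i" using Suc.prems by simp
    obtain m where m: "i = Suc m" using Suc.prems by (cases i) auto
    let ?c1 = "c(Suc n := 0)"
    obtain \<rho> l where \<rho>: "is_partition \<rho>" "\<nu> = \<rho>(l := Suc (\<rho> l))" "?c1(Suc m := 0) \<in> tableaux m \<rho>" "?c1 (Suc m) = content \<rho> l"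
    proof -
      have "?c1 \<in> tableaux (Suc m) \<nu>" by (subst m[symmetric], subst n[symmetric]) (rule \<nu>(4))
      then show ?thesis by (rule tableau_prefix) (rule that)
    qed
    have ci: "c i = content \<rho> l" using \<rho>(4) n m by simp
    have lj: "l \<noteq> j"
    proof
      assume "l = j"
      then have "c (Suc n) = c i + 1" using ci \<nu>(5) unfolding \<rho>(2) content_add_box by simp
      then show False using Suc.prems n by simp
    qed
    have cj: "content \<nu> j = content \<rho> j" using lj unfolding \<rho>(2) content_add_box by simp
    let ?\<nu> = "\<rho>(j := Suc (\<rho> j))"
    have "\<mu> = (\<rho>(l := Suc (\<rho> l)))(j := Suc (\<rho> j))" using \<nu>(3) \<rho>(2) lj by simp
    then have p: "is_partition ?\<nu>" and \<mu>: "\<mu> = ?\<nu>(l := Suc (?\<nu> l))"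
      using partition_swap_boxes[of \<rho> l j] \<rho>(1,2) \<nu>(1,2) lj ci cj \<nu>(5) Suc.prems(4) n by (auto simp: fun_upd_twist)
    have 1: "(c \<circ> sw i)(Suc n := 0) \<in> tableaux (Suc m) ?\<nu>"
    proof (rule tableau_extend[OF _ _ p refl])
      have "(c \<circ> sw i)(Suc n := 0, Suc m := 0) = ?c1(Suc m := 0)" using n m by (auto simp: fun_eq_iff sw_apply)
      then show "(c \<circ> sw i)(Suc n := 0, Suc m := 0) \<in> tableaux m \<rho>" using \<rho>(3) by simp
      show "((c \<circ> sw i)(Suc n := 0)) (Suc m) = content \<rho> j" using n m \<nu>(5) cj by (simp add: sw_apply)
    qed
    have "(c \<circ> sw i) (Suc n) = content ?\<nu> l" using n ci lj unfolding content_add_box by (simp add: sw_apply)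
    moreover have "(c \<circ> sw i)(Suc n := 0) \<in> tableaux n ?\<nu>" using 1 m n by simp
    ultimately show ?thesis using tableau_extend \<nu>(2) \<mu> by blast
  qed
qed simp

section \<open>Connectedness of the tableaux of one shape under swaps\<close>

definition swaps :: "nat \<Rightarrow> part \<Rightarrow> ((nat \<Rightarrow> int) \<times> (nat \<Rightarrow> int)) set" where
  "swaps n \<mu> = {(c, c \<circ> sw i) | c i. c \<in> tableaux n \<mu> \<and> 1 \<le> i \<and> Suc i \<le> n \<and> \<bar>c i - c (Suc i)\<bar> \<noteq> 1}"

lemma swapsI:
  "c \<in> tableaux n \<mu> \<Longrightarrow> 1 \<le> i \<Longrightarrow> Suc i \<le> n \<Longrightarrow> \<bar>c i - c (Suc i)\<bar> \<noteq> 1 \<Longrightarrow> c' = c \<circ> sw i \<Longrightarrow> (c, c') \<in> swaps n \<mu>"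
  unfolding swaps_def by blast

lemma swaps_lift:
  assumes "(a, b) \<in> (swaps n \<nu>)\<^sup>*" "is_partition \<mu>" "\<mu> = \<nu>(i := Suc (\<nu> i))"
  shows "(a(Suc n := content \<nu> i), b(Suc n := content \<nu> i)) \<in> (swaps (Suc n) \<mu>)\<^sup>*"
  using assms(1)
proof (induction rule: rtrancl_induct)
  case (step b d)
  then obtain j where j: "d = b \<circ> sw j" "b \<in> tableaux n \<nu>" "1 \<le> j" "Suc j \<le> n" "\<bar>b j - b (Suc j)\<bar> \<noteq> 1"
    unfolding swaps_def by blast
  let ?b = "b(Suc n := content \<nu> i)"
  have "d(Suc n := content \<nu> i) = ?b \<circ> sw j" using j(1,3,4) by (intro ext) (simp add: sw_apply)
  moreover have "?b \<in> tableaux (Suc n) \<mu>"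
    using j assms tableauxD(1)[OF j(2)] unfolding tableaux.simps by blast
  moreover have "\<bar>?b j - ?b (Suc j)\<bar> \<noteq> 1" using j by simp
  ultimately have "(?b, d(Suc n := content \<nu> i)) \<in> swaps (Suc n) \<mu>" using j(3,4) by (intro swapsI[of _ _ _ j]) simp_all
  then show ?case using step.IH by (rule rtrancl_into_rtrancl[rotated])
qed simp

text \<open>If the last boxes coincide, induction connects the prefixes. Otherwise a tableau of the
  meet of the two smaller shapes is extended by the two missing boxes in both orders. The results
  differ by one swap and are connected to \<open>c\<close> and \<open>c'\<close> by
  induction.\<close>

lemma swaps_connected:
  "c \<in> tableaux n \<mu> \<Longrightarrow> c' \<in> tableaux n \<mu> \<Longrightarrow> (c, c') \<in> (swaps n \<mu>)\<^sup>*"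
proof (induction n arbitrary: c c' \<mu>)
  case 0
  then show ?case by (auto split: if_splits)
next
  case (Suc n)
  obtain d \<nu> i where 1: "c = d(Suc n := content \<nu> i)" "is_partition \<nu>" "is_partition \<mu>" "\<mu> = \<nu>(i := Suc (\<nu> i))" "d \<in> tableaux n \<nu>"
    by (rule tableaux_SucE[OF Suc.prems(1)])
  obtain d' \<nu>' i' where 2: "c' = d'(Suc n := content \<nu>' i')" "is_partition \<nu>'" "\<mu> = \<nu>'(i' := Suc (\<nu>' i'))" "d' \<in> tableaux n \<nu>'"
    by (rule tableaux_SucE[OF Suc.prems(2)])
  show ?case
  proof (cases "\<nu> = \<nu>'")
    case True
    then have "i = i'" using 1(4) 2(3) by (metis fun_upd_apply n_not_Suc_n)
    then show ?thesis using swaps_lift[OF Suc.IH[OF 1(5)] 1(3,4)] 2 1 True by blast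
  next
    case False
    have ab: "adds_box \<nu> \<mu>" "adds_box \<nu>' \<mu>" unfolding adds_box_def using 1(4) 2(3) by blast+
    let ?\<kappa> = "meet \<nu> \<nu>'"
    have e: "(\<nu>(i := Suc (\<nu> i))) l = (\<nu>'(i' := Suc (\<nu>' i'))) l" for l using 1(4) 2(3) by metis
    have ii: "i \<noteq> i'"
    proof
      assume "i = i'"
      have "\<nu> l = \<nu>' l" for l using e[of l] \<open>i = i'\<close> by (simp split: if_splits)
      then show False using False by blast
    qed
    have ei: "\<nu>' i = Suc (\<nu> i)" and ej: "\<nu> i' = Suc (\<nu>' i')" using e[of i] e[of i'] ii by auto
    have el: "\<nu>' l = \<nu> l" if "l \<noteq> i" "l \<noteq> i'" for l using e[of l] that by simp
    have k: "?\<kappa> l = (if l = i then \<nu> i else if l = i' then \<nu>' i' else \<nu> l)" for l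
      using ei ej el[of l] by (auto simp: meet_def)
    have \<kappa>\<nu>: "\<nu> = ?\<kappa>(i' := Suc (?\<kappa> i'))" "\<nu>' = ?\<kappa>(i := Suc (?\<kappa> i))"
      using k ei ej el ii by (auto simp: fun_eq_iff)
    have \<kappa>: "is_partition ?\<kappa>" using is_partition_meet 1(2) 2(2) by blast
    have sz: "psize \<nu> = n" using tableauxD(2)[OF 1(5)] .
    then have "psize ?\<kappa> = n - 1" "n \<noteq> 0" using psize_add_box[OF \<kappa>, of i'] \<kappa>\<nu>(1) by simp_all
    then obtain m where m: "n = Suc m" by (cases n) auto
    then have "?\<kappa> \<in> parts_of m" using \<open>psize ?\<kappa> = n - 1\<close> \<kappa> by (simp add: parts_of_def)
    then obtain t where t: "t \<in> tableaux m ?\<kappa>" using ex_tableau by blast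
    define u where "u = t(n := content ?\<kappa> i')"
    define u' where "u' = t(n := content ?\<kappa> i)"
    have u: "u \<in> tableaux n \<nu>" and u': "u' \<in> tableaux n \<nu>'"
      unfolding u_def u'_def m tableaux.simps using \<kappa> 1(2) 2(2) \<kappa>\<nu> t by blast+
    let ?x = "content \<nu> i" and ?x' = "content \<nu>' i'"
    have cx: "?x = content ?\<kappa> i" "?x' = content ?\<kappa> i'" using k ii by (simp_all add: content_def)
    have p1: "(c, u(Suc n := ?x)) \<in> (swaps (Suc n) \<mu>)\<^sup>*" using swaps_lift[OF Suc.IH[OF 1(5) u] 1(3,4)] 1(1) by simp
    have p2: "(u'(Suc n := ?x'), c') \<in> (swaps (Suc n) \<mu>)\<^sup>*" using swaps_lift[OF Suc.IH[OF u' 2(4)] 1(3) 2(3)] 2(1) by simp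
    \<comment> \<open>Both boxes can be removed from \<open>\<mu>\<close>, so they are not adjacent.
      Comparing contents in the shape that already contains the box of the lower row gives a gap of
      at least two.\<close>
    have gap: "\<bar>content ?\<kappa> i' - content ?\<kappa> i\<bar> \<noteq> 1"
    proof (cases "i < i'")
      case True
      then have "content \<nu> i' < content \<nu> i" by (rule content_less[OF 1(2)])
      then show ?thesis using cx(1) ej k ii by (simp add: content_def)
    next
      case False
      then have "content \<nu>' i < content \<nu>' i'" using ii by (intro content_less[OF 2(2)]) simp
      then show ?thesis using cx(2) ei k ii by (simp add: content_def)
    qed
    have tn: "t n = 0" "t (Suc n) = 0" using tableauxD(3)[OF t] m by simp_all
    have "u'(Suc n := ?x') = u(Suc n := ?x) \<circ> sw n"
      using cx by (auto simp: fun_eq_iff sw_apply u_def u'_def)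
    moreover have "u(Suc n := ?x) \<in> tableaux (Suc n) \<mu>" using 1 u unfolding tableaux.simps by blast
    moreover have "\<bar>(u(Suc n := ?x)) n - (u(Suc n := ?x)) (Suc n)\<bar> \<noteq> 1" using gap cx by (simp add: u_def)
    ultimately have "(u(Suc n := ?x), u'(Suc n := ?x')) \<in> swaps (Suc n) \<mu>"
      using m by (intro swapsI[of _ _ _ n]) simp_all
    then show ?thesis using p1 p2 by (meson rtrancl.rtrancl_into_rtrancl rtrancl_trans)
  qed
qed

section \<open>The content system formed by all tableaux of one size\<close>

definition all_tableaux :: "nat \<Rightarrow> (nat \<Rightarrow> int) set" where
  "all_tableaux n = (\<Union>\<mu>\<in>parts_of n. tableaux n \<mu>)"

definition shape :: "nat \<Rightarrow> (nat \<Rightarrow> int) \<Rightarrow> part" where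
  "shape n c = (THE \<mu>. c \<in> tableaux n \<mu>)"

lemma shape_eq: "c \<in> tableaux n \<mu> \<Longrightarrow> shape n c = \<mu>"
  unfolding shape_def using tableaux_shape_unique by blast

lemma all_tableaux_iff: "c \<in> all_tableaux n \<longleftrightarrow> c \<in> tableaux n (shape n c)"
proof
  assume "c \<in> all_tableaux n"
  then obtain \<mu> where "c \<in> tableaux n \<mu>" by (auto simp: all_tableaux_def)
  then show "c \<in> tableaux n (shape n c)" by (simp add: shape_eq)
next
  assume c: "c \<in> tableaux n (shape n c)"
  then have "shape n c \<in> parts_of n" using tableauxD(1,2)[OF c] by (simp add: parts_of_def)
  then show "c \<in> all_tableaux n" using c by (auto simp: all_tableaux_def)
qed

lemma shape_parts: "c \<in> all_tableaux n \<Longrightarrow> shape n c \<in> parts_of n"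
  using all_tableaux_iff tableauxD(1,2) by (auto simp: parts_of_def)

lemma tableaux_eq: "\<mu> \<in> parts_of n \<Longrightarrow> tableaux n \<mu> = {c \<in> all_tableaux n. shape n c = \<mu>}"
  using all_tableaux_iff shape_eq by (auto simp: all_tableaux_def)

lemma first_content: "c \<in> tableaux n \<mu> \<Longrightarrow> 1 \<le> n \<Longrightarrow> c 1 = 0"
proof (induction n arbitrary: c \<mu>)
  case (Suc n)
  obtain \<nu> i where \<nu>: "is_partition \<nu>" "is_partition \<mu>" "\<mu> = \<nu>(i := Suc (\<nu> i))" "c(Suc n := 0) \<in> tableaux n \<nu>" "c (Suc n) = content \<nu> i"
    by (rule tableau_prefix[OF Suc.prems(1)])
  show ?case
  proof (cases "n = 0")
    case True
    then have \<nu>0: "\<nu> = empty_partition" using \<nu>(4) by (auto split: if_splits)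
    have "i = 0"
    proof (rule ccontr)
      assume "i \<noteq> 0"
      then have "\<mu> i \<le> \<mu> 0" "\<mu> 0 = 0" "\<mu> i = 1"
        using is_partition_antimono[OF \<nu>(2), of 0 i] \<nu>0 \<nu>(3) by (auto simp: empty_partition_def)
      then show False by simp
    qed
    then show ?thesis using \<nu>(5) \<nu>0 True by (simp add: content_def empty_partition_def)
  next
    case False
    then show ?thesis using Suc.IH[OF \<nu>(4)] by simp
  qed
qed simp

lemma content_system_tableaux: "content_system r (all_tableaux r) (shape r)"
proof
  show "finite (all_tableaux r)" by (simp add: all_tableaux_def)
next
  fix c assume c: "c \<in> all_tableaux r"
  then have t: "c \<in> tableaux r (shape r c)" by (simp add: all_tableaux_iff)
  show "c 1 = 0" if "1 \<le> r" using first_content[OF t that] .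
  show "c j = 0" if "j \<notin> {1..r}" for j using tableauxD(3)[OF t that] .
  show "c i \<noteq> c (Suc i)" if "1 \<le> i" "Suc i \<le> r" for i using tableau_adjacent[OF t that] .
  show "c i \<noteq> c (Suc (Suc i))" if "1 \<le> i" "Suc (Suc i) \<le> r" for i using tableau_adjacent2[OF t that] .
  show "c \<circ> sw i \<in> all_tableaux r \<and> shape r (c \<circ> sw i) = shape r c"
    if "1 \<le> i" "Suc i \<le> r" "\<bar>c i - c (Suc i)\<bar> \<noteq> 1" for i
    using tableau_swap[OF t that] shape_eq all_tableaux_iff by metis
  fix c' assume c': "c' \<in> all_tableaux r" "shape r c = shape r c'"
  then have t': "c' \<in> tableaux r (shape r c)" by (simp add: all_tableaux_iff)
  have "swaps r (shape r c) \<subseteq> {(c, c \<circ> sw i) | c i. c \<in> all_tableaux r \<and> 1 \<le> i \<and> Suc i \<le> r \<and> \<bar>c i - c (Suc i)\<bar> \<noteq> 1}"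
    unfolding swaps_def using tableaux_eq[OF shape_parts[OF c]] by auto
  then show "(c, c') \<in> {(c, c \<circ> sw i) | c i. c \<in> all_tableaux r \<and> 1 \<le> i \<and> Suc i \<le> r \<and> \<bar>c i - c (Suc i)\<bar> \<noteq> 1}\<^sup>*"
    using swaps_connected[OF t t'] rtrancl_mono by blast
next
  have "{(c, c'). c \<in> all_tableaux r \<and> c' \<in> all_tableaux r \<and> shape r c = shape r c'} =
      (\<Union>\<mu>\<in>parts_of r. tableaux r \<mu> \<times> tableaux r \<mu>)"
    using shape_parts by (auto simp: tableaux_eq)
  also have "card \<dots> = (\<Sum>\<mu>\<in>parts_of r. card (tableaux r \<mu> \<times> tableaux r \<mu>))"
    by (intro card_UN_disjoint) (use tableaux_shape_unique in \<open>auto simp: disjoint_iff\<close>)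
  also have "\<dots> = fact r" using sum_card_tableaux_squares[of r] by (simp add: card_cartesian_product power2_eq_square)
  finally show "card {(c, c'). c \<in> all_tableaux r \<and> c' \<in> all_tableaux r \<and> shape r c = shape r c'} = fact r" .
qed

text \<open>\<open>defects n r\<close> counts the partial matchings of \<open>n + r\<close> vertices in which \<open>r\<close> given vertices are
  matched to the other \<open>n\<close>.\<close>

primrec defects :: "nat \<Rightarrow> nat \<Rightarrow> nat" where
  "defects 0 r = (if r = 0 then 1 else 0)"
| "defects (Suc n) r = defects n r + r * defects n (r - 1) + defects n (Suc r)"

section \<open>Gluing partial matchings along through strands\<close>

lemma defects_zero: "n < r \<Longrightarrow> defects n r = 0"
  by (induction n arbitrary: r) auto

text \<open>Counts the partial matchings of \<open>k + l\<close> vertices by the number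
  \<open>r\<close> of edges between the two groups; the \<open>r!\<close> labellings of these edges
  are divided out. The proof moves one vertex at a time from the first group to the second: with the
  weights \<open>1 / r!\<close> the two shifting terms of the recursion are adjoint to each
  other.\<close>

lemma sum_defects:
  assumes "k + l \<le> N"
  shows "(\<Sum>r\<le>N. real (defects k r) * real (defects l r) / fact r) = real (defects (k + l) 0)"
  using assms
proof (induction k arbitrary: l)
  case 0
  have "(\<Sum>r\<le>N. real (defects 0 r) * real (defects l r) / fact r) = (\<Sum>r\<le>N. if r = 0 then real (defects l 0) else 0)"
    by (intro sum.cong) auto
  then show ?case by simp
next
  case (Suc k)
  define E where "E a b = (\<Sum>r\<le>N. real (r * defects a (r - 1)) * real (defects b r) / fact r)" for a b
  define G where "G a b = (\<Sum>r\<le>N. real (defects a (Suc r)) * real (defects b r) / fact r)" for a b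
  \<comment> \<open>Shifting the index and cancelling \<open>r\<close> against \<open>r!\<close>
    exchanges the two terms; the boundary term vanishes because \<open>b \<le> N\<close>.\<close>
  have EG: "E a b = G b a" if "b \<le> N" for a b
  proof -
    have "E a b = (\<Sum>r\<in>{1..N}. real (r * defects a (r - 1)) * real (defects b r) / fact r)"
      unfolding E_def by (intro sum.mono_neutral_right) (auto simp: not_less_eq_eq)
    also have "\<dots> = (\<Sum>r\<in>{..<N}. real (defects b (Suc r)) * real (defects a r) / fact r)"
      by (rule sum.reindex_bij_witness[of _ Suc "\<lambda>r. r - 1"]) (auto simp: field_simps fact_reduce)
    also have "\<dots> = G b a" unfolding G_def using that defects_zero[of b "Suc N"]
      by (intro sum.mono_neutral_left) (auto simp: not_less)
    finally show ?thesis .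
  qed
  have pt: "real (defects (Suc a) r) * real (defects b r) / fact r = real (defects a r) * real (defects b r) / fact r +
      real (r * defects a (r - 1)) * real (defects b r) / fact r + real (defects a (Suc r)) * real (defects b r) / fact r" for a b r
    by (simp add: add_divide_distrib distrib_right)
  have comm: "real (defects a r) * real (defects b r) / fact r = real (defects b r) * real (defects a r) / fact r" for a b r
    by (simp add: mult.commute)
  have step: "(\<Sum>r\<le>N. real (defects (Suc a) r) * real (defects b r) / fact r) =
      (\<Sum>r\<le>N. real (defects a r) * real (defects b r) / fact r) + E a b + G a b" for a b
    by (simp only: pt sum.distrib E_def G_def)
  have "(\<Sum>r\<le>N. real (defects (Suc k) r) * real (defects l r) / fact r) =
      (\<Sum>r\<le>N. real (defects k r) * real (defects l r) / fact r) + E k l + G k l"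
    by (rule step)
  also have "\<dots> = (\<Sum>r\<le>N. real (defects l r) * real (defects k r) / fact r) + E l k + G l k"
    using EG[of l k] EG[of k l] Suc.prems by (simp add: comm[of k _ l])
  also have "\<dots> = (\<Sum>r\<le>N. real (defects (Suc l) r) * real (defects k r) / fact r)" by (rule step[symmetric])
  also have "\<dots> = (\<Sum>r\<le>N. real (defects k r) * real (defects (Suc l) r) / fact r)" by (simp only: comm[of k _ "Suc l"])
  also have "\<dots> = real (defects (Suc k + l) 0)" using Suc.IH[of "Suc l"] Suc.prems by simp
  finally show ?case .
qed

section \<open>Counting lattice walks\<close>

lemma num_walks_0: "num_walks 0 \<mu> = (if \<mu> = empty_partition then 1 else 0)"
proof -
  have "walks 0 \<mu> = (if \<mu> = empty_partition then {[empty_partition]} else {})"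
    by (auto simp: walks_def length_Suc_conv empty_partition_parts)
  then show ?thesis by (simp add: num_walks_def)
qed

lemma walks_Suc:
  assumes \<mu>: "is_partition \<mu>"
  shows "walks (Suc k) \<mu> = (\<Union>\<nu>\<in>{\<mu>} \<union> lower_covers \<mu> \<union> upper_covers \<mu>. (\<lambda>ps. ps @ [\<mu>]) ` walks k \<nu>)"
proof
  show "walks (Suc k) \<mu> \<subseteq> (\<Union>\<nu>\<in>{\<mu>} \<union> lower_covers \<mu> \<union> upper_covers \<mu>. (\<lambda>ps. ps @ [\<mu>]) ` walks k \<nu>)"
  proof
    fix ps assume ps: "ps \<in> walks (Suc k) \<mu>"
    then have len: "length ps = Suc (Suc k)" by (simp add: walks_def)
    then obtain qs where qs: "ps = qs @ [ps ! Suc k]" "length qs = Suc k"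
      by (metis append_butlast_last_id diff_Suc_1 last_conv_nth length_butlast list.size(3) nat.distinct(1))
    define \<nu> where "\<nu> = ps ! k"
    have nth: "ps ! i = qs ! i" if "i \<le> k" for i using qs that by (metis le_imp_less_Suc nth_append)
    have last: "ps ! Suc k = \<mu>" using ps by (simp add: walks_def)
    have p: "\<forall>\<mu>\<in>set qs. is_partition \<mu>" using ps qs(1) unfolding walks_def by (metis (no_types, lifting) Un_iff mem_Collect_eq set_append)
    have st: "ps ! Suc i = ps ! i \<or> adds_box (ps ! i) (ps ! Suc i) \<or> adds_box (ps ! Suc i) (ps ! i)" if "i < Suc k" for i
      using ps that by (simp add: walks_def)
    have "qs \<in> walks k \<nu>" unfolding walks_def
    proof (intro CollectI conjI allI impI)
      show "qs ! 0 = empty_partition" using ps nth[of 0] by (simp add: walks_def)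
      show "qs ! k = \<nu>" using nth[of k] by (simp add: \<nu>_def)
      fix i assume "i < k"
      then show "qs ! Suc i = qs ! i \<or> adds_box (qs ! i) (qs ! Suc i) \<or> adds_box (qs ! Suc i) (qs ! i)"
        using st[of i] nth[of i] nth[of "Suc i"] by simp
    qed (use p qs in auto)
    moreover have "is_partition \<nu>" using p nth[of k] qs(2) by (simp add: \<nu>_def)
    then have "\<nu> \<in> {\<mu>} \<union> lower_covers \<mu> \<union> upper_covers \<mu>"
      using st[of k] last by (auto simp: \<nu>_def lower_covers_def upper_covers_def)
    ultimately show "ps \<in> (\<Union>\<nu>\<in>{\<mu>} \<union> lower_covers \<mu> \<union> upper_covers \<mu>. (\<lambda>ps. ps @ [\<mu>]) ` walks k \<nu>)"
      using qs(1) last by auto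
  qed
  show "(\<Union>\<nu>\<in>{\<mu>} \<union> lower_covers \<mu> \<union> upper_covers \<mu>. (\<lambda>ps. ps @ [\<mu>]) ` walks k \<nu>) \<subseteq> walks (Suc k) \<mu>"
  proof
    fix ps assume "ps \<in> (\<Union>\<nu>\<in>{\<mu>} \<union> lower_covers \<mu> \<union> upper_covers \<mu>. (\<lambda>ps. ps @ [\<mu>]) ` walks k \<nu>)"
    then obtain \<nu> qs where \<nu>: "\<nu> \<in> {\<mu>} \<union> lower_covers \<mu> \<union> upper_covers \<mu>" "qs \<in> walks k \<nu>" "ps = qs @ [\<mu>]" by blast
    have len: "length qs = Suc k" using \<nu>(2) by (simp add: walks_def)
    have nth: "ps ! i = (if i \<le> k then qs ! i else \<mu>)" if "i \<le> Suc k" for i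
      using that len \<nu>(3) by (auto simp: nth_append)
    show "ps \<in> walks (Suc k) \<mu>" unfolding walks_def
    proof (intro CollectI conjI allI impI)
      fix i assume "i < Suc k"
      then consider "i < k" | "i = k" by linarith
      then show "ps ! Suc i = ps ! i \<or> adds_box (ps ! i) (ps ! Suc i) \<or> adds_box (ps ! Suc i) (ps ! i)"
      proof cases
        case 1
        then show ?thesis using nth[of i] nth[of "Suc i"] \<nu>(2) by (simp add: walks_def)
      next
        case 2
        have "ps ! i = \<nu>" "ps ! Suc i = \<mu>" using nth[of i] nth[of "Suc i"] \<nu>(2) 2 by (simp_all add: walks_def)
        then show ?thesis using \<nu>(1) by (auto simp: lower_covers_def upper_covers_def)
      qed
    qed (use \<nu> len nth \<mu> in \<open>auto simp: walks_def\<close>)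
  qed
qed

lemma finite_walks:
  assumes "is_partition \<mu>"
  shows "finite (walks k \<mu>)"
  using assms
proof (induction k arbitrary: \<mu>)
  case 0
  have "walks 0 \<mu> \<subseteq> {[empty_partition]}" by (auto simp: walks_def length_Suc_conv)
  then show ?case by (rule finite_subset) simp
next
  case (Suc k)
  then show ?case unfolding walks_Suc[OF Suc.prems]
    using card_lower_covers(1)[OF Suc.prems] card_upper_covers(1)[OF Suc.prems]
    by (auto simp: lower_covers_def upper_covers_def)
qed

lemma num_walks_Suc:
  assumes \<mu>: "is_partition \<mu>"
  shows "num_walks (Suc k) \<mu> = num_walks k \<mu> + (\<Sum>\<nu>\<in>lower_covers \<mu>. num_walks k \<nu>) + (\<Sum>\<nu>\<in>upper_covers \<mu>. num_walks k \<nu>)"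
proof -
  let ?C = "{\<mu>} \<union> lower_covers \<mu> \<union> upper_covers \<mu>"
  have fin: "finite (lower_covers \<mu>)" "finite (upper_covers \<mu>)" using card_lower_covers card_upper_covers \<mu> by auto
  have sz: "psize \<mu> = Suc (psize \<nu>)" if "\<nu> \<in> lower_covers \<mu>" for \<nu>
    using that psize_adds_box by (auto simp: lower_covers_def)
  have sz': "psize \<nu> = Suc (psize \<mu>)" if "\<nu> \<in> upper_covers \<mu>" for \<nu>
    using that psize_adds_box \<mu> by (auto simp: upper_covers_def)
  have p: "is_partition \<nu>" if "\<nu> \<in> ?C" for \<nu> using that \<mu> by (auto simp: upper_covers_def lower_covers_def)
  have "num_walks (Suc k) \<mu> = (\<Sum>\<nu>\<in>?C. card ((\<lambda>ps. ps @ [\<mu>]) ` walks k \<nu>))"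
    unfolding num_walks_def walks_Suc[OF \<mu>]
  proof (rule card_UN_disjoint)
    show "\<forall>i\<in>?C. \<forall>j\<in>?C. i \<noteq> j \<longrightarrow> (\<lambda>ps. ps @ [\<mu>]) ` walks k i \<inter> (\<lambda>ps. ps @ [\<mu>]) ` walks k j = {}"
      by (auto simp: walks_def)
  qed (use fin p finite_walks in auto)
  also have "\<dots> = (\<Sum>\<nu>\<in>?C. num_walks k \<nu>)"
    by (intro sum.cong refl) (simp add: card_image num_walks_def inj_on_def)
  also have "\<dots> = num_walks k \<mu> + (\<Sum>\<nu>\<in>lower_covers \<mu>. num_walks k \<nu>) + (\<Sum>\<nu>\<in>upper_covers \<mu>. num_walks k \<nu>)"
  proof -
    have "\<mu> \<notin> lower_covers \<mu>" "\<mu> \<notin> upper_covers \<mu>" using sz[of \<mu>] sz'[of \<mu>] by auto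
    moreover have "lower_covers \<mu> \<inter> upper_covers \<mu> = {}"
    proof (rule equals0I)
      fix \<nu> assume "\<nu> \<in> lower_covers \<mu> \<inter> upper_covers \<mu>"
      then show False using sz[of \<nu>] sz'[of \<nu>] by simp
    qed
    ultimately show ?thesis using fin by (subst sum.union_disjoint; auto)
  qed
  finally show ?thesis .
qed

text \<open>Induction over the last step. Tableau numbers add up over the lower covers of
  \<open>\<mu>\<close> to the number for \<open>\<mu>\<close>, and over its upper covers to
  \<open>Suc r\<close> times that number. The factor \<open>fact r\<close> absorbs the change of
  size, which leaves the recursion of \<open>defects\<close>.\<close>

theorem num_walks_formula:
  "\<mu> \<in> parts_of r \<Longrightarrow> fact r * num_walks k \<mu> = defects k r * card (tableaux r \<mu>)"
proof (induction k arbitrary: r \<mu>)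
  case 0
  then have "r = 0 \<longleftrightarrow> \<mu> = empty_partition" using psize_zero_iff[of \<mu>] by (auto simp: parts_of_def)
  then show ?case by (auto simp: num_walks_0)
next
  case (Suc k)
  then have \<mu>: "is_partition \<mu>" by (simp add: parts_of_def)
  have "fact r * (\<Sum>\<nu>\<in>lower_covers \<mu>. num_walks k \<nu>) = r * defects k (r - 1) * card (tableaux r \<mu>)"
  proof (cases r)
    case 0
    then show ?thesis using lower_covers_empty Suc.prems by simp
  next
    case (Suc s)
    have "fact r * (\<Sum>\<nu>\<in>lower_covers \<mu>. num_walks k \<nu>) = r * (\<Sum>\<nu>\<in>lower_covers \<mu>. fact s * num_walks k \<nu>)"
      by (simp only: Suc fact_Suc of_nat_id sum_distrib_left mult.assoc)
    also have "(\<Sum>\<nu>\<in>lower_covers \<mu>. fact s * num_walks k \<nu>) = (\<Sum>\<nu>\<in>lower_covers \<mu>. defects k s * card (tableaux s \<nu>))"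
      using lower_covers_parts[of \<mu> s] Suc Suc.prems by (intro sum.cong refl Suc.IH) auto
    also have "\<dots> = defects k s * card (tableaux r \<mu>)"
      unfolding Suc card_tableaux_Suc[OF \<mu>] by (simp add: sum_distrib_left)
    finally show ?thesis by (simp add: Suc algebra_simps)
  qed
  moreover have "fact r * (\<Sum>\<nu>\<in>upper_covers \<mu>. num_walks k \<nu>) = defects k (Suc r) * card (tableaux r \<mu>)"
  proof -
    have "Suc r * (fact r * (\<Sum>\<nu>\<in>upper_covers \<mu>. num_walks k \<nu>)) = (\<Sum>\<nu>\<in>upper_covers \<mu>. fact (Suc r) * num_walks k \<nu>)"
      by (simp only: fact_Suc of_nat_id sum_distrib_left mult.assoc)
    also have "\<dots> = (\<Sum>\<nu>\<in>upper_covers \<mu>. defects k (Suc r) * card (tableaux (Suc r) \<nu>))"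
      using upper_covers_parts[OF Suc.prems] by (intro sum.cong refl Suc.IH) auto
    also have "\<dots> = defects k (Suc r) * (\<Sum>\<nu>\<in>upper_covers \<mu>. card (tableaux (Suc r) \<nu>))"
      by (rule sum_distrib_left[symmetric])
    also have "\<dots> = Suc r * (defects k (Suc r) * card (tableaux r \<mu>))"
      unfolding sum_card_tableaux_upper[OF Suc.prems] by (rule mult.left_commute)
    finally show ?thesis by (metis mult_left_cancel nat.distinct(1))
  qed
  moreover have "fact r * num_walks k \<mu> = defects k r * card (tableaux r \<mu>)" using Suc by simp
  ultimately show ?case by (simp add: num_walks_Suc[OF \<mu>] distrib_left distrib_right)
qed

section \<open>Half diagrams\<close>

text \<open>\<open>V\<close> carries the actual vertices, while \<open>W\<close> labels the through
  strands. As every label is matched into \<open>V\<close>, no edge joins two labels.\<close>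

definition through_matchings :: "'a set \<Rightarrow> 'a set \<Rightarrow> 'a set set set" where
  "through_matchings V W = {m \<in> matchings (V \<union> W). \<forall>w\<in>W. \<exists>v\<in>V. {v, w} \<in> m}"

lemma finite_matchings: "finite V \<Longrightarrow> finite (matchings V)"
  by (rule finite_subset[of _ "Pow (Pow V)"]) (auto simp: matchings_def)

lemma matchings_insert_edge:
  assumes "m \<in> matchings V" "u \<notin> V" "v \<notin> V" "u \<noteq> v"
  shows "insert {u, v} m \<in> matchings (insert u (insert v V))"
proof -
  have "\<Union>m \<subseteq> V" using matchings_subset assms(1) .
  then have "e \<inter> {u, v} = {}" "{u, v} \<inter> e = {}" if "e \<in> m" for e using assms(2,3) that by blast+
  then show ?thesis using assms unfolding matchings_def by (auto simp: subset_insertI2)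
qed

lemma matchings_remove_edge:
  assumes "m \<in> matchings V" "{u, v} \<in> m"
  shows "m - {{u, v}} \<in> matchings (V - {u, v})"
proof -
  have D: "e \<inter> e' = {}" if "e \<in> m" "e' \<in> m" "e \<noteq> e'" for e e'
    using assms(1) that by (simp add: matchings_def)
  have S: "e \<subseteq> V" "card e = 2" if "e \<in> m" for e using assms(1) that by (simp_all add: matchings_def)
  have "e \<subseteq> V - {u, v}" if "e \<in> m - {{u, v}}" for e
    using D[of e "{u, v}"] S(1)[of e] assms(2) that by blast
  then show ?thesis unfolding matchings_def using D S(2) by simp
qed

text \<open>The new vertex is isolated, joined to an old vertex, or joined to a label. In the second
  case it behaves like one more label, because its partner lies in \<open>V\<close>; in the third
  its edge is removed together with the label.\<close>

lemma through_matchings_split: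
  assumes v: "v \<notin> V" "v \<notin> W" and VW: "V \<inter> W = {}"
  shows "through_matchings (insert v V) W = through_matchings V W \<union> through_matchings V (insert v W) \<union>
     (\<Union>w\<in>W. insert {v, w} ` through_matchings V (W - {w}))"
proof
  show "through_matchings (insert v V) W \<subseteq> through_matchings V W \<union> through_matchings V (insert v W) \<union>
     (\<Union>w\<in>W. insert {v, w} ` through_matchings V (W - {w}))"
  proof
    fix m assume "m \<in> through_matchings (insert v V) W"
    then have m: "m \<in> matchings (insert v (V \<union> W))" "\<And>w. w \<in> W \<Longrightarrow> \<exists>u\<in>insert v V. {u, w} \<in> m"
      by (auto simp: through_matchings_def)
    show "m \<in> through_matchings V W \<union> through_matchings V (insert v W) \<union>
        (\<Union>w\<in>W. insert {v, w} ` through_matchings V (W - {w}))"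
    proof (cases "v \<in> \<Union>m")
      case False
      then have "m \<in> matchings (V \<union> W)" using matchings_mono[OF m(1)] matchings_subset[OF m(1)] by blast
      moreover have "\<exists>u\<in>V. {u, w} \<in> m" if "w \<in> W" for w using m(2)[OF that] False by blast
      ultimately show ?thesis by (auto simp: through_matchings_def)
    next
      case True
      then obtain u where u: "{v, u} \<in> m" "u \<noteq> v" by (rule matching_vertexE[OF m(1)])
      then have "u \<in> V \<union> W" using matchings_subset[OF m(1)] by blast
      then show ?thesis
      proof
        assume uV: "u \<in> V"
        have "\<exists>u'\<in>V. {u', w} \<in> m" if "w \<in> insert v W" for w
        proof (cases "w = v")
          case True
          then show ?thesis using uV u by (auto simp: insert_commute)
        next
          case False
          then have w: "w \<in> W" using that by simp
          then obtain u' where u': "u' \<in> insert v V" "{u', w} \<in> m" using m(2) by blast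
          have "u' \<noteq> v" using matching_partner[OF m(1) u(1), of w] u'(2) w uV VW by blast
          then show ?thesis using u' by blast
        qed
        then have "m \<in> through_matchings V (insert v W)" using m(1) by (simp add: through_matchings_def)
        then show ?thesis by blast
      next
        assume uW: "u \<in> W"
        let ?m = "m - {{v, u}}"
        have "?m \<in> matchings (insert v (V \<union> W) - {v, u})" by (rule matchings_remove_edge[OF m(1) u(1)])
        moreover have "insert v (V \<union> W) - {v, u} = V \<union> (W - {u})" using v uW VW by blast
        moreover have "\<exists>u'\<in>V. {u', w} \<in> ?m" if w: "w \<in> W - {u}" for w
        proof -
          obtain u' where u': "u' \<in> insert v V" "{u', w} \<in> m" using m(2) w by blast
          have "u' \<noteq> v" using matching_partner[OF m(1) u(1), of w] u'(2) w by blast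
          then show ?thesis using u' w v by (auto simp: doubleton_eq_iff)
        qed
        ultimately have "?m \<in> through_matchings V (W - {u})" by (auto simp: through_matchings_def)
        moreover have "m = insert {v, u} ?m" using u(1) by blast
        ultimately show ?thesis using uW by blast
      qed
    qed
  qed
  show "through_matchings V W \<union> through_matchings V (insert v W) \<union>
     (\<Union>w\<in>W. insert {v, w} ` through_matchings V (W - {w})) \<subseteq> through_matchings (insert v V) W"
  proof (intro Un_least UN_least)
    show "through_matchings V W \<subseteq> through_matchings (insert v V) W"
    proof
      fix m assume "m \<in> through_matchings V W"
      then have m: "m \<in> matchings (V \<union> W)" "\<forall>w\<in>W. \<exists>u\<in>V. {u, w} \<in> m" by (simp_all add: through_matchings_def)
      have "m \<in> matchings (insert v V \<union> W)" using matchings_subset[OF m(1)] by (intro matchings_mono[OF m(1)]) blast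
      then show "m \<in> through_matchings (insert v V) W" using m(2) by (simp add: through_matchings_def)
    qed
    show "through_matchings V (insert v W) \<subseteq> through_matchings (insert v V) W"
      by (auto simp: through_matchings_def)
    fix w assume w: "w \<in> W"
    show "insert {v, w} ` through_matchings V (W - {w}) \<subseteq> through_matchings (insert v V) W"
    proof
      fix m assume "m \<in> insert {v, w} ` through_matchings V (W - {w})"
      then obtain m' where m': "m' \<in> matchings (V \<union> (W - {w}))" "\<forall>x\<in>W - {w}. \<exists>u\<in>V. {u, x} \<in> m'" "m = insert {v, w} m'"
        by (auto simp: through_matchings_def)
      have "m \<in> matchings (insert v (insert w (V \<union> (W - {w}))))"
        unfolding m'(3) using m'(1) v w VW by (intro matchings_insert_edge) auto
      moreover have "insert v (insert w (V \<union> (W - {w}))) = insert v V \<union> W" using w by blast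
      ultimately show "m \<in> through_matchings (insert v V) W"
        using m'(2,3) by (auto simp: through_matchings_def)
    qed
  qed
qed

lemma card_through_matchings:
  assumes "finite V" "finite W" "V \<inter> W = {}"
  shows "card (through_matchings V W) = defects (card V) (card W)"
  using assms
proof (induction V arbitrary: W rule: finite_induct)
  case empty
  show ?case
  proof (cases "W = {}")
    case True
    have "matchings ({} :: 'a set) = {{}}" by (auto simp: matchings_def)
    then have "through_matchings {} W = {{}}" using True by (simp add: through_matchings_def)
    then show ?thesis using True by simp
  next
    case False
    then have e: "through_matchings {} W = {}" by (auto simp: through_matchings_def)
    show ?thesis unfolding e using False empty by simp
  qed
next
  case (insert v V)
  then have v: "v \<notin> V" "v \<notin> W" and VW: "V \<inter> W = {}" by auto
  let ?A = "through_matchings V W" and ?B = "through_matchings V (insert v W)"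
    and ?C = "\<lambda>w. insert {v, w} ` through_matchings V (W - {w})"
  have fin: "finite (through_matchings V W')" if "finite W'" for W'
    using finite_matchings[of "V \<union> W'"] insert that by (auto simp: through_matchings_def)
  have avoid: "v \<notin> \<Union>m" if "m \<in> through_matchings V W'" "v \<notin> W'" for m W'
    using that v matchings_subset[of m "V \<union> W'"] by (auto simp: through_matchings_def)
  have Bv: "\<exists>u\<in>V. {u, v} \<in> m" "m \<in> matchings (V \<union> insert v W)" if "m \<in> ?B" for m using that by (auto simp: through_matchings_def)
  have Cv: "m \<in> matchings (insert v V \<union> W)" "{v, w} \<in> m" if "w \<in> W" "m \<in> ?C w" for m w
  proof -
    have "m \<in> through_matchings (insert v V) W" unfolding through_matchings_split[OF v VW] using that by blast
    then show "m \<in> matchings (insert v V \<union> W)" by (simp add: through_matchings_def)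
    show "{v, w} \<in> m" using that(2) by blast
  qed
  have d1: "?A \<inter> ?B = {}" using avoid[of _ W] Bv(1) v(2) by blast
  have d2: "(?A \<union> ?B) \<inter> (\<Union>w\<in>W. ?C w) = {}"
  proof (rule equals0I)
    fix m assume "m \<in> (?A \<union> ?B) \<inter> (\<Union>w\<in>W. ?C w)"
    then obtain w where w: "w \<in> W" "m \<in> ?C w" and AB: "m \<in> ?A \<union> ?B" by blast
    note c = Cv[OF w]
    have "m \<notin> ?A" using c(2) avoid[of m W] v(2) by blast
    then obtain u where u: "u \<in> V" "{u, v} \<in> m" using AB Bv(1) by blast
    have "u = w" using matching_partner[OF c(1), of v u w] c(2) u(2) by (simp add: insert_commute)
    then show False using u w VW by blast
  qed
  have d3: "?C w \<inter> ?C w' = {}" if "w \<in> W" "w' \<in> W" "w \<noteq> w'" for w w'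
  proof (rule equals0I)
    fix m assume "m \<in> ?C w \<inter> ?C w'"
    then have m: "m \<in> ?C w" "m \<in> ?C w'" by simp_all
    have "w = w'"
      by (rule matching_partner[OF Cv(1)[OF that(1) m(1)] Cv(2)[OF that(1) m(1)] Cv(2)[OF that(2) m(2)]])
    then show False using that(3) by simp
  qed
  have cC: "card (?C w) = defects (card V) (card W - 1)" if w: "w \<in> W" for w
  proof -
    have "inj_on (insert {v, w}) (through_matchings V (W - {w}))"
    proof (rule inj_onI)
      fix m m' assume *: "m \<in> through_matchings V (W - {w})" "m' \<in> through_matchings V (W - {w})" "insert {v, w} m = insert {v, w} m'"
      then have "{v, w} \<notin> m" "{v, w} \<notin> m'" using avoid[of _ "W - {w}"] v(2) by blast+
      then show "m = m'" using *(3) by (metis Diff_insert_absorb)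
    qed
    then have "card (?C w) = card (through_matchings V (W - {w}))" by (rule card_image)
    also have "\<dots> = defects (card V) (card (W - {w}))" using insert VW by (intro insert.IH) auto
    finally show ?thesis using w insert by simp
  qed
  have "card (through_matchings (insert v V) W) = card (?A \<union> ?B) + card (\<Union>w\<in>W. ?C w)"
    unfolding through_matchings_split[OF v VW] using fin insert d2 by (intro card_Un_disjoint) auto
  also have "card (?A \<union> ?B) = card ?A + card ?B" using fin insert d1 by (intro card_Un_disjoint) auto
  also have "card (\<Union>w\<in>W. ?C w) = (\<Sum>w\<in>W. card (?C w))" using fin insert d3 by (intro card_UN_disjoint) auto
  also have "\<dots> = card W * defects (card V) (card W - 1)" using cC by simp
  also have "card ?A = defects (card V) (card W)" using insert VW by (intro insert.IH) auto
  also have "card ?B = defects (card V) (Suc (card W))"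
    using insert.IH[of "insert v W"] insert VW v by simp
  finally show ?case using insert by simp
qed

text \<open>The labels are the first \<open>r\<close> bottom vertices. For \<open>r \<le> k\<close>
  a half diagram is thus itself a diagram whose other bottom vertices are isolated, and composition
  applies to it.\<close>

definition half_diagrams :: "nat \<Rightarrow> nat \<Rightarrow> diagram set" where
  "half_diagrams k r = through_matchings (Top ` {1..k}) (Bot ` {1..r})"

lemma card_half_diagrams: "card (half_diagrams k r) = defects k r"
  unfolding half_diagrams_def by (subst card_through_matchings) (auto simp: card_image inj_on_def)

lemma card_RB_diagrams: "card (RB_diagrams k) = defects (2 * k) 0"
proof -
  have "RB_diagrams k = through_matchings (vertices k) {}" by (simp add: RB_diagrams_matchings through_matchings_def)
  moreover have "card (vertices k) = 2 * k"
    unfolding vertices_def by (subst card_Un_disjoint) (auto simp: card_image inj_on_def)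
  ultimately show ?thesis using card_through_matchings[of "vertices k" "{}"] by simp
qed

section \<open>Factorisation through half diagrams\<close>

lemma RB_disjoint: "d \<in> RB_diagrams k \<Longrightarrow> e \<in> d \<Longrightarrow> e' \<in> d \<Longrightarrow> e \<noteq> e' \<Longrightarrow> e \<inter> e' = {}"
  by (simp add: RB_diagrams_def)

text \<open>A test colouring for a single edge. For an edge of a composite it provides a nonzero
  matrix entry, hence a middle colouring that shows how the edge continues.\<close>

lemma edge_indicator_compat:
  assumes d: "d \<in> RB_diagrams k" and e: "{u, v} \<in> d"
  shows "compat k d (\<lambda>w. if w = u \<or> w = v then 1 else 0)"
  unfolding compat_def
proof (intro conjI ballI impI)
  fix e' a b assume e': "e' \<in> d" "a \<in> e'" "b \<in> e'"
  have D: "e' = {u, v} \<or> e' \<inter> {u, v} = {}" using RB_disjoint[OF d e'(1) e] by blast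
  show "(if a = u \<or> a = v then 1 else 0) = (if b = u \<or> b = v then 1 else (0::nat))"
    using D e'(2,3) by auto
next
  fix w assume "w \<in> vertices k" "w \<notin> \<Union>d"
  then show "(if w = u \<or> w = v then 1 else 0) = (0::nat)" using e by auto
qed

lemma middle_colouring_exists:
  assumes "d1 \<in> RB_diagrams k" "d2 \<in> RB_diagrams k" "\<alpha> \<in> colourings k n" "\<beta> \<in> colourings k n"
    and "compat k (compose_diagrams k d1 d2) (rows \<alpha> \<beta>)"
  shows "\<exists>\<gamma>\<in>colourings k n. compat k d1 (rows \<alpha> \<gamma>) \<and> compat k d2 (rows \<gamma> \<beta>)"
proof -
  have "card {\<gamma> \<in> colourings k n. compat k d1 (rows \<alpha> \<gamma>) \<and> compat k d2 (rows \<gamma> \<beta>)} \<noteq> 0"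
    unfolding card_middle_colourings[OF assms(1-4)] using assms(5) by simp
  then have "{\<gamma> \<in> colourings k n. compat k d1 (rows \<alpha> \<gamma>) \<and> compat k d2 (rows \<gamma> \<beta>)} \<noteq> {}"
    using card.empty by metis
  then show ?thesis by blast
qed

section \<open>Through strands of a composite\<close>

definition through_tops :: "diagram \<Rightarrow> nat set" where
  "through_tops d = {i. \<exists>j. {Top i, Bot j} \<in> d}"

definition through_bots :: "diagram \<Rightarrow> nat set" where
  "through_bots d = {j. \<exists>i. {Top i, Bot j} \<in> d}"

lemma mem_vertices: "Top i \<in> vertices k \<longleftrightarrow> i \<in> {1..k}" "Bot i \<in> vertices k \<longleftrightarrow> i \<in> {1..k}"
  by (auto simp: vertices_def)

lemma edge_vertices: "d \<in> RB_diagrams k \<Longrightarrow> {u, v} \<in> d \<Longrightarrow> u \<in> vertices k \<and> v \<in> vertices k"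
  by (auto simp: RB_diagrams_def)

lemma through_subset:
  assumes "d \<in> RB_diagrams k"
  shows "through_tops d \<subseteq> {1..k}" "through_bots d \<subseteq> {1..k}"
  using edge_vertices[OF assms] mem_vertices unfolding through_tops_def through_bots_def by blast+

lemma RB_partner: "d \<in> RB_diagrams k \<Longrightarrow> {u, v} \<in> d \<Longrightarrow> {u, w} \<in> d \<Longrightarrow> v = w"
  unfolding RB_diagrams_matchings by (rule matching_partner)

lemma card_through:
  assumes d: "d \<in> RB_diagrams k"
  shows "card (through_tops d) = card (through_bots d)"
proof -
  define h where "h i = (SOME j. {Top i, Bot j} \<in> d)" for i
  have h: "{Top i, Bot (h i)} \<in> d" if "i \<in> through_tops d" for i
    using that unfolding h_def through_tops_def by (auto intro: someI)
  have "bij_betw h (through_tops d) (through_bots d)"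
    unfolding bij_betw_def
  proof
    show "inj_on h (through_tops d)"
    proof (rule inj_onI)
      fix i i' assume i: "i \<in> through_tops d" "i' \<in> through_tops d" "h i = h i'"
      have "{Bot (h i), Top i} \<in> d" "{Bot (h i), Top i'} \<in> d" using h i by (metis insert_commute)+
      then show "i = i'" using RB_partner[OF d] by blast
    qed
    show "h ` through_tops d = through_bots d"
    proof
      show "h ` through_tops d \<subseteq> through_bots d" using h by (auto simp: through_bots_def)
      show "through_bots d \<subseteq> h ` through_tops d"
      proof
        fix j assume "j \<in> through_bots d"
        then obtain i where i: "{Top i, Bot j} \<in> d" by (auto simp: through_bots_def)
        then have t: "i \<in> through_tops d" by (auto simp: through_tops_def)
        have "j = h i" using RB_partner[OF d i h[OF t]] by simp
        then show "j \<in> h ` through_tops d" using t by blast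
      qed
    qed
  qed
  then show ?thesis by (rule bij_betw_same_card)
qed

text \<open>Colour the through edge \<open>1\<close> and everything else \<open>0\<close>. In a
  compatible middle colouring the partner of \<open>Bot j\<close> in \<open>d2\<close> has colour
  \<open>1\<close>, and \<open>Bot j\<close> is the only bottom vertex of that colour, so the
  partner is a top vertex.\<close>

lemma through_bots_compose:
  assumes d: "d1 \<in> RB_diagrams k" "d2 \<in> RB_diagrams k"
  shows "through_bots (compose_diagrams k d1 d2) \<subseteq> through_bots d2"
proof
  let ?d = "compose_diagrams k d1 d2"
  fix j assume "j \<in> through_bots ?d"
  then obtain i where e: "{Top i, Bot j} \<in> ?d" by (auto simp: through_bots_def)
  have dR: "?d \<in> RB_diagrams k" using d by simp
  have v: "i \<in> {1..k}" "j \<in> {1..k}" using edge_vertices[OF dR e] mem_vertices by blast+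
  define \<alpha> where "\<alpha> = (\<lambda>l\<in>{1..k}. if l = i then 1 else 0 :: nat)"
  define \<beta> where "\<beta> = (\<lambda>l\<in>{1..k}. if l = j then 1 else 0 :: nat)"
  have ab: "\<alpha> \<in> colourings k 1" "\<beta> \<in> colourings k 1" by (auto simp: \<alpha>_def \<beta>_def colourings_def)
  have "compat k ?d (rows \<alpha> \<beta>) = compat k ?d (\<lambda>w. if w = Top i \<or> w = Bot j then 1 else 0)"
    by (rule compat_cong[OF dR]) (auto simp: vertices_def \<alpha>_def \<beta>_def split: if_splits)
  then have "compat k ?d (rows \<alpha> \<beta>)" using edge_indicator_compat[OF dR e] by simp
  then obtain \<gamma> where "compat k d2 (rows \<gamma> \<beta>)" using middle_colouring_exists[OF d ab] by blast
  then have mono: "\<And>e u v. e \<in> d2 \<Longrightarrow> u \<in> e \<Longrightarrow> v \<in> e \<Longrightarrow> rows \<gamma> \<beta> u = rows \<gamma> \<beta> v"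
    and iso: "\<And>v. v \<in> vertices k \<Longrightarrow> v \<notin> \<Union>d2 \<Longrightarrow> rows \<gamma> \<beta> v = 0" unfolding compat_def by blast+
  have one: "rows \<gamma> \<beta> (Bot j) = 1" using v by (simp add: \<beta>_def)
  have "Bot j \<in> vertices k" using v by (simp add: mem_vertices)
  then have "Bot j \<in> \<Union>d2" using iso[of "Bot j"] one by (metis one_neq_zero)
  then obtain w where w: "{Bot j, w} \<in> d2" "w \<noteq> Bot j"
    using matching_vertexE[of d2 "vertices k" "Bot j"] d(2) by (auto simp: RB_diagrams_matchings)
  have "rows \<gamma> \<beta> w = 1" using mono[OF w(1), of "Bot j" w] one by simp
  moreover have "w \<in> vertices k" using edge_vertices[OF d(2) w(1)] by simp
  ultimately obtain i' where "w = Top i'" using w(2) by (cases w) (auto simp: \<beta>_def mem_vertices)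
  then show "j \<in> through_bots d2" using w(1) by (auto simp: through_bots_def insert_commute)
qed

text \<open>The mirror image of the argument for \<open>through_bots\<close>, with the partner of
  \<open>Top i\<close> in \<open>d1\<close>.\<close>

lemma through_tops_compose:
  assumes d: "d1 \<in> RB_diagrams k" "d2 \<in> RB_diagrams k"
  shows "through_tops (compose_diagrams k d1 d2) \<subseteq> through_tops d1"
proof
  let ?d = "compose_diagrams k d1 d2"
  fix i assume "i \<in> through_tops ?d"
  then obtain j where e: "{Top i, Bot j} \<in> ?d" by (auto simp: through_tops_def)
  have dR: "?d \<in> RB_diagrams k" using d by simp
  have v: "i \<in> {1..k}" "j \<in> {1..k}" using edge_vertices[OF dR e] mem_vertices by blast+
  define \<alpha> where "\<alpha> = (\<lambda>l\<in>{1..k}. if l = i then 1 else 0 :: nat)"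
  define \<beta> where "\<beta> = (\<lambda>l\<in>{1..k}. if l = j then 1 else 0 :: nat)"
  have ab: "\<alpha> \<in> colourings k 1" "\<beta> \<in> colourings k 1" by (auto simp: \<alpha>_def \<beta>_def colourings_def)
  have "compat k ?d (rows \<alpha> \<beta>) = compat k ?d (\<lambda>w. if w = Top i \<or> w = Bot j then 1 else 0)"
    by (rule compat_cong[OF dR]) (auto simp: vertices_def \<alpha>_def \<beta>_def split: if_splits)
  then have "compat k ?d (rows \<alpha> \<beta>)" using edge_indicator_compat[OF dR e] by simp
  then obtain \<gamma> where "compat k d1 (rows \<alpha> \<gamma>)" using middle_colouring_exists[OF d ab] by blast
  then have mono: "\<And>e u v. e \<in> d1 \<Longrightarrow> u \<in> e \<Longrightarrow> v \<in> e \<Longrightarrow> rows \<alpha> \<gamma> u = rows \<alpha> \<gamma> v"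
    and iso: "\<And>v. v \<in> vertices k \<Longrightarrow> v \<notin> \<Union>d1 \<Longrightarrow> rows \<alpha> \<gamma> v = 0" unfolding compat_def by blast+
  have one: "rows \<alpha> \<gamma> (Top i) = 1" using v by (simp add: \<alpha>_def)
  have "Top i \<in> vertices k" using v by (simp add: mem_vertices)
  then have "Top i \<in> \<Union>d1" using iso[of "Top i"] one by (metis one_neq_zero)
  then obtain w where w: "{Top i, w} \<in> d1" "w \<noteq> Top i"
    using matching_vertexE[of d1 "vertices k" "Top i"] d(1) by (auto simp: RB_diagrams_matchings)
  have "rows \<alpha> \<gamma> w = 1" using mono[OF w(1), of "Top i" w] one by simp
  moreover have "w \<in> vertices k" using edge_vertices[OF d(1) w(1)] by simp
  ultimately obtain j' where "w = Bot j'" using w(2) by (cases w) (auto simp: \<alpha>_def mem_vertices)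
  then show "i \<in> through_tops d1" using w(1) by (auto simp: through_tops_def)
qed

lemma half_diagrams_iff:
  assumes "r \<le> k"
  shows "y \<in> half_diagrams k r \<longleftrightarrow> y \<in> RB_diagrams k \<and> through_bots y = {1..r} \<and> (\<forall>j. Bot j \<in> \<Union>y \<longrightarrow> j \<in> {1..r})"
proof
  assume y: "y \<in> half_diagrams k r"
  then have m: "y \<in> matchings (Top ` {1..k} \<union> Bot ` {1..r})" and t: "\<And>j. j \<in> {1..r} \<Longrightarrow> \<exists>i\<in>{1..k}. {Top i, Bot j} \<in> y"
    by (auto simp: half_diagrams_def through_matchings_def)
  have sub: "\<Union>y \<subseteq> Top ` {1..k} \<union> Bot ` {1..r}" by (rule matchings_subset[OF m])
  have "y \<in> RB_diagrams k" unfolding RB_diagrams_matchings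
    using sub assms by (intro matchings_mono[OF m]) (auto simp: vertices_def)
  moreover have b: "\<forall>j. Bot j \<in> \<Union>y \<longrightarrow> j \<in> {1..r}" using sub by blast
  moreover have "through_bots y = {1..r}" using t b unfolding through_bots_def by blast
  ultimately show "y \<in> RB_diagrams k \<and> through_bots y = {1..r} \<and> (\<forall>j. Bot j \<in> \<Union>y \<longrightarrow> j \<in> {1..r})" by blast
next
  assume y: "y \<in> RB_diagrams k \<and> through_bots y = {1..r} \<and> (\<forall>j. Bot j \<in> \<Union>y \<longrightarrow> j \<in> {1..r})"
  then have yR: "y \<in> RB_diagrams k" by blast
  then have ym: "y \<in> matchings (vertices k)" by (simp add: RB_diagrams_matchings)
  have "\<Union>y \<subseteq> Top ` {1..k} \<union> Bot ` {1..r}"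
  proof
    fix v assume v: "v \<in> \<Union>y"
    then have "v \<in> vertices k" using matchings_subset[OF ym] by blast
    then show "v \<in> Top ` {1..k} \<union> Bot ` {1..r}" using y v by (cases v) (auto simp: vertices_def)
  qed
  then have "y \<in> matchings (Top ` {1..k} \<union> Bot ` {1..r})" by (rule matchings_mono[OF ym])
  moreover have "\<exists>v\<in>Top ` {1..k}. {v, w} \<in> y" if w: "w \<in> Bot ` {1..r}" for w
  proof -
    obtain j where j: "j \<in> {1..r}" "w = Bot j" using w by blast
    then have "j \<in> through_bots y" using y by blast
    then obtain i where "{Top i, Bot j} \<in> y" unfolding through_bots_def by blast
    moreover from this have "i \<in> {1..k}" using edge_vertices[OF yR] mem_vertices by blast
    ultimately show ?thesis using j by blast
  qed
  ultimately show "y \<in> half_diagrams k r" by (simp add: half_diagrams_def through_matchings_def)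
qed

lemma half_diagrams_RB: "r \<le> k \<Longrightarrow> y \<in> half_diagrams k r \<Longrightarrow> y \<in> RB_diagrams k"
  using half_diagrams_iff by blast

lemma finite_half_diagrams [simp]: "finite (half_diagrams k r)"
  unfolding half_diagrams_def through_matchings_def by (simp add: finite_matchings)

text \<open>A bottom vertex beyond \<open>r\<close> is isolated in \<open>y\<close> and must have
  colour \<open>0\<close>, which contradicts the test colouring of an edge of the composite at this
  vertex.\<close>

lemma compose_half_diagram_bots:
  assumes r: "r \<le> k" and d: "d \<in> RB_diagrams k" and y: "y \<in> half_diagrams k r" and j: "Bot j \<in> \<Union>(compose_diagrams k d y)"
  shows "j \<in> {1..r}"
proof (rule ccontr)
  assume nj: "j \<notin> {1..r}"
  have yR: "y \<in> RB_diagrams k" and yb: "\<And>j. Bot j \<in> \<Union>y \<Longrightarrow> j \<in> {1..r}" using half_diagrams_iff[OF r] y by blast+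
  let ?d = "compose_diagrams k d y"
  have dR: "?d \<in> RB_diagrams k" using d yR by simp
  obtain u where e: "{Bot j, u} \<in> ?d" using matching_vertexE[of ?d "vertices k" "Bot j"] dR j by (metis RB_diagrams_matchings)
  have v: "j \<in> {1..k}" using edge_vertices[OF dR e] mem_vertices by blast
  define \<alpha> where "\<alpha> = (\<lambda>l\<in>{1..k}. if Top l = u then 1 else 0 :: nat)"
  define \<beta> where "\<beta> = (\<lambda>l\<in>{1..k}. if l = j \<or> Bot l = u then 1 else 0 :: nat)"
  have ab: "\<alpha> \<in> colourings k 1" "\<beta> \<in> colourings k 1" by (auto simp: \<alpha>_def \<beta>_def colourings_def)
  have "compat k ?d (rows \<alpha> \<beta>) = compat k ?d (\<lambda>w. if w = Bot j \<or> w = u then 1 else 0)"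
    by (rule compat_cong[OF dR]) (auto simp: vertices_def \<alpha>_def \<beta>_def split: if_splits)
  then have "compat k ?d (rows \<alpha> \<beta>)" using edge_indicator_compat[OF dR e] by simp
  then obtain \<gamma> where c: "compat k y (rows \<gamma> \<beta>)" using middle_colouring_exists[OF d yR ab] by blast
  have "Bot j \<notin> \<Union>y" using yb nj by blast
  moreover have "Bot j \<in> vertices k" using v by (simp add: mem_vertices)
  ultimately have "rows \<gamma> \<beta> (Bot j) = 0" using c unfolding compat_def by blast
  then show False using v by (simp add: \<beta>_def)
qed

lemma compose_half_diagram:
  assumes r: "r \<le> k" and d: "d \<in> RB_diagrams k" and y: "y \<in> half_diagrams k r"
  shows "compose_diagrams k d y \<in> half_diagrams k r \<longleftrightarrow> through_bots (compose_diagrams k d y) = {1..r}"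
    and "through_bots (compose_diagrams k d y) \<subseteq> {1..r}"
proof -
  have yR: "y \<in> RB_diagrams k" and b: "through_bots y = {1..r}" using half_diagrams_iff[OF r] y by blast+
  show "through_bots (compose_diagrams k d y) \<subseteq> {1..r}" using through_bots_compose[OF d yR] b by simp
  show "compose_diagrams k d y \<in> half_diagrams k r \<longleftrightarrow> through_bots (compose_diagrams k d y) = {1..r}"
    using half_diagrams_iff[OF r] compose_half_diagram_bots[OF r d y] d yR compose_closed by blast
qed

text \<open>Through strands lost in the inner composite cannot be regained. This makes discarding
  such composites compatible with multiplication.\<close>

lemma compose_half_diagramD:
  assumes r: "r \<le> k" and d: "d1 \<in> RB_diagrams k" "d2 \<in> RB_diagrams k" and y: "y \<in> half_diagrams k r"
    and c: "compose_diagrams k d1 (compose_diagrams k d2 y) \<in> half_diagrams k r"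
  shows "compose_diagrams k d2 y \<in> half_diagrams k r"
proof -
  have yR: "y \<in> RB_diagrams k" using half_diagrams_RB[OF r y] .
  have "{1..r} = through_bots (compose_diagrams k d1 (compose_diagrams k d2 y))" using half_diagrams_iff[OF r] c by blast
  also have "\<dots> \<subseteq> through_bots (compose_diagrams k d2 y)" using d yR by (intro through_bots_compose) simp_all
  finally show ?thesis using compose_half_diagram[OF r d(2) y] by blast
qed

text \<open>The inverse makes \<open>relabel\<close> a right action.\<close>

primrec relabel_bot :: "(nat \<Rightarrow> nat) \<Rightarrow> vertex \<Rightarrow> vertex" where
  "relabel_bot f (Top i) = Top i"
| "relabel_bot f (Bot j) = Bot (f j)"

definition relabel :: "diagram \<Rightarrow> (nat \<Rightarrow> nat) \<Rightarrow> diagram" where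
  "relabel d \<sigma> = (\<lambda>e. relabel_bot (inv_into UNIV \<sigma>) ` e) ` d"

section \<open>The right action of the symmetric group on the strands\<close>

lemma relabel_bot_comp: "relabel_bot f (relabel_bot g v) = relabel_bot (f \<circ> g) v"
  by (cases v) auto

lemma relabel_bot_id: "relabel_bot id v = v"
  by (cases v) auto

lemma inj_relabel_bot: "inj f \<Longrightarrow> inj (relabel_bot f)"
proof (rule injI)
  show "inj f \<Longrightarrow> relabel_bot f u = relabel_bot f v \<Longrightarrow> u = v" for u v
    by (cases u; cases v) (auto dest: injD)
qed

lemma relabel_bot_vertices: "f permutes {1..k} \<Longrightarrow> relabel_bot f ` vertices k = vertices k"
proof -
  assume "f permutes {1..k}"
  then have "f ` {1..k} = {1..k}" by (rule permutes_image)
  then show ?thesis unfolding vertices_def image_Un image_image relabel_bot.simps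
    using image_image[of Bot f "{1..k}"] by simp
qed

lemma relabel_id: "relabel d id = d"
  by (simp add: relabel_def relabel_bot_id[abs_def])

lemma relabel_comp:
  assumes "\<sigma> permutes S" "\<tau> permutes S"
  shows "relabel (relabel d \<sigma>) \<tau> = relabel d (\<sigma> \<circ> \<tau>)"
proof -
  have "inv_into UNIV (\<sigma> \<circ> \<tau>) = inv_into UNIV \<tau> \<circ> inv_into UNIV \<sigma>"
    using assms by (intro o_inv_distrib permutes_bij)
  then show ?thesis by (simp add: relabel_def image_image relabel_bot_comp)
qed

lemma relabel_closed:
  assumes \<sigma>: "\<sigma> permutes {1..k}" and d: "d \<in> RB_diagrams k"
  shows "relabel d \<sigma> \<in> RB_diagrams k"
proof -
  let ?f = "inv_into UNIV \<sigma>"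
  have f: "?f permutes {1..k}" by (rule permutes_inv[OF \<sigma>])
  have "relabel d \<sigma> \<in> matchings (relabel_bot ?f ` vertices k)"
    unfolding relabel_def using d inj_relabel_bot[OF permutes_inj[OF f]]
    by (intro matchings_image) (auto simp: RB_diagrams_matchings intro: inj_on_subset)
  then show ?thesis unfolding relabel_bot_vertices[OF f] RB_diagrams_matchings .
qed

lemma edge_relabel:
  assumes "\<sigma> permutes S"
  shows "{relabel_bot (inv_into UNIV \<sigma>) u, relabel_bot (inv_into UNIV \<sigma>) v} \<in> relabel d \<sigma> \<longleftrightarrow> {u, v} \<in> d"
proof -
  let ?g = "relabel_bot (inv_into UNIV \<sigma>)"
  have inj: "inj ?g" using assms by (intro inj_relabel_bot permutes_inj[OF permutes_inv])
  have "{?g u, ?g v} = ?g ` {u, v}" by simp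
  then show ?thesis unfolding relabel_def using inj_image_eq_iff[OF inj] by (metis (no_types, lifting) imageE imageI)
qed

lemma compat_relabel:
  assumes \<sigma>: "\<sigma> permutes {1..k}"
  shows "compat k (relabel d \<sigma>) (rows \<gamma> \<beta>) \<longleftrightarrow> compat k d (rows \<gamma> (\<beta> \<circ> inv_into UNIV \<sigma>))"
proof -
  let ?f = "inv_into UNIV \<sigma>"
  let ?g = "relabel_bot ?f"
  have f: "?f permutes {1..k}" by (rule permutes_inv[OF \<sigma>])
  have inj: "inj ?g" by (rule inj_relabel_bot[OF permutes_inj[OF f]])
  have rg: "rows \<gamma> \<beta> (?g v) = rows \<gamma> (\<beta> \<circ> ?f) v" for v by (cases v) auto
  have 1: "(\<forall>e\<in>relabel d \<sigma>. \<forall>u\<in>e. \<forall>v\<in>e. rows \<gamma> \<beta> u = rows \<gamma> \<beta> v) \<longleftrightarrow>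
      (\<forall>e\<in>d. \<forall>u\<in>e. \<forall>v\<in>e. rows \<gamma> (\<beta> \<circ> ?f) u = rows \<gamma> (\<beta> \<circ> ?f) v)"
    unfolding relabel_def ball_simps(9) rg ..
  have U: "\<Union>(relabel d \<sigma>) = ?g ` \<Union>d" by (auto simp: relabel_def)
  have "(\<forall>v\<in>vertices k. v \<notin> \<Union>(relabel d \<sigma>) \<longrightarrow> rows \<gamma> \<beta> v = 0) \<longleftrightarrow>
      (\<forall>v\<in>?g ` vertices k. v \<notin> ?g ` \<Union>d \<longrightarrow> rows \<gamma> \<beta> v = 0)"
    unfolding relabel_bot_vertices[OF f] U ..
  also have "\<dots> \<longleftrightarrow> (\<forall>v\<in>vertices k. v \<notin> \<Union>d \<longrightarrow> rows \<gamma> (\<beta> \<circ> ?f) v = 0)"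
    unfolding ball_simps(9) inj_image_mem_iff[OF inj] rg ..
  finally show ?thesis unfolding compat_def 1 by blast
qed

text \<open>Relabelling permutes the colours of the bottom row, to which a diagram placed above is
  insensitive. Equality of the scaled matrices gives the composites and the loop numbers.\<close>

lemma compose_relabel:
  assumes \<sigma>: "\<sigma> permutes {1..k}" and d: "d1 \<in> RB_diagrams k" "d2 \<in> RB_diagrams k"
  shows "compose_diagrams k d1 (relabel d2 \<sigma>) = relabel (compose_diagrams k d1 d2) \<sigma>"
    and "kappa k d1 (relabel d2 \<sigma>) = kappa k d1 d2"
proof -
  let ?n = "num_colours k" and ?f = "inv_into UNIV \<sigma>"
  let ?l = "compose_diagrams k d1 (relabel d2 \<sigma>)" and ?r = "relabel (compose_diagrams k d1 d2) \<sigma>"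
  have f: "?f permutes {1..k}" by (rule permutes_inv[OF \<sigma>])
  have tm: "tensor_mat k (relabel d \<sigma>) \<gamma> \<beta> = tensor_mat k d \<gamma> (\<beta> \<circ> ?f)" for d \<gamma> \<beta>
    by (simp add: tensor_mat_def compat_relabel[OF \<sigma>])
  have eq: "(?n + 1) ^ kappa k d1 (relabel d2 \<sigma>) * tensor_mat k ?l \<alpha> \<beta> = (?n + 1) ^ kappa k d1 d2 * tensor_mat k ?r \<alpha> \<beta>"
    if ab: "\<alpha> \<in> colourings k ?n" "\<beta> \<in> colourings k ?n" for \<alpha> \<beta>
  proof -
    have bf: "\<beta> \<circ> ?f \<in> colourings k ?n"
    proof -
      have "?f j \<in> {1..k}" if "j \<in> {1..k}" for j using permutes_in_image[OF f] that by blast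
      moreover have "?f j = j" if "j \<notin> {1..k}" for j using f that by (simp add: permutes_def)
      ultimately show ?thesis using ab(2) by (auto simp: colourings_def PiE_def extensional_def Pi_def)
    qed
    have "(?n + 1) ^ kappa k d1 (relabel d2 \<sigma>) * tensor_mat k ?l \<alpha> \<beta> =
        (\<Sum>\<gamma>\<in>colourings k ?n. tensor_mat k d1 \<alpha> \<gamma> * tensor_mat k d2 \<gamma> (\<beta> \<circ> ?f))"
      using tensor_mat_compose[OF d(1) relabel_closed[OF \<sigma> d(2)] ab] by (simp add: tm)
    also have "\<dots> = (?n + 1) ^ kappa k d1 d2 * tensor_mat k (compose_diagrams k d1 d2) \<alpha> (\<beta> \<circ> ?f)"
      by (rule tensor_mat_compose[OF d ab(1) bf])
    finally show ?thesis by (simp only: tm)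
  qed
  have c: "?l \<in> RB_diagrams k" "?r \<in> RB_diagrams k" using d relabel_closed[OF \<sigma>] by simp_all
  show "?l = ?r" by (rule diagram_eq_if_scaled_tensor_mat_eq(1)[OF c _ _ eq]) simp_all
  have "(?n + 1) ^ kappa k d1 (relabel d2 \<sigma>) = (?n + 1) ^ kappa k d1 d2"
    by (rule diagram_eq_if_scaled_tensor_mat_eq(2)[OF c _ _ eq]) simp_all
  then show "kappa k d1 (relabel d2 \<sigma>) = kappa k d1 d2"
    using num_colours_pos[of k] power_inject_exp[of "?n + 1"] by simp
qed

lemma permutes_le: "\<sigma> permutes {1..r} \<Longrightarrow> r \<le> k \<Longrightarrow> \<sigma> permutes {1..k}" for r k :: nat
  by (rule permutes_subset) auto

lemma relabel_half_diagram:
  assumes r: "r \<le> k" and \<sigma>: "\<sigma> permutes {1..r}" and y: "y \<in> half_diagrams k r"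
  shows "relabel y \<sigma> \<in> half_diagrams k r"
proof -
  let ?f = "inv_into UNIV \<sigma>"
  have f: "?f permutes {1..r}" by (rule permutes_inv[OF \<sigma>])
  have Y: "y \<in> RB_diagrams k" "through_bots y = {1..r}" "\<And>j. Bot j \<in> \<Union>y \<Longrightarrow> j \<in> {1..r}"
    using half_diagrams_iff[OF r] y by blast+
  have "relabel y \<sigma> \<in> RB_diagrams k" using relabel_closed[OF permutes_le[OF \<sigma> r] Y(1)] .
  moreover have b: "j \<in> {1..r}" if "Bot j \<in> \<Union>(relabel y \<sigma>)" for j
  proof -
    obtain v where v: "v \<in> \<Union>y" "Bot j = relabel_bot ?f v" using \<open>Bot j \<in> \<Union>(relabel y \<sigma>)\<close> unfolding relabel_def by blast
    then obtain j' where "v = Bot j'" "j = ?f j'" by (cases v) auto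
    then show ?thesis using Y(3) v(1) permutes_in_image[OF f, of j'] by blast
  qed
  moreover have "through_bots (relabel y \<sigma>) = {1..r}"
  proof
    show "through_bots (relabel y \<sigma>) \<subseteq> {1..r}" using b unfolding through_bots_def by blast
    show "{1..r} \<subseteq> through_bots (relabel y \<sigma>)"
    proof
      fix j assume "j \<in> {1..r}"
      then have "\<sigma> j \<in> through_bots y" using Y(2) permutes_in_image[OF \<sigma>, of j] by simp
      then obtain i where "{Top i, Bot (\<sigma> j)} \<in> y" by (auto simp: through_bots_def)
      then have "{Top i, Bot (?f (\<sigma> j))} \<in> relabel y \<sigma>" using edge_relabel[OF \<sigma>, of "Top i" "Bot (\<sigma> j)"] by simp
      then show "j \<in> through_bots (relabel y \<sigma>)" using permutes_inverses(2)[OF \<sigma>] by (auto simp: through_bots_def)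
    qed
  qed
  ultimately show ?thesis using half_diagrams_iff[OF r] by blast
qed

text \<open>The partner of \<open>Bot (\<sigma> j)\<close> becomes the partner of
  \<open>Bot j\<close>. If the diagram does not change, uniqueness of partners gives
  \<open>\<sigma> j = j\<close>.\<close>

lemma relabel_free:
  assumes r: "r \<le> k" and \<sigma>: "\<sigma> permutes {1..r}" and y: "y \<in> half_diagrams k r" and eq: "relabel y \<sigma> = y"
  shows "\<sigma> = id"
proof
  fix j
  show "\<sigma> j = id j"
  proof (cases "j \<in> {1..r}")
    case True
    have Y: "y \<in> RB_diagrams k" "through_bots y = {1..r}" using half_diagrams_iff[OF r] y by blast+
    have "\<sigma> j \<in> through_bots y" using Y(2) permutes_in_image[OF \<sigma>, of j] True by simp
    then obtain i where i: "{Top i, Bot (\<sigma> j)} \<in> y" by (auto simp: through_bots_def)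
    then have "{Top i, Bot (inv_into UNIV \<sigma> (\<sigma> j))} \<in> relabel y \<sigma>" using edge_relabel[OF \<sigma>, of "Top i" "Bot (\<sigma> j)"] by simp
    then have "{Top i, Bot j} \<in> y" using eq permutes_inverses(2)[OF \<sigma>] by simp
    from RB_partner[OF Y(1) i this] show ?thesis by simp
  next
    case False
    then show ?thesis using \<sigma> by (simp add: permutes_def)
  qed
qed

text \<open>Since the action on half diagrams is free, one representative from each orbit
  suffices.\<close>

lemma ex_transversal:
  assumes r: "r \<le> k"
  shows "\<exists>U \<subseteq> half_diagrams k r. bij_betw (\<lambda>(u, \<sigma>). relabel u \<sigma>) (U \<times> {\<sigma>. \<sigma> permutes {1..r}}) (half_diagrams k r)"
proof -
  let ?X = "half_diagrams k r" and ?P = "{\<sigma>. \<sigma> permutes {1..r}}"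
  define orb where "orb y = relabel y ` ?P" for y
  have orbX: "orb y \<subseteq> ?X" if "y \<in> ?X" for y using relabel_half_diagram[OF r _ that] by (auto simp: orb_def)
  have self: "y \<in> orb y" for y
    unfolding orb_def by (rule image_eqI[of _ _ id]) (simp_all add: relabel_id permutes_id)
  have orb_sub: "orb z \<subseteq> orb y" if z: "z \<in> orb y" for y z
  proof
    fix w assume "w \<in> orb z"
    then obtain \<sigma> \<tau> where "\<sigma> \<in> ?P" "\<tau> \<in> ?P" "w = relabel (relabel y \<sigma>) \<tau>" using z unfolding orb_def by blast
    then have "w = relabel y (\<sigma> \<circ> \<tau>)" "\<sigma> \<circ> \<tau> \<in> ?P" using relabel_comp permutes_compose by auto
    then show "w \<in> orb y" unfolding orb_def by blast
  qed
  have orb_eq: "orb z = orb y" if z: "z \<in> orb y" for y z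
  proof -
    obtain \<sigma> where \<sigma>: "\<sigma> \<in> ?P" "z = relabel y \<sigma>" using z unfolding orb_def by blast
    then have "relabel z (inv_into UNIV \<sigma>) = relabel y (\<sigma> \<circ> inv_into UNIV \<sigma>)" using relabel_comp[of \<sigma> "{1..r}"] permutes_inv by auto
    moreover have "\<sigma> \<circ> inv_into UNIV \<sigma> = id" using \<sigma>(1) permutes_inv_o(1) by blast
    ultimately have "relabel z (inv_into UNIV \<sigma>) = y" by (simp only: relabel_id)
    moreover have "inv_into UNIV \<sigma> \<in> ?P" using \<sigma> permutes_inv by blast
    ultimately have "y \<in> orb z" unfolding orb_def by blast
    then show ?thesis using orb_sub z by blast
  qed
  \<comment> \<open>Choosing from the orbit as a set gives the same representative for all its
    elements.\<close>
  define c where "c y = (SOME z. z \<in> orb y)" for y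
  have c: "c y \<in> orb y" for y unfolding c_def by (rule someI[of _ y]) (rule self)
  have c_eq: "c z = c y" if "z \<in> orb y" for y z unfolding c_def orb_eq[OF that] ..
  let ?U = "c ` ?X"
  have UX: "?U \<subseteq> ?X" using c orbX by blast
  have "bij_betw (\<lambda>(u, \<sigma>). relabel u \<sigma>) (?U \<times> ?P) ?X"
    unfolding bij_betw_def
  proof
    show "inj_on (\<lambda>(u, \<sigma>). relabel u \<sigma>) (?U \<times> ?P)"
    proof (rule inj_onI, clarify)
      fix y \<sigma> y' \<sigma>' assume y: "y \<in> ?X" "y' \<in> ?X" and \<sigma>: "\<sigma> permutes {1..r}" "\<sigma>' permutes {1..r}"
        and eq: "relabel (c y) \<sigma> = relabel (c y') \<sigma>'"
      have m: "relabel (c y) \<sigma> \<in> orb (c y)" "relabel (c y') \<sigma>' \<in> orb (c y')" using \<sigma> unfolding orb_def by blast+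
      have "orb (c y) = orb (c y')" using orb_eq[OF m(1)] orb_eq[OF m(2)] eq by simp
      then have "orb y = orb y'" using orb_eq[OF c] by metis
      then have u: "c y = c y'" unfolding c_def by simp
      let ?u = "c y"
      have uX: "?u \<in> ?X" using UX y by blast
      have i: "inv_into UNIV \<sigma>' permutes {1..r}" by (rule permutes_inv[OF \<sigma>(2)])
      have "relabel ?u (\<sigma> \<circ> inv_into UNIV \<sigma>') = relabel ?u (\<sigma>' \<circ> inv_into UNIV \<sigma>')"
        using relabel_comp[OF \<sigma>(1) i] relabel_comp[OF \<sigma>(2) i] eq u by metis
      then have "relabel ?u (\<sigma> \<circ> inv_into UNIV \<sigma>') = ?u" using permutes_inv_o(1)[OF \<sigma>(2)] by (simp add: relabel_id)
      then have id: "\<sigma> \<circ> inv_into UNIV \<sigma>' = id" by (rule relabel_free[OF r permutes_compose[OF i \<sigma>(1)] uX])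
      have "\<sigma> = \<sigma> \<circ> (inv_into UNIV \<sigma>' \<circ> \<sigma>')" using permutes_inv_o(2)[OF \<sigma>(2)] by simp
      also have "\<dots> = \<sigma>'" unfolding comp_assoc[symmetric] id by simp
      finally show "c y = c y' \<and> \<sigma> = \<sigma>'" using u by simp
    qed
    show "(\<lambda>(u, \<sigma>). relabel u \<sigma>) ` (?U \<times> ?P) = ?X"
    proof
      show "(\<lambda>(u, \<sigma>). relabel u \<sigma>) ` (?U \<times> ?P) \<subseteq> ?X" using UX relabel_half_diagram[OF r] by auto
      show "?X \<subseteq> (\<lambda>(u, \<sigma>). relabel u \<sigma>) ` (?U \<times> ?P)"
      proof
        fix y assume y: "y \<in> ?X"
        have "y \<in> orb (c y)" using orb_eq[OF c] self by blast
        then obtain \<sigma> where "\<sigma> \<in> ?P" "y = relabel (c y) \<sigma>" unfolding orb_def by blast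
        then show "y \<in> (\<lambda>(u, \<sigma>). relabel u \<sigma>) ` (?U \<times> ?P)" using y by (intro image_eqI[of _ _ "(c y, \<sigma>)"]) auto
      qed
    qed
  qed
  then show ?thesis using UX by blast
qed

text \<open>\<open>y\<close> keeps the edges that meet the top row, with the through bottoms
  renumbered \<open>1, ..., r\<close>. \<open>d'\<close> joins each \<open>m\<close> to the original
  position \<open>b m\<close> and keeps the edges inside the bottom row. For given outer colours
  only one middle colouring is possible, so the product matrix is that of \<open>d\<close> and no
  loop arises.\<close>

lemma factor_through_half_diagram:
  assumes d: "d \<in> RB_diagrams k" and r: "card (through_bots d) = r"
  obtains y d' where "y \<in> half_diagrams k r" "d' \<in> RB_diagrams k" "compose_diagrams k y d' = d" "kappa k y d' = 0"
proof -
  have fB: "finite (through_bots d)" using through_subset(2)[OF d] finite_subset by blast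
  have rk: "r \<le> k" using card_mono[OF _ through_subset(2)[OF d]] r by simp
  obtain b where b: "bij_betw b {1..r} (through_bots d)"
    using finite_same_card_bij[of "{1..r}" "through_bots d"] fB r by auto
  define b' where "b' = the_inv_into {1..r} b"
  have b'b: "b' (b m) = m" if "m \<in> {1..r}" for m
    using that b unfolding b'_def by (intro the_inv_into_f_f) (auto simp: bij_betw_def)
  have bb': "b (b' j) = j" "b' j \<in> {1..r}" if "j \<in> through_bots d" for j
    using that b f_the_inv_into_f[of b "{1..r}" j] the_inv_into_into[of b "{1..r}" j "{1..r}"]
    unfolding b'_def by (auto simp: bij_betw_def)
  have bB: "b m \<in> through_bots d" if "m \<in> {1..r}" for m using b that by (auto simp: bij_betw_def)
  have bk: "b m \<in> {1..k}" if "m \<in> {1..r}" for m using bB[OF that] through_subset(2)[OF d] by blast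
  have dm: "d \<in> matchings (vertices k)" using d by (simp add: RB_diagrams_matchings)
  let ?T = "Top ` {1..k}"
  define d0 where "d0 = {e \<in> d. e \<inter> ?T \<noteq> {}}"
  define g where "g = relabel_bot b'"
  let ?V = "?T \<union> Bot ` through_bots d"
  have shape: "\<exists>i\<in>{1..k}. \<exists>v\<in>?V. e = {Top i, v}" if e: "e \<in> d0" for e
  proof -
    have "e \<in> d" using e by (simp add: d0_def)
    then obtain u v where uv: "e = {u, v}" "u \<in> vertices k" "v \<in> vertices k" by (rule matching_edgeE[OF dm])
    obtain i where i: "i \<in> {1..k}" "Top i \<in> e" using e unfolding d0_def by blast
    then obtain w where w: "e = {Top i, w}" "w \<in> vertices k" using uv by (metis doubleton_eq_iff insertE singletonD)
    have "w \<in> ?V"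
    proof (cases w)
      case (Top l)
      then show ?thesis using w(2) by (simp add: mem_vertices)
    next
      case (Bot l)
      then have "l \<in> through_bots d" using w(1) \<open>e \<in> d\<close> by (auto simp: through_bots_def)
      then show ?thesis using Bot by blast
    qed
    then show ?thesis using i(1) w(1) by blast
  qed
  have "\<Union>d0 \<subseteq> ?V" using shape by blast
  moreover have "d0 \<in> matchings (vertices k)" using dm unfolding matchings_def d0_def by simp
  ultimately have d0m: "d0 \<in> matchings ?V" using matchings_mono by blast
  have injg: "inj_on g ?V"
  proof (rule inj_onI)
    fix u v assume uv: "u \<in> ?V" "v \<in> ?V" "g u = g v"
    show "u = v"
    proof (cases u; cases v)
      fix i j assume "u = Bot i" "v = Bot j"
      then have "i \<in> through_bots d" "j \<in> through_bots d" "b' i = b' j" using uv by (auto simp: g_def)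
      then show ?thesis using bb'(1) \<open>u = Bot i\<close> \<open>v = Bot j\<close> by metis
    qed (use uv in \<open>auto simp: g_def\<close>)
  qed
  define y where "y = (\<lambda>e. g ` e) ` d0"
  have gV: "g ` ?V = ?T \<union> Bot ` {1..r}"
  proof -
    have "b' ` through_bots d = {1..r}" using bb'(2) bB b'b by (metis (no_types, lifting) equalityI image_subsetI subsetI image_eqI)
    then have "g ` Bot ` through_bots d = Bot ` {1..r}" unfolding g_def image_image relabel_bot.simps
      using image_image[of Bot b' "through_bots d"] by simp
    moreover have "g ` ?T = ?T" by (simp add: g_def image_image)
    ultimately show ?thesis by (simp only: image_Un)
  qed
  have ym: "y \<in> matchings (?T \<union> Bot ` {1..r})"
    using matchings_image[OF injg d0m] unfolding y_def gV .
  have yth: "\<exists>v\<in>?T. {v, w} \<in> y" if w: "w \<in> Bot ` {1..r}" for w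
  proof -
    obtain m where m: "m \<in> {1..r}" "w = Bot m" using w by blast
    obtain i where i: "{Top i, Bot (b m)} \<in> d" using bB[OF m(1)] by (auto simp: through_bots_def)
    then have ik: "i \<in> {1..k}" using edge_vertices[OF d] mem_vertices by blast
    then have "{Top i, Bot (b m)} \<in> d0" using i by (auto simp: d0_def)
    then have "g ` {Top i, Bot (b m)} \<in> y" unfolding y_def by (rule imageI)
    then have "{Top i, Bot m} \<in> y" using b'b[OF m(1)] by (simp add: g_def)
    then show ?thesis using ik m(2) by blast
  qed
  have y: "y \<in> half_diagrams k r" using ym yth by (simp add: half_diagrams_def through_matchings_def)
  have yR: "y \<in> RB_diagrams k" by (rule half_diagrams_RB[OF rk y])
  define d1 where "d1 = {e \<in> d. e \<inter> ?T = {}}"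
  define ds where "ds = (\<lambda>m. {Top m, Bot (b m)}) ` {1..r}"
  define d' where "d' = ds \<union> d1"
  \<comment> \<open>An edge without a top vertex cannot end at a through bottom, whose partner is a
    top vertex.\<close>
  have d1B: "v \<notin> ?T \<and> v \<notin> Bot ` through_bots d" if "e \<in> d1" "v \<in> e" for e v
  proof -
    have e: "e \<in> d" "e \<inter> ?T = {}" using that by (auto simp: d1_def)
    have "v \<noteq> Bot j" if j: "j \<in> through_bots d" for j
    proof
      assume v: "v = Bot j"
      obtain i where i: "{Top i, Bot j} \<in> d" using j by (auto simp: through_bots_def)
      then have "i \<in> {1..k}" using edge_vertices[OF d] mem_vertices by blast
      moreover have "{Top i, Bot j} = e" using RB_disjoint[OF d i e(1)] \<open>v \<in> e\<close> v by blast
      ultimately show False using e(2) by blast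
    qed
    then show ?thesis using e(2) that(2) by blast
  qed
  have d'R: "d' \<in> RB_diagrams k"
    unfolding RB_diagrams_def
  proof (intro CollectI conjI ballI impI)
    fix e assume "e \<in> d'"
    then show "e \<subseteq> vertices k" "card e = 2"
      using d bk rk unfolding d'_def d1_def ds_def RB_diagrams_def by (auto simp: vertices_def)
  next
    fix e e' assume e: "e \<in> d'" "e' \<in> d'" "e \<noteq> e'"
    have x1: "e \<inter> e' = {}" if "e \<in> ds" "e' \<in> ds" "e \<noteq> e'" for e e'
      using that b unfolding ds_def by (auto simp: bij_betw_def inj_on_def)
    have x2: "e \<inter> e' = {}" if "e \<in> ds" "e' \<in> d1" for e e'
    proof -
      obtain m where m: "m \<in> {1..r}" "e = {Top m, Bot (b m)}" using \<open>e \<in> ds\<close> by (auto simp: ds_def)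
      have "Top m \<in> ?T" using m(1) rk by auto
      moreover have "Bot (b m) \<in> Bot ` through_bots d" using bB[OF m(1)] by blast
      ultimately show ?thesis using d1B[OF \<open>e' \<in> d1\<close>] m(2) by blast
    qed
    have x3: "e \<inter> e' = {}" if "e \<in> d1" "e' \<in> d1" "e \<noteq> e'" for e e'
      using RB_disjoint[OF d, of e e'] that unfolding d1_def by blast
    show "e \<inter> e' = {}" using e x1 x2 x3 unfolding d'_def by blast
  qed
  have Ud: "\<Union>d = \<Union>d0 \<union> \<Union>d1" by (auto simp: d0_def d1_def)
  let ?n = "num_colours k"
  have Uds: "\<Union>ds = Top ` {1..r} \<union> Bot ` through_bots d"
  proof -
    have "b ` {1..r} = through_bots d" using b by (simp add: bij_betw_def)
    then show ?thesis unfolding ds_def by (auto simp: image_iff)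
  qed
  have compat_y: "compat k y (rows \<alpha> \<gamma>) \<longleftrightarrow> (\<forall>e\<in>d0. \<forall>u\<in>e. \<forall>v\<in>e. rows \<alpha> \<beta> u = rows \<alpha> \<beta> v) \<and> (\<forall>i\<in>{1..k}. Top i \<notin> \<Union>d \<longrightarrow> \<alpha> i = 0)"
    if g1: "\<And>m. m \<in> {1..r} \<Longrightarrow> \<gamma> m = \<beta> (b m)" and g2: "\<And>m. m \<in> {1..k} - {1..r} \<Longrightarrow> \<gamma> m = 0" for \<alpha> \<beta> \<gamma>
  proof -
    have rg: "rows \<alpha> \<gamma> (g v) = rows \<alpha> \<beta> v" if "v \<in> ?V" for v
      using that g1[OF bb'(2)] bb'(1) by (auto simp: g_def)
    have sub: "v \<in> ?V" if "e \<in> d0" "v \<in> e" for e v using matchings_subset[OF d0m] that by blast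
    have "(\<forall>e\<in>y. \<forall>u\<in>e. \<forall>v\<in>e. rows \<alpha> \<gamma> u = rows \<alpha> \<gamma> v) \<longleftrightarrow> (\<forall>e\<in>d0. \<forall>u\<in>e. \<forall>v\<in>e. rows \<alpha> \<gamma> (g u) = rows \<alpha> \<gamma> (g v))"
      unfolding y_def ball_simps(9) ..
    also have "\<dots> \<longleftrightarrow> (\<forall>e\<in>d0. \<forall>u\<in>e. \<forall>v\<in>e. rows \<alpha> \<beta> u = rows \<alpha> \<beta> v)"
      using rg sub by (intro ball_cong refl) metis
    finally have 1: "(\<forall>e\<in>y. \<forall>u\<in>e. \<forall>v\<in>e. rows \<alpha> \<gamma> u = rows \<alpha> \<gamma> v) \<longleftrightarrow> (\<forall>e\<in>d0. \<forall>u\<in>e. \<forall>v\<in>e. rows \<alpha> \<beta> u = rows \<alpha> \<beta> v)" .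
    have top: "Top i \<in> \<Union>y \<longleftrightarrow> Top i \<in> \<Union>d" if i: "i \<in> {1..k}" for i
    proof
      assume "Top i \<in> \<Union>y"
      then obtain v where v: "v \<in> \<Union>d0" "Top i = g v" unfolding y_def by blast
      then have "v = Top i" by (cases v) (auto simp: g_def)
      then show "Top i \<in> \<Union>d" using v Ud by blast
    next
      assume "Top i \<in> \<Union>d"
      then obtain e where "e \<in> d0" "Top i \<in> e" using i unfolding d0_def by blast
      then have "g (Top i) \<in> \<Union>y" unfolding y_def by blast
      then show "Top i \<in> \<Union>y" by (simp add: g_def)
    qed
    have bot: "Bot m \<in> \<Union>y \<longleftrightarrow> m \<in> {1..r}" for m
      using matchings_subset[OF ym] yth[of "Bot m"] by blast
    have 2: "(\<forall>v\<in>vertices k. v \<notin> \<Union>y \<longrightarrow> rows \<alpha> \<gamma> v = 0) \<longleftrightarrow> (\<forall>i\<in>{1..k}. Top i \<notin> \<Union>d \<longrightarrow> \<alpha> i = 0)"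
      unfolding vertices_def ball_Un ball_simps(9) rows.simps bot using top g2 by blast
    show ?thesis unfolding compat_def 1 2 ..
  qed
  have compat_d': "compat k d' (rows \<gamma> \<beta>) \<longleftrightarrow> (\<forall>m\<in>{1..r}. \<gamma> m = \<beta> (b m)) \<and> (\<forall>m\<in>{1..k} - {1..r}. \<gamma> m = 0) \<and>
      (\<forall>e\<in>d1. \<forall>u\<in>e. \<forall>v\<in>e. rows \<alpha> \<beta> u = rows \<alpha> \<beta> v) \<and> (\<forall>j\<in>{1..k}. Bot j \<notin> \<Union>d \<longrightarrow> \<beta> j = 0)" for \<alpha> \<beta> \<gamma>
  proof -
    have "rows \<gamma> \<beta> v = rows \<alpha> \<beta> v" if "e \<in> d1" "v \<in> e" for e v
    proof -
      have "v \<in> vertices k" using that d by (auto simp: d1_def RB_diagrams_def)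
      then show ?thesis using d1B[OF that] by (auto simp: vertices_def)
    qed
    then have 1: "(\<forall>e\<in>d1. \<forall>u\<in>e. \<forall>v\<in>e. rows \<gamma> \<beta> u = rows \<gamma> \<beta> v) \<longleftrightarrow> (\<forall>e\<in>d1. \<forall>u\<in>e. \<forall>v\<in>e. rows \<alpha> \<beta> u = rows \<alpha> \<beta> v)"
      by (intro ball_cong refl) metis
    have 2: "(\<forall>e\<in>ds. \<forall>u\<in>e. \<forall>v\<in>e. rows \<gamma> \<beta> u = rows \<gamma> \<beta> v) \<longleftrightarrow> (\<forall>m\<in>{1..r}. \<gamma> m = \<beta> (b m))"
      unfolding ds_def ball_simps(9) by (intro ball_cong refl) auto
    have top: "Top m \<in> \<Union>d' \<longleftrightarrow> m \<in> {1..r}" if "m \<in> {1..k}" for m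
    proof -
      have "Top m \<notin> \<Union>d1" using d1B that by blast
      then show ?thesis using Uds unfolding d'_def by auto
    qed
    have bot: "Bot j \<in> \<Union>d' \<longleftrightarrow> Bot j \<in> \<Union>d" if "j \<in> {1..k}" for j
    proof -
      have "Bot j \<in> \<Union>d0 \<longleftrightarrow> j \<in> through_bots d"
      proof
        assume "Bot j \<in> \<Union>d0"
        then show "j \<in> through_bots d" using matchings_subset[OF d0m] by blast
      next
        assume "j \<in> through_bots d"
        then obtain i where i: "{Top i, Bot j} \<in> d" by (auto simp: through_bots_def)
        then have "i \<in> {1..k}" using edge_vertices[OF d] mem_vertices by blast
        then have "{Top i, Bot j} \<in> d0" using i by (auto simp: d0_def)
        then show "Bot j \<in> \<Union>d0" by blast
      qed
      moreover have "Bot j \<in> \<Union>ds \<longleftrightarrow> j \<in> through_bots d" unfolding Uds by blast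
      ultimately show ?thesis unfolding Ud d'_def by blast
    qed
    have 3: "(\<forall>v\<in>vertices k. v \<notin> \<Union>d' \<longrightarrow> rows \<gamma> \<beta> v = 0) \<longleftrightarrow> (\<forall>m\<in>{1..k} - {1..r}. \<gamma> m = 0) \<and> (\<forall>j\<in>{1..k}. Bot j \<notin> \<Union>d \<longrightarrow> \<beta> j = 0)"
      unfolding vertices_def ball_Un ball_simps(9) rows.simps using top bot by blast
    show ?thesis unfolding compat_def 3 unfolding d'_def ball_Un 1 2 by blast
  qed
  have compat_d: "compat k d (rows \<alpha> \<beta>) \<longleftrightarrow> (\<forall>e\<in>d0. \<forall>u\<in>e. \<forall>v\<in>e. rows \<alpha> \<beta> u = rows \<alpha> \<beta> v) \<and>
      (\<forall>e\<in>d1. \<forall>u\<in>e. \<forall>v\<in>e. rows \<alpha> \<beta> u = rows \<alpha> \<beta> v) \<and>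
      (\<forall>i\<in>{1..k}. Top i \<notin> \<Union>d \<longrightarrow> \<alpha> i = 0) \<and> (\<forall>j\<in>{1..k}. Bot j \<notin> \<Union>d \<longrightarrow> \<beta> j = 0)" for \<alpha> \<beta>
  proof -
    have split: "d = d0 \<union> d1" by (auto simp: d0_def d1_def)
    have 1: "(\<forall>e\<in>d. \<forall>u\<in>e. \<forall>v\<in>e. rows \<alpha> \<beta> u = rows \<alpha> \<beta> v) \<longleftrightarrow> (\<forall>e\<in>d0. \<forall>u\<in>e. \<forall>v\<in>e. rows \<alpha> \<beta> u = rows \<alpha> \<beta> v) \<and>
      (\<forall>e\<in>d1. \<forall>u\<in>e. \<forall>v\<in>e. rows \<alpha> \<beta> u = rows \<alpha> \<beta> v)" by (subst split) (rule ball_Un)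
    have 2: "(\<forall>v\<in>vertices k. v \<notin> \<Union>d \<longrightarrow> rows \<alpha> \<beta> v = 0) \<longleftrightarrow>
        (\<forall>i\<in>{1..k}. Top i \<notin> \<Union>d \<longrightarrow> \<alpha> i = 0) \<and> (\<forall>j\<in>{1..k}. Bot j \<notin> \<Union>d \<longrightarrow> \<beta> j = 0)"
      unfolding vertices_def ball_Un ball_simps(9) rows.simps ..
    show ?thesis unfolding compat_def 1 2 by simp
  qed
  have eq: "(?n + 1) ^ kappa k y d' * tensor_mat k (compose_diagrams k y d') \<alpha> \<beta> = 1 * tensor_mat k d \<alpha> \<beta>"
    if ab: "\<alpha> \<in> colourings k ?n" "\<beta> \<in> colourings k ?n" for \<alpha> \<beta>
  proof -
    \<comment> \<open>The middle colours are forced by \<open>d'\<close>: on the strands they are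
      copied from the bottom row, elsewhere they are \<open>0\<close>.\<close>
    define \<gamma>0 where "\<gamma>0 = (\<lambda>m\<in>{1..k}. if m \<in> {1..r} then \<beta> (b m) else 0)"
    have g0: "\<gamma>0 \<in> colourings k ?n" using ab(2) bk by (auto simp: \<gamma>0_def colourings_def PiE_def Pi_def)
    have pt: "tensor_mat k y \<alpha> \<gamma> * tensor_mat k d' \<gamma> \<beta> = (if \<gamma> = \<gamma>0 then tensor_mat k d \<alpha> \<beta> else 0)"
      if \<gamma>: "\<gamma> \<in> colourings k ?n" for \<gamma>
    proof (cases "\<gamma> = \<gamma>0")
      case True
      have g12: "\<And>m. m \<in> {1..r} \<Longrightarrow> \<gamma>0 m = \<beta> (b m)" "\<And>m. m \<in> {1..k} - {1..r} \<Longrightarrow> \<gamma>0 m = 0"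
        using rk by (auto simp: \<gamma>0_def)
      then have g1': "\<forall>m\<in>{1..r}. \<gamma>0 m = \<beta> (b m)" "\<forall>m\<in>{1..k} - {1..r}. \<gamma>0 m = 0" by blast+
      have cy: "compat k y (rows \<alpha> \<gamma>0) \<longleftrightarrow> (\<forall>e\<in>d0. \<forall>u\<in>e. \<forall>v\<in>e. rows \<alpha> \<beta> u = rows \<alpha> \<beta> v) \<and> (\<forall>i\<in>{1..k}. Top i \<notin> \<Union>d \<longrightarrow> \<alpha> i = 0)"
        by (rule compat_y) (rule g12, assumption)+
      have "compat k y (rows \<alpha> \<gamma>0) \<and> compat k d' (rows \<gamma>0 \<beta>) \<longleftrightarrow> compat k d (rows \<alpha> \<beta>)"
        unfolding cy compat_d'[of \<gamma>0 \<beta> \<alpha>] compat_d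
        by (intro iffI; elim conjE; intro conjI; (assumption | rule g1'(1) | rule g1'(2)))
      then show ?thesis using True unfolding tensor_mat_def by (metis (full_types) mult_1 mult_zero_left mult_zero_right)
    next
      case False
      have "\<not> compat k d' (rows \<gamma> \<beta>)"
      proof
        assume "compat k d' (rows \<gamma> \<beta>)"
        note c = this[unfolded compat_d'[of \<gamma> \<beta> \<alpha>]]
        have "\<forall>m\<in>{1..r}. \<gamma> m = \<beta> (b m)" "\<forall>m\<in>{1..k} - {1..r}. \<gamma> m = 0"
          by (rule conjunct1[OF c], rule conjunct1[OF conjunct2[OF c]])
        then have "\<gamma> m = \<gamma>0 m" if "m \<in> {1..k}" for m using that by (simp add: \<gamma>0_def)
        then have "\<gamma> = \<gamma>0" using \<gamma> g0 by (intro PiE_ext[of \<gamma> "{1..k}" "\<lambda>_. {0..?n}"]) (auto simp: colourings_def)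
        then show False using False by simp
      qed
      then show ?thesis using False by (simp add: tensor_mat_def)
    qed
    have "(?n + 1) ^ kappa k y d' * tensor_mat k (compose_diagrams k y d') \<alpha> \<beta> =
        (\<Sum>\<gamma>\<in>colourings k ?n. tensor_mat k y \<alpha> \<gamma> * tensor_mat k d' \<gamma> \<beta>)"
      by (rule tensor_mat_compose[OF yR d'R ab, symmetric])
    also have "\<dots> = (\<Sum>\<gamma>\<in>colourings k ?n. if \<gamma> = \<gamma>0 then tensor_mat k d \<alpha> \<beta> else 0)"
      using pt by (intro sum.cong refl)
    also have "\<dots> = 1 * tensor_mat k d \<alpha> \<beta>" using g0 by simp
    finally show ?thesis .
  qed
  have c: "compose_diagrams k y d' \<in> RB_diagrams k" using yR d'R by simp
  have "compose_diagrams k y d' = d" by (rule diagram_eq_if_scaled_tensor_mat_eq(1)[OF c d _ _ eq]) simp_all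
  moreover have "(?n + 1) ^ kappa k y d' = 1" by (rule diagram_eq_if_scaled_tensor_mat_eq(2)[OF c d _ _ eq]) simp_all
  then have "kappa k y d' = 0" using num_colours_pos[of k] by simp
  ultimately show ?thesis using that y d'R by blast
qed

section \<open>Reflection of diagrams, which transposes their matrices\<close>

primrec flip_vertex :: "vertex \<Rightarrow> vertex" where
  "flip_vertex (Top i) = Bot i"
| "flip_vertex (Bot i) = Top i"

definition flip :: "diagram \<Rightarrow> diagram" where
  "flip d = (\<lambda>e. flip_vertex ` e) ` d"

lemma flip_vertex_flip: "flip_vertex (flip_vertex v) = v"
  by (cases v) auto

lemma flip_flip: "flip (flip d) = d"
  by (simp add: flip_def image_image flip_vertex_flip)

lemma inj_flip_vertex: "inj flip_vertex"
  by (rule injI) (metis flip_vertex_flip)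

lemma flip_vertices: "flip_vertex ` vertices k = vertices k"
  by (auto simp: vertices_def image_Un image_image)

lemma flip_closed: "d \<in> RB_diagrams k \<Longrightarrow> flip d \<in> RB_diagrams k"
  using matchings_image[of flip_vertex "vertices k" d] inj_flip_vertex
  by (simp add: RB_diagrams_matchings flip_def flip_vertices inj_on_subset)

lemma tensor_mat_flip: "tensor_mat k (flip d) \<alpha> \<beta> = tensor_mat k d \<beta> \<alpha>"
proof -
  have rf: "rows \<alpha> \<beta> (flip_vertex v) = rows \<beta> \<alpha> v" for v by (cases v) auto
  have 1: "(\<forall>e\<in>flip d. \<forall>u\<in>e. \<forall>v\<in>e. rows \<alpha> \<beta> u = rows \<alpha> \<beta> v) \<longleftrightarrow> (\<forall>e\<in>d. \<forall>u\<in>e. \<forall>v\<in>e. rows \<beta> \<alpha> u = rows \<beta> \<alpha> v)"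
    unfolding flip_def ball_simps(9) rf ..
  have U: "\<Union>(flip d) = flip_vertex ` \<Union>d" by (auto simp: flip_def)
  have "(\<forall>v\<in>vertices k. v \<notin> \<Union>(flip d) \<longrightarrow> rows \<alpha> \<beta> v = 0) \<longleftrightarrow>
      (\<forall>v\<in>flip_vertex ` vertices k. v \<notin> flip_vertex ` \<Union>d \<longrightarrow> rows \<alpha> \<beta> v = 0)"
    unfolding flip_vertices U ..
  also have "\<dots> \<longleftrightarrow> (\<forall>v\<in>vertices k. v \<notin> \<Union>d \<longrightarrow> rows \<beta> \<alpha> v = 0)"
    unfolding ball_simps(9) inj_image_mem_iff[OF inj_flip_vertex] rf ..
  finally show ?thesis unfolding tensor_mat_def compat_def 1 by simp
qed

section \<open>The rook-Brauer algebra as an associative algebra\<close>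

lemma RB_carrier: "a \<in> carrier (RB_algebra k x) \<longleftrightarrow> (\<forall>d. d \<notin> RB_diagrams k \<longrightarrow> a d = 0)"
  by (simp add: RB_algebra_def)

lemma RB_add: "(a \<oplus>\<^bsub>RB_algebra k x\<^esub> b) d = a d + b d"
  and RB_zero: "\<zero>\<^bsub>RB_algebra k x\<^esub> d = 0"
  and RB_smult: "(c \<odot>\<^bsub>RB_algebra k x\<^esub> a) d = c * a d"
  and RB_one: "\<one>\<^bsub>RB_algebra k x\<^esub> d = (if d = id_diagram k then 1 else 0)"
  by (simp_all add: RB_algebra_def)

lemma RB_mult: "(a \<otimes>\<^bsub>RB_algebra k x\<^esub> b) d = (\<Sum>d1\<in>RB_diagrams k. \<Sum>d2\<in>RB_diagrams k.
    if compose_diagrams k d1 d2 = d then a d1 * b d2 * x ^ kappa k d1 d2 else 0)"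
  by (simp add: RB_algebra_def)

text \<open>Here \<open>g\<close> is a linear functional, given by its values on diagrams. Moving
  the sum over the target diagram inside leaves only the composite. The representations below are
  multiplied out in this way.\<close>

lemma RB_mult_pairing:
  "(\<Sum>d\<in>RB_diagrams k. (a \<otimes>\<^bsub>RB_algebra k x\<^esub> b) d * g d) =
   (\<Sum>d1\<in>RB_diagrams k. \<Sum>d2\<in>RB_diagrams k. a d1 * b d2 * x ^ kappa k d1 d2 * g (compose_diagrams k d1 d2))"
proof -
  let ?D = "RB_diagrams k"
  have "(\<Sum>d\<in>?D. (a \<otimes>\<^bsub>RB_algebra k x\<^esub> b) d * g d) =
      (\<Sum>d\<in>?D. \<Sum>d1\<in>?D. \<Sum>d2\<in>?D. if d = compose_diagrams k d1 d2 then a d1 * b d2 * x ^ kappa k d1 d2 * g d else 0)"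
    unfolding RB_mult sum_distrib_right by (intro sum.cong refl) auto
  also have "\<dots> = (\<Sum>d1\<in>?D. \<Sum>d\<in>?D. \<Sum>d2\<in>?D. if d = compose_diagrams k d1 d2 then a d1 * b d2 * x ^ kappa k d1 d2 * g d else 0)"
    by (rule sum.swap)
  also have "\<dots> = (\<Sum>d1\<in>?D. \<Sum>d2\<in>?D. \<Sum>d\<in>?D. if d = compose_diagrams k d1 d2 then a d1 * b d2 * x ^ kappa k d1 d2 * g d else 0)"
    by (intro sum.cong refl sum.swap)
  also have "\<dots> = (\<Sum>d1\<in>?D. \<Sum>d2\<in>?D. a d1 * b d2 * x ^ kappa k d1 d2 * g (compose_diagrams k d1 d2))"
    by (intro sum.cong refl) (simp add: sum.delta)
  finally show ?thesis .
qed

lemma RB_mult_closed: "a \<otimes>\<^bsub>RB_algebra k x\<^esub> b \<in> carrier (RB_algebra k x)"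
  unfolding RB_carrier
proof (intro allI impI)
  fix d assume "d \<notin> RB_diagrams k"
  then have "compose_diagrams k d1 d2 \<noteq> d" if "d1 \<in> RB_diagrams k" "d2 \<in> RB_diagrams k" for d1 d2
    using compose_closed[OF that] by blast
  then show "(a \<otimes>\<^bsub>RB_algebra k x\<^esub> b) d = 0" unfolding RB_mult by (intro sum.neutral ballI) simp
qed

lemma RB_mult_assoc:
  "(a \<otimes>\<^bsub>RB_algebra k x\<^esub> b) \<otimes>\<^bsub>RB_algebra k x\<^esub> c = a \<otimes>\<^bsub>RB_algebra k x\<^esub> (b \<otimes>\<^bsub>RB_algebra k x\<^esub> c)"
proof
  fix d
  let ?D = "RB_diagrams k" and ?m = "\<lambda>a b. a \<otimes>\<^bsub>RB_algebra k x\<^esub> b"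
  have "?m (?m a b) c d = (\<Sum>e\<in>?D. \<Sum>d3\<in>?D. ?m a b e * (if compose_diagrams k e d3 = d then c d3 * x ^ kappa k e d3 else 0))"
    unfolding RB_mult[of k x "?m a b"] by (intro sum.cong refl) simp
  also have "\<dots> = (\<Sum>d3\<in>?D. \<Sum>e\<in>?D. ?m a b e * (if compose_diagrams k e d3 = d then c d3 * x ^ kappa k e d3 else 0))"
    by (rule sum.swap)
  also have "\<dots> = (\<Sum>d3\<in>?D. \<Sum>d1\<in>?D. \<Sum>d2\<in>?D. a d1 * b d2 * x ^ kappa k d1 d2 *
      (if compose_diagrams k (compose_diagrams k d1 d2) d3 = d then c d3 * x ^ kappa k (compose_diagrams k d1 d2) d3 else 0))"
    by (simp only: RB_mult_pairing)
  also have "\<dots> = (\<Sum>d1\<in>?D. \<Sum>d3\<in>?D. \<Sum>d2\<in>?D. a d1 * b d2 * x ^ kappa k d1 d2 *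
      (if compose_diagrams k (compose_diagrams k d1 d2) d3 = d then c d3 * x ^ kappa k (compose_diagrams k d1 d2) d3 else 0))"
    by (rule sum.swap)
  also have "\<dots> = (\<Sum>d1\<in>?D. \<Sum>d2\<in>?D. \<Sum>d3\<in>?D. a d1 * b d2 * x ^ kappa k d1 d2 *
      (if compose_diagrams k (compose_diagrams k d1 d2) d3 = d then c d3 * x ^ kappa k (compose_diagrams k d1 d2) d3 else 0))"
    by (intro sum.cong refl sum.swap)
  also have "\<dots> = (\<Sum>d1\<in>?D. \<Sum>d2\<in>?D. \<Sum>d3\<in>?D. b d2 * c d3 * x ^ kappa k d2 d3 *
      (if compose_diagrams k d1 (compose_diagrams k d2 d3) = d then a d1 * x ^ kappa k d1 (compose_diagrams k d2 d3) else 0))"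
  proof (intro sum.cong refl)
    fix d1 d2 d3 assume D: "d1 \<in> ?D" "d2 \<in> ?D" "d3 \<in> ?D"
    note as = compose_kappa_assoc[OF D]
    have "x ^ kappa k d1 d2 * x ^ kappa k (compose_diagrams k d1 d2) d3 = x ^ kappa k d2 d3 * x ^ kappa k d1 (compose_diagrams k d2 d3)"
      using as(2) by (simp flip: power_add)
    then show "a d1 * b d2 * x ^ kappa k d1 d2 *
      (if compose_diagrams k (compose_diagrams k d1 d2) d3 = d then c d3 * x ^ kappa k (compose_diagrams k d1 d2) d3 else 0) =
      b d2 * c d3 * x ^ kappa k d2 d3 *
      (if compose_diagrams k d1 (compose_diagrams k d2 d3) = d then a d1 * x ^ kappa k d1 (compose_diagrams k d2 d3) else 0)"
      unfolding as(1) by (simp add: mult_ac)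
  qed
  also have "\<dots> = (\<Sum>d1\<in>?D. \<Sum>e\<in>?D. ?m b c e * (if compose_diagrams k d1 e = d then a d1 * x ^ kappa k d1 e else 0))"
    by (simp only: RB_mult_pairing)
  also have "\<dots> = ?m a (?m b c) d"
    unfolding RB_mult[of k x a] by (intro sum.cong refl) simp
  finally show "?m (?m a b) c d = ?m a (?m b c) d" .
qed

definition basis_diagram :: "diagram \<Rightarrow> diagram \<Rightarrow> complex" where
  "basis_diagram e = (\<lambda>d. if d = e then 1 else 0)"

lemma RB_mult_basis:
  assumes "e \<in> RB_diagrams k"
  shows "(a \<otimes>\<^bsub>RB_algebra k x\<^esub> basis_diagram e) z =
    (\<Sum>d\<in>RB_diagrams k. a d * (if compose_diagrams k d e = z then x ^ kappa k d e else 0))"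
proof -
  have "(a \<otimes>\<^bsub>RB_algebra k x\<^esub> basis_diagram e) z =
      (\<Sum>d\<in>RB_diagrams k. \<Sum>d2\<in>RB_diagrams k. if d2 = e then a d * (if compose_diagrams k d e = z then x ^ kappa k d e else 0) else 0)"
    unfolding RB_mult basis_diagram_def by (intro sum.cong refl) auto
  then show ?thesis using assms by simp
qed

lemma basis_mult_basis:
  assumes "d \<in> RB_diagrams k" "e \<in> RB_diagrams k" "kappa k d e = 0"
  shows "basis_diagram d \<otimes>\<^bsub>RB_algebra k x\<^esub> basis_diagram e = basis_diagram (compose_diagrams k d e)"
proof
  fix z
  have "(basis_diagram d \<otimes>\<^bsub>RB_algebra k x\<^esub> basis_diagram e) z =
      (\<Sum>d'\<in>RB_diagrams k. if d' = d then (if compose_diagrams k d e = z then x ^ kappa k d e else 0) else 0)"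
    unfolding RB_mult_basis[OF assms(2)] by (intro sum.cong refl) (auto simp: basis_diagram_def)
  then show "(basis_diagram d \<otimes>\<^bsub>RB_algebra k x\<^esub> basis_diagram e) z = basis_diagram (compose_diagrams k d e) z"
    using assms by (auto simp: basis_diagram_def)
qed

lemma RB_mult_expand: "(a \<otimes>\<^bsub>RB_algebra k x\<^esub> b) z = (\<Sum>e\<in>RB_diagrams k. b e * (a \<otimes>\<^bsub>RB_algebra k x\<^esub> basis_diagram e) z)"
proof -
  have "(a \<otimes>\<^bsub>RB_algebra k x\<^esub> b) z = (\<Sum>e\<in>RB_diagrams k. \<Sum>d\<in>RB_diagrams k. if compose_diagrams k d e = z then a d * b e * x ^ kappa k d e else 0)"
    unfolding RB_mult by (rule sum.swap)
  also have "\<dots> = (\<Sum>e\<in>RB_diagrams k. b e * (a \<otimes>\<^bsub>RB_algebra k x\<^esub> basis_diagram e) z)"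
    by (intro sum.cong refl) (simp add: RB_mult_basis sum_distrib_left if_distrib[of "\<lambda>t. _ * t"] mult_ac cong: if_cong)
  finally show ?thesis .
qed

lemma ring_RB_algebra: "ring (RB_algebra k x)"
proof (rule ringI)
  let ?A = "RB_algebra k x"
  show "abelian_group ?A"
  proof (rule abelian_groupI)
    fix a assume "a \<in> carrier ?A"
    then show "\<exists>b\<in>carrier ?A. b \<oplus>\<^bsub>?A\<^esub> a = \<zero>\<^bsub>?A\<^esub>"
      by (intro bexI[of _ "\<lambda>d. - a d"]) (auto simp: RB_carrier RB_add RB_zero fun_eq_iff)
  qed (auto simp: RB_carrier RB_add RB_zero fun_eq_iff)
  show "Group.monoid ?A"
  proof
    show "\<one>\<^bsub>?A\<^esub> \<in> carrier ?A" by (auto simp: RB_carrier RB_one)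
  next
    fix a assume a: "a \<in> carrier ?A"
    have "(\<one>\<^bsub>?A\<^esub> \<otimes>\<^bsub>?A\<^esub> a) z = a z" for z
    proof -
      have "(\<one>\<^bsub>?A\<^esub> \<otimes>\<^bsub>?A\<^esub> a) z = (\<Sum>d1\<in>RB_diagrams k. if d1 = id_diagram k then (\<Sum>d2\<in>RB_diagrams k. if d2 = z then a z else 0) else 0)"
        unfolding RB_mult RB_one by (intro sum.cong refl) (auto simp: compose_id intro!: sum.cong)
      then show ?thesis using a by (auto simp: RB_carrier)
    qed
    then show "\<one>\<^bsub>?A\<^esub> \<otimes>\<^bsub>?A\<^esub> a = a" by blast
    have "(a \<otimes>\<^bsub>?A\<^esub> \<one>\<^bsub>?A\<^esub>) z = a z" for z
    proof -
      have "(a \<otimes>\<^bsub>?A\<^esub> basis_diagram (id_diagram k)) z = (\<Sum>d\<in>RB_diagrams k. if d = z then a z else 0)"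
        unfolding RB_mult_basis[OF id_diagram_closed] by (intro sum.cong refl) (auto simp: compose_id)
      moreover have "\<one>\<^bsub>?A\<^esub> = basis_diagram (id_diagram k)" by (auto simp: RB_one basis_diagram_def fun_eq_iff)
      ultimately show ?thesis using a by (auto simp: RB_carrier)
    qed
    then show "a \<otimes>\<^bsub>?A\<^esub> \<one>\<^bsub>?A\<^esub> = a" by blast
  qed (simp_all add: RB_mult_closed RB_mult_assoc)
next
  let ?A = "RB_algebra k x"
  fix a b c
  show "(a \<oplus>\<^bsub>?A\<^esub> b) \<otimes>\<^bsub>?A\<^esub> c = a \<otimes>\<^bsub>?A\<^esub> c \<oplus>\<^bsub>?A\<^esub> b \<otimes>\<^bsub>?A\<^esub> c"
    unfolding fun_eq_iff RB_add RB_mult sum.distrib[symmetric]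
    by (intro allI sum.cong refl) (simp add: RB_add distrib_right)
  show "c \<otimes>\<^bsub>?A\<^esub> (a \<oplus>\<^bsub>?A\<^esub> b) = c \<otimes>\<^bsub>?A\<^esub> a \<oplus>\<^bsub>?A\<^esub> c \<otimes>\<^bsub>?A\<^esub> b"
    unfolding fun_eq_iff RB_add RB_mult sum.distrib[symmetric]
    by (intro allI sum.cong refl) (simp add: RB_add distrib_left distrib_right)
qed

lemma assoc_algebra_RB: "assoc_algebra class_ring (RB_algebra k x)"
proof -
  let ?A = "RB_algebra k x"
  interpret ring ?A by (rule ring_RB_algebra)
  have "Module.module_axioms class_ring ?A"
    unfolding Module.module_axioms_def by (auto simp: RB_carrier RB_add RB_smult fun_eq_iff algebra_simps)
  then have "Module.module class_ring ?A" using is_abelian_group by (simp add: module_class_ring_iff)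
  moreover have "assoc_algebra_axioms class_ring ?A"
  proof
    fix c a b
    show "(c \<odot>\<^bsub>?A\<^esub> a) \<otimes>\<^bsub>?A\<^esub> b = c \<odot>\<^bsub>?A\<^esub> (a \<otimes>\<^bsub>?A\<^esub> b)"
      unfolding fun_eq_iff RB_smult RB_mult sum_distrib_left by (intro allI sum.cong refl) (simp add: RB_smult mult.assoc)
    show "a \<otimes>\<^bsub>?A\<^esub> (c \<odot>\<^bsub>?A\<^esub> b) = c \<odot>\<^bsub>?A\<^esub> (a \<otimes>\<^bsub>?A\<^esub> b)"
      unfolding fun_eq_iff RB_smult RB_mult sum_distrib_left by (intro allI sum.cong refl) (simp add: RB_smult mult_ac)
  qed
  ultimately show ?thesis by (simp add: assoc_algebra_def ring_axioms)
qed

section \<open>The filtration by the number of through strands\<close>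

text \<open>The coefficient of \<open>y\<close> in the action of \<open>a\<close> on
  \<open>y'\<close>. With both indices restricted to half diagrams with \<open>r\<close> strands,
  composites with fewer strands are not recorded, which amounts to passing to a quotient.\<close>

definition half_rep :: "nat \<Rightarrow> complex \<Rightarrow> (diagram \<Rightarrow> complex) \<Rightarrow> diagram \<Rightarrow> diagram \<Rightarrow> complex" where
  "half_rep k x a y y' = (\<Sum>d\<in>RB_diagrams k. a d * (if compose_diagrams k d y' = y then x ^ kappa k d y' else 0))"

text \<open>On the right, terms whose inner composite has lost strands are missing. On the left they
  vanish as well, because the lost strands cannot be regained and so \<open>y\<close> is not
  reached.\<close>

lemma half_rep_mult:
  assumes r: "r \<le> k" and y: "y \<in> half_diagrams k r" "y'' \<in> half_diagrams k r"
  shows "half_rep k x (a \<otimes>\<^bsub>RB_algebra k x\<^esub> b) y y'' = (\<Sum>y'\<in>half_diagrams k r. half_rep k x a y y' * half_rep k x b y' y'')"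
proof -
  let ?D = "RB_diagrams k" and ?X = "half_diagrams k r"
  have yR: "y'' \<in> ?D" by (rule half_diagrams_RB[OF r y(2)])
  let ?t = "\<lambda>d1 d2. a d1 * b d2 * (x ^ kappa k d2 y'' * x ^ kappa k d1 (compose_diagrams k d2 y''))"
  have "half_rep k x (a \<otimes>\<^bsub>RB_algebra k x\<^esub> b) y y'' = (\<Sum>d1\<in>?D. \<Sum>d2\<in>?D. a d1 * b d2 * x ^ kappa k d1 d2 *
      (if compose_diagrams k (compose_diagrams k d1 d2) y'' = y then x ^ kappa k (compose_diagrams k d1 d2) y'' else 0))"
    unfolding half_rep_def RB_mult_pairing ..
  also have "\<dots> = (\<Sum>d1\<in>?D. \<Sum>d2\<in>?D. if compose_diagrams k d1 (compose_diagrams k d2 y'') = y then ?t d1 d2 else 0)"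
  proof (intro sum.cong refl)
    fix d1 d2 assume D: "d1 \<in> ?D" "d2 \<in> ?D"
    note as = compose_kappa_assoc[OF D yR]
    have "x ^ kappa k d1 d2 * x ^ kappa k (compose_diagrams k d1 d2) y'' = x ^ kappa k d2 y'' * x ^ kappa k d1 (compose_diagrams k d2 y'')"
      using as(2) by (simp flip: power_add)
    then show "a d1 * b d2 * x ^ kappa k d1 d2 *
      (if compose_diagrams k (compose_diagrams k d1 d2) y'' = y then x ^ kappa k (compose_diagrams k d1 d2) y'' else 0) =
      (if compose_diagrams k d1 (compose_diagrams k d2 y'') = y then ?t d1 d2 else 0)"
      unfolding as(1) by (simp add: mult.assoc)
  qed
  also have "\<dots> = (\<Sum>d1\<in>?D. \<Sum>d2\<in>?D. \<Sum>y'\<in>?X. a d1 * (if compose_diagrams k d1 y' = y then x ^ kappa k d1 y' else 0) *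
       (b d2 * (if compose_diagrams k d2 y'' = y' then x ^ kappa k d2 y'' else 0)))"
  proof (intro sum.cong refl)
    fix d1 d2 assume D: "d1 \<in> ?D" "d2 \<in> ?D"
    let ?z = "compose_diagrams k d2 y''"
    have "(\<Sum>y'\<in>?X. a d1 * (if compose_diagrams k d1 y' = y then x ^ kappa k d1 y' else 0) *
       (b d2 * (if ?z = y' then x ^ kappa k d2 y'' else 0))) =
       (\<Sum>y'\<in>?X. if y' = ?z then (if compose_diagrams k d1 ?z = y then ?t d1 d2 else 0) else 0)"
      by (intro sum.cong refl) auto
    also have "\<dots> = (if compose_diagrams k d1 ?z = y then ?t d1 d2 else 0)"
      using compose_half_diagramD[OF r D y(2)] y(1) by auto
    finally show "(if compose_diagrams k d1 ?z = y then ?t d1 d2 else 0) =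
       (\<Sum>y'\<in>?X. a d1 * (if compose_diagrams k d1 y' = y then x ^ kappa k d1 y' else 0) *
       (b d2 * (if ?z = y' then x ^ kappa k d2 y'' else 0)))" by simp
  qed
  also have "\<dots> = (\<Sum>d1\<in>?D. \<Sum>y'\<in>?X. \<Sum>d2\<in>?D. a d1 * (if compose_diagrams k d1 y' = y then x ^ kappa k d1 y' else 0) *
       (b d2 * (if compose_diagrams k d2 y'' = y' then x ^ kappa k d2 y'' else 0)))"
    by (intro sum.cong refl sum.swap)
  also have "\<dots> = (\<Sum>y'\<in>?X. \<Sum>d1\<in>?D. \<Sum>d2\<in>?D. a d1 * (if compose_diagrams k d1 y' = y then x ^ kappa k d1 y' else 0) *
       (b d2 * (if compose_diagrams k d2 y'' = y' then x ^ kappa k d2 y'' else 0)))"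
    by (rule sum.swap)
  also have "\<dots> = (\<Sum>y'\<in>?X. half_rep k x a y y' * half_rep k x b y' y'')"
    unfolding half_rep_def sum_product ..
  finally show ?thesis .
qed

lemma half_rep_one:
  assumes r: "r \<le> k" and y: "y' \<in> half_diagrams k r"
  shows "half_rep k x \<one>\<^bsub>RB_algebra k x\<^esub> y y' = (if y = y' then 1 else 0)"
proof -
  have "half_rep k x \<one>\<^bsub>RB_algebra k x\<^esub> y y' = (\<Sum>d\<in>RB_diagrams k. if d = id_diagram k then (if y = y' then 1 else 0) else 0)"
    unfolding half_rep_def RB_one using compose_id[OF half_diagrams_RB[OF r y]] by (intro sum.cong refl) auto
  then show ?thesis by simp
qed

lemma half_rep_relabel:
  assumes r: "r \<le> k" and \<sigma>: "\<sigma> permutes {1..r}" and y: "y' \<in> half_diagrams k r"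
  shows "half_rep k x a (relabel y \<sigma>) (relabel y' \<sigma>) = half_rep k x a y y'"
  unfolding half_rep_def
proof (intro sum.cong refl)
  fix d assume d: "d \<in> RB_diagrams k"
  have yR: "y' \<in> RB_diagrams k" by (rule half_diagrams_RB[OF r y])
  note c = compose_relabel[OF permutes_le[OF \<sigma> r] d yR]
  have "relabel u \<sigma> = relabel v \<sigma> \<longleftrightarrow> u = v" for u v
  proof
    assume "relabel u \<sigma> = relabel v \<sigma>"
    then have "relabel (relabel u \<sigma>) (inv_into UNIV \<sigma>) = relabel (relabel v \<sigma>) (inv_into UNIV \<sigma>)" by simp
    then have "relabel u (\<sigma> \<circ> inv_into UNIV \<sigma>) = relabel v (\<sigma> \<circ> inv_into UNIV \<sigma>)"
      by (simp only: relabel_comp[OF \<sigma> permutes_inv[OF \<sigma>]])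
    then show "u = v" by (simp only: permutes_inv_o(1)[OF \<sigma>] relabel_id)
  qed simp
  then show "a d * (if compose_diagrams k d (relabel y' \<sigma>) = relabel y \<sigma> then x ^ kappa k d (relabel y' \<sigma>) else 0) =
      a d * (if compose_diagrams k d y' = y then x ^ kappa k d y' else 0)"
    unfolding c by simp
qed

definition rank_below :: "nat \<Rightarrow> nat \<Rightarrow> (diagram \<Rightarrow> complex) set" where
  "rank_below k r = {a. \<forall>d. a d \<noteq> 0 \<longrightarrow> d \<in> RB_diagrams k \<and> card (through_tops d) < r}"

lemma rank_below_0: "rank_below k 0 = {\<zero>\<^bsub>RB_algebra k x\<^esub>}"
  by (auto simp: rank_below_def RB_zero fun_eq_iff)

lemma rank_below_Suc: "rank_below k (Suc k) = carrier (RB_algebra k x)"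
proof -
  have "card (through_tops d) < Suc k" if "d \<in> RB_diagrams k" for d
    using card_mono[OF _ through_subset(1)[OF that]] by simp
  then show ?thesis unfolding rank_below_def by (intro Set.set_eqI) (unfold RB_carrier mem_Collect_eq, blast)
qed

text \<open>Write a diagram \<open>e\<close> with \<open>r\<close> through strands as
  \<open>y d'\<close> with a half diagram \<open>y\<close>. A half diagram in \<open>a y\<close> has
  an entry of \<open>half_rep\<close> as coefficient, which is zero, so \<open>a y\<close> involves
  only diagrams with fewer strands, and \<open>d'\<close> on the right creates none. For diagrams
  with fewer strands than \<open>r\<close> the bound is preserved by any left factor.\<close>

lemma rank_below_mult:
  assumes ker: "\<And>r y y'. r \<le> k \<Longrightarrow> y \<in> half_diagrams k r \<Longrightarrow> y' \<in> half_diagrams k r \<Longrightarrow> half_rep k x a y y' = 0"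
    and b: "b \<in> rank_below k (Suc r)"
  shows "a \<otimes>\<^bsub>RB_algebra k x\<^esub> b \<in> rank_below k r"
proof -
  let ?m = "\<lambda>a b. a \<otimes>\<^bsub>RB_algebra k x\<^esub> b"
  have key: "card (through_tops z) < r" if e: "e \<in> RB_diagrams k" "card (through_tops e) \<le> r"
    and nz: "?m a (basis_diagram e) z \<noteq> 0" for e z
  proof (cases "card (through_tops e) = r")
    case False
    have "\<exists>d\<in>RB_diagrams k. compose_diagrams k d e = z"
    proof (rule ccontr)
      assume "\<not> ?thesis"
      then have "?m a (basis_diagram e) z = 0" unfolding RB_mult_basis[OF e(1)] by (intro sum.neutral) auto
      then show False using nz by simp
    qed
    then obtain d where d: "d \<in> RB_diagrams k" "compose_diagrams k d e = z" by blast
    then have z: "z \<in> RB_diagrams k" using e by auto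
    have "through_bots z \<subseteq> through_bots e" using through_bots_compose[OF d(1) e(1)] d(2) by simp
    then have "card (through_bots z) \<le> card (through_bots e)"
      using through_subset(2)[OF e(1)] by (intro card_mono) (auto intro: finite_subset)
    then show ?thesis using False e(2) card_through[OF z] card_through[OF e(1)] by simp
  next
    case True
    then have "card (through_bots e) = r" using card_through[OF e(1)] by simp
    then obtain y d' where y: "y \<in> half_diagrams k r" "d' \<in> RB_diagrams k" "compose_diagrams k y d' = e" "kappa k y d' = 0"
      using factor_through_half_diagram[OF e(1)] by metis
    have rk: "r \<le> k" using card_mono[OF _ through_subset(1)[OF e(1)]] True by simp
    have yR: "y \<in> RB_diagrams k" by (rule half_diagrams_RB[OF rk y(1)])
    have low: "card (through_tops w) < r" if w: "?m a (basis_diagram y) w \<noteq> 0" for w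
    proof -
      have "\<exists>d\<in>RB_diagrams k. compose_diagrams k d y = w"
      proof (rule ccontr)
        assume "\<not> ?thesis"
        then have "?m a (basis_diagram y) w = 0" unfolding RB_mult_basis[OF yR] by (intro sum.neutral) auto
        then show False using w by simp
      qed
      then obtain d where d: "d \<in> RB_diagrams k" "compose_diagrams k d y = w" by blast
      then have wR: "w \<in> RB_diagrams k" using yR by auto
      have sub: "through_bots w \<subseteq> {1..r}" using compose_half_diagram(2)[OF rk d(1) y(1)] d(2) by simp
      have "through_bots w \<noteq> {1..r}"
      proof
        assume "through_bots w = {1..r}"
        then have "w \<in> half_diagrams k r" using compose_half_diagram(1)[OF rk d(1) y(1)] d(2) by simp
        then have "half_rep k x a w y = 0" using ker[OF rk _ y(1)] by blast
        then show False using w unfolding RB_mult_basis[OF yR] half_rep_def by simp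
      qed
      then have "card (through_bots w) < r" using psubset_card_mono[of "{1..r}" "through_bots w"] sub by auto
      then show ?thesis using card_through[OF wR] by simp
    qed
    have "basis_diagram e = ?m (basis_diagram y) (basis_diagram d')"
      using basis_mult_basis[OF yR y(2,4)] y(3) by simp
    then have eq: "?m a (basis_diagram e) = ?m (?m a (basis_diagram y)) (basis_diagram d')"
      by (simp add: RB_mult_assoc)
    have "\<exists>w\<in>RB_diagrams k. ?m a (basis_diagram y) w \<noteq> 0 \<and> compose_diagrams k w d' = z"
    proof (rule ccontr)
      assume "\<not> ?thesis"
      then have "?m (?m a (basis_diagram y)) (basis_diagram d') z = 0"
        unfolding RB_mult_basis[OF y(2)] by (intro sum.neutral) auto
      then show False using nz eq by simp
    qed
    then obtain w where w: "w \<in> RB_diagrams k" "?m a (basis_diagram y) w \<noteq> 0" "compose_diagrams k w d' = z" by blast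
    have "through_tops z \<subseteq> through_tops w" using through_tops_compose[OF w(1) y(2)] w(3) by simp
    then have "card (through_tops z) \<le> card (through_tops w)"
      using through_subset(1)[OF w(1)] by (intro card_mono) (auto intro: finite_subset)
    then show ?thesis using low[OF w(2)] by simp
  qed
  have "card (through_tops z) < r" if nz: "?m a b z \<noteq> 0" for z
  proof -
    have "\<exists>e\<in>RB_diagrams k. b e \<noteq> 0 \<and> ?m a (basis_diagram e) z \<noteq> 0"
    proof (rule ccontr)
      assume "\<not> ?thesis"
      then have "?m a b z = 0"
        unfolding RB_mult_expand[of k x a b] by (intro sum.neutral) auto
      then show False using nz by simp
    qed
    then obtain e where e: "e \<in> RB_diagrams k" "b e \<noteq> 0" "?m a (basis_diagram e) z \<noteq> 0" by blast
    then have "card (through_tops e) \<le> r" using b by (auto simp: rank_below_def)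
    then show ?thesis using key e by blast
  qed
  moreover have "z \<in> RB_diagrams k" if "?m a b z \<noteq> 0" for z
    using RB_mult_closed[of k x a b] that unfolding RB_carrier by blast
  ultimately show ?thesis by (simp add: rank_below_def)
qed

section \<open>Faithfulness at a large integer parameter\<close>

definition tensor_rep :: "nat \<Rightarrow> (diagram \<Rightarrow> complex) \<Rightarrow> (nat \<Rightarrow> nat) \<Rightarrow> (nat \<Rightarrow> nat) \<Rightarrow> complex" where
  "tensor_rep k a \<alpha> \<beta> = (\<Sum>d\<in>RB_diagrams k. a d * of_nat (tensor_mat k d \<alpha> \<beta>))"

lemma tensor_rep_mult:
  assumes "\<alpha> \<in> colourings k n" "\<beta> \<in> colourings k n"
  shows "tensor_rep k (a \<otimes>\<^bsub>RB_algebra k (of_nat (n + 1))\<^esub> b) \<alpha> \<beta> =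
    (\<Sum>\<gamma>\<in>colourings k n. tensor_rep k a \<alpha> \<gamma> * tensor_rep k b \<gamma> \<beta>)"
proof -
  let ?D = "RB_diagrams k" and ?C = "colourings k n"
  have "tensor_rep k (a \<otimes>\<^bsub>RB_algebra k (of_nat (n + 1))\<^esub> b) \<alpha> \<beta> =
      (\<Sum>d1\<in>?D. \<Sum>d2\<in>?D. a d1 * b d2 * of_nat (n + 1) ^ kappa k d1 d2 * of_nat (tensor_mat k (compose_diagrams k d1 d2) \<alpha> \<beta>))"
    unfolding tensor_rep_def by (rule RB_mult_pairing)
  also have "\<dots> = (\<Sum>d1\<in>?D. \<Sum>d2\<in>?D. \<Sum>\<gamma>\<in>?C. a d1 * of_nat (tensor_mat k d1 \<alpha> \<gamma>) * (b d2 * of_nat (tensor_mat k d2 \<gamma> \<beta>)))"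
  proof (intro sum.cong refl)
    fix d1 d2 assume D: "d1 \<in> ?D" "d2 \<in> ?D"
    have "of_nat (n + 1) ^ kappa k d1 d2 * of_nat (tensor_mat k (compose_diagrams k d1 d2) \<alpha> \<beta>) =
        (of_nat (\<Sum>\<gamma>\<in>?C. tensor_mat k d1 \<alpha> \<gamma> * tensor_mat k d2 \<gamma> \<beta>) :: complex)"
      unfolding tensor_mat_compose[OF D assms] by simp
    then show "a d1 * b d2 * of_nat (n + 1) ^ kappa k d1 d2 * of_nat (tensor_mat k (compose_diagrams k d1 d2) \<alpha> \<beta>) =
        (\<Sum>\<gamma>\<in>?C. a d1 * of_nat (tensor_mat k d1 \<alpha> \<gamma>) * (b d2 * of_nat (tensor_mat k d2 \<gamma> \<beta>)))"
      by (simp add: mult.assoc sum_distrib_left mult_ac)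
  qed
  also have "\<dots> = (\<Sum>d1\<in>?D. \<Sum>\<gamma>\<in>?C. \<Sum>d2\<in>?D. a d1 * of_nat (tensor_mat k d1 \<alpha> \<gamma>) * (b d2 * of_nat (tensor_mat k d2 \<gamma> \<beta>)))"
    by (intro sum.cong refl sum.swap)
  also have "\<dots> = (\<Sum>\<gamma>\<in>?C. \<Sum>d1\<in>?D. \<Sum>d2\<in>?D. a d1 * of_nat (tensor_mat k d1 \<alpha> \<gamma>) * (b d2 * of_nat (tensor_mat k d2 \<gamma> \<beta>)))"
    by (rule sum.swap)
  finally show ?thesis unfolding tensor_rep_def sum_product .
qed

text \<open>Take \<open>d\<close> maximal under inclusion in the support of \<open>a\<close>. A
  generic colouring of \<open>d\<close> is compatible only with diagrams containing
  \<open>d\<close>, so the corresponding entry is the coefficient \<open>a d\<close>.\<close>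

lemma tensor_rep_inj:
  assumes a: "a \<in> carrier (RB_algebra k x)"
    and z: "\<And>\<alpha> \<beta>. \<alpha> \<in> colourings k (num_colours k) \<Longrightarrow> \<beta> \<in> colourings k (num_colours k) \<Longrightarrow> tensor_rep k a \<alpha> \<beta> = 0"
  shows "a = \<zero>\<^bsub>RB_algebra k x\<^esub>"
proof (rule ccontr)
  assume ne: "a \<noteq> \<zero>\<^bsub>RB_algebra k x\<^esub>"
  let ?S = "{d \<in> RB_diagrams k. a d \<noteq> 0}"
  have "?S \<noteq> {}"
  proof
    assume "?S = {}"
    then have "a d = 0" for d using a by (cases "d \<in> RB_diagrams k") (auto simp: RB_carrier)
    then show False using ne by (auto simp: fun_eq_iff RB_zero)
  qed
  moreover have "finite ?S" by simp
  ultimately obtain d where d: "d \<in> ?S" "\<And>d'. d' \<in> ?S \<Longrightarrow> d \<subseteq> d' \<Longrightarrow> d = d'"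
    using finite_has_maximal[of ?S] by blast
  obtain \<alpha> \<beta> where ab: "\<alpha> \<in> colourings k (num_colours k)" "\<beta> \<in> colourings k (num_colours k)" "compat k d (rows \<alpha> \<beta>)"
      "\<And>d'. d' \<in> RB_diagrams k \<Longrightarrow> compat k d' (rows \<alpha> \<beta>) \<Longrightarrow> d \<subseteq> d'"
    using ex_generic_colouring[of d k] d(1) by blast
  have "tensor_rep k a \<alpha> \<beta> = (\<Sum>d'\<in>RB_diagrams k. if d' = d then a d else 0)"
    unfolding tensor_rep_def
  proof (intro sum.cong refl)
    fix d' assume d': "d' \<in> RB_diagrams k"
    show "a d' * of_nat (tensor_mat k d' \<alpha> \<beta>) = (if d' = d then a d else 0)"
    proof (cases "d' = d")
      case True
      then show ?thesis using ab(3) by (simp add: tensor_mat_def)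
    next
      case False
      then have "a d' = 0 \<or> \<not> compat k d' (rows \<alpha> \<beta>)" using d(2)[of d'] ab(4)[OF d'] d' by blast
      then show ?thesis using False by (auto simp: tensor_mat_def)
    qed
  qed
  also have "\<dots> = a d" using d(1) by simp
  finally show False using z[OF ab(1,2)] d(1) by simp
qed

text \<open>The conjugate-linear extension of the reflection; the tensor representation turns it
  into the adjoint matrix.\<close>

definition star :: "(diagram \<Rightarrow> complex) \<Rightarrow> diagram \<Rightarrow> complex" where
  "star a d = cnj (a (flip d))"

lemma star_closed: "a \<in> carrier (RB_algebra k x) \<Longrightarrow> star a \<in> carrier (RB_algebra k x)"
  unfolding RB_carrier star_def by (metis flip_closed flip_flip complex_cnj_zero)

lemma tensor_rep_star: "tensor_rep k (star a) \<alpha> \<beta> = cnj (tensor_rep k a \<beta> \<alpha>)"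
proof -
  have "tensor_rep k (star a) \<alpha> \<beta> = (\<Sum>d\<in>RB_diagrams k. cnj (a d) * of_nat (tensor_mat k d \<beta> \<alpha>))"
    unfolding tensor_rep_def star_def
    by (rule sum.reindex_bij_witness[of _ flip flip]) (auto simp: flip_flip flip_closed tensor_mat_flip)
  then show ?thesis by (simp add: tensor_rep_def)
qed

text \<open>Tensor space with the standard inner product carries a faithful \<open>*\<close>-representation, and a
  nilpotent self-adjoint matrix vanishes.\<close>

lemma nil_left_ideal_zero_at_integer:
  fixes k :: nat
  defines "x0 \<equiv> of_nat (num_colours k + 1) :: complex"
  assumes N: "N \<subseteq> carrier (RB_algebra k x0)"
    and left: "\<And>b a. b \<in> carrier (RB_algebra k x0) \<Longrightarrow> a \<in> N \<Longrightarrow> b \<otimes>\<^bsub>RB_algebra k x0\<^esub> a \<in> N"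
    and F: "F 0 = {\<zero>\<^bsub>RB_algebra k x0\<^esub>}" "F n = carrier (RB_algebra k x0)"
    and chain: "\<And>i a y. a \<in> N \<Longrightarrow> y \<in> F (Suc i) \<Longrightarrow> a \<otimes>\<^bsub>RB_algebra k x0\<^esub> y \<in> F i"
  shows "N \<subseteq> {\<zero>\<^bsub>RB_algebra k x0\<^esub>}"
proof
  let ?A = "RB_algebra k x0" and ?C = "colourings k (num_colours k)"
  let ?R = "tensor_rep k"
  fix a assume a: "a \<in> N"
  show "a \<in> {\<zero>\<^bsub>?A\<^esub>}"
  proof (rule ccontr)
    assume "a \<notin> {\<zero>\<^bsub>?A\<^esub>}"
    then have a0: "a \<noteq> \<zero>\<^bsub>?A\<^esub>" by simp
    have Rm: "?R (u \<otimes>\<^bsub>?A\<^esub> v) \<alpha> \<beta> = (\<Sum>\<gamma>\<in>?C. ?R u \<alpha> \<gamma> * ?R v \<gamma> \<beta>)" if "\<alpha> \<in> ?C" "\<beta> \<in> ?C" for u v \<alpha> \<beta>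
      unfolding x0_def by (rule tensor_rep_mult[OF that])
    \<comment> \<open>Positivity: the diagonal entries of the matrix of \<open>star u\<close> times
      \<open>u\<close> are sums of squared absolute values, so this product is nonzero whenever
      \<open>u\<close> is.\<close>
    have sq: "star u \<otimes>\<^bsub>?A\<^esub> u \<in> N \<and> star u \<otimes>\<^bsub>?A\<^esub> u \<noteq> \<zero>\<^bsub>?A\<^esub> \<and> star (star u \<otimes>\<^bsub>?A\<^esub> u) = star u \<otimes>\<^bsub>?A\<^esub> u"
      if u: "u \<in> N" "u \<noteq> \<zero>\<^bsub>?A\<^esub>" for u
    proof (intro conjI)
      have uA: "u \<in> carrier ?A" using u N by blast
      show "star u \<otimes>\<^bsub>?A\<^esub> u \<in> N" by (rule left[OF star_closed[OF uA] u(1)])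
      have R: "?R (star u \<otimes>\<^bsub>?A\<^esub> u) \<alpha> \<beta> = (\<Sum>\<gamma>\<in>?C. cnj (?R u \<gamma> \<alpha>) * ?R u \<gamma> \<beta>)" if "\<alpha> \<in> ?C" "\<beta> \<in> ?C" for \<alpha> \<beta>
        using Rm[OF that] by (simp add: tensor_rep_star)
      show "star u \<otimes>\<^bsub>?A\<^esub> u \<noteq> \<zero>\<^bsub>?A\<^esub>"
      proof
        assume e: "star u \<otimes>\<^bsub>?A\<^esub> u = \<zero>\<^bsub>?A\<^esub>"
        have "?R u \<gamma> \<alpha> = 0" if "\<gamma> \<in> ?C" "\<alpha> \<in> ?C" for \<gamma> \<alpha>
        proof -
          have "(\<Sum>\<gamma>\<in>?C. cnj (?R u \<gamma> \<alpha>) * ?R u \<gamma> \<alpha>) = ?R \<zero>\<^bsub>?A\<^esub> \<alpha> \<alpha>" using R[OF that(2,2)] e by simp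
          also have "\<dots> = 0" by (simp add: tensor_rep_def RB_zero)
          also have "(\<Sum>\<gamma>\<in>?C. cnj (?R u \<gamma> \<alpha>) * ?R u \<gamma> \<alpha>) = of_real (\<Sum>\<gamma>\<in>?C. (cmod (?R u \<gamma> \<alpha>))\<^sup>2)"
            unfolding of_real_sum by (intro sum.cong refl) (simp only: complex_norm_square mult.commute)
          finally have "(\<Sum>\<gamma>\<in>?C. (cmod (?R u \<gamma> \<alpha>))\<^sup>2) = 0" using of_real_eq_0_iff by blast
          then have "(cmod (?R u \<gamma> \<alpha>))\<^sup>2 = 0" using that(1) sum_nonneg_eq_0_iff[of ?C "\<lambda>\<gamma>. (cmod (?R u \<gamma> \<alpha>))\<^sup>2"] by simp
          then show ?thesis by simp
        qed
        then have "u = \<zero>\<^bsub>?A\<^esub>" by (rule tensor_rep_inj[OF uA])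
        then show False using u(2) by simp
      qed
      let ?w = "star u \<otimes>\<^bsub>?A\<^esub> u"
      interpret ring ?A by (rule ring_RB_algebra)
      have wA: "?w \<in> carrier ?A" "star ?w \<in> carrier ?A" using star_closed uA RB_mult_closed by blast+
      have "(\<lambda>d. star ?w d - ?w d) = \<zero>\<^bsub>?A\<^esub>"
      proof (rule tensor_rep_inj)
        show "(\<lambda>d. star ?w d - ?w d) \<in> carrier ?A" using wA by (auto simp: RB_carrier)
        fix \<alpha> \<beta> assume ab: "\<alpha> \<in> ?C" "\<beta> \<in> ?C"
        have "?R (\<lambda>d. star ?w d - ?w d) \<alpha> \<beta> = ?R (star ?w) \<alpha> \<beta> - ?R ?w \<alpha> \<beta>"
          by (simp add: tensor_rep_def left_diff_distrib sum_subtractf)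
        also have "\<dots> = 0" unfolding tensor_rep_star R[OF ab] R[OF ab(2,1)] by (simp add: mult.commute)
        finally show "?R (\<lambda>d. star ?w d - ?w d) \<alpha> \<beta> = 0" .
      qed
      then show "star ?w = ?w" by (auto simp: fun_eq_iff RB_zero)
    qed
    \<comment> \<open>For self-adjoint \<open>u\<close> the product of \<open>star u\<close> and
      \<open>u\<close> is the square of \<open>u\<close>. It stays in \<open>N\<close>, is again
      nonzero and self-adjoint, and lies one level lower in the chain.\<close>
    have "\<exists>u. u \<in> N \<and> u \<noteq> \<zero>\<^bsub>?A\<^esub> \<and> star u = u \<and> u \<in> F (n - m)" if "m \<le> n" for m
      using that
    proof (induction m)
      case 0
      then show ?case using sq[OF a a0] F N by auto
    next
      case (Suc m)
      then obtain u where u: "u \<in> N" "u \<noteq> \<zero>\<^bsub>?A\<^esub>" "star u = u" "u \<in> F (Suc (n - Suc m))" by (auto simp: Suc_diff_Suc)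
      then show ?case using sq[OF u(1,2)] chain[OF u(1,4)] by metis
    qed
    from this[of n] show False using F by auto
  qed
qed

section \<open>Cell representations\<close>

definition sym_rep :: "nat \<Rightarrow> (nat \<Rightarrow> nat) \<Rightarrow> (nat \<Rightarrow> int) \<Rightarrow> (nat \<Rightarrow> int) \<Rightarrow> complex" where
  "sym_rep r = content_system.rep r"

text \<open>The orthogonal form is block diagonal by shape, so the sum over all tableaux of size
  \<open>r\<close> reduces to those of shape \<open>\<mu>\<close>.\<close>

lemma sym_rep_mult:
  assumes \<mu>: "\<mu> \<in> parts_of r" and \<sigma>: "\<sigma> permutes {1..r}" "\<tau> permutes {1..r}" and t: "t \<in> tableaux r \<mu>" "t'' \<in> tableaux r \<mu>"
  shows "sym_rep r (\<sigma> \<circ> \<tau>) t t'' = (\<Sum>t'\<in>tableaux r \<mu>. sym_rep r \<sigma> t t' * sym_rep r \<tau> t' t'')"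
proof -
  interpret content_system r "all_tableaux r" "shape r" by (rule content_system_tableaux)
  have tt: "t \<in> all_tableaux r" "t'' \<in> all_tableaux r" "shape r t = \<mu>"
    using t \<mu> shape_eq[OF t(1)] by (auto simp: all_tableaux_def)
  have z: "rep \<sigma> t t' = 0" if "t' \<in> all_tableaux r - tableaux r \<mu>" for t'
    using rep_shape[OF \<sigma>(1) tt(1)] tt(3) that by (auto simp: tableaux_eq[OF \<mu>])
  have "sym_rep r (\<sigma> \<circ> \<tau>) t t'' = (\<Sum>t'\<in>all_tableaux r. rep \<sigma> t t' * rep \<tau> t' t'')"
    unfolding sym_rep_def by (rule rep_mult[OF \<sigma> tt(1,2)])
  also have "\<dots> = (\<Sum>t'\<in>tableaux r \<mu>. rep \<sigma> t t' * rep \<tau> t' t'')"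
    using \<mu> fin_Z by (intro sum.mono_neutral_right ballI) (auto simp: z all_tableaux_def)
  finally show ?thesis by (simp add: sym_rep_def)
qed

lemma sym_rep_id:
  assumes "t \<in> tableaux r \<mu>"
  shows "sym_rep r id t t' = (if t = t' then 1 else 0)"
proof -
  interpret content_system r "all_tableaux r" "shape r" by (rule content_system_tableaux)
  have "t \<in> all_tableaux r" using assms shape_eq all_tableaux_iff by metis
  then show ?thesis unfolding sym_rep_def by (rule rep_id)
qed

lemma sym_rep_faithful:
  assumes z: "\<And>\<mu> t t'. \<mu> \<in> parts_of r \<Longrightarrow> t \<in> tableaux r \<mu> \<Longrightarrow> t' \<in> tableaux r \<mu> \<Longrightarrow>
      (\<Sum>\<sigma> | \<sigma> permutes {1..r}. v \<sigma> * sym_rep r \<sigma> t t') = 0"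
    and \<sigma>: "\<sigma> permutes {1..r}"
  shows "v \<sigma> = 0"
proof -
  interpret content_system r "all_tableaux r" "shape r" by (rule content_system_tableaux)
  have "(\<Sum>\<sigma> | \<sigma> permutes {1..r}. (case j of (c, c') \<Rightarrow> \<lambda>\<sigma>. rep \<sigma> c c') \<sigma> * v \<sigma>) = 0"
    if j: "j \<in> {(c, c'). c \<in> all_tableaux r \<and> c' \<in> all_tableaux r \<and> shape r c = shape r c'}" for j
  proof -
    obtain c c' where c: "j = (c, c')" "c \<in> all_tableaux r" "c' \<in> all_tableaux r" "shape r c = shape r c'" using j by blast
    have "(\<Sum>\<sigma> | \<sigma> permutes {1..r}. v \<sigma> * sym_rep r \<sigma> c c') = 0"
      using c by (intro z[of "shape r c"] shape_parts) (simp_all add: all_tableaux_iff)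
    then show ?thesis unfolding c(1) by (simp add: sym_rep_def mult.commute)
  qed
  then show ?thesis using rep_trivial_kernel \<sigma> unfolding trivial_kernel_def by blast
qed

section \<open>Cell modules for fixed orbit representatives of half diagrams\<close>

locale half_transversals =
  fixes k :: nat and U :: "nat \<Rightarrow> diagram set"
  assumes U_sub: "r \<le> k \<Longrightarrow> U r \<subseteq> half_diagrams k r"
    and U_bij: "r \<le> k \<Longrightarrow> bij_betw (\<lambda>(u, \<sigma>). relabel u \<sigma>) (U r \<times> {\<sigma>. \<sigma> permutes {1..r}}) (half_diagrams k r)"
begin

lemma finite_U: "r \<le> k \<Longrightarrow> finite (U r)"
  using U_sub finite_half_diagrams by (meson finite_subset)

lemma sum_half_diagrams:
  assumes "r \<le> k"
  shows "(\<Sum>y\<in>half_diagrams k r. f y) = (\<Sum>u\<in>U r. \<Sum>\<sigma> | \<sigma> permutes {1..r}. f (relabel u \<sigma>))"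
proof -
  have "(\<Sum>y\<in>half_diagrams k r. f y) = (\<Sum>p\<in>U r \<times> {\<sigma>. \<sigma> permutes {1..r}}. f ((\<lambda>(u, \<sigma>). relabel u \<sigma>) p))"
    by (rule sum.reindex_bij_betw[OF U_bij[OF assms], symmetric])
  then show ?thesis by (simp add: sum.cartesian_product case_prod_beta)
qed

lemma card_U:
  assumes "r \<le> k"
  shows "card (U r) * fact r = defects k r"
proof -
  have "defects k r = card (U r \<times> {\<sigma>. \<sigma> permutes {1..r}})"
    using bij_betw_same_card[OF U_bij[OF assms]] card_half_diagrams by simp
  then show ?thesis using card_permutations[of "{1..r}" r] by (simp add: card_cartesian_product)
qed

text \<open>A basis of the cell module for \<open>\<mu>\<close>: the half diagrams span a free right
  module over the group algebra with basis \<open>U\<close>, which is tensored with the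
  representation of shape \<open>\<mu>\<close>.\<close>

definition index :: "part \<Rightarrow> (diagram \<times> (nat \<Rightarrow> int)) set" where
  "index \<mu> = U (psize \<mu>) \<times> tableaux (psize \<mu>) \<mu>"

text \<open>If \<open>d\<close> carries the representative of column \<open>j\<close> to the
  relabelling by \<open>\<sigma>\<close> of the representative of row \<open>i\<close>, then
  \<open>\<sigma>\<close> is evaluated in the orthogonal form. The action is free, so at most one
  \<open>\<sigma>\<close> contributes. As functions of \<open>d\<close> these numbers are the
  coefficient matrix of \<open>Phi\<close>.\<close>

definition entry :: "complex \<Rightarrow> part \<Rightarrow> diagram \<times> (nat \<Rightarrow> int) \<Rightarrow> diagram \<times> (nat \<Rightarrow> int) \<Rightarrow> diagram \<Rightarrow> complex" where
  "entry x \<mu> i j d = (\<Sum>\<sigma> | \<sigma> permutes {1..psize \<mu>}.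
     (if compose_diagrams k d (fst j) = relabel (fst i) \<sigma> then x ^ kappa k d (fst j) else 0) * sym_rep (psize \<mu>) \<sigma> (snd i) (snd j))"

definition Phi :: "complex \<Rightarrow> (diagram \<Rightarrow> complex) \<Rightarrow> part \<Rightarrow> diagram \<times> (nat \<Rightarrow> int) \<Rightarrow> diagram \<times> (nat \<Rightarrow> int) \<Rightarrow> complex" where
  "Phi x a \<mu> i j = (\<Sum>d\<in>RB_diagrams k. entry x \<mu> i j d * a d)"

lemma Phi_eq:
  "Phi x a \<mu> (u, t) (u', t') = (\<Sum>\<sigma> | \<sigma> permutes {1..psize \<mu>}. half_rep k x a (relabel u \<sigma>) u' * sym_rep (psize \<mu>) \<sigma> t t')"
proof -
  let ?e = "\<lambda>d \<sigma>. (if compose_diagrams k d u' = relabel u \<sigma> then x ^ kappa k d u' else 0)"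
  have "Phi x a \<mu> (u, t) (u', t') = (\<Sum>d\<in>RB_diagrams k. \<Sum>\<sigma> | \<sigma> permutes {1..psize \<mu>}. a d * ?e d \<sigma> * sym_rep (psize \<mu>) \<sigma> t t')"
    unfolding Phi_def entry_def sum_distrib_right by (intro sum.cong refl) (simp add: mult_ac)
  also have "\<dots> = (\<Sum>\<sigma> | \<sigma> permutes {1..psize \<mu>}. \<Sum>d\<in>RB_diagrams k. a d * ?e d \<sigma> * sym_rep (psize \<mu>) \<sigma> t t')"
    by (rule sum.swap)
  finally show ?thesis by (simp only: half_rep_def sum_distrib_right)
qed

lemma Phi_add: "Phi x (a \<oplus>\<^bsub>RB_algebra k x\<^esub> b) \<mu> i j = Phi x a \<mu> i j + Phi x b \<mu> i j"
  by (simp add: Phi_def RB_add distrib_left sum.distrib)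

lemma Phi_smult: "Phi x (c \<odot>\<^bsub>RB_algebra k x\<^esub> a) \<mu> i j = c * Phi x a \<mu> i j"
  by (simp add: Phi_def RB_smult sum_distrib_left mult_ac)

lemma partitions_uptoD: "\<mu> \<in> partitions_upto k \<Longrightarrow> \<mu> \<in> parts_of (psize \<mu>) \<and> psize \<mu> \<le> k"
  by (simp add: partitions_upto_def parts_of_def)

lemma finite_index: "\<mu> \<in> partitions_upto k \<Longrightarrow> finite (index \<mu>)"
  using partitions_uptoD finite_U by (auto simp: index_def)

text \<open>The sum over tableaux multiplies the matrices of \<open>\<sigma>\<close> and
  \<open>\<tau>\<close>. Equivariance of \<open>half_rep\<close> moves \<open>\<tau>\<close> into
  the first factor, and the substitution \<open>\<omega> = \<sigma> \<circ> \<tau>\<close> decouples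
  it. The pairs \<open>(u', \<tau>)\<close> then run through all half diagrams, where
  \<open>half_rep\<close> is multiplicative.\<close>

lemma Phi_mult:
  assumes \<mu>: "\<mu> \<in> partitions_upto k" and i: "i \<in> index \<mu>" and j: "j \<in> index \<mu>"
  shows "Phi x (a \<otimes>\<^bsub>RB_algebra k x\<^esub> b) \<mu> i j = (\<Sum>m\<in>index \<mu>. Phi x a \<mu> i m * Phi x b \<mu> m j)"
proof -
  define r where "r = psize \<mu>"
  have r: "r \<le> k" and \<mu>r: "\<mu> \<in> parts_of r" using partitions_uptoD[OF \<mu>] by (auto simp: r_def)
  obtain u t where i': "i = (u, t)" "u \<in> U r" "t \<in> tableaux r \<mu>" using i by (auto simp: index_def r_def)
  obtain u2 t2 where j': "j = (u2, t2)" "u2 \<in> U r" "t2 \<in> tableaux r \<mu>" using j by (auto simp: index_def r_def)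
  let ?P = "{\<sigma>. \<sigma> permutes {1..r}}" and ?T = "tableaux r \<mu>" and ?S = "sym_rep r"
  let ?h = "half_rep k x"
  have UX: "u' \<in> half_diagrams k r" if "u' \<in> U r" for u' using U_sub[OF r] that by blast
  have "(\<Sum>m\<in>index \<mu>. Phi x a \<mu> i m * Phi x b \<mu> m j) =
      (\<Sum>u'\<in>U r. \<Sum>t'\<in>?T. (\<Sum>\<sigma>\<in>?P. ?h a (relabel u \<sigma>) u' * ?S \<sigma> t t') * (\<Sum>\<tau>\<in>?P. ?h b (relabel u' \<tau>) u2 * ?S \<tau> t' t2))"
    unfolding index_def r_def[symmetric] sum.cartesian_product' i'(1) j'(1) Phi_eq ..
  also have "\<dots> = (\<Sum>u'\<in>U r. \<Sum>\<tau>\<in>?P. \<Sum>\<omega>\<in>?P. ?h a (relabel u \<omega>) (relabel u' \<tau>) * ?h b (relabel u' \<tau>) u2 * ?S \<omega> t t2)"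
  proof (rule sum.cong[OF refl])
    fix u' assume u': "u' \<in> U r"
    have "(\<Sum>t'\<in>?T. (\<Sum>\<sigma>\<in>?P. ?h a (relabel u \<sigma>) u' * ?S \<sigma> t t') * (\<Sum>\<tau>\<in>?P. ?h b (relabel u' \<tau>) u2 * ?S \<tau> t' t2)) =
        (\<Sum>t'\<in>?T. \<Sum>\<tau>\<in>?P. \<Sum>\<sigma>\<in>?P. ?h a (relabel u \<sigma>) u' * ?h b (relabel u' \<tau>) u2 * (?S \<sigma> t t' * ?S \<tau> t' t2))"
    proof (rule sum.cong[OF refl])
      fix t' assume "t' \<in> ?T"
      have "(\<Sum>\<sigma>\<in>?P. ?h a (relabel u \<sigma>) u' * ?S \<sigma> t t') * (\<Sum>\<tau>\<in>?P. ?h b (relabel u' \<tau>) u2 * ?S \<tau> t' t2) =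
          (\<Sum>\<sigma>\<in>?P. \<Sum>\<tau>\<in>?P. (?h a (relabel u \<sigma>) u' * ?S \<sigma> t t') * (?h b (relabel u' \<tau>) u2 * ?S \<tau> t' t2))"
        by (rule sum_product)
      also have "\<dots> = (\<Sum>\<tau>\<in>?P. \<Sum>\<sigma>\<in>?P. (?h a (relabel u \<sigma>) u' * ?S \<sigma> t t') * (?h b (relabel u' \<tau>) u2 * ?S \<tau> t' t2))"
        by (rule sum.swap)
      finally show "(\<Sum>\<sigma>\<in>?P. ?h a (relabel u \<sigma>) u' * ?S \<sigma> t t') * (\<Sum>\<tau>\<in>?P. ?h b (relabel u' \<tau>) u2 * ?S \<tau> t' t2) =
          (\<Sum>\<tau>\<in>?P. \<Sum>\<sigma>\<in>?P. ?h a (relabel u \<sigma>) u' * ?h b (relabel u' \<tau>) u2 * (?S \<sigma> t t' * ?S \<tau> t' t2))"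
        by (simp only: mult_ac)
    qed
    also have "\<dots> = (\<Sum>\<tau>\<in>?P. \<Sum>t'\<in>?T. \<Sum>\<sigma>\<in>?P. ?h a (relabel u \<sigma>) u' * ?h b (relabel u' \<tau>) u2 * (?S \<sigma> t t' * ?S \<tau> t' t2))"
      by (rule sum.swap)
    also have "\<dots> = (\<Sum>\<tau>\<in>?P. \<Sum>\<sigma>\<in>?P. \<Sum>t'\<in>?T. ?h a (relabel u \<sigma>) u' * ?h b (relabel u' \<tau>) u2 * (?S \<sigma> t t' * ?S \<tau> t' t2))"
      by (intro sum.cong refl sum.swap)
    also have "\<dots> = (\<Sum>\<tau>\<in>?P. \<Sum>\<omega>\<in>?P. ?h a (relabel u \<omega>) (relabel u' \<tau>) * ?h b (relabel u' \<tau>) u2 * ?S \<omega> t t2)"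
    proof (rule sum.cong[OF refl])
      fix \<tau> assume "\<tau> \<in> ?P"
      then have \<tau>: "\<tau> permutes {1..r}" by simp
      have "(\<Sum>\<sigma>\<in>?P. \<Sum>t'\<in>?T. ?h a (relabel u \<sigma>) u' * ?h b (relabel u' \<tau>) u2 * (?S \<sigma> t t' * ?S \<tau> t' t2)) =
          (\<Sum>\<sigma>\<in>?P. ?h a (relabel u (\<sigma> \<circ> \<tau>)) (relabel u' \<tau>) * ?h b (relabel u' \<tau>) u2 * ?S (\<sigma> \<circ> \<tau>) t t2)"
      proof (rule sum.cong[OF refl])
        fix \<sigma> assume "\<sigma> \<in> ?P"
        then have \<sigma>: "\<sigma> permutes {1..r}" by simp
        have "?h a (relabel u (\<sigma> \<circ> \<tau>)) (relabel u' \<tau>) = ?h a (relabel u \<sigma>) u'"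
          using half_rep_relabel[OF r \<tau> UX[OF u'], of x a "relabel u \<sigma>"] relabel_comp[OF \<sigma> \<tau>] by simp
        then show "(\<Sum>t'\<in>?T. ?h a (relabel u \<sigma>) u' * ?h b (relabel u' \<tau>) u2 * (?S \<sigma> t t' * ?S \<tau> t' t2)) =
            ?h a (relabel u (\<sigma> \<circ> \<tau>)) (relabel u' \<tau>) * ?h b (relabel u' \<tau>) u2 * ?S (\<sigma> \<circ> \<tau>) t t2"
          unfolding sym_rep_mult[OF \<mu>r \<sigma> \<tau> i'(3) j'(3)] sum_distrib_left by simp
      qed
      also have "\<dots> = (\<Sum>\<omega>\<in>?P. ?h a (relabel u \<omega>) (relabel u' \<tau>) * ?h b (relabel u' \<tau>) u2 * ?S \<omega> t t2)"
      proof (rule sum.reindex_bij_witness[of _ "\<lambda>\<omega>. \<omega> \<circ> inv_into UNIV \<tau>" "\<lambda>\<sigma>. \<sigma> \<circ> \<tau>"])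
        show "\<sigma> \<circ> \<tau> \<circ> inv_into UNIV \<tau> = \<sigma>" for \<sigma> by (simp only: comp_assoc permutes_inv_o(1)[OF \<tau>] comp_id)
        show "\<omega> \<circ> inv_into UNIV \<tau> \<circ> \<tau> = \<omega>" for \<omega> by (simp only: comp_assoc permutes_inv_o(2)[OF \<tau>] comp_id)
        show "\<sigma> \<in> ?P \<Longrightarrow> \<sigma> \<circ> \<tau> \<in> ?P" for \<sigma> using permutes_compose[OF \<tau>] by blast
        show "\<omega> \<in> ?P \<Longrightarrow> \<omega> \<circ> inv_into UNIV \<tau> \<in> ?P" for \<omega> using permutes_compose[OF permutes_inv[OF \<tau>]] by blast
      qed (rule refl)
      finally show "(\<Sum>\<sigma>\<in>?P. \<Sum>t'\<in>?T. ?h a (relabel u \<sigma>) u' * ?h b (relabel u' \<tau>) u2 * (?S \<sigma> t t' * ?S \<tau> t' t2)) =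
          (\<Sum>\<omega>\<in>?P. ?h a (relabel u \<omega>) (relabel u' \<tau>) * ?h b (relabel u' \<tau>) u2 * ?S \<omega> t t2)" .
    qed
    finally show "(\<Sum>t'\<in>?T. (\<Sum>\<sigma>\<in>?P. ?h a (relabel u \<sigma>) u' * ?S \<sigma> t t') * (\<Sum>\<tau>\<in>?P. ?h b (relabel u' \<tau>) u2 * ?S \<tau> t' t2)) =
        (\<Sum>\<tau>\<in>?P. \<Sum>\<omega>\<in>?P. ?h a (relabel u \<omega>) (relabel u' \<tau>) * ?h b (relabel u' \<tau>) u2 * ?S \<omega> t t2)" .
  qed
  also have "\<dots> = (\<Sum>y\<in>half_diagrams k r. \<Sum>\<omega>\<in>?P. ?h a (relabel u \<omega>) y * ?h b y u2 * ?S \<omega> t t2)"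
    by (rule sum_half_diagrams[OF r, symmetric])
  also have "\<dots> = (\<Sum>\<omega>\<in>?P. \<Sum>y\<in>half_diagrams k r. ?h a (relabel u \<omega>) y * ?h b y u2 * ?S \<omega> t t2)"
    by (rule sum.swap)
  also have "\<dots> = (\<Sum>\<omega>\<in>?P. ?h (a \<otimes>\<^bsub>RB_algebra k x\<^esub> b) (relabel u \<omega>) u2 * ?S \<omega> t t2)"
  proof (rule sum.cong[OF refl])
    fix \<omega> assume "\<omega> \<in> ?P"
    then have "relabel u \<omega> \<in> half_diagrams k r" using relabel_half_diagram[OF r _ UX[OF i'(2)]] by simp
    then show "(\<Sum>y\<in>half_diagrams k r. ?h a (relabel u \<omega>) y * ?h b y u2 * ?S \<omega> t t2) =
        ?h (a \<otimes>\<^bsub>RB_algebra k x\<^esub> b) (relabel u \<omega>) u2 * ?S \<omega> t t2"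
      using half_rep_mult[OF r _ UX[OF j'(2)]] by (simp only: sum_distrib_right)
  qed
  also have "\<dots> = Phi x (a \<otimes>\<^bsub>RB_algebra k x\<^esub> b) \<mu> i j" unfolding i'(1) j'(1) Phi_eq r_def ..
  finally show ?thesis by simp
qed

lemma Phi_one:
  assumes \<mu>: "\<mu> \<in> partitions_upto k" and i: "i \<in> index \<mu>" and j: "j \<in> index \<mu>"
  shows "Phi x \<one>\<^bsub>RB_algebra k x\<^esub> \<mu> i j = (if i = j then 1 else 0)"
proof -
  define r where "r = psize \<mu>"
  have r: "r \<le> k" using partitions_uptoD[OF \<mu>] by (auto simp: r_def)
  obtain u t where i': "i = (u, t)" "u \<in> U r" "t \<in> tableaux r \<mu>" using i by (auto simp: index_def r_def)
  obtain u2 t2 where j': "j = (u2, t2)" "u2 \<in> U r" using j by (auto simp: index_def r_def)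
  let ?P = "{\<sigma>. \<sigma> permutes {1..r}}"
  have inj: "relabel u \<sigma> = u2 \<longleftrightarrow> \<sigma> = id \<and> u = u2" if "\<sigma> \<in> ?P" for \<sigma>
  proof
    assume "relabel u \<sigma> = u2"
    then have "(\<lambda>(u, \<sigma>). relabel u \<sigma>) (u, \<sigma>) = (\<lambda>(u, \<sigma>). relabel u \<sigma>) (u2, id)" by (simp add: relabel_id)
    moreover have "(u, \<sigma>) \<in> U r \<times> ?P" "(u2, id) \<in> U r \<times> ?P" using that i'(2) j'(2) permutes_id by auto
    ultimately show "\<sigma> = id \<and> u = u2" using inj_onD[OF bij_betw_imp_inj_on[OF U_bij[OF r]]] by (metis prod.inject)
  qed (auto simp: relabel_id)
  have "Phi x \<one>\<^bsub>RB_algebra k x\<^esub> \<mu> i j = (\<Sum>\<sigma>\<in>?P. (if relabel u \<sigma> = u2 then 1 else 0) * sym_rep r \<sigma> t t2)"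
    unfolding i' j' Phi_eq r_def[symmetric] using U_sub[OF r] j'(2) by (subst half_rep_one[OF r]) auto
  also have "\<dots> = (\<Sum>\<sigma>\<in>?P. if \<sigma> = id then (if u = u2 then sym_rep r id t t2 else 0) else 0)"
    using inj by (intro sum.cong refl) auto
  also have "\<dots> = (if u = u2 then sym_rep r id t t2 else 0)"
    by (subst sum.delta) (simp_all add: finite_permutations permutes_id)
  also have "\<dots> = (if i = j then 1 else 0)" using sym_rep_id[OF i'(3)] i' j' by auto
  finally show ?thesis .
qed

text \<open>Faithfulness of the orthogonal form removes the tableaux and gives the columns at
  representatives. Equivariance carries the result to all columns.\<close>

lemma Phi_zero_imp_half_rep_zero:
  assumes z: "\<And>\<mu> i j. \<mu> \<in> partitions_upto k \<Longrightarrow> i \<in> index \<mu> \<Longrightarrow> j \<in> index \<mu> \<Longrightarrow> Phi x a \<mu> i j = 0"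
    and r: "r \<le> k" and y: "y \<in> half_diagrams k r" "y' \<in> half_diagrams k r"
  shows "half_rep k x a y y' = 0"
proof -
  have v: "half_rep k x a (relabel u \<sigma>) u' = 0" if u: "u \<in> U r" "u' \<in> U r" and \<sigma>: "\<sigma> permutes {1..r}" for u u' \<sigma>
  proof (rule sym_rep_faithful[OF _ \<sigma>])
    fix \<mu> t t' assume \<mu>: "\<mu> \<in> parts_of r" and t: "t \<in> tableaux r \<mu>" "t' \<in> tableaux r \<mu>"
    have ps: "psize \<mu> = r" "\<mu> \<in> partitions_upto k" using \<mu> r by (auto simp: parts_of_def partitions_upto_def)
    then have "Phi x a \<mu> (u, t) (u', t') = 0" using u t by (intro z) (auto simp: index_def)
    then show "(\<Sum>\<sigma> | \<sigma> permutes {1..r}. half_rep k x a (relabel u \<sigma>) u' * sym_rep r \<sigma> t t') = 0"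
      unfolding Phi_eq ps(1) .
  qed
  have surj: "\<exists>u\<in>U r. \<exists>\<sigma>. \<sigma> permutes {1..r} \<and> w = relabel u \<sigma>" if "w \<in> half_diagrams k r" for w
  proof -
    have "w \<in> (\<lambda>(u, \<sigma>). relabel u \<sigma>) ` (U r \<times> {\<sigma>. \<sigma> permutes {1..r}})"
      using that bij_betw_imp_surj_on[OF U_bij[OF r]] by blast
    then show ?thesis by (elim imageE SigmaE) auto
  qed
  obtain u \<sigma> where u: "u \<in> U r" "\<sigma> permutes {1..r}" "y = relabel u \<sigma>" using surj[OF y(1)] by blast
  obtain u' \<tau> where u': "u' \<in> U r" "\<tau> permutes {1..r}" "y' = relabel u' \<tau>" using surj[OF y(2)] by blast
  \<comment> \<open>Taking \<open>\<tau>\<close> off both arguments moves the column to its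
    representative \<open>u'\<close>.\<close>
  have p: "\<sigma> \<circ> inv_into UNIV \<tau> permutes {1..r}" by (rule permutes_compose[OF permutes_inv[OF u'(2)] u(2)])
  have "relabel (relabel u (\<sigma> \<circ> inv_into UNIV \<tau>)) \<tau> = relabel u (\<sigma> \<circ> inv_into UNIV \<tau> \<circ> \<tau>)" by (rule relabel_comp[OF p u'(2)])
  also have "\<dots> = y" by (simp only: comp_assoc permutes_inv_o(2)[OF u'(2)] comp_id u(3))
  finally have "half_rep k x a y y' = half_rep k x a (relabel u (\<sigma> \<circ> inv_into UNIV \<tau>)) u'"
    using half_rep_relabel[OF r u'(2), of u' x a "relabel u (\<sigma> \<circ> inv_into UNIV \<tau>)"] U_sub[OF r] u' by auto
  then show ?thesis using v[OF u(1) u'(1) p] by simp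
qed

lemma card_index:
  assumes "\<mu> \<in> partitions_upto k"
  shows "card (index \<mu>) = num_walks k \<mu>"
proof -
  have \<mu>: "\<mu> \<in> parts_of (psize \<mu>)" "psize \<mu> \<le> k" using partitions_uptoD[OF assms] by auto
  have "fact (psize \<mu>) * num_walks k \<mu> = fact (psize \<mu>) * (card (U (psize \<mu>)) * card (tableaux (psize \<mu>) \<mu>))"
    using num_walks_formula[OF \<mu>(1), of k] card_U[OF \<mu>(2)] by (simp add: mult_ac)
  then show ?thesis by (simp add: index_def card_cartesian_product)
qed

lemma index_nonempty:
  assumes "\<mu> \<in> partitions_upto k"
  shows "index \<mu> \<noteq> {}"
proof -
  have \<mu>: "\<mu> \<in> parts_of (psize \<mu>)" "psize \<mu> \<le> k" using partitions_uptoD[OF assms] by auto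
  have "r \<le> n \<Longrightarrow> defects n r > 0" for n r
  proof (induction n arbitrary: r)
    case (Suc n)
    show ?case
    proof (cases "r \<le> n")
      case False
      then have "r * defects n (r - 1) > 0" using Suc by simp
      then show ?thesis by simp
    qed (use Suc in simp)
  qed simp
  then have "card (U (psize \<mu>)) > 0" using card_U[OF \<mu>(2)] \<mu>(2) by (metis mult_is_0 neq0_conv)
  then have "U (psize \<mu>) \<noteq> {}" by auto
  then show ?thesis using ex_tableau[OF \<mu>(1)] by (simp add: index_def)
qed

section \<open>Comparison of dimensions, and the parameters at which the product map is
  bijective\<close>

definition entries :: "(part \<times> (diagram \<times> (nat \<Rightarrow> int)) \<times> (diagram \<times> (nat \<Rightarrow> int))) set" where
  "entries = Sigma (partitions_upto k) (\<lambda>\<mu>. index \<mu> \<times> index \<mu>)"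

lemma partitions_upto_eq: "partitions_upto k = (\<Union>r\<in>{..k}. parts_of r)"
  by (auto simp: partitions_upto_def parts_of_def)

lemma finite_partitions_upto: "finite (partitions_upto k)"
  unfolding partitions_upto_eq by (intro finite_UN_I finite_atMost finite_parts_of)

lemma finite_entries: "finite entries"
  unfolding entries_def using finite_partitions_upto finite_index by blast

text \<open>Summing over the partitions of \<open>r\<close> replaces the squared tableau numbers by
  \<open>r!\<close>. What remains is the gluing formula for defect numbers with two groups of
  \<open>k\<close> vertices, whose value counts the partial matchings of \<open>2 * k\<close>
  vertices.\<close>

lemma card_entries: "card entries = card (RB_diagrams k)"
proof -
  have "real (card entries) = (\<Sum>\<mu>\<in>partitions_upto k. (real (card (index \<mu>)))\<^sup>2)"
    unfolding entries_def using finite_partitions_upto finite_index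
    by (subst card_SigmaI) (auto simp: card_cartesian_product power2_eq_square)
  also have "\<dots> = (\<Sum>r\<le>k. \<Sum>\<mu>\<in>parts_of r. (real (card (index \<mu>)))\<^sup>2)"
    unfolding partitions_upto_eq using finite_parts_of
    by (intro sum.UNION_disjoint ballI impI finite_atMost) (auto simp: parts_of_def)
  also have "\<dots> = (\<Sum>r\<le>k. real (defects k r) * real (defects k r) / fact r)"
  proof (rule sum.cong[OF refl])
    fix r assume "r \<in> {..k}"
    then have r: "r \<le> k" by simp
    have "(\<Sum>\<mu>\<in>parts_of r. (real (card (index \<mu>)))\<^sup>2) = (\<Sum>\<mu>\<in>parts_of r. (real (card (U r)))\<^sup>2 * real ((card (tableaux r \<mu>))\<^sup>2))"
      by (intro sum.cong refl) (auto simp: index_def parts_of_def card_cartesian_product power_mult_distrib)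
    also have "\<dots> = (real (card (U r)))\<^sup>2 * real (\<Sum>\<mu>\<in>parts_of r. (card (tableaux r \<mu>))\<^sup>2)"
      by (simp add: sum_distrib_left)
    also have "\<dots> = (real (card (U r)))\<^sup>2 * fact r" unfolding sum_card_tableaux_squares by simp
    also have "\<dots> = real (defects k r) * real (defects k r) / fact r"
      unfolding card_U[OF r, symmetric] by (simp add: power2_eq_square)
    finally show "(\<Sum>\<mu>\<in>parts_of r. (real (card (index \<mu>)))\<^sup>2) = real (defects k r) * real (defects k r) / fact r" .
  qed
  also have "\<dots> = (\<Sum>r\<le>k + k. real (defects k r) * real (defects k r) / fact r)"
    by (rule sum.mono_neutral_left) (auto simp: defects_zero)
  also have "\<dots> = real (defects (k + k) 0)" by (rule sum_defects) simp
  finally show ?thesis using card_RB_diagrams[of k] by (simp add: mult_2)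
qed

text \<open>Formulated as injectivity of a coefficient matrix, which gives access to its
  determinant. As the system is square by \<open>card_entries\<close>, it means that
  \<open>Phi\<close> is bijective onto the product of matrix algebras.\<close>

definition faithful :: "complex \<Rightarrow> bool" where
  "faithful x \<longleftrightarrow> trivial_kernel (RB_diagrams k) entries (\<lambda>(\<mu>, i, j) d. entry x \<mu> i j d)"

lemma faithfulI:
  assumes "\<And>a. a \<in> carrier (RB_algebra k x) \<Longrightarrow>
    (\<And>\<mu> i j. \<mu> \<in> partitions_upto k \<Longrightarrow> i \<in> index \<mu> \<Longrightarrow> j \<in> index \<mu> \<Longrightarrow> Phi x a \<mu> i j = 0) \<Longrightarrow> a = \<zero>\<^bsub>RB_algebra k x\<^esub>"
  shows "faithful x"
  unfolding faithful_def trivial_kernel_def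
proof (intro allI impI ballI)
  fix v d assume v: "\<forall>j\<in>entries. (\<Sum>d\<in>RB_diagrams k. (case j of (\<mu>, i, j) \<Rightarrow> \<lambda>d. entry x \<mu> i j d) d * v d) = 0" and d: "d \<in> RB_diagrams k"
  define a where "a d = (if d \<in> RB_diagrams k then v d else 0)" for d
  have "Phi x a \<mu> i j = 0" if "\<mu> \<in> partitions_upto k" "i \<in> index \<mu>" "j \<in> index \<mu>" for \<mu> i j
  proof -
    have "(\<mu>, i, j) \<in> entries" using that by (simp add: entries_def)
    then have "(\<Sum>d\<in>RB_diagrams k. entry x \<mu> i j d * v d) = 0" using v by force
    then show ?thesis by (simp add: Phi_def a_def)
  qed
  moreover have "a \<in> carrier (RB_algebra k x)" by (simp add: RB_carrier a_def)
  ultimately have "a = \<zero>\<^bsub>RB_algebra k x\<^esub>" using assms by blast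
  then have "a d = 0" by (simp add: RB_zero)
  then show "v d = 0" using d by (simp add: a_def)
qed

lemma split_algebra_if_faithful:
  assumes "faithful x"
  shows "split_algebra (RB_algebra k x) (partitions_upto k) index (Phi x)"
proof -
  let ?A = "RB_algebra k x"
  interpret assoc_algebra class_ring ?A by (rule assoc_algebra_RB)
  have fin: "finite (RB_diagrams k)" "finite entries" "card (RB_diagrams k) = card entries"
    using finite_entries card_entries by simp_all
  have tk: "trivial_kernel (RB_diagrams k) entries (\<lambda>(\<mu>, i, j) d. entry x \<mu> i j d)"
    using assms by (simp add: faithful_def)
  show ?thesis
  proof (intro split_algebra.intro split_algebra_axioms.intro)
    show "assoc_algebra class_ring ?A" by (rule assoc_algebra_RB)
  next
    fix a assume a: "a \<in> carrier ?A" and z: "\<And>\<mu> i j. \<mu> \<in> partitions_upto k \<Longrightarrow> i \<in> index \<mu> \<Longrightarrow> j \<in> index \<mu> \<Longrightarrow> Phi x a \<mu> i j = 0"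
    have "\<forall>j\<in>entries. (\<Sum>d\<in>RB_diagrams k. (case j of (\<mu>, i, j) \<Rightarrow> \<lambda>d. entry x \<mu> i j d) d * a d) = 0"
      using z by (auto simp: entries_def Phi_def)
    then have "\<forall>d\<in>RB_diagrams k. a d = 0" using tk unfolding trivial_kernel_def by blast
    then show "a = \<zero>\<^bsub>?A\<^esub>" using a by (fastforce simp: RB_carrier RB_zero fun_eq_iff)
  next
    fix X
    \<comment> \<open>\<open>v e\<close> holds the coefficients of an element whose matrices have a
      single nonzero entry, a \<open>1\<close> at \<open>e\<close>. It exists because an injective
      square system is surjective.\<close>
    define v where "v e = (SOME v. \<forall>e'\<in>entries. (\<Sum>d\<in>RB_diagrams k. (case e' of (\<mu>, i, j) \<Rightarrow> \<lambda>d. entry x \<mu> i j d) d * v d) = (if e' = e then 1 else 0))" for e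
    have v: "(\<Sum>d\<in>RB_diagrams k. (case e' of (\<mu>, i, j) \<Rightarrow> \<lambda>d. entry x \<mu> i j d) d * v e d) = (if e' = e then 1 else 0)"
      if "e \<in> entries" "e' \<in> entries" for e e'
      using someI_ex[OF square_matrix_inj_imp_surj[OF fin tk that(1)]] that(2) unfolding v_def[symmetric] by blast
    define a where "a d = (if d \<in> RB_diagrams k then (\<Sum>e\<in>entries. (case e of (\<mu>, i, j) \<Rightarrow> X \<mu> i j) * v e d) else 0)" for d
    have "Phi x a \<mu> i j = X \<mu> i j" if m: "\<mu> \<in> partitions_upto k" "i \<in> index \<mu>" "j \<in> index \<mu>" for \<mu> i j
    proof -
      have e: "(\<mu>, i, j) \<in> entries" using m by (simp add: entries_def)
      have "Phi x a \<mu> i j = (\<Sum>d\<in>RB_diagrams k. \<Sum>e\<in>entries. (case e of (\<mu>, i, j) \<Rightarrow> X \<mu> i j) * (entry x \<mu> i j d * v e d))"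
        unfolding Phi_def a_def by (intro sum.cong refl) (simp add: sum_distrib_left mult_ac)
      also have "\<dots> = (\<Sum>e\<in>entries. (case e of (\<mu>, i, j) \<Rightarrow> X \<mu> i j) * (\<Sum>d\<in>RB_diagrams k. entry x \<mu> i j d * v e d))"
        by (subst sum.swap) (simp add: sum_distrib_left)
      also have "\<dots> = (\<Sum>e\<in>entries. if e = (\<mu>, i, j) then X \<mu> i j else 0)"
        using v[OF _ e] by (intro sum.cong refl) auto
      also have "\<dots> = X \<mu> i j" using e finite_entries by simp
      finally show ?thesis .
    qed
    moreover have "a \<in> carrier ?A" by (simp add: RB_carrier a_def)
    ultimately show "\<exists>a\<in>carrier ?A. \<forall>\<mu>\<in>partitions_upto k. \<forall>i\<in>index \<mu>. \<forall>j\<in>index \<mu>. Phi x a \<mu> i j = X \<mu> i j" by blast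
  qed (auto simp: finite_partitions_upto finite_index index_nonempty Phi_mult Phi_one Phi_add Phi_smult)
qed

text \<open>The kernel \<open>N\<close> is the common input of two arguments about nil left ideals,
  one for semisimple algebras and one at the integer parameter. Each of them requires a set closed
  under left multiplication that lowers the rank filtration, and shows that it is zero.\<close>

lemma Phi_kernel_chain:
  fixes x
  defines "N \<equiv> {a \<in> carrier (RB_algebra k x). \<forall>\<mu>\<in>partitions_upto k. \<forall>i\<in>index \<mu>. \<forall>j\<in>index \<mu>. Phi x a \<mu> i j = 0}"
  shows "N \<subseteq> carrier (RB_algebra k x)"
    and "b \<in> carrier (RB_algebra k x) \<Longrightarrow> a \<in> N \<Longrightarrow> b \<otimes>\<^bsub>RB_algebra k x\<^esub> a \<in> N"
    and "a \<in> N \<Longrightarrow> y \<in> rank_below k (Suc r) \<Longrightarrow> a \<otimes>\<^bsub>RB_algebra k x\<^esub> y \<in> rank_below k r"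
    and "N \<subseteq> {\<zero>\<^bsub>RB_algebra k x\<^esub>} \<Longrightarrow> faithful x"
proof -
  show "N \<subseteq> carrier (RB_algebra k x)" by (auto simp: N_def)
  show "b \<in> carrier (RB_algebra k x) \<Longrightarrow> a \<in> N \<Longrightarrow> b \<otimes>\<^bsub>RB_algebra k x\<^esub> a \<in> N"
    by (auto simp: N_def RB_mult_closed Phi_mult)
  show "a \<in> N \<Longrightarrow> y \<in> rank_below k (Suc r) \<Longrightarrow> a \<otimes>\<^bsub>RB_algebra k x\<^esub> y \<in> rank_below k r"
    by (rule rank_below_mult, rule Phi_zero_imp_half_rep_zero) (auto simp: N_def)
  show "N \<subseteq> {\<zero>\<^bsub>RB_algebra k x\<^esub>} \<Longrightarrow> faithful x"
    by (rule faithfulI) (auto simp: N_def)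
qed

text \<open>A diagram has at most \<open>k\<close> through strands, so the chain exhausts the
  algebra at level \<open>Suc k\<close>, and semisimplicity excludes a nonzero kernel.\<close>

lemma faithful_if_semisimple:
  assumes "semisimple_algebra class_ring (RB_algebra k x)"
  shows "faithful x"
  by (rule Phi_kernel_chain(4), rule semisimple_no_nil_left_ideal[OF assms Phi_kernel_chain(1,2), of "rank_below k" "Suc k"])
     (simp_all only: rank_below_0 rank_below_Suc Phi_kernel_chain(3))

text \<open>The parameter is the number of colours \<open>0, ..., num_colours k\<close>, at which
  the tensor matrices both multiply like diagrams and separate them.\<close>

lemma faithful_at_integer: "faithful (of_nat (num_colours k + 1))"
  by (rule Phi_kernel_chain(4), rule nil_left_ideal_zero_at_integer[OF Phi_kernel_chain(1,2), of "rank_below k" "Suc k"])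
     (simp_all only: rank_below_0 rank_below_Suc Phi_kernel_chain(3))

text \<open>The parameter enters an entry only through powers counting loops. Replacing them by
  monomials gives a polynomial matrix, and the integer parameter shows that its determinant is not
  the zero polynomial.\<close>

lemma faithful_cofinite: "finite {x. \<not> faithful x}"
proof -
  define p where "p e d = (case e of (\<mu>, i, j) \<Rightarrow> \<Sum>\<sigma> | \<sigma> permutes {1..psize \<mu>}.
     (if compose_diagrams k d (fst j) = relabel (fst i) \<sigma> then monom (sym_rep (psize \<mu>) \<sigma> (snd i) (snd j)) (kappa k d (fst j)) else 0))"
    for e :: "part \<times> (diagram \<times> (nat \<Rightarrow> int)) \<times> (diagram \<times> (nat \<Rightarrow> int))" and d
  have p: "poly (p e d) x = (case e of (\<mu>, i, j) \<Rightarrow> entry x \<mu> i j d)" for e d x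
    by (cases e) (auto simp: p_def entry_def poly_sum poly_monom intro!: sum.cong)
  have F: "faithful x \<longleftrightarrow> trivial_kernel (RB_diagrams k) entries (\<lambda>e d. poly (p e d) x)" for x
    unfolding faithful_def p by (simp add: case_prod_beta')
  show ?thesis unfolding F
    by (rule trivial_kernel_cofinite[where ?x0.0 = "of_nat (num_colours k + 1)"])
       (use finite_entries card_entries faithful_at_integer F in simp_all)
qed

end

theorem mainTheorem5:
  fixes k :: nat
  shows "finite {x :: complex. \<not> semisimple_algebra class_ring (RB_algebra k x)} \<and>
    (\<forall>x :: complex. semisimple_algebra class_ring (RB_algebra k x) \<longrightarrow>
      (\<exists>M :: part \<Rightarrow> (diagram \<Rightarrow> complex, diagram \<Rightarrow> complex) module.
        (\<forall>\<nu>\<in>partitions_upto k.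
            irreducible_module (RB_algebra k x) (M \<nu>) \<and>
            vectorspace.fin_dim class_ring (underlying_space (RB_algebra k x) (M \<nu>)) \<and>
            vectorspace.dim class_ring (underlying_space (RB_algebra k x) (M \<nu>)) = num_walks k \<nu>) \<and>
        (\<forall>\<nu>\<in>partitions_upto k. \<forall>\<mu>\<in>partitions_upto k.
            isomorphic_modules (RB_algebra k x) (M \<nu>) (M \<mu>) \<longrightarrow> \<nu> = \<mu>) \<and>
        (\<forall>N :: (diagram \<Rightarrow> complex, 'v) module.
            irreducible_module (RB_algebra k x) N \<longrightarrow>
            (\<exists>\<nu>\<in>partitions_upto k. isomorphic_modules (RB_algebra k x) N (M \<nu>)))))"
proof -
  \<comment> \<open>The representatives are chosen before \<open>x\<close>, so that one family of
    polynomial matrices covers all parameters.\<close>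
  have "\<forall>r. \<exists>V. r \<le> k \<longrightarrow> V \<subseteq> half_diagrams k r \<and>
      bij_betw (\<lambda>(u, \<sigma>). relabel u \<sigma>) (V \<times> {\<sigma>. \<sigma> permutes {1..r}}) (half_diagrams k r)"
    using ex_transversal by blast
  then obtain U where U: "\<And>r. r \<le> k \<Longrightarrow> U r \<subseteq> half_diagrams k r \<and>
      bij_betw (\<lambda>(u, \<sigma>). relabel u \<sigma>) (U r \<times> {\<sigma>. \<sigma> permutes {1..r}}) (half_diagrams k r)"
    by metis
  interpret half_transversals k U by unfold_locales (use U in auto)
  \<comment> \<open>Part (a) uses that the algebra is semisimple at faithful parameters, part (b)
    the converse.\<close>
  have ss: "semisimple_algebra class_ring (RB_algebra k x) \<longleftrightarrow> faithful x" for x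
    using faithful_if_semisimple split_algebra.semisimple[OF split_algebra_if_faithful] by blast
  show ?thesis
  proof (intro conjI allI impI)
    show "finite {x. \<not> semisimple_algebra class_ring (RB_algebra k x)}" unfolding ss by (rule faithful_cofinite)
  next
    fix x assume "semisimple_algebra class_ring (RB_algebra k x)"
    then interpret S: split_algebra "RB_algebra k x" "partitions_upto k" index "Phi x"
      using split_algebra_if_faithful ss by blast
    \<comment> \<open>Any column of the block can represent its label; the columns of one block are
      isomorphic.\<close>
    define p where "p \<nu> = (SOME i. i \<in> index \<nu>)" for \<nu>
    have p: "p \<nu> \<in> index \<nu>" if "\<nu> \<in> partitions_upto k" for \<nu>
      using index_nonempty[OF that] unfolding p_def by (simp add: some_in_eq)
    show "\<exists>M :: part \<Rightarrow> (diagram \<Rightarrow> complex, diagram \<Rightarrow> complex) module.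
        (\<forall>\<nu>\<in>partitions_upto k.
            irreducible_module (RB_algebra k x) (M \<nu>) \<and>
            vectorspace.fin_dim class_ring (underlying_space (RB_algebra k x) (M \<nu>)) \<and>
            vectorspace.dim class_ring (underlying_space (RB_algebra k x) (M \<nu>)) = num_walks k \<nu>) \<and>
        (\<forall>\<nu>\<in>partitions_upto k. \<forall>\<mu>\<in>partitions_upto k.
            isomorphic_modules (RB_algebra k x) (M \<nu>) (M \<mu>) \<longrightarrow> \<nu> = \<mu>) \<and>
        (\<forall>N :: (diagram \<Rightarrow> complex, 'v) module.
            irreducible_module (RB_algebra k x) N \<longrightarrow>
            (\<exists>\<nu>\<in>partitions_upto k. isomorphic_modules (RB_algebra k x) N (M \<nu>)))"
    proof (intro exI[of _ "\<lambda>\<nu>. S.col_module \<nu> (p \<nu>)"] conjI ballI allI impI)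
      fix \<nu> assume \<nu>: "\<nu> \<in> partitions_upto k"
      show "irreducible_module (RB_algebra k x) (S.col_module \<nu> (p \<nu>))" by (rule S.irreducible_column[OF \<nu> p[OF \<nu>]])
      show "vectorspace.fin_dim class_ring (underlying_space (RB_algebra k x) (S.col_module \<nu> (p \<nu>)))"
        by (rule S.dim_column(1)[OF \<nu> p[OF \<nu>]])
      show "vectorspace.dim class_ring (underlying_space (RB_algebra k x) (S.col_module \<nu> (p \<nu>))) = num_walks k \<nu>"
        using S.dim_column(2)[OF \<nu> p[OF \<nu>]] card_index[OF \<nu>] by simp
    next
      fix \<nu> \<mu> assume "\<nu> \<in> partitions_upto k" "\<mu> \<in> partitions_upto k"
        "isomorphic_modules (RB_algebra k x) (S.col_module \<nu> (p \<nu>)) (S.col_module \<mu> (p \<mu>))"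
      then show "\<nu> = \<mu>" using S.not_isomorphic_columns p by blast
    next
      fix N :: "(diagram \<Rightarrow> complex, 'v) module" assume "irreducible_module (RB_algebra k x) N"
      then show "\<exists>\<nu>\<in>partitions_upto k. isomorphic_modules (RB_algebra k x) N (S.col_module \<nu> (p \<nu>))"
        by (rule S.irreducible_imp_isomorphic_column[where p = p]) (rule p)
    qed
  qed
qed

end
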